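(* Let $K$ be a field, let $\mathcal{D}$ be a weighted oriented forest without isolated vertices (that is, a vertex-weighted oriented graph with no isolated vertices whose underlying graph is a forest), with weight function $d$, and let $G$ be its underlying forest. The following conditions are equivalent: (a) $\mathcal{D}$ is Cohen--Macaulay (over $K$). (b) $I(\mathcal{D})$ is unmixed, that is, all its associated primes have the same height. (c) $G$ has a perfect matching $\{x_1,y_1\},\ldots,\{x_r,y_r\}$ such that $\deg_G(y_i)=1$ for $i=1,\ldots,r$, and $d(x_i)=1$ whenever $(x_i,y_i)\in E(\mathcal{D})$.
   Context: A digraph $\mathcal{D}$ consists of a finite vertex set $V(\mathcal{D})$ and a set $E(\mathcal{D})$ of ordered pairs of distinct vertices (edges or arrows). An oriented graph is a digraph with no oriented cycles of length two, i.e. a finite simple graph $G$ (its underlying graph) together with an orientation of each of its edges; $(x,y)\in E(\mathcal{D})$ denotes an arrow from $x$ to $y$. A (vertex-)weighted oriented graph is an oriented graph $\mathcal{D}$ together with a function $d\colon V(\mathcal{D})\to\mathbb{N}_+=\{1,2,\ldots\}$. Standing convention: if a vertex is a source (it has only arrows leaving it), its weight is assumed to be $1$. Let $R$ be the polynomial ring over $K$ whose variables are the vertices of $\mathcal{D}$. The edge ideal of $\mathcal{D}$ is $I(\mathcal{D})=(x\,y^{d(y)} \mid (x,y)\in E(\mathcal{D}))\subset R$. $\mathcal{D}$ is called Cohen--Macaulay (over $K$) if $R/I(\mathcal{D})$ is a Cohen--Macaulay ring. *)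

theory Defs
  imports
    "HOL-Library.Poly_Mapping"
    "HOL-Library.Extended_Nat"
    "HOL-Library.Disjoint_Sets"
    "HOL-Algebra.QuotRing"
    "HOL-Algebra.Ring_Divisibility"
    "Graph_Theory.Digraph_Component"
begin

section \<open>Dimension, depth and the Cohen--Macaulay property\<close>

definition prime_chain :: "('a, 'b) ring_scheme \<Rightarrow> (nat \<Rightarrow> 'a set) \<Rightarrow> nat \<Rightarrow> bool" where
  "prime_chain A P n \<longleftrightarrow> (\<forall>i\<le>n. primeideal (P i) A) \<and> (\<forall>i<n. P i \<subset> P (Suc i))"

definition krull_dim :: "('a, 'b) ring_scheme \<Rightarrow> enat" where
  "krull_dim A = Sup {enat n | n. \<exists>P. prime_chain A P n}"

text \<open>Only meant for prime ideals.\<close>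
definition height :: "('a, 'b) ring_scheme \<Rightarrow> 'a set \<Rightarrow> enat" where
  "height A Q = Sup {enat n | n. \<exists>P. prime_chain A P n \<and> P n = Q}"

text \<open>The first condition says that the \<open>i\<close>-th element is not a zero divisor on the quotient of
  \<open>A\<close> by the ideal generated by its predecessors.\<close>
definition regular_sequence :: "('a, 'b) ring_scheme \<Rightarrow> 'a list \<Rightarrow> bool" where
  "regular_sequence A xs \<longleftrightarrow>
     set xs \<subseteq> carrier A \<and>
     (\<forall>i<length xs. \<forall>b\<in>carrier A.
        xs ! i \<otimes>\<^bsub>A\<^esub> b \<in> Idl\<^bsub>A\<^esub> (set (take i xs)) \<longrightarrow> b \<in> Idl\<^bsub>A\<^esub> (set (take i xs))) \<and>
     Idl\<^bsub>A\<^esub> (set xs) \<noteq> carrier A"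

definition depth :: "('a, 'b) ring_scheme \<Rightarrow> 'a set \<Rightarrow> enat" where
  "depth A m = Sup {enat (length xs) | xs. regular_sequence A xs \<and> set xs \<subseteq> m}"

definition cm_local_ring :: "('a, 'b) ring_scheme \<Rightarrow> bool" where
  "cm_local_ring A \<longleftrightarrow> cring A \<and> noetherian_ring A \<and>
     (\<exists>m. (\<forall>J. maximalideal J A \<longleftrightarrow> J = m) \<and> depth A m = krull_dim A)"

text \<open>The fraction \<open>a / s\<close> in the localization of \<open>A\<close> at the prime \<open>P\<close>, as an equivalence class
  of pairs.\<close>
definition loc_frac :: "('a, 'b) ring_scheme \<Rightarrow> 'a set \<Rightarrow> 'a \<Rightarrow> 'a \<Rightarrow> ('a \<times> 'a) set" where
  "loc_frac A P a s = {(b, t). b \<in> carrier A \<and> t \<in> carrier A - P \<and>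
     (\<exists>u\<in>carrier A - P. u \<otimes>\<^bsub>A\<^esub> (a \<otimes>\<^bsub>A\<^esub> t) = u \<otimes>\<^bsub>A\<^esub> (b \<otimes>\<^bsub>A\<^esub> s))}"

definition localization :: "('a, 'b) ring_scheme \<Rightarrow> 'a set \<Rightarrow> ('a \<times> 'a) set ring" where
  "localization A P =
     \<lparr>carrier = {loc_frac A P a s | a s. a \<in> carrier A \<and> s \<in> carrier A - P},
      mult = (\<lambda>X Y. \<Union>(a, s)\<in>X. \<Union>(b, t)\<in>Y. loc_frac A P (a \<otimes>\<^bsub>A\<^esub> b) (s \<otimes>\<^bsub>A\<^esub> t)),
      one = loc_frac A P \<one>\<^bsub>A\<^esub> \<one>\<^bsub>A\<^esub>,
      zero = loc_frac A P \<zero>\<^bsub>A\<^esub> \<one>\<^bsub>A\<^esub>,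
      add = (\<lambda>X Y. \<Union>(a, s)\<in>X. \<Union>(b, t)\<in>Y.
               loc_frac A P (a \<otimes>\<^bsub>A\<^esub> t \<oplus>\<^bsub>A\<^esub> b \<otimes>\<^bsub>A\<^esub> s) (s \<otimes>\<^bsub>A\<^esub> t))\<rparr>"

definition cohen_macaulay_ring :: "('a, 'b) ring_scheme \<Rightarrow> bool" where
  "cohen_macaulay_ring A \<longleftrightarrow> cring A \<and> noetherian_ring A \<and>
     (\<forall>m. maximalideal m A \<longrightarrow> cm_local_ring (localization A m))"

section \<open>Associated primes and unmixed ideals\<close>

text \<open>The associated primes of the module \<open>R/I\<close>: the primes that are the annihilator of some
  residue class \<open>f + I\<close>.\<close>
definition associated_primes :: "('a, 'b) ring_scheme \<Rightarrow> 'a set \<Rightarrow> 'a set set" where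
  "associated_primes R I =
     {P. primeideal P R \<and> (\<exists>f\<in>carrier R. P = {r \<in> carrier R. r \<otimes>\<^bsub>R\<^esub> f \<in> I})}"

definition unmixed :: "('a, 'b) ring_scheme \<Rightarrow> 'a set \<Rightarrow> bool" where
  "unmixed R I \<longleftrightarrow>
     (\<forall>P\<in>associated_primes R I. \<forall>Q\<in>associated_primes R I. height R P = height R Q)"

section \<open>Polynomial rings\<close>

text \<open>Monomials are finitely supported exponent vectors and polynomials are finitely supported
  coefficient functions on monomials, so the variables occurring in \<open>p\<close> are the keys of the keys
  of \<open>p\<close>.\<close>
definition mpoly_ring :: "'v set \<Rightarrow> (('v \<Rightarrow>\<^sub>0 nat) \<Rightarrow>\<^sub>0 'k::field) ring" where
  "mpoly_ring V =
     \<lparr>carrier = {p. \<forall>m\<in>Poly_Mapping.keys p. Poly_Mapping.keys m \<subseteq> V},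
      mult = (*), one = 1, zero = 0, add = (+)\<rparr>"

definition var :: "'v \<Rightarrow> (('v \<Rightarrow>\<^sub>0 nat) \<Rightarrow>\<^sub>0 'k::field)" where
  "var x = Poly_Mapping.single (Poly_Mapping.single x 1) 1"

section \<open>Weighted oriented graphs\<close>

locale weighted_oriented_graph = pair_digraph D
  for D :: "'v pair_pre_digraph" +
  fixes d :: "'v \<Rightarrow> nat"
  assumes oriented: "(x, y) \<in> parcs D \<Longrightarrow> (y, x) \<notin> parcs D"
    and weight_pos: "v \<in> pverts D \<Longrightarrow> d v \<ge> 1"
    and weight_source: "v \<in> pverts D \<Longrightarrow> in_arcs D v = {} \<Longrightarrow> d v = 1"

definition edge_ideal ::
  "'v pair_pre_digraph \<Rightarrow> ('v \<Rightarrow> nat) \<Rightarrow> (('v \<Rightarrow>\<^sub>0 nat) \<Rightarrow>\<^sub>0 'k::field) set" where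
  "edge_ideal D d =
     Idl\<^bsub>mpoly_ring (pverts D)\<^esub> {var x * var y ^ d y | x y. (x, y) \<in> parcs D}"

text \<open>An undirected simple graph is a loop-free symmetric digraph; the underlying graph of \<open>D\<close> is
  \<^term>\<open>mk_symmetric (with_proj D)\<close>, and the degree of a vertex is its out-degree there.\<close>
abbreviation underlying :: "'v pair_pre_digraph \<Rightarrow> 'v pair_pre_digraph" where
  "underlying D \<equiv> mk_symmetric (with_proj D)"

abbreviation vertex_degree :: "'v pair_pre_digraph \<Rightarrow> 'v \<Rightarrow> nat" where
  "vertex_degree G v \<equiv> out_degree (with_proj G) v"

text \<open>The constant \<^const>\<open>forest\<close> is of no use here: in a symmetric digraph, going back and forth
  along one edge is a \<^const>\<open>pre_digraph.cycle\<close> of length 2. Excluding these, the cycles of the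
  digraph are those of the undirected graph.\<close>
definition undirected_forest :: "'v pair_pre_digraph \<Rightarrow> bool" where
  "undirected_forest G \<longleftrightarrow> \<not> (\<exists>p. pre_digraph.cycle (with_proj G) p \<and> length p \<ge> 3)"

definition no_isolated_vertices :: "'v pair_pre_digraph \<Rightarrow> bool" where
  "no_isolated_vertices G \<longleftrightarrow> (\<forall>v\<in>pverts G. vertex_degree G v \<noteq> 0)"

definition perfect_matching :: "'v pair_pre_digraph \<Rightarrow> 'v set set \<Rightarrow> bool" where
  "perfect_matching G M \<longleftrightarrow>
     M \<subseteq> {{u, v} | u v. (u, v) \<in> parcs G} \<and> disjoint M \<and> \<Union>M = pverts G"

end

theory Submission
  imports Defs "HOL-Computational_Algebra.Polynomial"
begin

text \<open>The prime generated by a set \<open>C\<close> of variables has height \<open>|C|\<close>. For certain vertex covers,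
  the strong covers, it is the annihilator of a monomial modulo the edge ideal \<open>I\<close>. If \<open>I\<close> is
  unmixed, all strong covers therefore have the same cardinality. They also do if \<open>R/I\<close> is
  Cohen--Macaulay: localize at the ideal of all variables and use that a regular sequence of length
  \<open>n\<close> yields a chain of \<open>n\<close> proper inclusions of primes above every associated prime. Complements of maximal
  independent sets are strong covers, so the forest is well-covered, and removing a leaf together
  with its neighbour repeatedly produces a perfect matching each of whose edges has a leaf. If
  \<open>x \<rightarrow> y\<close> with \<open>y\<close> a leaf and \<open>d x \<ge> 2\<close>, there is a strong cover with one vertex too many.

  Conversely, given the matching, passing to \<open>I : v\<close> and \<open>I + (v)\<close> for variables \<open>v\<close>, again and again,
  leads from \<open>I\<close> to primes generated by one variable of each pair \<open>{x\<^sub>i, y\<^sub>i}\<close>. So these are the only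
  possible associated primes, and the sequence of the \<open>p\<^sub>i(x\<^sub>i + y\<^sub>i)\<close> is regular modulo \<open>I\<close> for monic
  univariate polynomials \<open>p\<^sub>i\<close> over \<open>K\<close>, because it is so modulo each of these primes. As a prime above
  \<open>I\<close> contains \<open>x\<^sub>i\<close> or \<open>y\<^sub>i\<close>, Zariski's lemma provides \<open>p\<^sub>i\<close> for which the sequence lies in
  a given maximal ideal.\<close>

text \<open>Cohen-Macaulayness is tested at every maximal ideal, not only at that of the variables,
  and \<open>K\<close> is an arbitrary field; the regular sequence must therefore adapt to the
  maximal ideal, which the monic \<open>p\<^sub>i\<close> achieve. They are evaluated at
  \<open>x\<^sub>i + y\<^sub>i\<close> because each prime reached by the splitting kills exactly one
  of the two vertices: whichever it is, a monic polynomial in the other, a free variable of the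
  quotient, remains. Passing to \<open>I : v\<close> and \<open>I + (v)\<close> is the exact
  sequence 0 -> R/(I : v) -> R/I -> R/(I + (v)) -> 0, whose outer terms control regularity and
  associated primes of the middle one. Strong covers may be larger than minimal covers: weights of
  at least 2 can create embedded primes, and these detect the condition on \<open>d\<close>. All
  dimensions come from one bound, \<open>prime_chain_length\<close>: a chain of primes whose first
  member contains the variables of \<open>C\<close> has length at most
  \<open>card V - card C\<close>. It is obtained by counting monomials, without transcendence
  degrees.\<close>

definition ring_on :: "'a::comm_ring_1 set \<Rightarrow> 'a ring" where
  "ring_on S = \<lparr>carrier = S, mult = (*), one = 1, zero = 0, add = (+)\<rparr>"

lemma ring_on_simps [simp]:
  "carrier (ring_on S) = S" "x \<otimes>\<^bsub>ring_on S\<^esub> y = x * y" "x \<oplus>\<^bsub>ring_on S\<^esub> y = x + y"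
  "\<one>\<^bsub>ring_on S\<^esub> = 1" "\<zero>\<^bsub>ring_on S\<^esub> = 0"
  by (simp_all add: ring_on_def)

text \<open>Negatives have no clause of their own: in a subring they arise by multiplication with
  \<open>- 1\<close>.\<close>

definition ideal_on :: "'a::comm_ring_1 set \<Rightarrow> 'a set \<Rightarrow> bool" where
  "ideal_on S J \<longleftrightarrow> J \<subseteq> S \<and> 0 \<in> J \<and> (\<forall>a\<in>J. \<forall>b\<in>J. a + b \<in> J) \<and> (\<forall>r\<in>S. \<forall>a\<in>J. r * a \<in> J)"

definition colon :: "'a::comm_ring_1 set \<Rightarrow> 'a set \<Rightarrow> 'a \<Rightarrow> 'a set" where
  "colon S J f = {r \<in> S. r * f \<in> J}"

definition adjoin :: "'a::comm_ring_1 set \<Rightarrow> 'a set \<Rightarrow> 'a \<Rightarrow> 'a set" where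
  "adjoin S J f = {j + f * r | j r. j \<in> J \<and> r \<in> S}"

text \<open>In contrast to \<open>regular_sequence\<close>, the final ideal may be the whole ring
  and the initial ideal is an argument. The splitting needs both, since a colon ideal can be all of
  \<open>S\<close>.\<close>

fun weakly_regular :: "'a::comm_ring_1 set \<Rightarrow> 'a set \<Rightarrow> 'a list \<Rightarrow> bool" where
  "weakly_regular S J [] \<longleftrightarrow> True"
| "weakly_regular S J (q # qs) \<longleftrightarrow>
     (\<forall>b\<in>S. q * b \<in> J \<longrightarrow> b \<in> J) \<and> weakly_regular S (adjoin S J q) qs"

text \<open>The polynomial rings of the proof are subsets of one type with the operations of the
  type class, so that identities are settled by \<open>algebra_simps\<close>. The record
  \<open>ring_on S\<close> is the bridge to the notions of the theorem.\<close>

locale unital_subring =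
  fixes S :: "'a::comm_ring_1 set"
  assumes one_mem [simp]: "1 \<in> S"
    and add_mem [simp]: "a \<in> S \<Longrightarrow> b \<in> S \<Longrightarrow> a + b \<in> S"
    and uminus_mem [simp]: "a \<in> S \<Longrightarrow> - a \<in> S"
    and mult_mem [simp]: "a \<in> S \<Longrightarrow> b \<in> S \<Longrightarrow> a * b \<in> S"
begin

lemma zero_mem [simp]: "0 \<in> S"
  using add_mem[OF one_mem uminus_mem[OF one_mem]] by simp

lemma diff_mem [simp]: "a \<in> S \<Longrightarrow> b \<in> S \<Longrightarrow> a - b \<in> S"
  using add_mem[of a "- b"] by simp

lemma power_mem [simp]: "a \<in> S \<Longrightarrow> a ^ n \<in> S"
  by (induction n) auto

lemma sum_mem: "(\<And>i. i \<in> A \<Longrightarrow> f i \<in> S) \<Longrightarrow> sum f A \<in> S"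
  by (induction A rule: infinite_finite_induct) auto

lemma prod_mem: "(\<And>i. i \<in> A \<Longrightarrow> f i \<in> S) \<Longrightarrow> prod f A \<in> S"
  by (induction A rule: infinite_finite_induct) auto

lemma cring_ring_on: "cring (ring_on S)"
proof (rule cringI)
  show "abelian_group (ring_on S)"
    by (rule abelian_groupI) (auto simp: algebra_simps intro: bexI[of _ "- x" for x])
  show "Group.comm_monoid (ring_on S)"
    by (rule Group.comm_monoidI) (auto simp: algebra_simps)
qed (auto simp: algebra_simps)

lemma ring_ring_on: "ring (ring_on S)"
  by (rule cring.axioms(1)[OF cring_ring_on])

lemma ring_on_uminus [simp]: "a \<in> S \<Longrightarrow> \<ominus>\<^bsub>ring_on S\<^esub> a = - a"
proof -
  interpret R: cring "ring_on S" by (rule cring_ring_on)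
  show "a \<in> S \<Longrightarrow> \<ominus>\<^bsub>ring_on S\<^esub> a = - a"
    by (metis R.add.inv_equality ring_on_simps(1,3,5) add.left_inverse uminus_mem)
qed

lemma ideal_on_iff: "ideal J (ring_on S) \<longleftrightarrow> ideal_on S J"
proof
  assume "ideal J (ring_on S)"
  then interpret J: ideal J "ring_on S" .
  have "J \<subseteq> S" using J.a_subset by simp
  moreover have "0 \<in> J" using additive_subgroup.zero_closed[OF J.is_additive_subgroup, unfolded ring_on_simps] .
  moreover have "\<forall>a\<in>J. \<forall>b\<in>J. a + b \<in> J" using additive_subgroup.a_closed[OF J.is_additive_subgroup, unfolded ring_on_simps] by blast
  moreover have "\<forall>r\<in>S. \<forall>a\<in>J. r * a \<in> J" using J.I_l_closed[unfolded ring_on_simps] by blast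
  ultimately show "ideal_on S J" unfolding ideal_on_def by blast
next
  assume J: "ideal_on S J"
  show "ideal J (ring_on S)"
  proof (rule idealI)
    show "ring (ring_on S)" by (rule ring_ring_on)
    have inv: "- a \<in> J" if "a \<in> J" for a
    proof -
      have "(- 1) * a \<in> J" using J that uminus_mem[OF one_mem] unfolding ideal_on_def by blast
      then show ?thesis by simp
    qed
    show "subgroup J (add_monoid (ring_on S))"
    proof (rule subgroup.intro)
      fix x assume x: "x \<in> J"
      then have "inv\<^bsub>add_monoid (ring_on S)\<^esub> x = - x"
        using ring_on_uminus[of x] J by (auto simp: ideal_on_def a_inv_def)
      then show "inv\<^bsub>add_monoid (ring_on S)\<^esub> x \<in> J" using inv[OF x] by simp
    qed (use J in \<open>auto simp: ideal_on_def\<close>)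
    show "a \<otimes>\<^bsub>ring_on S\<^esub> x \<in> J" if "a \<in> J" "x \<in> carrier (ring_on S)" for a x
      using J that unfolding ideal_on_def by (simp add: mult.commute[of a])
    show "x \<otimes>\<^bsub>ring_on S\<^esub> a \<in> J" if "a \<in> J" "x \<in> carrier (ring_on S)" for a x
      using J that unfolding ideal_on_def by simp
  qed
qed

lemma primeideal_on_iff:
  "primeideal P (ring_on S) \<longleftrightarrow>
     ideal_on S P \<and> 1 \<notin> P \<and> (\<forall>a\<in>S. \<forall>b\<in>S. a * b \<in> P \<longrightarrow> a \<in> P \<or> b \<in> P)"
proof
  assume "primeideal P (ring_on S)"
  then interpret P: primeideal P "ring_on S" .
  show "ideal_on S P \<and> 1 \<notin> P \<and> (\<forall>a\<in>S. \<forall>b\<in>S. a * b \<in> P \<longrightarrow> a \<in> P \<or> b \<in> P)"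
    using P.I_notcarr P.I_prime P.one_imp_carrier P.is_ideal by (auto simp: ideal_on_iff)
next
  assume P: "ideal_on S P \<and> 1 \<notin> P \<and> (\<forall>a\<in>S. \<forall>b\<in>S. a * b \<in> P \<longrightarrow> a \<in> P \<or> b \<in> P)"
  then have "ideal P (ring_on S)" by (simp add: ideal_on_iff)
  then show "primeideal P (ring_on S)"
    by (rule primeidealI) (use P cring_ring_on one_mem in auto)
qed

lemma ideal_on_diff: "ideal_on S J \<Longrightarrow> a \<in> J \<Longrightarrow> b \<in> J \<Longrightarrow> a - b \<in> J"
proof -
  assume J: "ideal_on S J" "a \<in> J" "b \<in> J"
  then have "a + (- 1) * b \<in> J" using uminus_mem[OF one_mem] unfolding ideal_on_def by blast
  then show "a - b \<in> J" by simp
qed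

lemma ideal_on_add: "ideal_on S J \<Longrightarrow> a \<in> J \<Longrightarrow> b \<in> J \<Longrightarrow> a + b \<in> J"
  by (simp add: ideal_on_def)

lemma ideal_on_mult: "ideal_on S J \<Longrightarrow> r \<in> S \<Longrightarrow> a \<in> J \<Longrightarrow> r * a \<in> J"
  by (simp add: ideal_on_def)

lemma ideal_on_mult': "ideal_on S J \<Longrightarrow> r \<in> S \<Longrightarrow> a \<in> J \<Longrightarrow> a * r \<in> J"
  using ideal_on_mult[of J r a] by (simp add: mult.commute)

lemma ideal_on_sum: "ideal_on S J \<Longrightarrow> (\<And>i. i \<in> A \<Longrightarrow> f i \<in> J) \<Longrightarrow> sum f A \<in> J"
  by (induction A rule: infinite_finite_induct) (auto simp: ideal_on_def)

lemma ideal_on_cancel: "ideal_on S J \<Longrightarrow> a - b \<in> J \<Longrightarrow> a \<in> J \<longleftrightarrow> b \<in> J"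
  using ideal_on_diff[of J a "a - b"] ideal_on_add[of J "a - b" b] by auto

lemma ideal_on_sub: "ideal_on S J \<Longrightarrow> a \<in> J \<Longrightarrow> a \<in> S"
  by (auto simp: ideal_on_def)

lemma ideal_on_adjoin:
  assumes "ideal_on S J" "f \<in> S"
  shows "ideal_on S (adjoin S J f)"
  unfolding ideal_on_def
proof (intro conjI ballI)
  show "adjoin S J f \<subseteq> S" using assms ideal_on_sub by (auto simp: adjoin_def)
  show "0 \<in> adjoin S J f"
    using assms by (auto simp: adjoin_def ideal_on_def intro!: exI[of _ 0])
  fix a assume "a \<in> adjoin S J f"
  then obtain j r where a: "a = j + f * r" "j \<in> J" "r \<in> S" by (auto simp: adjoin_def)
  { fix b assume "b \<in> adjoin S J f"
    then obtain j' r' where b: "b = j' + f * r'" "j' \<in> J" "r' \<in> S" by (auto simp: adjoin_def)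
    have "a + b = (j + j') + f * (r + r')" using a b by (simp add: algebra_simps)
    then show "a + b \<in> adjoin S J f" unfolding adjoin_def
      using ideal_on_add[OF assms(1) a(2) b(2)] add_mem[OF a(3) b(3)] by blast }
  { fix s assume s: "s \<in> S"
    have "s * a = s * j + f * (s * r)" using a by (simp add: algebra_simps)
    then show "s * a \<in> adjoin S J f" unfolding adjoin_def
      using ideal_on_mult[OF assms(1) s a(2)] mult_mem[OF s a(3)] by blast }
qed

lemma adjoin_supset: "J \<subseteq> adjoin S J f"
proof
  fix a assume "a \<in> J"
  then show "a \<in> adjoin S J f"
    unfolding adjoin_def by (intro CollectI exI[of _ a] exI[of _ 0]) simp
qed

lemma adjoin_mem: "ideal_on S J \<Longrightarrow> f \<in> adjoin S J f"
  unfolding adjoin_def by (rule CollectI, rule exI[of _ 0], rule exI[of _ 1]) (simp add: ideal_on_def)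

lemma adjoin_cong:
  assumes J: "ideal_on S J" and "f - g \<in> J"
  shows "adjoin S J f = adjoin S J g"
proof -
  have *: "adjoin S J f \<subseteq> adjoin S J g" if "f - g \<in> J" for f g
  proof
    fix a assume "a \<in> adjoin S J f"
    then obtain j r where a: "a = j + f * r" "j \<in> J" "r \<in> S" by (auto simp: adjoin_def)
    then have "a = (j + (f - g) * r) + g * r" by (simp add: algebra_simps)
    then show "a \<in> adjoin S J g"
      unfolding adjoin_def using ideal_on_add[OF J a(2) ideal_on_mult'[OF J a(3) that]] a(3) by blast
  qed
  have "g - f \<in> J" using ideal_on_diff[OF J, of 0 "f - g"] assms J by (simp add: ideal_on_def)
  then show ?thesis using * assms by blast
qed

lemma adjoin_commute: "adjoin S (adjoin S J f) g = adjoin S (adjoin S J g) f"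
proof -
  have "adjoin S (adjoin S J f) g \<subseteq> adjoin S (adjoin S J g) f" for f g
  proof
    fix a assume "a \<in> adjoin S (adjoin S J f) g"
    then obtain j r s where "a = j + f * r + g * s" "j \<in> J" "r \<in> S" "s \<in> S"
      unfolding adjoin_def by blast
    then have "a = (j + g * s) + f * r" "j + g * s \<in> adjoin S J g"
      unfolding adjoin_def by (simp add: algebra_simps, blast)
    then show "a \<in> adjoin S (adjoin S J g) f"
      using \<open>r \<in> S\<close> unfolding adjoin_def[of _ "adjoin S J g"] by blast
  qed
  then show ?thesis by blast
qed

text \<open>Since \<open>q\<close> is regular modulo \<open>J + (f)\<close>, the exact sequence 0 ->
  S/(J : f) -> S/J -> S/(J + (f)) -> 0 stays exact after reduction modulo \<open>q\<close>.
  Concretely, if \<open>r f = j + q s\<close>, then \<open>q s\<close> and hence \<open>s\<close>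
  lies in \<open>J + (f)\<close>, and its multiple of \<open>f\<close> can be subtracted from
  \<open>r\<close>.\<close>

lemma colon_adjoin:
  assumes J: "ideal_on S J" and f: "f \<in> S" and q: "q \<in> S"
    and reg: "\<And>b. b \<in> S \<Longrightarrow> q * b \<in> adjoin S J f \<Longrightarrow> b \<in> adjoin S J f"
  shows "colon S (adjoin S J q) f = adjoin S (colon S J f) q"
proof (intro equalityI subsetI)
  fix r assume "r \<in> colon S (adjoin S J q) f"
  then obtain j s where r: "r \<in> S" "r * f = j + q * s" "j \<in> J" "s \<in> S"
    unfolding colon_def adjoin_def by blast
  have "q * s = - j + f * r" using r(2) by (simp add: algebra_simps)
  moreover have "- j \<in> J" using ideal_on_diff[OF J, of 0 j] J r by (simp add: ideal_on_def)
  ultimately have "q * s \<in> adjoin S J f" unfolding adjoin_def using r by blast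
  then have "s \<in> adjoin S J f" using reg r by blast
  then obtain j' t where s: "s = j' + f * t" "j' \<in> J" "t \<in> S" unfolding adjoin_def by blast
  have "(r - q * t) * f = j + q * j'" using r(2) s by (simp add: algebra_simps)
  also have "\<dots> \<in> J" using r s J q by (simp add: ideal_on_add ideal_on_mult)
  finally have "r - q * t \<in> colon S J f" using r s q by (simp add: colon_def)
  moreover have "r = (r - q * t) + q * t" by simp
  ultimately show "r \<in> adjoin S (colon S J f) q" using s unfolding adjoin_def by blast
next
  fix r assume "r \<in> adjoin S (colon S J f) q"
  then obtain j s where r: "r = j + q * s" "j \<in> S" "j * f \<in> J" "s \<in> S"
    unfolding colon_def adjoin_def by blast
  then have "r * f = j * f + q * (s * f)" by (simp add: algebra_simps)
  moreover have "s * f \<in> S" "r \<in> S" using r f q by auto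
  ultimately show "r \<in> colon S (adjoin S J q) f"
    unfolding colon_def adjoin_def using r(3) by blast
qed

text \<open>Regularity of the first element passes from the outer terms of the exact sequence to the
  middle one. By \<open>colon_adjoin\<close> and \<open>adjoin_commute\<close>, the quotients by
  this element form a sequence of the same kind, so the induction continues.\<close>

lemma weakly_regular_split:
  assumes "ideal_on S J" "f \<in> S" "set qs \<subseteq> S"
    and "weakly_regular S (colon S J f) qs" "weakly_regular S (adjoin S J f) qs"
  shows "weakly_regular S J qs"
  using assms
proof (induction qs arbitrary: J)
  case (Cons q qs)
  have J: "ideal_on S J" and f: "f \<in> S" and q: "q \<in> S" using Cons.prems by auto
  have reg: "b \<in> adjoin S J f" if "b \<in> S" "q * b \<in> adjoin S J f" for b
    using Cons.prems that by auto
  have "b \<in> J" if b: "b \<in> S" "q * b \<in> J" for b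
  proof -
    have "q * b \<in> adjoin S J f" using b(2) adjoin_supset by (rule subsetD[rotated])
    then have "b \<in> adjoin S J f" using b(1) reg by simp
    then obtain j t where t: "b = j + f * t" "j \<in> J" "t \<in> S" unfolding adjoin_def by blast
    have "q * b - q * j \<in> J" using ideal_on_diff[OF J b(2) ideal_on_mult[OF J q t(2)]] .
    also have "q * b - q * j = q * t * f" using t(1) by (simp add: algebra_simps)
    finally have "q * t \<in> colon S J f" using t(3) q by (simp add: colon_def)
    moreover have "\<forall>b\<in>S. q * b \<in> colon S J f \<longrightarrow> b \<in> colon S J f"
      using Cons.prems(4) by simp
    ultimately have "t * f \<in> J" using t(3) by (simp add: colon_def)
    then show "b \<in> J" using t(1) ideal_on_add[OF J t(2)] by (simp add: mult.commute)
  qed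
  moreover have "weakly_regular S (adjoin S J q) qs"
  proof (rule Cons.IH)
    show "weakly_regular S (colon S (adjoin S J q) f) qs"
    proof -
      have "colon S (adjoin S J q) f = adjoin S (colon S J f) q"
        by (rule colon_adjoin[OF J f q]) (rule reg)
      then show ?thesis using Cons.prems(4) by simp
    qed
    show "weakly_regular S (adjoin S (adjoin S J q) f) qs"
      using Cons.prems(5) unfolding adjoin_commute[of J q f] by simp
    show "ideal_on S (adjoin S J q)" by (rule ideal_on_adjoin[OF J q])
  qed (use Cons.prems in auto)
  ultimately show ?case by simp
qed simp

lemma weakly_regular_trivial: "ideal_on S S \<Longrightarrow> set qs \<subseteq> S \<Longrightarrow> weakly_regular S S qs"
proof (induction qs)
  case (Cons q qs)
  have "adjoin S S q = S"
    using adjoin_supset[of S q] ideal_on_adjoin[of S q] Cons.prems by (auto simp: ideal_on_def)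
  with Cons show ?case by simp
qed simp

text \<open>The module generated by the residue class of \<open>g\<close> is a copy of
  \<open>S / P\<close>, in which every nonzero element has annihilator \<open>P\<close>. Either it
  contains a nonzero multiple of \<open>f\<close>, whose cofactor \<open>t\<close> then has
  annihilator \<open>P\<close> modulo the colon ideal, or it embeds into the quotient by
  \<open>J + (f)\<close>.\<close>

lemma associated_primes_split:
  assumes J: "ideal_on S J" and f: "f \<in> S" and P: "P \<in> associated_primes (ring_on S) J"
  shows "P \<in> associated_primes (ring_on S) (colon S J f) \<or>
    P \<in> associated_primes (ring_on S) (adjoin S J f)"
proof -
  obtain g where prime: "primeideal P (ring_on S)" and g: "g \<in> S" "P = {r \<in> S. r * g \<in> J}"
    using P by (auto simp: associated_primes_def)
  note prime' = prime[unfolded primeideal_on_iff]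
  show ?thesis
  proof (cases "\<exists>r\<in>S. \<exists>t\<in>S. r * g - f * t \<in> J \<and> r * g \<notin> J")
    case True
    then obtain r t where rt: "r \<in> S" "t \<in> S" "r * g - f * t \<in> J" "r * g \<notin> J" by blast
    have "P = {s \<in> S. s * t \<in> colon S J f}"
    proof -
      have "s \<in> P \<longleftrightarrow> s * t * f \<in> J" if s: "s \<in> S" for s
      proof -
        have "s * r * g - s * t * f \<in> J"
          using ideal_on_mult[OF J s rt(3)] by (simp add: algebra_simps)
        then have "s * t * f \<in> J \<longleftrightarrow> s * r * g \<in> J" using ideal_on_cancel[OF J] by blast
        also have "\<dots> \<longleftrightarrow> s * r \<in> P" using g s rt by (simp add: mult.assoc)
        also have "\<dots> \<longleftrightarrow> s \<in> P"
        proof -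
          have "r \<notin> P" using rt g by simp
          moreover have "s * r \<in> P" if "s \<in> P" using ideal_on_mult'[OF _ rt(1) that] prime' by simp
          ultimately show ?thesis using prime' s rt(1) by metis
        qed
        finally show ?thesis by simp
      qed
      moreover have "P \<subseteq> S" using g by auto
      ultimately show ?thesis using rt by (auto simp: colon_def)
    qed
    then have "P \<in> associated_primes (ring_on S) (colon S J f)"
      unfolding associated_primes_def using prime rt(2) by simp blast
    then show ?thesis ..
  next
    case False
    have "P = {s \<in> S. s * g \<in> adjoin S J f}"
    proof (intro equalityI subsetI)
      fix s assume "s \<in> P"
      then have "s \<in> S" "s * g \<in> J" using g(2) by auto
      then show "s \<in> {s \<in> S. s * g \<in> adjoin S J f}" using adjoin_supset[of J f] by blast
    next
      fix s assume "s \<in> {s \<in> S. s * g \<in> adjoin S J f}"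
      then obtain j t where s: "s \<in> S" "s * g = j + f * t" "j \<in> J" "t \<in> S"
        unfolding adjoin_def by blast
      then have "s * g - f * t \<in> J" by simp
      then have "s * g \<in> J" using False s(1,4) by blast
      then show "s \<in> P" using s(1) g(2) by simp
    qed
    then have "P \<in> associated_primes (ring_on S) (adjoin S J f)"
      unfolding associated_primes_def using prime g(1) by simp blast
    then show ?thesis ..
  qed
qed

end

section \<open>Polynomials in a varying set of variables\<close>

type_synonym ('v, 'k) mpoly = "('v \<Rightarrow>\<^sub>0 nat) \<Rightarrow>\<^sub>0 'k"

text \<open>All sets of variables share one type, so embeddings of polynomial rings are
  inclusions.\<close>

definition polys :: "'v set \<Rightarrow> ('v, 'k::field) mpoly set" where
  "polys V = {p. \<forall>m\<in>Poly_Mapping.keys p. Poly_Mapping.keys m \<subseteq> V}"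

lemma mpoly_ring_eq: "mpoly_ring V = ring_on (polys V)"
  by (simp add: mpoly_ring_def ring_on_def polys_def)

lemma single_mem_polys: "Poly_Mapping.keys m \<subseteq> V \<Longrightarrow> Poly_Mapping.single m c \<in> polys V"
  by (simp add: polys_def)

lemma keys_add_nat:
  "Poly_Mapping.keys (a + b :: 'v \<Rightarrow>\<^sub>0 nat) = Poly_Mapping.keys a \<union> Poly_Mapping.keys b"
  by (auto simp: in_keys_iff lookup_add)

interpretation polys: unital_subring "polys V :: ('v, 'k::field) mpoly set" for V
proof
  fix a b :: "('v, 'k) mpoly"
  show "1 \<in> polys V" by (simp add: polys_def)
  show "a + b \<in> polys V" if "a \<in> polys V" "b \<in> polys V"
    using that keys_add[of a b] by (fastforce simp: polys_def)
  show "- a \<in> polys V" if "a \<in> polys V"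
    using that by (auto simp: polys_def in_keys_iff)
  show "a * b \<in> polys V" if "a \<in> polys V" "b \<in> polys V"
    using that keys_mult[of a b] by (fastforce simp: polys_def keys_add_nat)
qed

lemma polys_mono: "V \<subseteq> W \<Longrightarrow> polys V \<subseteq> polys W"
  by (auto simp: polys_def)

lemma var_mem_polys: "x \<in> V \<Longrightarrow> var x \<in> polys V"
  by (simp add: polys_def var_def)

lemma mpoly_sum_singles:
  fixes p :: "('v, 'k::field) mpoly"
  shows "p = (\<Sum>m\<in>Poly_Mapping.keys p. Poly_Mapping.single m (Poly_Mapping.lookup p m))"
proof (rule poly_mapping_eqI)
  fix k
  show "Poly_Mapping.lookup p k = Poly_Mapping.lookup
    (\<Sum>m\<in>Poly_Mapping.keys p. Poly_Mapping.single m (Poly_Mapping.lookup p m)) k"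
    by (simp add: lookup_sum lookup_single when_def in_keys_iff)
qed

lemma mpoly_induct [case_names zero single add]:
  fixes p :: "('v, 'k::field) mpoly"
  assumes "P 0" "\<And>m c. P (Poly_Mapping.single m c)" "\<And>p q. P p \<Longrightarrow> P q \<Longrightarrow> P (p + q)"
  shows "P p"
proof -
  have "P (\<Sum>m\<in>A. Poly_Mapping.single m (Poly_Mapping.lookup p m))" if "finite A" for A
    using that by (induction A) (auto intro: assms)
  from this[OF finite_keys[of p]] show ?thesis
    using mpoly_sum_singles[of p] by simp
qed

lemma var_power: "var w ^ n = Poly_Mapping.single (Poly_Mapping.single w n) 1"
  by (induction n) (simp_all add: var_def mult_single single_add[symmetric])

subsection \<open>Polynomials as univariate polynomials in one of the variables\<close>

definition drop_var :: "'v \<Rightarrow> ('v \<Rightarrow>\<^sub>0 nat) \<Rightarrow> 'v \<Rightarrow>\<^sub>0 nat" where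
  "drop_var w m = Poly_Mapping.update w 0 m"

lemma drop_var_add: "drop_var w (m + n) = drop_var w m + drop_var w n"
  by (rule poly_mapping_eqI) (simp add: drop_var_def lookup_update lookup_add)

lemma drop_var_split: "drop_var w m + Poly_Mapping.single w (Poly_Mapping.lookup m w) = m"
  by (rule poly_mapping_eqI)
    (simp add: drop_var_def lookup_update lookup_add lookup_single when_def)

lemma keys_drop_var: "Poly_Mapping.keys (drop_var w m) = Poly_Mapping.keys m - {w}"
  by (simp add: drop_var_def keys_update)

text \<open>The coefficients stay in the type of multivariate polynomials and merely avoid
  \<open>w\<close>; evaluation at \<open>var w\<close> is the inverse, by \<open>poly_uni\<close>
  and \<open>uni_poly\<close>.\<close>

definition uni :: "'v \<Rightarrow> ('v, 'k::field) mpoly \<Rightarrow> ('v, 'k) mpoly poly" where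
  "uni w p = (\<Sum>m\<in>Poly_Mapping.keys p.
     Polynomial.monom (Poly_Mapping.single (drop_var w m) (Poly_Mapping.lookup p m))
       (Poly_Mapping.lookup m w))"

lemma uni_single:
  "uni w (Poly_Mapping.single m c) =
     Polynomial.monom (Poly_Mapping.single (drop_var w m) c) (Poly_Mapping.lookup m w)"
  by (simp add: uni_def)

lemma uni_zero [simp]: "uni w 0 = 0"
  by (simp add: uni_def)

lemma uni_add: "uni w (p + q) = uni w p + uni w q"
  unfolding uni_def
  by (rule setsum_keys_plus_distrib) (simp_all add: single_add add_monom)

lemma uni_uminus: "uni w (- p) = - uni w p"
  using uni_add[of w p "- p"] by (simp add: eq_neg_iff_add_eq_0 add.commute)

lemma uni_diff: "uni w (p - q) = uni w p - uni w q"
  using uni_add[of w p "- q"] by (simp add: uni_uminus)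

lemma uni_sum: "uni w (sum f A) = (\<Sum>i\<in>A. uni w (f i))"
  by (induction A rule: infinite_finite_induct) (simp_all add: uni_add)

lemma uni_mult: "uni w (p * q) = uni w p * uni w q"
proof (induction p rule: mpoly_induct)
  case (single m c)
  show ?case
  proof (induction q rule: mpoly_induct)
    case (single n d)
    show ?case
      by (simp add: mult_single uni_single mult_monom drop_var_add lookup_add)
  qed (simp_all add: uni_add algebra_simps)
qed (simp_all add: uni_add algebra_simps)

lemma uni_var: "uni w (var w) = Polynomial.monom 1 1"
  by (simp add: var_def uni_single drop_var_def)
    (metis drop_var_def drop_var_split lookup_single_eq add_right_cancel add_0 single_one)

lemma uni_one [simp]: "uni w 1 = 1"
proof -
  have "drop_var w 0 = 0" by (rule poly_mapping_eqI) (simp add: drop_var_def lookup_update)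
  then show ?thesis using uni_single[of w 0 1] by (simp add: monom_0 one_pCons)
qed

lemma uni_power: "uni w (p ^ n) = uni w p ^ n"
  by (induction n) (simp_all add: uni_mult)

lemma poly_uni: "poly (uni w p) (var w) = p"
proof (induction p rule: mpoly_induct)
  case (single m c)
  show ?case by (simp add: uni_single poly_monom var_power mult_single drop_var_split)
qed (simp_all add: uni_add)

lemma coeff_uni_mem: "p \<in> polys V \<Longrightarrow> poly.coeff (uni w p) i \<in> polys (V - {w})"
  unfolding uni_def coeff_sum coeff_monom
  by (rule polys.sum_mem) (auto simp: polys_def keys_drop_var)

lemma uni_eq_0_iff: "uni w p = 0 \<longleftrightarrow> p = 0"
  by (metis poly_uni poly_0 uni_zero)

lemma uni_const:
  assumes "p \<in> polys V" "w \<notin> V"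
  shows "uni w p = [:p:]"
proof -
  have "Poly_Mapping.lookup m w = 0 \<and> drop_var w m = m" if "m \<in> Poly_Mapping.keys p" for m
  proof -
    have "Poly_Mapping.lookup m w = 0" using that assms unfolding polys_def not_in_keys_iff_lookup_eq_zero[symmetric] by blast
    then show ?thesis using drop_var_split[of w m] by simp
  qed
  then have "uni w p = (\<Sum>m\<in>Poly_Mapping.keys p. [:Poly_Mapping.single m (Poly_Mapping.lookup p m):])"
    unfolding uni_def by (intro sum.cong) (simp_all add: monom_0)
  also have "\<dots> = [:\<Sum>m\<in>Poly_Mapping.keys p. Poly_Mapping.single m (Poly_Mapping.lookup p m):]"
    by (rule poly_eqI) (auto simp: coeff_sum coeff_pCons split: nat.splits)
  finally show ?thesis using mpoly_sum_singles[of p] by simp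
qed

lemma uni_poly:
  assumes "\<And>i. poly.coeff P i \<in> polys V" "w \<notin> V"
  shows "uni w (poly P (var w)) = P"
proof -
  have "uni w (poly P (var w)) = (\<Sum>i\<le>Polynomial.degree P. [:poly.coeff P i:] * Polynomial.monom 1 1 ^ i)"
    unfolding poly_altdef uni_sum
    by (intro sum.cong) (simp_all add: uni_mult uni_power uni_var uni_const[OF assms])
  also have "\<dots> = (\<Sum>i\<le>Polynomial.degree P. Polynomial.monom (poly.coeff P i) i)"
    by (intro sum.cong) (simp_all add: monom_power smult_monom)
  finally show ?thesis by (simp add: poly_as_sum_of_monoms)
qed

lemma poly_mem_polys:
  assumes "\<And>i. poly.coeff P i \<in> polys V" "x \<in> polys V"
  shows "poly P x \<in> polys V"
  unfolding poly_altdef by (rule polys.sum_mem) (use assms in simp)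

lemma polys_empty:
  assumes "p \<in> polys {}"
  obtains c where "p = Poly_Mapping.single 0 c"
proof
  show "p = Poly_Mapping.single 0 (Poly_Mapping.lookup p 0)"
  proof (rule poly_mapping_eqI)
    fix k
    show "Poly_Mapping.lookup p k = Poly_Mapping.lookup (Poly_Mapping.single 0 (Poly_Mapping.lookup p 0)) k"
    proof (cases "k \<in> Poly_Mapping.keys p")
      case True
      then have "k = 0" using assms by (simp add: polys_def)
      then show ?thesis by simp
    next
      case False
      then show ?thesis by (auto simp: in_keys_iff lookup_single when_def)
    qed
  qed
qed

text \<open>The leading coefficients with respect to the added variable multiply to the coefficient
  of the product at the sum of the degrees. This identity holds over any commutative ring, and the
  two coefficients lie in the ring with fewer variables.\<close>

lemma polys_integral:
  assumes "finite V" "f \<in> polys V" "g \<in> polys V" "f * g = 0"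
  shows "f = 0 \<or> g = 0"
  using assms
proof (induction V arbitrary: f g)
  case empty
  obtain a b where f: "f = Poly_Mapping.single 0 a" and g: "g = Poly_Mapping.single 0 b"
    using polys_empty empty(1,2) by metis
  have "Poly_Mapping.single 0 (a * b) = (0 :: ('a, 'b) mpoly)"
    using empty(3) unfolding f g mult_single by simp
  then have "a * b = 0" by (metis lookup_single_eq lookup_zero)
  then show ?case using f g by auto
next
  case (insert x V)
  let ?F = "uni x f" and ?G = "uni x g"
  have "?F * ?G = 0" using insert.prems by (simp add: uni_mult[symmetric])
  then have 3: "lead_coeff ?F * lead_coeff ?G = 0"
    by (metis coeff_mult_degree_sum coeff_0)
  have 1: "lead_coeff ?F \<in> polys V"
    using coeff_uni_mem[OF insert.prems(1), of x "Polynomial.degree ?F"] insert.hyps by simp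
  have 2: "lead_coeff ?G \<in> polys V"
    using coeff_uni_mem[OF insert.prems(2), of x "Polynomial.degree ?G"] insert.hyps by simp
  have "lead_coeff ?F = 0 \<or> lead_coeff ?G = 0" by (rule insert.IH[OF 1 2 3])
  then show ?case by (simp add: uni_eq_0_iff)
qed

subsection \<open>Monomial ideals\<close>

definition up_closed :: "('v \<Rightarrow>\<^sub>0 nat) set \<Rightarrow> bool" where
  "up_closed U \<longleftrightarrow> (\<forall>m\<in>U. \<forall>n. m + n \<in> U)"

text \<open>Encoding the ideal by exponents turns colon ideals and sums with variables into
  operations on \<open>U\<close>. Exponents in \<open>U\<close> that are not supported in
  \<open>V\<close> have no effect, so no restriction on \<open>U\<close> has to be
  maintained.\<close>

definition monomial_ideal :: "'v set \<Rightarrow> ('v \<Rightarrow>\<^sub>0 nat) set \<Rightarrow> ('v, 'k::field) mpoly set" where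
  "monomial_ideal V U = {p \<in> polys V. Poly_Mapping.keys p \<subseteq> U}"

lemma ideal_on_monomial_ideal:
  fixes V :: "'v set"
  assumes U: "up_closed U"
  shows "ideal_on (polys V) (monomial_ideal V U :: ('v, 'k::field) mpoly set)"
  unfolding ideal_on_def
proof (intro conjI ballI)
  fix a b :: "('v, 'k) mpoly"
  show "a + b \<in> monomial_ideal V U" if "a \<in> monomial_ideal V U" "b \<in> monomial_ideal V U"
    using that keys_add[of a b] by (auto simp: monomial_ideal_def)
  show "a * b \<in> monomial_ideal V U" if "a \<in> polys V" "b \<in> monomial_ideal V U"
  proof -
    have "m + n \<in> U" if "n \<in> Poly_Mapping.keys b" for m n
      using that \<open>b \<in> monomial_ideal V U\<close> U
      unfolding monomial_ideal_def up_closed_def add.commute[of m] by blast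
    then have "Poly_Mapping.keys (a * b) \<subseteq> U" using keys_mult[of a b] by blast
    then show ?thesis using that by (simp add: monomial_ideal_def)
  qed
qed (auto simp: monomial_ideal_def)

lemma mult_single_conv_sum:
  fixes p :: "('v, 'k::field) mpoly"
  shows "p * Poly_Mapping.single e 1 = (\<Sum>m\<in>Poly_Mapping.keys p. Poly_Mapping.single (m + e) (Poly_Mapping.lookup p m))"
  by (subst mpoly_sum_singles[of p]) (simp add: sum_distrib_right mult_single del: mpoly_sum_singles)

lemma lookup_mult_single:
  fixes p :: "('v, 'k::field) mpoly"
  shows "Poly_Mapping.lookup (p * Poly_Mapping.single e 1) (m + e) = Poly_Mapping.lookup p m"
  by (simp add: mult_single_conv_sum lookup_sum lookup_single when_def in_keys_iff)

lemma keys_mult_single: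
  fixes p :: "('v, 'k::field) mpoly"
  shows "Poly_Mapping.keys (p * Poly_Mapping.single e 1) = (\<lambda>m. m + e) ` Poly_Mapping.keys p"
proof
  show "Poly_Mapping.keys (p * Poly_Mapping.single e 1) \<subseteq> (\<lambda>m. m + e) ` Poly_Mapping.keys p"
    using keys_mult[of p "Poly_Mapping.single e 1"] by auto
  show "(\<lambda>m. m + e) ` Poly_Mapping.keys p \<subseteq> Poly_Mapping.keys (p * Poly_Mapping.single e 1)"
    by (auto simp: in_keys_iff lookup_mult_single)
qed

lemma colon_monomial_ideal:
  assumes "Poly_Mapping.keys e \<subseteq> V"
  shows "colon (polys V) (monomial_ideal V U) (Poly_Mapping.single e 1) = monomial_ideal V {m. m + e \<in> U}"
  using polys.mult_mem[OF _ single_mem_polys[OF assms]]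
  by (auto simp: colon_def monomial_ideal_def keys_mult_single)

lemma monomial_ideal_memI:
  assumes J: "ideal_on (polys V) J" and p: "p \<in> polys V"
    and "\<And>m c. m \<in> Poly_Mapping.keys p \<Longrightarrow> Poly_Mapping.keys m \<subseteq> V \<Longrightarrow> Poly_Mapping.single m c \<in> J"
  shows "p \<in> J"
proof -
  have "(\<Sum>m\<in>Poly_Mapping.keys p. Poly_Mapping.single m (Poly_Mapping.lookup p m)) \<in> J"
    by (rule polys.ideal_on_sum[OF J]) (use assms in \<open>auto simp: polys_def\<close>)
  then show ?thesis using mpoly_sum_singles[of p] by simp
qed

lemma adjoin_monomial_ideal:
  fixes V :: "'v set"
  assumes x: "x \<in> V" and U: "up_closed U"
  shows "adjoin (polys V) (monomial_ideal V U) (var x :: ('v, 'k::field) mpoly) =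
    monomial_ideal V (U \<union> {m. 1 \<le> Poly_Mapping.lookup m x})"
proof (intro equalityI subsetI)
  fix p :: "('v, 'k) mpoly" assume "p \<in> adjoin (polys V) (monomial_ideal V U) (var x)"
  then obtain j r where p: "p = j + var x * r" "j \<in> monomial_ideal V U" "r \<in> polys V"
    by (auto simp: adjoin_def)
  have "Poly_Mapping.keys (var x * r) \<subseteq> {m. 1 \<le> Poly_Mapping.lookup m x}"
    using keys_mult_single[of r "Poly_Mapping.single x 1"]
    by (auto simp: var_def mult.commute[of _ r] lookup_add)
  then show "p \<in> monomial_ideal V (U \<union> {m. 1 \<le> Poly_Mapping.lookup m x})"
    using p keys_add[of j "var x * r"] polys.mult_mem[OF var_mem_polys[OF x] p(3)]
    by (auto simp: monomial_ideal_def)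
next
  fix p :: "('v, 'k) mpoly" assume p: "p \<in> monomial_ideal V (U \<union> {m. 1 \<le> Poly_Mapping.lookup m x})"
  have J: "ideal_on (polys V) (monomial_ideal V U :: ('v, 'k) mpoly set)"
    using U by (rule ideal_on_monomial_ideal)
  show "p \<in> adjoin (polys V) (monomial_ideal V U) (var x)"
  proof (rule monomial_ideal_memI)
    show "ideal_on (polys V) (adjoin (polys V) (monomial_ideal V U) (var x :: ('v, 'k) mpoly))"
      by (rule polys.ideal_on_adjoin[OF J var_mem_polys[OF x]])
    show "p \<in> polys V" using p by (simp add: monomial_ideal_def)
    fix m and c :: 'k assume m: "m \<in> Poly_Mapping.keys p" "Poly_Mapping.keys m \<subseteq> V"
    consider "m \<in> U" | "1 \<le> Poly_Mapping.lookup m x" using p m by (auto simp: monomial_ideal_def)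
    then show "Poly_Mapping.single m c \<in> adjoin (polys V) (monomial_ideal V U) (var x)"
    proof cases
      case 1
      then have "Poly_Mapping.single m c \<in> monomial_ideal V U"
        using m by (simp add: monomial_ideal_def single_mem_polys)
      then show ?thesis using polys.adjoin_supset by blast
    next
      case 2
      define n where "n = Poly_Mapping.update x (Poly_Mapping.lookup m x - 1) m"
      have "Poly_Mapping.single x 1 + n = m"
        using 2 by (intro poly_mapping_eqI)
          (auto simp: n_def lookup_add lookup_update lookup_single when_def)
      moreover have "Poly_Mapping.keys n \<subseteq> V" using m x by (auto simp: n_def keys_update)
      ultimately have "Poly_Mapping.single m c = 0 + var x * Poly_Mapping.single n c"
        "Poly_Mapping.single n c \<in> polys V"
        by (simp_all add: var_def mult_single single_mem_polys)
      moreover have "0 \<in> monomial_ideal V U" by (simp add: monomial_ideal_def)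
      ultimately show ?thesis unfolding adjoin_def by blast
    qed
  qed
qed

lemma genideal_monomials:
  fixes V :: "'v set"
  assumes G: "\<And>g. g \<in> G \<Longrightarrow> Poly_Mapping.keys g \<subseteq> V"
  shows "Idl\<^bsub>ring_on (polys V)\<^esub> ((\<lambda>g. Poly_Mapping.single g 1 :: ('v, 'k::field) mpoly) ` G) =
    monomial_ideal V {m. \<exists>g\<in>G. \<exists>n. m = g + n}" (is "Idl\<^bsub>_\<^esub> ?S = monomial_ideal V ?U")
proof (rule equalityI)
  interpret R: ring "ring_on (polys V :: ('v, 'k) mpoly set)" by (rule polys.ring_ring_on)
  have S: "?S \<subseteq> carrier (ring_on (polys V))" using G by (auto intro: single_mem_polys)
  have "up_closed ?U" unfolding up_closed_def using add.assoc by blast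
  then have "ideal (monomial_ideal V ?U :: ('v, 'k) mpoly set) (ring_on (polys V))"
    by (simp add: polys.ideal_on_iff ideal_on_monomial_ideal)
  moreover have "?S \<subseteq> monomial_ideal V ?U"
    using G by (force simp: monomial_ideal_def single_mem_polys intro: exI[of _ 0])
  ultimately show "Idl\<^bsub>ring_on (polys V)\<^esub> ?S \<subseteq> monomial_ideal V ?U"
    by (rule R.genideal_minimal)
  have I: "ideal_on (polys V) (Idl\<^bsub>ring_on (polys V)\<^esub> ?S)"
    using R.genideal_ideal[OF S] by (simp add: polys.ideal_on_iff)
  show "monomial_ideal V ?U \<subseteq> Idl\<^bsub>ring_on (polys V)\<^esub> ?S"
  proof
    fix p :: "('v, 'k) mpoly" assume p: "p \<in> monomial_ideal V ?U"
    show "p \<in> Idl\<^bsub>ring_on (polys V)\<^esub> ?S"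
    proof (rule monomial_ideal_memI[OF I])
      show "p \<in> polys V" using p by (simp add: monomial_ideal_def)
      fix m and c :: 'k assume m: "m \<in> Poly_Mapping.keys p" "Poly_Mapping.keys m \<subseteq> V"
      then obtain g n where g: "g \<in> G" "m = g + n" using p by (auto simp: monomial_ideal_def)
      have "Poly_Mapping.single n c \<in> polys V" using m g by (simp add: keys_add_nat single_mem_polys)
      moreover have "Poly_Mapping.single g 1 \<in> Idl\<^bsub>ring_on (polys V)\<^esub> ?S"
        using R.genideal_self[OF S] g by blast
      ultimately have "Poly_Mapping.single n c * Poly_Mapping.single g 1 \<in> Idl\<^bsub>ring_on (polys V)\<^esub> ?S"
        using polys.ideal_on_mult[OF I] by blast
      then show "Poly_Mapping.single m c \<in> Idl\<^bsub>ring_on (polys V)\<^esub> ?S"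
        using g by (simp add: mult_single add.commute)
    qed
  qed
qed

section \<open>Primes generated by variables\<close>

definition touching :: "'v set \<Rightarrow> ('v \<Rightarrow>\<^sub>0 nat) set" where
  "touching C = {m. \<exists>v\<in>C. 1 \<le> Poly_Mapping.lookup m v}"

lemma up_closed_touching: "up_closed (touching C)"
  by (auto simp: up_closed_def touching_def lookup_add intro: trans_le_add1)

text \<open>For \<open>C\<close> inside \<open>V\<close> this is the ideal generated by the
  variables in \<open>C\<close>.\<close>

abbreviation var_ideal :: "'v set \<Rightarrow> 'v set \<Rightarrow> ('v, 'k::field) mpoly set" where
  "var_ideal V C \<equiv> monomial_ideal V (touching C)"

text \<open>The remainder keeps the monomials free of \<open>C\<close>, that is, the variables in
  \<open>C\<close> are set to zero. Thus the subring \<open>polys (V - C)\<close> stands in for the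
  quotient ring.\<close>

lemma var_ideal_reduce:
  fixes p :: "('v, 'k::field) mpoly"
  assumes p: "p \<in> polys V"
  shows "\<exists>p0\<in>polys (V - C). p - p0 \<in> var_ideal V C"
proof
  let ?J = "var_ideal V C :: ('v, 'k) mpoly set"
  have J: "ideal_on (polys V) ?J" by (rule ideal_on_monomial_ideal[OF up_closed_touching])
  let ?K = "{m \<in> Poly_Mapping.keys p. m \<in> touching C}"
  let ?p1 = "\<Sum>m\<in>?K. Poly_Mapping.single m (Poly_Mapping.lookup p m)"
  let ?p0 = "\<Sum>m\<in>Poly_Mapping.keys p - ?K. Poly_Mapping.single m (Poly_Mapping.lookup p m)"
  have sp: "?p1 + ?p0 = p"
    using sum.subset_diff[of ?K "Poly_Mapping.keys p" "\<lambda>m. Poly_Mapping.single m (Poly_Mapping.lookup p m)"]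
      mpoly_sum_singles[of p] by (simp add: add.commute)
  have "?p1 \<in> ?J"
    by (rule polys.ideal_on_sum[OF J]) (use p in \<open>auto simp: monomial_ideal_def polys_def\<close>)
  then show "p - ?p0 \<in> ?J"
    using add_implies_diff[OF sp] by (rule back_subst[where P = "\<lambda>z. z \<in> ?J"])
  show "?p0 \<in> polys (V - C)"
  proof (rule polys.sum_mem, rule single_mem_polys)
    fix m assume "m \<in> Poly_Mapping.keys p - ?K"
    then have "Poly_Mapping.keys m \<subseteq> V" "m \<notin> touching C" using p by (auto simp: polys_def)
    moreover have "v \<notin> C" if "v \<in> Poly_Mapping.keys m" for v
      using that \<open>m \<notin> touching C\<close> by (auto simp: touching_def in_keys_iff)
    ultimately show "Poly_Mapping.keys m \<subseteq> V - C" by blast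
  qed
qed

text \<open>The product of the two remainders avoids \<open>C\<close>, while each of its monomials
  would have to touch \<open>C\<close>; so it is zero and one factor vanishes.\<close>

lemma prime_var_ideal:
  fixes V :: "'v set"
  assumes V: "finite V"
  shows "primeideal (var_ideal V C :: ('v, 'k::field) mpoly set) (ring_on (polys V))"
  unfolding polys.primeideal_on_iff
proof (intro conjI ballI impI)
  let ?J = "var_ideal V C :: ('v, 'k) mpoly set"
  show J: "ideal_on (polys V) ?J" by (rule ideal_on_monomial_ideal[OF up_closed_touching])
  show "1 \<notin> ?J" by (simp add: monomial_ideal_def touching_def)
  fix a b assume a: "a \<in> polys V" and b: "b \<in> polys V" and ab: "a * b \<in> ?J"
  obtain a0 where a0: "a0 \<in> polys (V - C)" "a - a0 \<in> ?J" using var_ideal_reduce[OF a] by blast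
  obtain b0 where b0: "b0 \<in> polys (V - C)" "b - b0 \<in> ?J" using var_ideal_reduce[OF b] by blast
  have a0': "a0 \<in> polys V" using a0 polys_mono[of "V - C" V] by blast
  have "b * (a - a0) + a0 * (b - b0) \<in> ?J"
    by (intro polys.ideal_on_add[OF J] polys.ideal_on_mult[OF J] a0 b0 b a0')
  then have "a * b - a0 * b0 \<in> ?J" by (simp add: algebra_simps)
  then have ab0: "a0 * b0 \<in> ?J" using ab polys.ideal_on_cancel[OF J, of "a * b" "a0 * b0"] by simp
  have "Poly_Mapping.keys (a0 * b0) = {}"
  proof (rule equals0I)
    fix m assume m: "m \<in> Poly_Mapping.keys (a0 * b0)"
    then have "m \<in> touching C" using ab0 by (auto simp: monomial_ideal_def)
    then obtain v where "v \<in> C" "v \<in> Poly_Mapping.keys m" by (auto simp: touching_def in_keys_iff)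
    moreover have "Poly_Mapping.keys m \<subseteq> V - C"
      using m polys.mult_mem[OF a0(1) b0(1)] unfolding polys_def by blast
    ultimately show False by blast
  qed
  then have "a0 * b0 = 0" by simp
  then have "a0 = 0 \<or> b0 = 0" using polys_integral[OF _ a0(1) b0(1)] V by simp
  then show "a \<in> ?J \<or> b \<in> ?J"
  proof
    assume "a0 = 0"
    then have "a \<in> ?J" using a0(2) unfolding \<open>a0 = 0\<close> diff_0_right by simp
    then show ?thesis ..
  next
    assume "b0 = 0"
    then have "b \<in> ?J" using b0(2) unfolding \<open>b0 = 0\<close> diff_0_right by simp
    then show ?thesis ..
  qed
qed

subsection \<open>Hilbert's basis theorem\<close>

definition span_below :: "'a::comm_ring_1 set \<Rightarrow> (nat \<Rightarrow> 'a) \<Rightarrow> nat \<Rightarrow> 'a set" where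
  "span_below S f k = {\<Sum>i<k. c i * f i | c. \<forall>i<k. c i \<in> S}"

text \<open>The form of the noetherian property that Hilbert's argument consumes: it is applied to a
  sequence of leading coefficients.\<close>

definition seq_noetherian :: "'a::comm_ring_1 set \<Rightarrow> bool" where
  "seq_noetherian S \<longleftrightarrow> (\<forall>f. (\<forall>k. f k \<in> S) \<longrightarrow> (\<exists>k. f k \<in> span_below S f k))"

context unital_subring
begin

lemma ideal_on_span_below:
  assumes "\<And>i. i < k \<Longrightarrow> f i \<in> S"
  shows "ideal_on S (span_below S f k)"
  unfolding ideal_on_def
proof (intro conjI ballI)
  show "span_below S f k \<subseteq> S" using assms by (auto simp: span_below_def intro!: sum_mem)
  show "0 \<in> span_below S f k"
    unfolding span_below_def by (rule CollectI, rule exI[of _ "\<lambda>_. 0"]) simp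
  fix a assume "a \<in> span_below S f k"
  then obtain c where c: "a = (\<Sum>i<k. c i * f i)" "\<forall>i<k. c i \<in> S"
    by (auto simp: span_below_def)
  { fix b assume "b \<in> span_below S f k"
    then obtain c' where c': "b = (\<Sum>i<k. c' i * f i)" "\<forall>i<k. c' i \<in> S"
      by (auto simp: span_below_def)
    have "a + b = (\<Sum>i<k. (c i + c' i) * f i)"
      by (simp add: c c' sum.distrib algebra_simps)
    moreover have "\<forall>i<k. c i + c' i \<in> S" using c c' by simp
    ultimately show "a + b \<in> span_below S f k" unfolding span_below_def
      by (intro CollectI exI[of _ "\<lambda>i. c i + c' i"] conjI) }
  { fix r assume r: "r \<in> S"
    have "r * a = (\<Sum>i<k. (r * c i) * f i)"
      by (simp add: c sum_distrib_left algebra_simps)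
    moreover have "\<forall>i<k. r * c i \<in> S" using c r by simp
    ultimately show "r * a \<in> span_below S f k" unfolding span_below_def
      by (intro CollectI exI[of _ "\<lambda>i. r * c i"] conjI) }
qed

lemma span_below_mem: "i < k \<Longrightarrow> f i \<in> span_below S f k"
proof -
  assume i: "i < k"
  have "(\<Sum>j<k. (if j = i then 1 else 0) * f j) = (\<Sum>j<k. if j = i then f j else 0)"
    by (rule sum.cong) auto
  then have "(\<Sum>j<k. (if j = i then 1 else 0) * f j) = f i"
    using i by simp
  then show ?thesis unfolding span_below_def
    by (intro CollectI exI[of _ "\<lambda>j. if j = i then 1 else 0"]) simp
qed

lemma span_below_least: "ideal_on S J \<Longrightarrow> (\<And>i. i < k \<Longrightarrow> f i \<in> J) \<Longrightarrow> span_below S f k \<subseteq> J"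
  by (auto simp: span_below_def intro!: ideal_on_sum ideal_on_mult)

lemma span_below_mono:
  assumes "\<And>i. f i \<in> S" "k \<le> l"
  shows "span_below S f k \<subseteq> span_below S f l"
  by (rule span_below_least) (use assms span_below_mem ideal_on_span_below in auto)

text \<open>The increasing spans have an ideal as union. Its finitely many generators all occur in
  one stage \<open>N\<close>, which then contains the term \<open>f N\<close>.\<close>

lemma seq_noetherianI:
  assumes fg: "\<And>J. ideal_on S J \<Longrightarrow> \<exists>f k. J = span_below S f k"
  shows "seq_noetherian S"
  unfolding seq_noetherian_def
proof (intro allI impI)
  fix f :: "nat \<Rightarrow> 'a" assume f: "\<forall>k. f k \<in> S"
  then have f': "f i \<in> S" for i by simp
  let ?J = "\<Union>k. span_below S f k"
  have id: "ideal_on S (span_below S f k)" for k by (rule ideal_on_span_below[where f = f, OF f'])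
  have "ideal_on S ?J"
    unfolding ideal_on_def
  proof (intro conjI ballI)
    show "?J \<subseteq> S" using ideal_on_sub[OF id] by blast
    show "0 \<in> ?J" using id[of 0] by (auto simp: ideal_on_def)
    fix a assume "a \<in> ?J"
    then obtain k where k: "a \<in> span_below S f k" by blast
    { fix b assume "b \<in> ?J"
      then obtain l where l: "b \<in> span_below S f l" by blast
      have "a \<in> span_below S f (max k l)" "b \<in> span_below S f (max k l)"
        using k l span_below_mono[where f = f, OF f', of k "max k l"] span_below_mono[where f = f, OF f', of l "max k l"] by auto
      then show "a + b \<in> ?J" using ideal_on_add[OF id] by blast }
    show "r * a \<in> ?J" if "r \<in> S" for r using ideal_on_mult[OF id that k] by blast
  qed
  then obtain g n where g: "?J = span_below S g n" using fg by blast
  have "\<forall>i. \<exists>k. i < n \<longrightarrow> g i \<in> span_below S f k"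
    using span_below_mem[of _ n g] g by blast
  then obtain K where K: "\<And>i. i < n \<Longrightarrow> g i \<in> span_below S f (K i)" by metis
  define N where "N = (\<Sum>i<n. K i)"
  have "g i \<in> span_below S f N" if "i < n" for i
  proof -
    have "K i \<le> N" unfolding N_def using that by (intro member_le_sum) auto
    then show ?thesis using K[OF that] span_below_mono[where f = f, OF f'] by blast
  qed
  then have "span_below S g n \<subseteq> span_below S f N" by (rule span_below_least[OF id])
  moreover have "f N \<in> ?J" using span_below_mem[of N "Suc N" f] by blast
  ultimately have "f N \<in> span_below S f N" using g by blast
  then show "\<exists>k. f k \<in> span_below S f k" ..
qed

end

lemma seq_noetherian_polys_empty: "seq_noetherian (polys {} :: ('v, 'k::field) mpoly set)"
  unfolding seq_noetherian_def
proof (intro allI impI)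
  fix f :: "nat \<Rightarrow> ('v, 'k) mpoly" assume f: "\<forall>k. f k \<in> polys {}"
  obtain a where a: "f 0 = Poly_Mapping.single 0 a" using polys_empty f by blast
  obtain b where b: "f 1 = Poly_Mapping.single 0 b" using polys_empty f by blast
  show "\<exists>k. f k \<in> span_below (polys {}) f k"
  proof (cases "a = 0")
    case True
    then have "f 0 \<in> span_below (polys {}) f 0" using a by (simp add: span_below_def)
    then show ?thesis ..
  next
    case False
    let ?c = "\<lambda>_::nat. Poly_Mapping.single 0 (b / a) :: ('v, 'k) mpoly"
    have "f 1 = Poly_Mapping.single (0 + 0) (b / a * a)" using b False by simp
    then have "f 1 = (\<Sum>i<1. ?c i * f i)" unfolding mult_single[symmetric] a[symmetric] by simp
    moreover have "\<forall>i<1. ?c i \<in> polys {}" by (simp add: single_mem_polys)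
    ultimately have "f 1 \<in> span_below (polys {}) f 1" unfolding span_below_def
      by (intro CollectI exI[of _ ?c] conjI)
    then show ?thesis ..
  qed
qed

text \<open>Hilbert's argument: generators of least degree in \<open>x\<close> are chosen one after
  another. A relation among their leading coefficients, lifted to the polynomials, produces an
  element of smaller degree outside the span of the earlier ones.\<close>

lemma polys_insert_finitely_generated:
  fixes V :: "'v set" and J :: "('v, 'k::field) mpoly set"
  assumes x: "x \<notin> V" and noeth: "seq_noetherian (polys V :: ('v, 'k) mpoly set)"
    and J: "ideal_on (polys (insert x V)) J"
  shows "\<exists>f k. J = span_below (polys (insert x V)) f k"
proof (rule ccontr)
  assume no: "\<not> ?thesis"
  let ?S = "polys (insert x V) :: ('v, 'k) mpoly set"
  let ?deg = "\<lambda>h. Polynomial.degree (uni x h)"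
  define P where "P = (\<lambda>f k r. r \<in> J \<and> r \<notin> span_below ?S f k \<and>
    (\<forall>h\<in>J - span_below ?S f k. ?deg r \<le> ?deg h))"
  have "\<exists>f. \<forall>k. P f k (f k)"
  proof (rule dependent_wellorder_choice)
    fix r :: "('v, 'k) mpoly" and f g :: "nat \<Rightarrow> ('v, 'k) mpoly" and k :: nat
    assume "\<And>y. y < k \<Longrightarrow> f y = g y"
    then have "span_below ?S f k = span_below ?S g k" by (simp add: span_below_def)
    then show "P f k r = P g k r" by (simp add: P_def)
  next
    fix k :: nat and f :: "nat \<Rightarrow> ('v, 'k) mpoly"
    assume "\<And>y. y < k \<Longrightarrow> P f y (f y)"
    then have "span_below ?S f k \<subseteq> J" by (intro polys.span_below_least[OF J]) (simp add: P_def)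
    moreover have "J \<noteq> span_below ?S f k" using no by blast
    ultimately obtain h where "h \<in> J - span_below ?S f k" by blast
    then obtain r where "r \<in> J - span_below ?S f k" "\<And>h. h \<in> J - span_below ?S f k \<Longrightarrow> ?deg r \<le> ?deg h"
      using ex_has_least_nat[of "\<lambda>h. h \<in> J - span_below ?S f k" h ?deg] by blast
    then show "\<exists>r. P f k r" unfolding P_def by blast
  qed
  then obtain f where f: "\<And>k. P f k (f k)" by blast
  have fJ: "f k \<in> J" and fspan: "f k \<notin> span_below ?S f k"
    and fmin: "\<And>h. h \<in> J \<Longrightarrow> h \<notin> span_below ?S f k \<Longrightarrow> ?deg (f k) \<le> ?deg h" for k
    using f[of k] by (auto simp: P_def)
  have fS: "f k \<in> ?S" for k using fJ J by (auto simp: ideal_on_def)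
  define a where "a = (\<lambda>k. lead_coeff (uni x (f k)))"
  have "a k \<in> polys V" for k
    using coeff_uni_mem[OF fS[of k], of x "?deg (f k)"] x by (simp add: a_def)
  then obtain k where "a k \<in> span_below (polys V) a k"
    using noeth unfolding seq_noetherian_def by blast
  then obtain c where c: "a k = (\<Sum>i<k. c i * a i)" "\<forall>i<k. c i \<in> polys V"
    by (auto simp: span_below_def)
  define n where "n = (\<lambda>k. ?deg (f k))"
  \<comment> \<open>\<open>f k\<close> lies outside the smaller span as well, so it already competed
    when \<open>f i\<close> was chosen.\<close>
  have n_le: "n i \<le> n k" if "i < k" for i
    using fmin[of "f k" i] fJ[of k] fspan[of k] polys.span_below_mono[where f = f, OF fS, of i k] that
    by (auto simp: n_def)
  \<comment> \<open>The powers of the variable lift every \<open>f i\<close> to the degree of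
    \<open>f k\<close>, so that subtracting \<open>s\<close> cancels the top term.\<close>
  define s where "s = (\<Sum>i<k. c i * var x ^ (n k - n i) * f i)"
  have s: "s \<in> span_below ?S f k"
  proof -
    have "\<forall>i<k. c i * var x ^ (n k - n i) \<in> ?S"
    proof (intro allI impI)
      fix i assume "i < k"
      then have "c i \<in> ?S" using c(2) polys_mono[of V "insert x V"] by blast
      then show "c i * var x ^ (n k - n i) \<in> ?S" by (simp add: var_mem_polys)
    qed
    then show ?thesis unfolding s_def span_below_def
      by (intro CollectI exI[of _ "\<lambda>i. c i * var x ^ (n k - n i)"] conjI) simp_all
  qed
  have sJ: "s \<in> J" using s polys.span_below_least[where f = f, OF J fJ, of k] by blast
  let ?g = "f k - s"
  have gJ: "?g \<in> J" using polys.ideal_on_diff[OF J fJ sJ] .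
  have id: "ideal_on ?S (span_below ?S f k)" by (rule polys.ideal_on_span_below[where f = f, OF fS])
  have gspan: "?g \<notin> span_below ?S f k"
    using fspan[of k] s polys.ideal_on_add[OF id, of ?g s] by auto
  have us: "uni x s = (\<Sum>i<k. Polynomial.monom (c i) (n k - n i) * uni x (f i))"
    unfolding s_def uni_sum
  proof (rule sum.cong)
    fix i assume "i \<in> {..<k}"
    then have "uni x (c i) = [:c i:]" using c x by (intro uni_const[of _ V]) auto
    then show "uni x (c i * var x ^ (n k - n i) * f i) =
        Polynomial.monom (c i) (n k - n i) * uni x (f i)"
      by (simp add: uni_mult uni_power uni_var monom_power smult_monom_mult smult_monom
          flip: mult.assoc)
  qed simp
  have co: "poly.coeff (uni x ?g) j = 0" if "j \<ge> n k" for j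
  proof -
    have "poly.coeff (Polynomial.monom (c i) (n k - n i) * uni x (f i)) j =
        (if j = n k then c i * a i else 0)" if i: "i < k" for i
      using n_le[OF i] \<open>j \<ge> n k\<close> coeff_eq_0[of "uni x (f i)" "j - (n k - n i)"]
      by (auto simp: coeff_monom_mult a_def n_def)
    then have "poly.coeff (uni x s) j = (if j = n k then \<Sum>i<k. c i * a i else 0)"
      unfolding us coeff_sum by (simp cong: if_cong)
    then show ?thesis using that c
      by (auto simp: uni_diff a_def n_def intro: coeff_eq_0)
  qed
  have "uni x ?g \<noteq> 0"
    using gspan id by (auto simp: uni_eq_0_iff ideal_on_def)
  then have "?deg ?g < n k"
    using co[of "?deg ?g"] by (metis leading_coeff_0_iff not_le)
  then show False using fmin[OF gJ gspan] by (simp add: n_def)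
qed

lemma seq_noetherian_polys: "finite V \<Longrightarrow> seq_noetherian (polys V :: ('v, 'k::field) mpoly set)"
proof (induction V rule: finite_induct)
  case (insert x V)
  show ?case
    by (rule polys.seq_noetherianI) (rule polys_insert_finitely_generated[OF insert.hyps(2) insert.IH])
qed (rule seq_noetherian_polys_empty)

text \<open>If no finite set generated \<open>J\<close>, one could choose elements of
  \<open>J\<close> forever, each outside the span of its predecessors.\<close>

lemma noetherian_polys:
  assumes "finite V"
  shows "noetherian_ring (ring_on (polys V) :: ('v, 'k::field) mpoly ring)"
proof (rule ring.noetherian_ringI)
  show "ring (ring_on (polys V) :: ('v, 'k::field) mpoly ring)" by (rule polys.ring_ring_on)
  interpret R: ring "ring_on (polys V :: ('v, 'k) mpoly set)" by (rule polys.ring_ring_on)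
  fix J :: "('v, 'k) mpoly set" assume J: "ideal J (ring_on (polys V))"
  then have J': "ideal_on (polys V) J" by (simp add: polys.ideal_on_iff)
  show "\<exists>A\<subseteq>carrier (ring_on (polys V)). finite A \<and> J = Idl\<^bsub>ring_on (polys V)\<^esub> A"
  proof (rule ccontr)
    assume no: "\<not> ?thesis"
    define P where "P = (\<lambda>(f :: nat \<Rightarrow> ('v, 'k) mpoly) k r. r \<in> J - span_below (polys V) f k)"
    have "\<exists>f. \<forall>k. P f k (f k)"
    proof (rule dependent_wellorder_choice)
      fix r :: "('v, 'k) mpoly" and f g :: "nat \<Rightarrow> ('v, 'k) mpoly" and k :: nat
      assume "\<And>y. y < k \<Longrightarrow> f y = g y"
      then have "span_below (polys V) f k = span_below (polys V) g k" by (simp add: span_below_def)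
      then show "P f k r = P g k r" by (simp add: P_def)
    next
      fix k :: nat and f :: "nat \<Rightarrow> ('v, 'k) mpoly"
      assume "\<And>y. y < k \<Longrightarrow> P f y (f y)"
      then have fJ: "f i \<in> J" if "i < k" for i using that by (simp add: P_def)
      then have fS: "f i \<in> polys V" if "i < k" for i using that J' by (auto simp: ideal_on_def)
      have sub: "f ` {..<k} \<subseteq> carrier (ring_on (polys V))" using fS by auto
      have "span_below (polys V) f k \<subseteq> Idl\<^bsub>ring_on (polys V)\<^esub> (f ` {..<k})"
        using R.genideal_self[OF sub] R.genideal_ideal[OF sub]
        by (intro polys.span_below_least) (auto simp: polys.ideal_on_iff)
      moreover have "Idl\<^bsub>ring_on (polys V)\<^esub> (f ` {..<k}) \<subseteq> J"
        using fJ by (intro R.genideal_minimal[OF J]) auto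
      moreover have "J \<noteq> Idl\<^bsub>ring_on (polys V)\<^esub> (f ` {..<k})" using no sub by blast
      ultimately obtain r where "r \<in> J - span_below (polys V) f k" by blast
      then show "\<exists>r. P f k r" unfolding P_def by blast
    qed
    then obtain f where f: "\<And>k. P f k (f k)" by blast
    then have "f k \<in> polys V" for k using J' by (auto simp: P_def ideal_on_def)
    then obtain k where "f k \<in> span_below (polys V) f k"
      using seq_noetherian_polys[OF assms] unfolding seq_noetherian_def by blast
    then show False using f[of k] by (simp add: P_def)
  qed
qed

subsection \<open>Zariski's lemma\<close>

definition coeffs_in :: "'a::comm_ring_1 set \<Rightarrow> 'a poly \<Rightarrow> bool" where
  "coeffs_in D P \<longleftrightarrow> (\<forall>i. poly.coeff P i \<in> D)"

lemma coeffs_inD: "coeffs_in D P \<Longrightarrow> poly.coeff P i \<in> D"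
  by (simp add: coeffs_in_def)

context unital_subring
begin

lemma coeffs_in_0 [simp]: "coeffs_in S 0"
  by (simp add: coeffs_in_def)

lemma coeffs_in_monom [simp]: "c \<in> S \<Longrightarrow> coeffs_in S (Polynomial.monom c n)"
  by (simp add: coeffs_in_def)

lemma coeffs_in_1 [simp]: "coeffs_in S 1"
  using coeffs_in_monom[OF one_mem, of 0] by (simp add: monom_0 one_pCons)

lemma coeffs_in_const [simp]: "c \<in> S \<Longrightarrow> coeffs_in S [:c:]"
  using coeffs_in_monom[of c 0] by (simp add: monom_0)

lemma coeffs_in_add [simp]: "coeffs_in S P \<Longrightarrow> coeffs_in S Q \<Longrightarrow> coeffs_in S (P + Q)"
  by (simp add: coeffs_in_def)

lemma coeffs_in_uminus [simp]: "coeffs_in S P \<Longrightarrow> coeffs_in S (- P)"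
  by (simp add: coeffs_in_def)

lemma coeffs_in_diff [simp]: "coeffs_in S P \<Longrightarrow> coeffs_in S Q \<Longrightarrow> coeffs_in S (P - Q)"
  by (simp add: coeffs_in_def)

lemma coeffs_in_mult [simp]: "coeffs_in S P \<Longrightarrow> coeffs_in S Q \<Longrightarrow> coeffs_in S (P * Q)"
  unfolding coeffs_in_def coeff_mult by (intro allI sum_mem) simp

lemma coeffs_in_smult [simp]: "c \<in> S \<Longrightarrow> coeffs_in S P \<Longrightarrow> coeffs_in S (Polynomial.smult c P)"
  by (simp add: coeffs_in_def)

lemma coeffs_in_power [simp]: "coeffs_in S P \<Longrightarrow> coeffs_in S (P ^ n)"
  by (induction n) simp_all

lemma coeffs_in_sum: "(\<And>i. i \<in> A \<Longrightarrow> coeffs_in S (f i)) \<Longrightarrow> coeffs_in S (sum f A)"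
  by (induction A rule: infinite_finite_induct) simp_all

lemma poly_mem: "coeffs_in S P \<Longrightarrow> x \<in> S \<Longrightarrow> poly P x \<in> S"
  unfolding poly_altdef by (rule sum_mem) (simp add: coeffs_in_def)

text \<open>The leading coefficient of \<open>Q\<close> need not be invertible, so each cancellation
  of a top term costs one factor of it; quotient and remainder keep coefficients in
  \<open>S\<close>.\<close>

lemma pseudo_division:
  assumes F: "coeffs_in S F" and Q: "coeffs_in S Q" and "Q \<noteq> 0"
  shows "\<exists>N B R. coeffs_in S B \<and> coeffs_in S R \<and>
    Polynomial.smult (lead_coeff Q ^ N) F = Q * B + R \<and>
    (R = 0 \<or> Polynomial.degree R < Polynomial.degree Q)"
  using F
proof (induction "Polynomial.degree F" arbitrary: F rule: less_induct)
  case less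
  let ?c = "lead_coeff Q" and ?n = "Polynomial.degree F - Polynomial.degree Q"
  have c: "?c \<in> S" and l: "lead_coeff F \<in> S" using less.prems Q by (auto intro: coeffs_inD)
  show ?case
  proof (cases "F = 0 \<or> Polynomial.degree F < Polynomial.degree Q")
    case True
    then show ?thesis using less.prems
      by (intro exI[of _ 0] exI[of _ F]) auto
  next
    case False
    define m where "m = Polynomial.monom (lead_coeff F) ?n"
    define F' where "F' = Polynomial.smult ?c F - m * Q"
    have F': "coeffs_in S F'" and m: "coeffs_in S m" using less.prems Q c l by (simp_all add: F'_def m_def)
    have "Polynomial.degree F' \<le> Polynomial.degree F"
      unfolding F'_def
    proof (rule degree_diff_le)
      have "Polynomial.degree (m * Q) \<le> Polynomial.degree m + Polynomial.degree Q" by (rule degree_mult_le)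
      also have "\<dots> \<le> ?n + Polynomial.degree Q" unfolding m_def by (simp add: degree_monom_le)
      finally show "Polynomial.degree (m * Q) \<le> Polynomial.degree F" using False by simp
    qed (rule degree_smult_le)
    moreover have "poly.coeff F' (Polynomial.degree F) = 0"
      using False by (simp add: F'_def m_def coeff_monom_mult)
    ultimately have "F' = 0 \<or> Polynomial.degree F' < Polynomial.degree F"
      by (rule eq_zero_or_degree_less)
    then obtain N B R where IH: "coeffs_in S B" "coeffs_in S R"
      "Polynomial.smult (?c ^ N) F' = Q * B + R" "R = 0 \<or> Polynomial.degree R < Polynomial.degree Q"
    proof
      assume "F' = 0"
      then show ?thesis using that[of 0 0 0] by simp
    next
      assume "Polynomial.degree F' < Polynomial.degree F"
      from less.hyps[OF this F'] show ?thesis using that by blast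
    qed
    have "Polynomial.smult ?c F = F' + m * Q" by (simp add: F'_def)
    then have "Polynomial.smult (?c ^ Suc N) F = Polynomial.smult (?c ^ N) F' + Polynomial.smult (?c ^ N) (m * Q)"
      by (metis mult.commute power_Suc smult_add_right smult_smult)
    also have "\<dots> = Q * (B + Polynomial.smult (?c ^ N) m) + R"
      unfolding IH(3) by (simp add: algebra_simps)
    finally show ?thesis using IH m c
      by (intro exI[of _ "Suc N"] exI[of _ "B + Polynomial.smult (?c ^ N) m"] exI[of _ R]) simp
  qed
qed

end

section \<open>Arithmetic modulo a prime ideal\<close>

locale prime_in_subring = unital_subring S for S :: "'a::comm_ring_1 set" +
  fixes M :: "'a set"
  assumes ideal_M: "ideal_on S M" and one_notin: "1 \<notin> M"
    and prime_M: "a \<in> S \<Longrightarrow> b \<in> S \<Longrightarrow> a * b \<in> M \<Longrightarrow> a \<in> M \<or> b \<in> M"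
begin

lemma zero_in_M [simp]: "0 \<in> M"
  using ideal_M by (simp add: ideal_on_def)

lemma M_power: "a \<in> S \<Longrightarrow> a ^ n \<in> M \<Longrightarrow> a \<in> M"
proof (induction n)
  case (Suc n)
  then show ?case using prime_M[of a "a ^ n"] by auto
qed (use one_notin in simp)

text \<open>Equality in the domain \<open>S / M\<close>, which is never formed: all computations use
  representatives in \<open>S\<close>.\<close>

definition eqM :: "'a \<Rightarrow> 'a \<Rightarrow> bool" where
  "eqM a b \<longleftrightarrow> a - b \<in> M"

lemma eqM_refl: "eqM a a"
  by (simp add: eqM_def)

lemma eqM_sym: "eqM a b \<Longrightarrow> eqM b a"
  unfolding eqM_def using ideal_on_diff[OF ideal_M zero_in_M, of "a - b"] by simp

lemma eqM_trans: "eqM a b \<Longrightarrow> eqM b c \<Longrightarrow> eqM a c"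
  unfolding eqM_def using ideal_on_add[OF ideal_M, of "a - b" "b - c"] by simp

lemma eqM_mult_left: "eqM a b \<Longrightarrow> r \<in> S \<Longrightarrow> eqM (r * a) (r * b)"
  unfolding eqM_def using ideal_on_mult[OF ideal_M, of r "a - b"] by (simp add: algebra_simps)

lemma eqM_mult_right: "eqM a b \<Longrightarrow> r \<in> S \<Longrightarrow> eqM (a * r) (b * r)"
  using eqM_mult_left[of a b r] by (simp add: mult.commute)

lemma eqM_power:
  assumes "eqM a b" "a \<in> S" "b \<in> S"
  shows "eqM (a ^ n) (b ^ n)"
proof (induction n)
  case (Suc n)
  show ?case
    using eqM_trans[OF eqM_mult_right[OF assms(1), of "a ^ n"] eqM_mult_left[OF Suc assms(3)]] assms
    by simp
qed (simp add: eqM_refl)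

lemma eqM_mem_iff: "eqM a b \<Longrightarrow> a \<in> M \<longleftrightarrow> b \<in> M"
  unfolding eqM_def by (rule ideal_on_cancel[OF ideal_M])

lemma coeffs_in_M_mult: "coeffs_in S P \<Longrightarrow> coeffs_in M Q \<Longrightarrow> coeffs_in M (P * Q)"
  unfolding coeffs_in_def coeff_mult
  by (intro allI ideal_on_sum[OF ideal_M] ideal_on_mult[OF ideal_M]) auto

lemma coeffs_in_M_diff: "coeffs_in M P \<Longrightarrow> coeffs_in M Q \<Longrightarrow> coeffs_in M (P - Q)"
  by (simp add: coeffs_in_def ideal_on_diff[OF ideal_M])

lemma coeffs_in_M_add: "coeffs_in M P \<Longrightarrow> coeffs_in M Q \<Longrightarrow> coeffs_in M (P + Q)"
  by (simp add: coeffs_in_def ideal_on_add[OF ideal_M])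

lemma poly_in_M: "coeffs_in M P \<Longrightarrow> x \<in> S \<Longrightarrow> poly P x \<in> M"
  unfolding poly_altdef
  by (intro ideal_on_sum[OF ideal_M] ideal_on_mult'[OF ideal_M]) (auto simp: coeffs_in_def)

text \<open>Replacing the coefficients in \<open>M\<close> by zero makes the formal degree of a
  representative equal to its degree over the quotient by \<open>M\<close>, so that degree arguments
  over a domain become available.\<close>

lemma strip:
  assumes "coeffs_in D P" "D \<subseteq> S" "0 \<in> D" "\<not> coeffs_in M P"
  obtains Q where "coeffs_in D Q" "lead_coeff Q \<notin> M" "coeffs_in M (P - Q)"
    "Polynomial.degree Q \<le> Polynomial.degree P" "\<And>x. x \<in> S \<Longrightarrow> eqM (poly P x) (poly Q x)"
proof -
  define f where "f = (\<lambda>c. if c \<in> M then 0 else c)"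
  define Q where "Q = map_poly f P"
  have co: "poly.coeff Q i = f (poly.coeff P i)" for i
    unfolding Q_def by (rule coeff_map_poly) (simp add: f_def)
  have Q: "coeffs_in D Q" using assms by (simp add: coeffs_in_def co f_def)
  obtain i where "poly.coeff P i \<notin> M" using assms(4) by (auto simp: coeffs_in_def)
  then have "poly.coeff Q i \<noteq> 0" by (auto simp: co f_def)
  then have "lead_coeff Q \<noteq> 0" by auto
  then have "lead_coeff Q \<notin> M" unfolding co[of "Polynomial.degree Q"] by (auto simp: f_def)
  moreover have PQ: "coeffs_in M (P - Q)" by (simp add: coeffs_in_def co f_def)
  moreover have "Polynomial.degree Q \<le> Polynomial.degree P"
    by (rule degree_le) (simp add: co f_def coeff_eq_0)
  moreover have "eqM (poly P x) (poly Q x)" if "x \<in> S" for x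
    using poly_in_M[OF PQ that] by (simp add: eqM_def)
  ultimately show ?thesis using Q that by blast
qed

text \<open>Modulo \<open>M\<close>, a field is obtained from \<open>D\<close> by inverting a single element.\<close>
definition goldman :: "'a set \<Rightarrow> bool" where
  "goldman D \<longleftrightarrow> (\<exists>h\<in>D. h \<notin> M \<and> (\<forall>e\<in>D. e \<notin> M \<longrightarrow> (\<exists>k. \<exists>g\<in>D. eqM (e * g) (h ^ k))))"

end

locale simple_extension_mod = prime_in_subring S M for S M :: "'a::comm_ring_1 set" +
  fixes D :: "'a set" and x :: 'a
  assumes subring_D: "unital_subring D" and D_sub: "D \<subseteq> S" and x_mem: "x \<in> S"
begin

sublocale D: unital_subring D
  by (rule subring_D)

definition ext :: "'a set" where
  "ext = {poly P x | P. coeffs_in D P}"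

lemma extI: "coeffs_in D P \<Longrightarrow> poly P x \<in> ext"
  by (auto simp: ext_def)

lemma extE: "e \<in> ext \<Longrightarrow> (\<And>P. coeffs_in D P \<Longrightarrow> e = poly P x \<Longrightarrow> thesis) \<Longrightarrow> thesis"
  by (auto simp: ext_def)

lemma coeffs_in_S: "coeffs_in D P \<Longrightarrow> coeffs_in S P"
  using D_sub by (auto simp: coeffs_in_def)

lemma ext_sub: "e \<in> ext \<Longrightarrow> e \<in> S"
  by (elim extE) (simp add: poly_mem[OF coeffs_in_S x_mem])

lemma ext_mult: "a \<in> ext \<Longrightarrow> b \<in> ext \<Longrightarrow> a * b \<in> ext"
  by (elim extE) (metis D.coeffs_in_mult extI poly_mult)

lemma ext_const: "d \<in> D \<Longrightarrow> d \<in> ext"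
  using extI[of "[:d:]"] by simp

lemma ext_power: "a \<in> ext \<Longrightarrow> a ^ n \<in> ext"
  by (induction n) (simp_all add: ext_const ext_mult)

lemma ext_uminus: "a \<in> ext \<Longrightarrow> - a \<in> ext"
  using ext_mult[OF ext_const[OF D.uminus_mem[OF D.one_mem]], of a] by simp

text \<open>Otherwise \<open>1 + x h\<close> would divide a power of \<open>h\<close> modulo \<open>M\<close>, where inverting \<open>h\<close> makes
  \<open>ext\<close> a field.\<close>
lemma algebraic:
  assumes G: "goldman ext"
  shows "\<exists>P. coeffs_in D P \<and> lead_coeff P \<notin> M \<and> Polynomial.degree P \<ge> 1 \<and> poly P x \<in> M"
proof (rule ccontr)
  assume no: "\<not> ?thesis"
  \<comment> \<open>This says that \<open>x\<close> is transcendental over \<open>D\<close> modulo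
    \<open>M\<close>.\<close>
  have indep: "coeffs_in M Q" if Q: "coeffs_in D Q" "poly Q x \<in> M" for Q
  proof (rule ccontr)
    assume "\<not> coeffs_in M Q"
    then obtain Q' where Q': "coeffs_in D Q'" "lead_coeff Q' \<notin> M" "eqM (poly Q x) (poly Q' x)"
      using strip[OF Q(1) D_sub D.zero_mem] x_mem by metis
    have in_M: "poly Q' x \<in> M" using Q' Q(2) eqM_mem_iff by blast
    show False
    proof (cases "Polynomial.degree Q' = 0")
      case True
      then obtain c where "Q' = [:c:]" by (rule degree_eq_zeroE)
      then show False using Q' in_M by simp
    next
      case False
      then have "Polynomial.degree Q' \<ge> 1" by simp
      then show False using no Q' in_M by blast
    qed
  qed
  obtain h where h: "h \<in> ext" "h \<notin> M"
    and inv: "\<And>e. e \<in> ext \<Longrightarrow> e \<notin> M \<Longrightarrow> \<exists>k. \<exists>g\<in>ext. eqM (e * g) (h ^ k)"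
    using G unfolding goldman_def by blast
  obtain H where H: "coeffs_in D H" "h = poly H x" using h by (auto elim: extE)
  let ?X = "Polynomial.monom 1 1 :: 'a poly"
  define E where "E = 1 + ?X * H"
  have X: "coeffs_in D ?X" by simp
  have E: "coeffs_in D E" using H(1) by (simp add: E_def)
  have Ex: "poly E x = 1 + x * h" by (simp add: E_def H poly_monom)
  have coE: "poly.coeff E i = (if i = 0 then 1 else poly.coeff H (i - 1))" for i
    by (cases i) (auto simp: E_def coeff_monom_mult coeff_1)
  have "poly E x \<notin> M"
  proof
    assume "poly E x \<in> M"
    then have "poly.coeff E 0 \<in> M" using indep[OF E] by (simp add: coeffs_in_def)
    then show False using one_notin by (simp add: coE)
  qed
  then obtain k g where g: "g \<in> ext" "eqM (poly E x * g) (h ^ k)"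
    using inv[OF extI[OF E]] by blast
  obtain C where C: "coeffs_in D C" "g = poly C x" using g by (auto elim: extE)
  \<comment> \<open>\<open>B\<close> is an inverse of \<open>E\<close> modulo \<open>M\<close>.
    Indeed \<open>(1 - E) ^ k\<close> equals \<open>(- X) ^ k * H ^ k\<close>, to be replaced by
    \<open>(- X) ^ k * (E * C)\<close>, and the geometric sum accounts for
    \<open>1 - (1 - E) ^ k\<close>.\<close>
  define B where "B = (\<Sum>i<k. (1 - E) ^ i) + (- ?X) ^ k * C"
  have B: "coeffs_in D B" unfolding B_def
    using E C X by (intro D.coeffs_in_add D.coeffs_in_sum D.coeffs_in_mult D.coeffs_in_power) simp_all
  have "1 - (1 - E) ^ k = E * (\<Sum>i<k. (1 - E) ^ i)"
    using one_diff_power_eq[of "1 - E" k] by simp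
  then have "E * B - 1 = E * ((- ?X) ^ k * C) - (1 - E) ^ k"
    unfolding B_def by (simp add: algebra_simps)
  also have "1 - E = (- ?X) * H" by (simp add: E_def)
  also have "E * ((- ?X) ^ k * C) - ((- ?X) * H) ^ k = (- ?X) ^ k * (E * C - H ^ k)"
    unfolding power_mult_distrib by (simp add: algebra_simps)
  finally have "poly (E * B - 1) x = (- x) ^ k * (poly E x * g - h ^ k)"
    by (simp add: H C poly_monom poly_power)
  also have "\<dots> \<in> M"
    using g(2) x_mem by (intro ideal_on_mult[OF ideal_M]) (simp_all add: eqM_def)
  finally have EB: "coeffs_in M (E * B - 1)"
    using E B by (intro indep) simp_all
  have nE: "\<not> coeffs_in M E" using one_notin coE[of 0] unfolding coeffs_in_def by metis
  have nB: "\<not> coeffs_in M B"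
  proof
    assume "coeffs_in M B"
    then have "coeffs_in M (E * B - (E * B - 1))"
      by (intro coeffs_in_M_diff coeffs_in_M_mult EB coeffs_in_S E)
    then have "poly.coeff (1 :: 'a poly) 0 \<in> M" unfolding coeffs_in_def by (metis diff_diff_eq2 add_diff_cancel_left')
    then show False using one_notin by simp
  qed
  obtain E' where E': "coeffs_in D E'" "lead_coeff E' \<notin> M" "coeffs_in M (E - E')"
    by (rule strip[OF E D_sub D.zero_mem nE]) blast
  obtain B' where B': "coeffs_in D B'" "lead_coeff B' \<notin> M" "coeffs_in M (B - B')"
    by (rule strip[OF B D_sub D.zero_mem nB]) blast
  have "coeffs_in M (E' * B' - 1)"
  proof -
    have "coeffs_in M ((E * B - 1) - B * (E - E') - E' * (B - B'))"
      by (intro coeffs_in_M_diff coeffs_in_M_mult EB coeffs_in_S B E' B')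
    also have "(E * B - 1) - B * (E - E') - E' * (B - B') = E' * B' - 1"
      by (simp add: algebra_simps)
    finally show ?thesis .
  qed
  then have "poly.coeff (E' * B' - 1) (Polynomial.degree E' + Polynomial.degree B') \<in> M"
    by (rule coeffs_inD)
  \<comment> \<open>Above the constant term the coefficients of \<open>E\<close> are those of
    \<open>H\<close>, so a constant \<open>E'\<close> would put \<open>h\<close> into
    \<open>M\<close>. In positive degree the constant polynomial 1 has coefficient zero, and the
    product of the leading coefficients falls into \<open>M\<close>.\<close>
  moreover have "Polynomial.degree E' \<ge> 1"
  proof (rule ccontr)
    assume "\<not> ?thesis"
    then have "poly.coeff H i \<in> M" for i
      using coeffs_inD[OF E'(3), of "Suc i"] by (simp add: coE coeff_eq_0)
    then have "h \<in> M" unfolding H(2) by (intro poly_in_M x_mem) (simp add: coeffs_in_def)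
    then show False using h by simp
  qed
  ultimately have "lead_coeff E' * lead_coeff B' \<in> M"
    by (simp add: coeff_mult_degree_sum coeff_1)
  moreover have "lead_coeff E' \<in> S" "lead_coeff B' \<in> S"
    using E' B' D_sub by (auto intro: coeffs_inD)
  ultimately show False using prime_M E' B' by blast
qed

text \<open>Let \<open>P\<close> be of minimal degree in the relation for \<open>x\<close>, and let \<open>Q\<close> be of minimal degree among the
  polynomials whose value at \<open>x\<close> is a multiple of \<open>h\<close> modulo \<open>M\<close>. Dividing \<open>P\<close> by \<open>Q\<close> shows that \<open>Q\<close>
  is a constant \<open>b\<close>, and \<open>D\<close> becomes a field when the product of \<open>b\<close> and the leading coefficient of
  \<open>P\<close> is inverted.\<close>
lemma goldman_descent:
  assumes G: "goldman ext"
  shows "goldman D"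
proof -
  let ?Q = "\<lambda>P. coeffs_in D P \<and> lead_coeff P \<notin> M \<and> Polynomial.degree P \<ge> 1 \<and> poly P x \<in> M"
  obtain P where P: "coeffs_in D P" "lead_coeff P \<notin> M" "Polynomial.degree P \<ge> 1" "poly P x \<in> M"
    and minP: "\<And>P'. ?Q P' \<Longrightarrow> Polynomial.degree P \<le> Polynomial.degree P'"
    using algebraic[OF G] ex_has_least_nat[of ?Q _ Polynomial.degree] by metis
  define m where "m = Polynomial.degree P"
  define c where "c = lead_coeff P"
  have m: "m \<ge> 1" and c: "c \<in> D" "c \<notin> M" "c \<in> S"
    using P D_sub by (auto simp: m_def c_def intro: coeffs_inD)
  have P0: "P \<noteq> 0" using P by auto
  have indep: "coeffs_in M Q" if Q: "coeffs_in D Q" "poly Q x \<in> M" "Polynomial.degree Q < m" for Q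
  proof (rule ccontr)
    assume "\<not> coeffs_in M Q"
    then obtain Q' where Q': "coeffs_in D Q'" "lead_coeff Q' \<notin> M" "eqM (poly Q x) (poly Q' x)"
      "Polynomial.degree Q' \<le> Polynomial.degree Q"
      using strip[OF Q(1) D_sub D.zero_mem] x_mem by metis
    have in_M: "poly Q' x \<in> M" using Q' Q(2) eqM_mem_iff by blast
    show False
    proof (cases "Polynomial.degree Q' = 0")
      case True
      then obtain c where "Q' = [:c:]" by (rule degree_eq_zeroE)
      then show False using Q' in_M by simp
    next
      case False
      then have "m \<le> Polynomial.degree Q'" using minP[of Q'] Q' in_M by (simp add: m_def)
      then show False using Q' Q by simp
    qed
  qed
  \<comment> \<open>Pseudo-division by \<open>P\<close>: up to powers of \<open>c\<close>, elements
    of \<open>ext\<close> are values of polynomials of degree below \<open>m\<close>, which are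
    unique modulo \<open>M\<close> by \<open>indep\<close>.\<close>
  have reduce: "\<exists>N F'. coeffs_in D F' \<and> Polynomial.degree F' < m \<and> eqM (c ^ N * e) (poly F' x)"
    if "e \<in> ext" for e
  proof -
    obtain F where F: "coeffs_in D F" "e = poly F x" using \<open>e \<in> ext\<close> by (auto elim: extE)
    obtain N B R where d: "coeffs_in D B" "coeffs_in D R" "Polynomial.smult (c ^ N) F = P * B + R"
      "R = 0 \<or> Polynomial.degree R < Polynomial.degree P"
      using D.pseudo_division[OF F(1) P(1) P0] unfolding c_def by blast
    have "c ^ N * e - poly R x = poly P x * poly B x"
      using arg_cong[OF d(3), of "\<lambda>P. poly P x"] by (simp add: F)
    also have "\<dots> \<in> M" using P(4) d(1) x_mem
      by (intro ideal_on_mult'[OF ideal_M] poly_mem coeffs_in_S)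
    finally have "eqM (c ^ N * e) (poly R x)" by (simp add: eqM_def)
    moreover have "Polynomial.degree R < m" using d(4) m by (auto simp: m_def)
    ultimately show ?thesis using d(2) by blast
  qed
  obtain h where h: "h \<in> ext" "h \<notin> M"
    and inv: "\<And>e. e \<in> ext \<Longrightarrow> e \<notin> M \<Longrightarrow> \<exists>k. \<exists>g\<in>ext. eqM (e * g) (h ^ k)"
    using G unfolding goldman_def by blast
  have hS: "h \<in> S" using h ext_sub by blast
  let ?T = "\<lambda>Q. coeffs_in D Q \<and> lead_coeff Q \<notin> M \<and> (\<exists>e\<in>ext. eqM (poly Q x) (h * e))"
  have "\<exists>Q. ?T Q \<and> Polynomial.degree Q < m"
  proof -
    obtain N F where F: "coeffs_in D F" "Polynomial.degree F < m" "eqM (c ^ N * h) (poly F x)"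
      using reduce[OF h(1)] by blast
    have "c ^ N * h \<notin> M" using prime_M[of "c ^ N" h] M_power[of c N] c h hS by auto
    then have "poly F x \<notin> M" using F eqM_mem_iff by blast
    then have "\<not> coeffs_in M F" using poly_in_M x_mem by blast
    then obtain Q where Q: "coeffs_in D Q" "lead_coeff Q \<notin> M" "eqM (poly F x) (poly Q x)"
      "Polynomial.degree Q \<le> Polynomial.degree F"
      using strip[OF F(1) D_sub D.zero_mem] x_mem by metis
    have "eqM (poly Q x) (h * c ^ N)"
      using eqM_sym[OF eqM_trans[OF F(3) Q(3)]] by (simp add: mult.commute)
    moreover have "c ^ N \<in> ext" using c by (simp add: ext_const)
    ultimately have "?T Q" using Q(1,2) by blast
    moreover have "Polynomial.degree Q < m" using Q(4) F(2) by simp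
    ultimately show ?thesis by blast
  qed
  then obtain Q0 where Q0: "?T Q0" "Polynomial.degree Q0 < m" by blast
  obtain Q where Q: "?T Q" and minQ: "\<And>Q'. ?T Q' \<Longrightarrow> Polynomial.degree Q \<le> Polynomial.degree Q'"
    using ex_has_least_nat[of ?T Q0 Polynomial.degree] Q0(1) by blast
  have Qm: "Polynomial.degree Q < m" using minQ[OF Q0(1)] Q0(2) by simp
  obtain e' where e': "e' \<in> ext" "eqM (poly Q x) (h * e')" using Q by blast
  have QD: "coeffs_in D Q" and Ql: "lead_coeff Q \<notin> M" using Q by auto
  have QlS: "lead_coeff Q \<in> S" using QD D_sub by (auto intro: coeffs_inD)
  have e'S: "e' \<in> S" using e' ext_sub by blast
  have "Polynomial.degree Q = 0"
  proof (rule ccontr)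
    assume j: "Polynomial.degree Q \<noteq> 0"
    have Q0: "Q \<noteq> 0" using j by auto
    obtain N B R where d: "coeffs_in D B" "coeffs_in D R"
      "Polynomial.smult (lead_coeff Q ^ N) P = Q * B + R"
      "R = 0 \<or> Polynomial.degree R < Polynomial.degree Q"
      using D.pseudo_division[OF P(1) QD Q0] by blast
    have BS: "poly B x \<in> S" and QS: "poly Q x \<in> S" using poly_mem coeffs_in_S d(1) QD x_mem by auto
    have lM: "lead_coeff Q ^ N * poly P x \<in> M"
      using P(4) QlS by (intro ideal_on_mult[OF ideal_M]) simp_all
    have eq: "poly Q x * poly B x + poly R x = lead_coeff Q ^ N * poly P x"
      using arg_cong[OF d(3), of "\<lambda>P. poly P x"] by simp
    \<comment> \<open>The value of \<open>R\<close> at \<open>x\<close> is congruent to a multiple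
      of that of \<open>Q\<close>, hence of \<open>h\<close>; minimality of \<open>Q\<close> leaves
      no room for a nonzero remainder of smaller degree.\<close>
    have RM: "coeffs_in M R"
    proof (rule ccontr)
      assume n: "\<not> coeffs_in M R"
      then have "R \<noteq> 0" by (auto simp: coeffs_in_def)
      then have Rd: "Polynomial.degree R < Polynomial.degree Q" using d(4) by simp
      obtain R' where R': "coeffs_in D R'" "lead_coeff R' \<notin> M" "eqM (poly R x) (poly R' x)"
        "Polynomial.degree R' \<le> Polynomial.degree R"
        using strip[OF d(2) D_sub D.zero_mem n] x_mem by metis
      have "eqM (poly R x) (- poly Q x * poly B x)"
        using lM unfolding eqM_def eq[symmetric] by (simp add: algebra_simps)
      moreover have "eqM (poly Q x * (- poly B x)) (h * e' * (- poly B x))"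
        using e'(2) BS by (intro eqM_mult_right) simp_all
      ultimately have "eqM (poly R' x) (h * (e' * (- poly B x)))"
        using R'(3) by (metis eqM_sym eqM_trans mult.assoc mult_minus_left mult_minus_right)
      moreover have "e' * (- poly B x) \<in> ext"
        by (intro ext_mult ext_uminus e' extI d)
      ultimately have "Polynomial.degree Q \<le> Polynomial.degree R'" using minQ R' by blast
      then show False using R' Rd by simp
    qed
    have "poly Q x * poly B x = lead_coeff Q ^ N * poly P x - poly R x" using eq by (simp add: algebra_simps)
    also have "\<dots> \<in> M" by (intro ideal_on_diff[OF ideal_M] lM poly_in_M[OF RM] x_mem)
    finally have "poly Q x \<in> M \<or> poly B x \<in> M" using prime_M BS QS by blast
    moreover have "poly Q x \<notin> M" using indep[OF QD _ Qm] Ql by (auto simp: coeffs_in_def)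
    ultimately have BM: "poly B x \<in> M" by blast
    have lNc: "lead_coeff Q ^ N * c \<notin> M" using prime_M[of "lead_coeff Q ^ N" c] M_power[OF QlS] QlS c Ql by auto
    have nB: "\<not> coeffs_in M B"
    proof
      assume "coeffs_in M B"
      then have "coeffs_in M (Q * B + R)"
        by (intro coeffs_in_M_add coeffs_in_M_mult coeffs_in_S QD RM)
      then have "poly.coeff (Polynomial.smult (lead_coeff Q ^ N) P) m \<in> M"
        unfolding d(3)[symmetric] by (rule coeffs_inD)
      then have "lead_coeff Q ^ N * c \<in> M" by (simp add: m_def c_def)
      then show False using lNc by simp
    qed
    obtain B' where B': "coeffs_in D B'" "lead_coeff B' \<notin> M" "coeffs_in M (B - B')" "eqM (poly B x) (poly B' x)"
      by (rule strip[OF d(1) D_sub D.zero_mem nB]) (use x_mem in blast)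
    \<comment> \<open>The product \<open>Q * B'\<close> keeps its top coefficient modulo
      \<open>M\<close> and is congruent to a multiple of \<open>P\<close>, so its degree is at most
      \<open>m\<close>. As \<open>Q\<close> is not constant, \<open>B'\<close> has degree below
      \<open>m\<close> although its value at \<open>x\<close> lies in \<open>M\<close>.\<close>
    have "coeffs_in M (Polynomial.smult (lead_coeff Q ^ N) P - Q * B')"
    proof -
      have "Polynomial.smult (lead_coeff Q ^ N) P - Q * B' = Q * (B - B') + R"
        unfolding d(3) by (simp add: algebra_simps)
      also have "coeffs_in M \<dots>" by (intro coeffs_in_M_add coeffs_in_M_mult coeffs_in_S QD RM B')
      finally show ?thesis .
    qed
    then have "poly.coeff (Polynomial.smult (lead_coeff Q ^ N) P - Q * B')
        (Polynomial.degree Q + Polynomial.degree B') \<in> M" by (rule coeffs_inD)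
    moreover have "lead_coeff Q * lead_coeff B' \<notin> M"
      using prime_M[of "lead_coeff Q" "lead_coeff B'"] QlS Ql B' D_sub by (auto intro: coeffs_inD)
    ultimately have "poly.coeff (Polynomial.smult (lead_coeff Q ^ N) P)
        (Polynomial.degree Q + Polynomial.degree B') \<noteq> 0"
      using ideal_on_diff[OF ideal_M zero_in_M, of "- (lead_coeff Q * lead_coeff B')"]
      by (auto simp: coeff_mult_degree_sum)
    then have "poly.coeff P (Polynomial.degree Q + Polynomial.degree B') \<noteq> 0" by auto
    then have "Polynomial.degree Q + Polynomial.degree B' \<le> m" unfolding m_def by (rule le_degree)
    then have "Polynomial.degree B' < m" using j by simp
    then have "coeffs_in M B'" using indep[OF B'(1)] BM B'(4) eqM_mem_iff by blast
    then show False using B' by (auto simp: coeffs_in_def)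
  qed
  then obtain b where b: "Q = [:b:]" by (rule degree_eq_zeroE)
  have bD: "b \<in> D" and bM: "b \<notin> M" and be: "eqM b (h * e')"
    using QD Ql e'(2) coeffs_inD[OF QD, of 0] by (simp_all add: b)
  have bS: "b \<in> S" using bD D_sub by blast
  have cb: "c * b \<notin> M" using prime_M c bS bM by blast
  have "\<exists>k. \<exists>g\<in>D. eqM (d * g) ((c * b) ^ k)" if d: "d \<in> D" "d \<notin> M" for d
  proof -
    obtain k g where g: "g \<in> ext" "eqM (d * g) (h ^ k)" using inv[OF ext_const] d by blast
    have gS: "g \<in> S" and dS: "d \<in> S" using g d ext_sub D_sub by auto
    \<comment> \<open>Then \<open>d * e\<close> is congruent to \<open>(h * e') ^ k\<close> and so
      to \<open>b ^ k\<close>. After reduction of \<open>e\<close> to degree below \<open>m\<close>,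
      the constant coefficients can be compared, and these lie in \<open>D\<close>.\<close>
    define e where "e = g * e' ^ k"
    have e: "e \<in> ext" by (simp add: e_def ext_mult ext_power g e')
    obtain N F where F: "coeffs_in D F" "Polynomial.degree F < m" "eqM (c ^ N * e) (poly F x)"
      using reduce[OF e] by blast
    have "eqM (b ^ k) ((h * e') ^ k)" using be bS hS e'S by (intro eqM_power) simp_all
    moreover have "eqM (h ^ k * e' ^ k) (d * g * e' ^ k)"
      using eqM_sym[OF g(2)] e'S by (intro eqM_mult_right) simp_all
    ultimately have "eqM (b ^ k) (d * e)"
      unfolding power_mult_distrib e_def using eqM_trans by (simp add: mult.assoc)
    then have "eqM (c ^ N * b ^ k) (c ^ N * (d * e))" using c by (intro eqM_mult_left) simp_all
    moreover have "eqM (d * (c ^ N * e)) (d * poly F x)" using F(3) dS by (rule eqM_mult_left)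
    ultimately have "eqM (c ^ N * b ^ k) (d * poly F x)"
      using eqM_trans by (simp add: mult.left_commute)
    then have "poly ([:c ^ N * b ^ k:] - Polynomial.smult d F) x \<in> M" by (simp add: eqM_def)
    moreover have "coeffs_in D ([:c ^ N * b ^ k:] - Polynomial.smult d F)" using c bD d F by simp
    moreover have "Polynomial.degree ([:c ^ N * b ^ k:] - Polynomial.smult d F) < m"
    proof -
      have "Polynomial.degree ([:c ^ N * b ^ k:] - Polynomial.smult d F) \<le> m - 1"
        using F(2) m degree_smult_le[of d F] by (intro degree_diff_le) simp_all
      then show ?thesis using m by simp
    qed
    ultimately have "coeffs_in M ([:c ^ N * b ^ k:] - Polynomial.smult d F)" using indep by blast
    then have "poly.coeff ([:c ^ N * b ^ k:] - Polynomial.smult d F) 0 \<in> M" by (rule coeffs_inD)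
    then have "eqM (c ^ N * b ^ k) (d * poly.coeff F 0)" by (simp add: eqM_def)
    \<comment> \<open>The factor makes the exponents of \<open>c\<close> and \<open>b\<close> equal,
      so that a power of the single element \<open>c * b\<close> appears.\<close>
    then have *: "eqM (c ^ k * b ^ N * (c ^ N * b ^ k)) (c ^ k * b ^ N * (d * poly.coeff F 0))"
      using c bS by (intro eqM_mult_left) simp_all
    have **: "c ^ k * b ^ N * (c ^ N * b ^ k) = (c * b) ^ (N + k)"
      by (simp only: power_mult_distrib power_add ac_simps)
    have "eqM (d * (c ^ k * b ^ N * poly.coeff F 0)) ((c * b) ^ (N + k))"
      using eqM_sym[OF *] unfolding ** by (simp add: ac_simps)
    moreover have "c ^ k * b ^ N * poly.coeff F 0 \<in> D"
      using c bD coeffs_inD[OF F(1)] by simp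
    ultimately show ?thesis by blast
  qed
  then show ?thesis unfolding goldman_def using c bD cb by (intro bexI[of _ "c * b"]) simp_all
qed

end

text \<open>Modulo \<open>M\<close> the ring \<open>polys V\<close> is a field, so
  \<open>goldman\<close> holds with \<open>h = 1\<close>. Descent removes all variables except
  \<open>v\<close>, and \<open>algebraic\<close> gives a relation for \<open>var v\<close> over the
  constants, whose leading coefficient is a nonzero scalar and can be divided out.\<close>

lemma zariski:
  fixes V :: "'v set" and M :: "('v, 'k::field) mpoly set"
  assumes V: "finite V" and v: "v \<in> V" and M: "maximalideal M (ring_on (polys V))"
  shows "\<exists>P. coeffs_in (polys {}) P \<and> lead_coeff P = 1 \<and> poly P (var v) \<in> M"
proof -
  interpret Q: cring "ring_on (polys V :: ('v, 'k) mpoly set)" by (rule polys.cring_ring_on)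
  interpret Max: maximalideal M "ring_on (polys V)" by (rule M)
  have prime: "primeideal M (ring_on (polys V))" by (rule Q.maximalideal_prime[OF M])
  interpret prime_in_subring "polys V" M
    using prime unfolding polys.primeideal_on_iff by unfold_locales blast+
  have ext: "simple_extension_mod (polys V) M (polys W) (var x)" if "x \<in> V" "W \<subseteq> V" for x W
    using that polys_mono[OF that(2)] var_mem_polys[of x V] by unfold_locales simp_all
  have ext_eq: "simple_extension_mod.ext (polys W) (var x :: ('v, 'k) mpoly) = polys (insert x W)"
    if "x \<in> V" "W \<subseteq> V" "x \<notin> W" for x W
    unfolding simple_extension_mod.ext_def[OF ext[OF that(1,2)]]
  proof (intro equalityI subsetI)
    fix p :: "('v, 'k) mpoly" assume "p \<in> {poly P (var x) | P. coeffs_in (polys W) P}"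
    then obtain P where P: "p = poly P (var x)" "coeffs_in (polys W) P" by blast
    then show "p \<in> polys (insert x W)"
      using polys_mono[of W "insert x W"] by (auto simp: coeffs_in_def intro!: poly_mem_polys var_mem_polys)
  next
    fix p :: "('v, 'k) mpoly" assume "p \<in> polys (insert x W)"
    then have "coeffs_in (polys W) (uni x p)"
      using coeff_uni_mem[of p "insert x W" x] that by (simp add: coeffs_in_def)
    then show "p \<in> {poly P (var x) | P. coeffs_in (polys W) P}"
      using poly_uni[of x p] by (intro CollectI exI[of _ "uni x p"]) simp
  qed
  have "goldman (polys V)"
    unfolding goldman_def
  proof (intro bexI conjI ballI impI)
    fix e :: "('v, 'k) mpoly" assume e: "e \<in> polys V" "e \<notin> M"
    have a: "ideal_on (polys V) (adjoin (polys V) M e)" by (rule polys.ideal_on_adjoin[OF ideal_M e(1)])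
    have sub: "adjoin (polys V) M e \<subseteq> carrier (ring_on (polys V))"
      using polys.ideal_on_sub[OF a] by (simp add: subset_iff)
    have "ideal (adjoin (polys V) M e) (ring_on (polys V))" using a by (simp only: polys.ideal_on_iff)
    from Max.I_maximal[OF this polys.adjoin_supset sub]
    have "adjoin (polys V) M e = M \<or> adjoin (polys V) M e = polys V" unfolding ring_on_simps .
    moreover have "adjoin (polys V) M e \<noteq> M"
      using polys.adjoin_mem[OF ideal_M, of e] e(2) by (elim contrapos_nn) simp
    ultimately have "adjoin (polys V) M e = polys V" by simp
    then have "1 \<in> adjoin (polys V) M e" by simp
    then obtain j r where "1 = j + e * r" "j \<in> M" "r \<in> polys V" unfolding adjoin_def by blast
    then have "e * r - 1 = 0 - j" by (simp add: algebra_simps)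
    then have "eqM (e * r) (1 ^ 0)"
      using polys.ideal_on_diff[OF ideal_M zero_in_M \<open>j \<in> M\<close>] by (simp only: eqM_def power_0)
    then show "\<exists>k. \<exists>g\<in>polys V. eqM (e * g) (1 ^ k)" using \<open>r \<in> polys V\<close> by blast
  qed (simp_all add: one_notin)
  moreover have "goldman (polys (insert v F)) \<Longrightarrow> goldman (polys {v})"
    if "finite F" "F \<subseteq> V - {v}" for F
    using that
  proof (induction F rule: finite_induct)
    case (insert x F)
    have "goldman (polys (insert v F))"
    proof -
      have "goldman (polys (insert x (insert v F)))"
        using insert.prems by (simp add: insert_commute)
      then show ?thesis
        using simple_extension_mod.goldman_descent[OF ext[of x "insert v F"]]
          ext_eq[of x "insert v F"] insert.prems insert.hyps v by auto
    qed
    then show ?case using insert by auto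
  qed simp
  ultimately have "goldman (polys {v})"
    using V v by (metis finite_Diff insert_Diff order_refl)
  then have "goldman (simple_extension_mod.ext (polys {}) (var v))" using ext_eq[of v "{}"] v by simp
  from simple_extension_mod.algebraic[OF ext[OF v] this]
  obtain P where P: "coeffs_in (polys {}) P" "lead_coeff P \<notin> M" "poly P (var v) \<in> M" by auto
  obtain a where a: "lead_coeff P = Poly_Mapping.single 0 a"
    using polys_empty[OF coeffs_inD[OF P(1)]] by blast
  have "a \<noteq> 0" using a P(2) by auto
  define c :: "('v, 'k) mpoly" where "c = Poly_Mapping.single 0 (inverse a)"
  have c: "c * lead_coeff P = 1" "c \<in> polys {}"
    using a \<open>a \<noteq> 0\<close> by (simp_all add: c_def mult_single single_mem_polys)
  then have "c * lead_coeff P \<noteq> 0" by simp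
  then have "Polynomial.degree (Polynomial.smult c P) = Polynomial.degree P"
    by (intro antisym degree_smult_le le_degree) simp
  then have "lead_coeff (Polynomial.smult c P) = 1" using c by simp
  moreover have "coeffs_in (polys {}) (Polynomial.smult c P)" using P c by simp
  moreover have "poly (Polynomial.smult c P) (var v) \<in> M"
    using P(3) c(2) polys_mono[of "{}" V] by (auto intro!: polys.ideal_on_mult[OF ideal_M])
  ultimately show ?thesis by blast
qed

subsection \<open>The length of a chain of primes\<close>

text \<open>A homogeneous linear system with more unknowns than equations. Gaussian elimination: the
  pivot \<open>a0\<close> removes the equation \<open>b\<close> together with one unknown.\<close>

lemma exists_nontrivial_relation:
  fixes M :: "'a \<Rightarrow> 'b \<Rightarrow> 'k::field"
  assumes "finite B" "finite A" "card B < card A"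
  shows "\<exists>c. (\<exists>a\<in>A. c a \<noteq> 0) \<and> (\<forall>b\<in>B. (\<Sum>a\<in>A. c a * M a b) = 0)"
  using assms
proof (induction B arbitrary: A M rule: finite_induct)
  case empty
  then obtain a where "a \<in> A" by fastforce
  then show ?case by (intro exI[of _ "\<lambda>_. 1"]) auto
next
  case (insert b B)
  show ?case
  proof (cases "\<forall>a\<in>A. M a b = 0")
    case True
    obtain c where "\<exists>a\<in>A. c a \<noteq> 0" "\<forall>b\<in>B. (\<Sum>a\<in>A. c a * M a b) = 0"
      using insert.IH[of A M] insert.prems insert.hyps by auto
    then show ?thesis using True by (intro exI[of _ c]) auto
  next
    case False
    then obtain a0 where a0: "a0 \<in> A" "M a0 b \<noteq> 0" by blast
    define M' where "M' = (\<lambda>a b'. M a b' - M a b / M a0 b * M a0 b')"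
    have "card B < card (A - {a0})" using insert a0 by simp
    then obtain c where c: "\<exists>a\<in>A - {a0}. c a \<noteq> 0" "\<forall>b\<in>B. (\<Sum>a\<in>A - {a0}. c a * M' a b) = 0"
      using insert.IH[of "A - {a0}" M'] insert.prems by auto
    define s where "s = (\<Sum>a\<in>A - {a0}. c a * M a b)"
    define c' where "c' = c(a0 := - s / M a0 b)"
    have split: "(\<Sum>a\<in>A. c' a * M a b') = - s / M a0 b * M a0 b' + (\<Sum>a\<in>A - {a0}. c a * M a b')" for b'
      using insert.prems a0 by (simp add: sum.remove[of A a0] c'_def)
    have "(\<Sum>a\<in>A. c' a * M a b') = 0" if "b' \<in> B" for b'
    proof -
      have "0 = (\<Sum>a\<in>A - {a0}. c a * M' a b')" using c that by simp
      also have "\<dots> = (\<Sum>a\<in>A - {a0}. c a * M a b') - (\<Sum>a\<in>A - {a0}. c a * M a b * (M a0 b' / M a0 b))"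
        unfolding M'_def sum_subtractf[symmetric] by (intro sum.cong) (simp_all add: algebra_simps)
      also have "\<dots> = (\<Sum>a\<in>A - {a0}. c a * M a b') - s * (M a0 b' / M a0 b)"
        unfolding s_def sum_distrib_right ..
      finally show ?thesis unfolding split by (simp add: algebra_simps)
    qed
    moreover have "(\<Sum>a\<in>A. c' a * M a b) = 0" unfolding split using a0 by (simp add: s_def)
    moreover have "\<exists>a\<in>A. c' a \<noteq> 0" using c(1) by (auto simp: c'_def)
    ultimately show ?thesis by blast
  qed
qed

text \<open>Divide a putative relation modulo \<open>P 0\<close> by the lowest power of \<open>g 0\<close> occurring in it and
  reduce modulo \<open>P 1\<close>, which contains \<open>g 0\<close>.\<close>
lemma (in unital_subring) prime_chain_independent:
  fixes e :: "'b \<Rightarrow> nat \<Rightarrow> nat"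
  assumes "\<And>i. i \<le> h \<Longrightarrow> primeideal (P i) (ring_on S)" "\<And>i. i < h \<Longrightarrow> P i \<subseteq> P (Suc i)"
    and "\<And>i. i < h \<Longrightarrow> g i \<in> P (Suc i)" "\<And>i. i < h \<Longrightarrow> g i \<notin> P i"
    and "finite T" "T \<noteq> {}" "\<And>a b. a \<in> T \<Longrightarrow> b \<in> T \<Longrightarrow> (\<And>i. i < h \<Longrightarrow> e a i = e b i) \<Longrightarrow> a = b"
    and "\<And>a. a \<in> T \<Longrightarrow> c a \<in> S" "\<And>a. a \<in> T \<Longrightarrow> c a \<notin> P h"
  shows "(\<Sum>a\<in>T. c a * (\<Prod>i<h. g i ^ e a i)) \<notin> P 0"
  using assms
proof (induction h arbitrary: P g T e)
  case 0
  then obtain a where "a \<in> T" by blast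
  then have "T = {a}" using 0(7) by auto
  then show ?case using 0 by simp
next
  case (Suc h)
  note prime = Suc.prems(1)[unfolded primeideal_on_iff]
  have gS: "g i \<in> S" if "i < Suc h" for i
    using ideal_on_sub Suc.prems(3)[OF that] prime[of "Suc i"] that by auto
  define m where "m = Min ((\<lambda>a. e a 0) ` T)"
  define T' where "T' = {a \<in> T. e a 0 = m}"
  have m_le: "m \<le> e a 0" if "a \<in> T" for a using that Suc.prems(5) by (simp add: m_def)
  have "m \<in> (\<lambda>a. e a 0) ` T" unfolding m_def using Suc.prems(5,6) by (intro Min_in) auto
  then have T': "T' \<noteq> {}" "T' \<subseteq> T" "finite T'" using Suc.prems(5) by (auto simp: T'_def)
  define p where "p = (\<lambda>a. c a * (\<Prod>i<h. g (Suc i) ^ e a (Suc i)))"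
  have pS: "p a \<in> S" if "a \<in> T" for a
    unfolding p_def using that Suc.prems(8) gS by (intro mult_mem prod_mem power_mem) auto
  define r where "r = (\<Sum>a\<in>T - T'. g 0 ^ (e a 0 - m) * p a)"
  have rS: "r \<in> S" unfolding r_def using pS gS by (intro sum_mem mult_mem power_mem) auto
  have p'S: "sum p T' \<in> S" using pS T' by (intro sum_mem) auto
  have "(\<Sum>a\<in>T. c a * (\<Prod>i<Suc h. g i ^ e a i)) = (\<Sum>a\<in>T. g 0 ^ m * (g 0 ^ (e a 0 - m) * p a))"
  proof (rule sum.cong)
    fix a assume "a \<in> T"
    then have "g 0 ^ e a 0 = g 0 ^ m * g 0 ^ (e a 0 - m)" using m_le by (simp flip: power_add)
    then show "c a * (\<Prod>i<Suc h. g i ^ e a i) = g 0 ^ m * (g 0 ^ (e a 0 - m) * p a)"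
      unfolding p_def prod.lessThan_Suc_shift by (simp add: algebra_simps)
  qed simp
  also have "\<dots> = g 0 ^ m * (\<Sum>a\<in>T. g 0 ^ (e a 0 - m) * p a)" by (simp add: sum_distrib_left)
  also have "(\<Sum>a\<in>T. g 0 ^ (e a 0 - m) * p a) = r + (\<Sum>a\<in>T'. g 0 ^ (e a 0 - m) * p a)"
    unfolding r_def by (rule sum.subset_diff[OF T'(2) Suc.prems(5)])
  also have "(\<Sum>a\<in>T'. g 0 ^ (e a 0 - m) * p a) = sum p T'"
    by (rule sum.cong) (auto simp: T'_def)
  finally have eq: "(\<Sum>a\<in>T. c a * (\<Prod>i<Suc h. g i ^ e a i)) = g 0 ^ m * (r + sum p T')" .
  show ?case
  proof
    assume "(\<Sum>a\<in>T. c a * (\<Prod>i<Suc h. g i ^ e a i)) \<in> P 0"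
    then have "g 0 ^ m * (r + sum p T') \<in> P 0" unfolding eq .
    moreover have "g 0 ^ m \<notin> P 0"
    proof -
      have g0: "g 0 \<notin> P 0" "g 0 \<in> S" using Suc.prems(4)[of 0] gS[of 0] by auto
      have "g 0 ^ n \<notin> P 0" for n
      proof (induction n)
        case (Suc n)
        then show ?case using prime[of 0] g0 by auto
      qed (use prime[of 0] in simp)
      then show ?thesis .
    qed
    ultimately have "r + sum p T' \<in> P 0" using prime[of 0] gS[of 0] rS p'S by (metis le0 add_mem power_mem zero_less_Suc)
    then have 1: "r + sum p T' \<in> P 1" using Suc.prems(2)[of 0] by auto
    have P1: "ideal_on S (P 1)" using prime[of 1] by simp
    have "r \<in> P 1"
      unfolding r_def
    proof (rule ideal_on_sum[OF P1])
      fix a assume a: "a \<in> T - T'"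
      then obtain n where "e a 0 - m = Suc n" using m_le[of a] by (auto simp: T'_def intro: that[of "e a 0 - m - 1"])
      then have "g 0 ^ (e a 0 - m) * p a = (g 0 ^ n * p a) * g 0" by (simp add: algebra_simps)
      also have "\<dots> \<in> P 1"
        using a pS[of a] gS[of 0] Suc.prems(3)[of 0] by (intro ideal_on_mult[OF P1]) auto
      finally show "g 0 ^ (e a 0 - m) * p a \<in> P 1" .
    qed
    then have "sum p T' \<in> P 1" using ideal_on_diff[OF P1 1, of r] by simp
    moreover have "(\<Sum>a\<in>T'. c a * (\<Prod>i<h. g (Suc i) ^ e a (Suc i))) \<notin> P (Suc 0)"
    proof (rule Suc.IH[of "\<lambda>i. P (Suc i)" "\<lambda>i. g (Suc i)" T' "\<lambda>a i. e a (Suc i)"])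
      \<comment> \<open>Members of \<open>T'\<close> share the exponent \<open>m\<close> of
        \<open>g 0\<close>, so the remaining exponents still separate them.\<close>
      fix a b assume ab: "a \<in> T'" "b \<in> T'" "\<And>i. i < h \<Longrightarrow> e a (Suc i) = e b (Suc i)"
      show "a = b"
      proof (rule Suc.prems(7))
        fix i assume "i < Suc h"
        then show "e a i = e b i" using ab by (cases i) (auto simp: T'_def)
      qed (use ab T' in auto)
    qed (use Suc.prems T' in auto)
    ultimately show False by (simp add: p_def)
  qed
qed

text \<open>Bounding each exponent separately, instead of the total degree, puts the monomials into
  a box whose size is a plain power.\<close>

definition exponents_le :: "nat \<Rightarrow> ('v, 'k::field) mpoly \<Rightarrow> bool" where
  "exponents_le b p \<longleftrightarrow> (\<forall>m\<in>Poly_Mapping.keys p. \<forall>v. Poly_Mapping.lookup m v \<le> b)"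

lemma exponents_le_mono: "exponents_le b p \<Longrightarrow> b \<le> b' \<Longrightarrow> exponents_le b' p"
  unfolding exponents_le_def using le_trans by blast

lemma exponents_le_mult:
  assumes "exponents_le b p" "exponents_le b' q"
  shows "exponents_le (b + b') (p * q)"
  unfolding exponents_le_def
proof (intro ballI allI)
  fix m v assume "m \<in> Poly_Mapping.keys (p * q)"
  then obtain m1 m2 where "m = m1 + m2" "m1 \<in> Poly_Mapping.keys p" "m2 \<in> Poly_Mapping.keys q"
    using keys_mult[of p q] by blast
  then show "Poly_Mapping.lookup m v \<le> b + b'"
    using assms by (simp add: exponents_le_def lookup_add add_mono)
qed

lemma exponents_le_power: "exponents_le b p \<Longrightarrow> exponents_le (n * b) (p ^ n)"
proof (induction n)
  case (Suc n)
  then show ?case using exponents_le_mult[of b p "n * b" "p ^ n"] by simp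
qed (simp add: exponents_le_def)

lemma exponents_le_prod:
  "(\<And>i. i < h \<Longrightarrow> exponents_le b (p i)) \<Longrightarrow> exponents_le (h * b) (\<Prod>i<h. p i)"
proof (induction h)
  case (Suc h)
  then show ?case
    using exponents_le_mult[of "h * b" "\<Prod>i<h. p i" b "p h"] by (simp add: add.commute)
qed (simp add: exponents_le_def)

lemma exponents_le_exists: "\<exists>b. exponents_le b p"
proof -
  have "Poly_Mapping.lookup m v \<le> (\<Sum>m\<in>Poly_Mapping.keys p. \<Sum>v\<in>Poly_Mapping.keys m. Poly_Mapping.lookup m v)"
    if "m \<in> Poly_Mapping.keys p" for m v
  proof -
    have "Poly_Mapping.lookup m v \<le> (\<Sum>v\<in>Poly_Mapping.keys m. Poly_Mapping.lookup m v)"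
      by (cases "v \<in> Poly_Mapping.keys m") (auto simp: in_keys_iff intro: member_le_sum)
    also have "\<dots> \<le> (\<Sum>m\<in>Poly_Mapping.keys p. \<Sum>v\<in>Poly_Mapping.keys m. Poly_Mapping.lookup m v)"
      using that by (intro member_le_sum) auto
    finally show ?thesis .
  qed
  then show ?thesis unfolding exponents_le_def by blast
qed

lemma bounded_monomials:
  fixes W :: "'v set" and b :: nat
  assumes "finite W"
  defines "B \<equiv> {m :: 'v \<Rightarrow>\<^sub>0 nat. Poly_Mapping.keys m \<subseteq> W \<and> (\<forall>v. Poly_Mapping.lookup m v \<le> b)}"
  shows "finite B" "card B \<le> (b + 1) ^ card W"
proof -
  let ?f = "\<lambda>m :: 'v \<Rightarrow>\<^sub>0 nat. restrict (Poly_Mapping.lookup m) W"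
  let ?E = "PiE W (\<lambda>_. {..b})"
  have inj: "inj_on ?f B"
  proof (rule inj_onI)
    fix m n assume mn: "m \<in> B" "n \<in> B" "?f m = ?f n"
    show "m = n"
    proof (rule poly_mapping_eqI)
      fix v
      show "Poly_Mapping.lookup m v = Poly_Mapping.lookup n v"
      proof (cases "v \<in> W")
        case True
        then show ?thesis using fun_cong[OF mn(3), of v] by simp
      next
        case False
        then have "v \<notin> Poly_Mapping.keys m" "v \<notin> Poly_Mapping.keys n" using mn by (auto simp: B_def)
        then show ?thesis by (simp add: in_keys_iff)
      qed
    qed
  qed
  have sub: "?f ` B \<subseteq> ?E" by (auto simp: B_def)
  have fin: "finite ?E" using assms by (intro finite_PiE) auto
  show "finite B" by (rule inj_on_finite[OF inj sub fin])
  have "card B \<le> card ?E" by (rule card_inj_on_le[OF inj sub fin])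
  also have "\<dots> = (b + 1) ^ card W" using assms by (simp add: card_PiE)
  finally show "card B \<le> (b + 1) ^ card W" .
qed

lemma lookup_const_mult:
  fixes p :: "('v, 'k::field) mpoly"
  shows "Poly_Mapping.lookup (Poly_Mapping.single 0 c * p) m = c * Poly_Mapping.lookup p m"
proof (induction p rule: mpoly_induct)
  case (single n d)
  show ?case by (simp add: mult_single lookup_single when_def)
qed (simp_all add: algebra_simps lookup_add)

lemma var_ideal_least:
  fixes J :: "('v, 'k::field) mpoly set"
  assumes J: "ideal_on (polys V) J" and C: "var ` C \<subseteq> J" "C \<subseteq> V"
  shows "var_ideal V C \<subseteq> J"
proof
  fix p :: "('v, 'k) mpoly" assume p: "p \<in> var_ideal V C"
  show "p \<in> J"
  proof (rule monomial_ideal_memI[OF J])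
    show "p \<in> polys V" using p by (simp add: monomial_ideal_def)
    fix m and c :: 'k assume m: "m \<in> Poly_Mapping.keys p" "Poly_Mapping.keys m \<subseteq> V"
    then obtain v where v: "v \<in> C" "1 \<le> Poly_Mapping.lookup m v"
      using p by (auto simp: monomial_ideal_def touching_def)
    define n where "n = Poly_Mapping.update v (Poly_Mapping.lookup m v - 1) m"
    have "n + Poly_Mapping.single v 1 = m"
      using v by (intro poly_mapping_eqI)
        (auto simp: n_def lookup_add lookup_update lookup_single when_def)
    then have "Poly_Mapping.single m c = Poly_Mapping.single n c * var v"
      by (simp add: var_def mult_single)
    moreover have "Poly_Mapping.keys n \<subseteq> V" using m v C by (auto simp: n_def keys_update)
    then have "Poly_Mapping.single n c \<in> polys V" by (rule single_mem_polys)
    ultimately show "Poly_Mapping.single m c \<in> J"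
      using polys.ideal_on_mult[OF J] v C by (simp add: image_subset_iff)
  qed
qed

lemma prime_chain_mono:
  assumes "prime_chain A P n" "i \<le> j" "j \<le> n"
  shows "P i \<subseteq> P j"
  using assms(2,3)
proof (induction j rule: dec_induct)
  case (step k)
  then have "P k \<subset> P (Suc k)" using assms(1) by (simp add: prime_chain_def)
  then show ?case using step by auto
qed simp

text \<open>Each inclusion is witnessed by some \<open>g i\<close>, which after reduction involves
  only the variables \<open>W\<close> outside \<open>C\<close>. Products of powers of the
  \<open>g i\<close> with exponents up to \<open>N\<close> number \<open>(N + 1) ^ h\<close>,
  whereas the monomials available to them grow like a power with exponent \<open>card W\<close>. For
  \<open>h\<close> above \<open>card W\<close> this forces a linear relation over the field, against
  \<open>prime_chain_independent\<close>.\<close>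

theorem prime_chain_length:
  fixes V :: "'v set" and P :: "nat \<Rightarrow> ('v, 'k::field) mpoly set"
  assumes V: "finite V" and chain: "prime_chain (ring_on (polys V)) P h"
    and C: "C \<subseteq> V" "var ` C \<subseteq> P 0"
  shows "h + card C \<le> card V"
proof (rule ccontr)
  define W where "W = V - C"
  assume "\<not> h + card C \<le> card V"
  then have h: "card W < h" using C V card_mono[OF V C(1)] by (simp add: W_def card_Diff_subset finite_subset)
  have finW: "finite W" using V by (simp add: W_def)
  have prime: "primeideal (P i) (ring_on (polys V))" if "i \<le> h" for i
    using chain that by (auto simp: prime_chain_def)
  note prime' = prime[unfolded polys.primeideal_on_iff]
  have "\<exists>g\<in>polys W. g \<in> P (Suc i) \<and> g \<notin> P i" if i: "i < h" for i
  proof -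
    have "P i \<subset> P (Suc i)" using chain i by (simp add: prime_chain_def)
    then obtain p where p: "p \<in> P (Suc i)" "p \<notin> P i" by blast
    then have "p \<in> polys V" using prime'[of "Suc i"] i polys.ideal_on_sub by (meson Suc_leI)
    then obtain g where g: "g \<in> polys W" "p - g \<in> var_ideal V C"
      using var_ideal_reduce unfolding W_def by blast
    have "var_ideal V C \<subseteq> P 0" using prime'[of 0] C by (intro var_ideal_least) auto
    then have "p - g \<in> P i" "p - g \<in> P (Suc i)"
      using g prime_chain_mono[OF chain, of 0] i by (auto simp: subset_iff)
    then have "p \<in> P i \<longleftrightarrow> g \<in> P i" "p \<in> P (Suc i) \<longleftrightarrow> g \<in> P (Suc i)"
      using polys.ideal_on_cancel prime'[of i] prime'[of "Suc i"] i by (meson Suc_leI less_imp_le)+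
    then show ?thesis using p g by blast
  qed
  then obtain g where g: "\<And>i. i < h \<Longrightarrow> g i \<in> polys W" "\<And>i. i < h \<Longrightarrow> g i \<in> P (Suc i)"
    "\<And>i. i < h \<Longrightarrow> g i \<notin> P i" by metis
  have "\<forall>i. \<exists>b. exponents_le b (g i)" using exponents_le_exists by blast
  then obtain b where b: "\<And>i. exponents_le (b i) (g i)" by metis
  define D where "D = (\<Sum>i<h. b i)"
  have D: "exponents_le D (g i)" if "i < h" for i
    by (rule exponents_le_mono[OF b]) (use that in \<open>auto simp: D_def intro: member_le_sum\<close>)
  \<comment> \<open>Chosen so that \<open>h * (N * D) + 1\<close> being at most
    \<open>(h * D + 1) * (N + 1)\<close> bounds the number of monomials by
    \<open>N * (N + 1) ^ card W\<close>, which is less than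
    \<open>(N + 1) ^ Suc (card W)\<close>.\<close>
  define N where "N = (h * D + 1) ^ card W"
  define T where "T = PiE {..<h} (\<lambda>_. {..N})"
  define F where "F = (\<lambda>a. \<Prod>i<h. g i ^ a i)"
  define B where "B = {m :: 'v \<Rightarrow>\<^sub>0 nat. Poly_Mapping.keys m \<subseteq> W \<and> (\<forall>v. Poly_Mapping.lookup m v \<le> h * (N * D))}"
  have finT: "finite T" unfolding T_def by (intro finite_PiE) auto
  have B: "finite B" "card B \<le> (h * (N * D) + 1) ^ card W"
    unfolding B_def by (rule bounded_monomials[OF finW])+
  have FB: "Poly_Mapping.keys (F a) \<subseteq> B" if "a \<in> T" for a
  proof -
    have "exponents_le (N * D) (g i ^ a i)" if "i < h" for i
    proof (rule exponents_le_mono[OF exponents_le_power[OF D[OF that]]])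
      have "a i \<le> N" using \<open>a \<in> T\<close> that by (auto simp: T_def PiE_def Pi_def)
      then show "a i * D \<le> N * D" by simp
    qed
    then have "exponents_le (h * (N * D)) (F a)" unfolding F_def by (rule exponents_le_prod)
    moreover have "F a \<in> polys W" unfolding F_def using g by (intro polys.prod_mem) simp
    ultimately show ?thesis by (auto simp: exponents_le_def polys_def B_def)
  qed
  have "card B < card T"
  proof -
    have "h * (N * D) + 1 \<le> (h * D + 1) * (N + 1)" by (simp add: algebra_simps)
    then have "card B \<le> ((h * D + 1) * (N + 1)) ^ card W"
      using B(2) power_mono[of "h * (N * D) + 1" "(h * D + 1) * (N + 1)" "card W"] by linarith
    also have "\<dots> = (h * D + 1) ^ card W * (N + 1) ^ card W" by (rule power_mult_distrib)
    also have "\<dots> = N * (N + 1) ^ card W" by (simp only: N_def)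
    also have "\<dots> < (N + 1) * (N + 1) ^ card W" by simp
    also have "\<dots> = (N + 1) ^ Suc (card W)" by simp
    also have "\<dots> \<le> (N + 1) ^ h" using h by (intro power_increasing) auto
    also have "\<dots> = card T" by (simp add: T_def card_PiE)
    finally show ?thesis .
  qed
  then obtain c where c: "\<exists>a\<in>T. c a \<noteq> 0" "\<And>m. m \<in> B \<Longrightarrow> (\<Sum>a\<in>T. c a * Poly_Mapping.lookup (F a) m) = 0"
    using exists_nontrivial_relation[OF B(1) finT, of "\<lambda>a. Poly_Mapping.lookup (F a)"] by blast
  \<comment> \<open>Only nonzero scalars may remain: these are units and thus lie outside the top
    prime of the chain.\<close>
  define T0 where "T0 = {a \<in> T. c a \<noteq> 0}"
  have "(\<Sum>a\<in>T0. Poly_Mapping.single 0 (c a) * F a) = (\<Sum>a\<in>T. Poly_Mapping.single 0 (c a) * F a)"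
    by (rule sum.mono_neutral_left) (use finT in \<open>auto simp: T0_def\<close>)
  also have "\<dots> = 0"
  proof (rule poly_mapping_eqI)
    fix m
    have "(\<Sum>a\<in>T. c a * Poly_Mapping.lookup (F a) m) = 0"
    proof (cases "m \<in> B")
      case False
      then have "Poly_Mapping.lookup (F a) m = 0" if "a \<in> T" for a
        using FB[OF that] by (auto simp: in_keys_iff)
      then show ?thesis by simp
    qed (rule c(2))
    then show "Poly_Mapping.lookup (\<Sum>a\<in>T. Poly_Mapping.single 0 (c a) * F a) m = Poly_Mapping.lookup 0 m"
      by (simp add: lookup_sum lookup_const_mult)
  qed
  finally have zero: "(\<Sum>a\<in>T0. Poly_Mapping.single 0 (c a) * F a) = 0" .
  have "(\<Sum>a\<in>T0. Poly_Mapping.single 0 (c a) * (\<Prod>i<h. g i ^ a i)) \<notin> P 0"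
  proof (rule polys.prime_chain_independent[of h P V g T0 "\<lambda>a. a"])
    show "P i \<subseteq> P (Suc i)" if "i < h" for i using chain that by (auto simp: prime_chain_def)
    show "T0 \<noteq> {}" using c(1) by (auto simp: T0_def)
    fix a assume a: "a \<in> T0"
    show "Poly_Mapping.single 0 (c a) \<in> polys V" by (simp add: single_mem_polys)
    show "Poly_Mapping.single 0 (c a) \<notin> P h"
    proof
      assume "Poly_Mapping.single 0 (c a) \<in> P h"
      then have "Poly_Mapping.single 0 (inverse (c a)) * Poly_Mapping.single 0 (c a) \<in> P h"
        using prime'[of h] by (intro polys.ideal_on_mult) (auto simp: single_mem_polys)
      then show False using a prime'[of h] by (simp add: mult_single T0_def)
    qed
  next
    fix a b assume "a \<in> T0" "b \<in> T0" "\<And>i. i < h \<Longrightarrow> a i = b i"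
    then show "a = b" by (intro PiE_ext[of a "{..<h}" "\<lambda>_. {..N}" b]) (auto simp: T0_def T_def)
  qed (use g prime finT in \<open>auto simp: T0_def\<close>)
  then show False using zero prime'[of 0] by (simp add: F_def ideal_on_def)
qed

subsection \<open>Regular sequences and chains of primes\<close>

context cring
begin

lemma genideal_insert:
  assumes "A \<subseteq> carrier R" "x \<in> carrier R"
  shows "Idl (insert x A) = {j \<oplus> x \<otimes> r | j r. j \<in> Idl A \<and> r \<in> carrier R}" (is "_ = ?J")
proof (rule equalityI)
  interpret A: ideal "Idl A" R by (rule genideal_ideal[OF assms(1)])
  have AR: "j \<in> carrier R" if "j \<in> Idl A" for j using A.a_subset that by blast
  have "ideal ?J R"
  proof (rule idealI)
    show "subgroup ?J (add_monoid R)"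
    proof (rule subgroup.intro)
      show "?J \<subseteq> carrier (add_monoid R)" using AR assms(2) by auto
      show "\<one>\<^bsub>add_monoid R\<^esub> \<in> ?J"
        using additive_subgroup.zero_closed[OF A.is_additive_subgroup] assms(2)
        by (auto intro!: exI[of _ \<zero>])
      fix a assume "a \<in> ?J"
      then obtain j r where a: "a = j \<oplus> x \<otimes> r" "j \<in> Idl A" "r \<in> carrier R" by blast
      { fix b assume "b \<in> ?J"
        then obtain j' r' where b: "b = j' \<oplus> x \<otimes> r'" "j' \<in> Idl A" "r' \<in> carrier R" by blast
        have "a \<oplus> b = (j \<oplus> j') \<oplus> x \<otimes> (r \<oplus> r')"
          using a b AR assms(2) by (simp add: r_distr a_ac)
        moreover have "j \<oplus> j' \<in> Idl A"
          using additive_subgroup.a_closed[OF A.is_additive_subgroup] a b by blast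
        ultimately show "a \<otimes>\<^bsub>add_monoid R\<^esub> b \<in> ?J" using a b by auto }
      have "\<ominus> a = (\<ominus> j) \<oplus> x \<otimes> (\<ominus> r)"
        using a AR assms(2) by (simp add: minus_add r_minus)
      moreover have "\<ominus> j \<in> Idl A"
        using additive_subgroup.a_inv_closed[OF A.is_additive_subgroup] a by blast
      ultimately show "inv\<^bsub>add_monoid R\<^esub> a \<in> ?J" using a by (auto simp: a_inv_def[symmetric])
    qed
    fix a s assume "a \<in> ?J" and s: "s \<in> carrier R"
    then obtain j r where a: "a = j \<oplus> x \<otimes> r" "j \<in> Idl A" "r \<in> carrier R" by blast
    have "s \<otimes> a = s \<otimes> j \<oplus> x \<otimes> (s \<otimes> r)"
      using a s AR assms(2) by (simp add: r_distr m_lcomm)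
    moreover have "s \<otimes> j \<in> Idl A" using A.I_l_closed a s by blast
    ultimately show sa: "s \<otimes> a \<in> ?J" using a s by auto
    have "a \<otimes> s = s \<otimes> a" using a s AR assms(2) by (intro m_comm) auto
    then show "a \<otimes> s \<in> ?J" using sa by simp
  qed (rule ring_axioms)
  moreover have "insert x A \<subseteq> ?J"
  proof -
    have "x \<in> ?J"
      using additive_subgroup.zero_closed[OF A.is_additive_subgroup] assms(2)
      by (intro CollectI exI[of _ \<zero>] exI[of _ \<one>]) simp
    moreover have "a \<in> ?J" if "a \<in> A" for a
      using genideal_self[OF assms(1)] that assms by (intro CollectI exI[of _ a] exI[of _ \<zero>]) auto
    ultimately show ?thesis by blast
  qed
  ultimately show "Idl (insert x A) \<subseteq> ?J" by (rule genideal_minimal)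
  have sub: "insert x A \<subseteq> carrier R" using assms by blast
  interpret B: ideal "Idl (insert x A)" R by (rule genideal_ideal[OF sub])
  have "Idl A \<subseteq> Idl (insert x A)"
    using genideal_self[OF sub] by (intro genideal_minimal B.is_ideal) blast
  moreover have "x \<in> Idl (insert x A)" using genideal_self[OF sub] by blast
  ultimately show "?J \<subseteq> Idl (insert x A)"
    using B.I_r_closed additive_subgroup.a_closed[OF B.is_additive_subgroup] by blast
qed

lemma ideal_annihilator:
  assumes "ideal J R" "f \<in> carrier R"
  shows "ideal {r \<in> carrier R. r \<otimes> f \<in> J} R"
proof -
  interpret J: ideal J R by fact
  show ?thesis
  proof (rule idealI)
    show "subgroup {r \<in> carrier R. r \<otimes> f \<in> J} (add_monoid R)"
    proof (rule subgroup.intro)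
      show "\<one>\<^bsub>add_monoid R\<^esub> \<in> {r \<in> carrier R. r \<otimes> f \<in> J}"
        using additive_subgroup.zero_closed[OF J.is_additive_subgroup] assms(2) by simp
      fix a assume a: "a \<in> {r \<in> carrier R. r \<otimes> f \<in> J}"
      show "a \<otimes>\<^bsub>add_monoid R\<^esub> b \<in> {r \<in> carrier R. r \<otimes> f \<in> J}" if "b \<in> {r \<in> carrier R. r \<otimes> f \<in> J}" for b
        using a that assms(2) additive_subgroup.a_closed[OF J.is_additive_subgroup] by (simp add: l_distr)
      show "inv\<^bsub>add_monoid R\<^esub> a \<in> {r \<in> carrier R. r \<otimes> f \<in> J}"
        using a assms(2) additive_subgroup.a_inv_closed[OF J.is_additive_subgroup]
        by (simp add: a_inv_def[symmetric] l_minus)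
    qed auto
    fix a s assume a: "a \<in> {r \<in> carrier R. r \<otimes> f \<in> J}" and s: "s \<in> carrier R"
    then have "s \<otimes> (a \<otimes> f) \<in> J" by (auto intro: J.I_l_closed)
    then show "s \<otimes> a \<in> {r \<in> carrier R. r \<otimes> f \<in> J}" "a \<otimes> s \<in> {r \<in> carrier R. r \<otimes> f \<in> J}"
      using a s assms(2) by (simp_all add: m_assoc m_lcomm)
  qed (rule ring_axioms)
qed

lemma minus_mem_ideal:
  assumes "ideal J R" "a \<in> J" "b \<in> J"
  shows "a \<ominus> b \<in> J"
proof -
  interpret J: ideal J R by fact
  show ?thesis
    using additive_subgroup.a_closed[OF J.is_additive_subgroup assms(2)
        additive_subgroup.a_inv_closed[OF J.is_additive_subgroup assms(3)]]
    by (simp add: a_minus_def)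
qed

end

context noetherian_ring
begin

lemma ideal_family_maximal:
  assumes "F \<noteq> {}" "\<And>I. I \<in> F \<Longrightarrow> ideal I R"
  shows "\<exists>I\<in>F. \<forall>J\<in>F. I \<subseteq> J \<longrightarrow> J = I"
proof (rule subset_Zorn)
  fix C assume C: "subset.chain F C"
  show "\<exists>U\<in>F. \<forall>X\<in>C. X \<subseteq> U"
  proof (cases "C = {}")
    case False
    have "subset.chain {I. ideal I R} C" using C assms(2) unfolding pred_on.chain_def by auto
    then have "\<Union>C \<in> C" using ideal_chain_is_trivial False by blast
    moreover have "C \<subseteq> F" using C unfolding pred_on.chain_def by (rule conjunct1)
    ultimately have "\<Union>C \<in> F" by (rule subsetD[rotated])
    then show ?thesis by (rule bexI[rotated]) (intro ballI Union_upper)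
  qed (use assms(1) in blast)
qed

lemma ideal_sequence_stable:
  assumes "\<And>n. ideal (J n) R" "\<And>n. J n \<subseteq> J (Suc n)"
  shows "\<exists>n. J (Suc n) = J n"
proof -
  obtain I where I: "I \<in> range J" "\<forall>K\<in>range J. I \<subseteq> K \<longrightarrow> K = I"
    using ideal_family_maximal[of "range J"] assms(1) by blast
  then obtain n where n: "I = J n" by blast
  have "J (Suc n) = J n" using I(2) assms(2)[of n] unfolding n by simp
  then show ?thesis ..
qed

end

locale noetherian_cring = noetherian_ring R + cring R for R (structure)
begin

text \<open>A maximal annihilator of an element outside \<open>J\<close> is prime: if
  \<open>a c\<close> kills \<open>f\<close> and \<open>c f\<close> is not in \<open>J\<close>, then
  \<open>c f\<close> has the same annihilator as \<open>f\<close>, and \<open>a\<close> belongs to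
  it.\<close>

lemma associated_prime_above_annihilator:
  assumes J: "ideal J R" and b: "b \<in> carrier R" "b \<notin> J"
  shows "\<exists>q\<in>associated_primes R J. {r \<in> carrier R. r \<otimes> b \<in> J} \<subseteq> q"
proof -
  interpret J: ideal J R by (rule J)
  let ?ann = "\<lambda>f. {r \<in> carrier R. r \<otimes> f \<in> J}"
  let ?F = "{?ann f | f. f \<in> carrier R \<and> f \<notin> J \<and> ?ann b \<subseteq> ?ann f}"
  have "?F \<noteq> {}" using b by blast
  moreover have "ideal I R" if "I \<in> ?F" for I using that ideal_annihilator[OF J] by blast
  ultimately have "\<exists>I\<in>?F. \<forall>K\<in>?F. I \<subseteq> K \<longrightarrow> K = I" by (rule ideal_family_maximal)
  then obtain I where I: "I \<in> ?F" and I_max: "\<forall>K\<in>?F. I \<subseteq> K \<longrightarrow> K = I" by (rule bexE)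
  have max_I: "K = I" if "K \<in> ?F" "I \<subseteq> K" for K
    by (rule mp[OF bspec[OF I_max that(1)] that(2)])
  obtain f where f: "f \<in> carrier R" "f \<notin> J" "?ann b \<subseteq> ?ann f" and If: "I = ?ann f"
    using I by blast
  have max: "?ann g = ?ann f" if g: "g \<in> carrier R" "g \<notin> J" "?ann f \<subseteq> ?ann g" for g
  proof -
    have "?ann b \<subseteq> ?ann g" using f(3) g(3) by (rule subset_trans)
    then have "?ann g \<in> ?F" using g(1,2) by blast
    from max_I[OF this] g(3) show ?thesis unfolding If by blast
  qed
  have "primeideal (?ann f) R"
  proof (rule primeidealI)
    show "ideal (?ann f) R" by (rule ideal_annihilator[OF J f(1)])
    show "carrier R \<noteq> ?ann f"
    proof
      assume "carrier R = ?ann f"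
      then have "\<one> \<in> ?ann f" using one_closed by blast
      then show False using f by simp
    qed
    fix a c assume ac: "a \<in> carrier R" "c \<in> carrier R" "a \<otimes> c \<in> ?ann f"
    show "a \<in> ?ann f \<or> c \<in> ?ann f"
    proof (cases "c \<in> ?ann f")
      case False
      then have cf: "c \<otimes> f \<in> carrier R" "c \<otimes> f \<notin> J" using ac f by auto
      have "?ann f \<subseteq> ?ann (c \<otimes> f)"
      proof
        fix r assume r: "r \<in> ?ann f"
        then have "c \<otimes> (r \<otimes> f) \<in> J" using ac J.I_l_closed by blast
        then show "r \<in> ?ann (c \<otimes> f)" using r ac f by (simp add: m_lcomm)
      qed
      then have "?ann (c \<otimes> f) = ?ann f" by (rule max[OF cf])
      moreover have "a \<in> ?ann (c \<otimes> f)" using ac f by (simp add: m_assoc)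
      ultimately show ?thesis by blast
    qed blast
  qed (rule cring_axioms)
  then have "?ann f \<in> associated_primes R J" using f by (auto simp: associated_primes_def)
  then show ?thesis using f(3) by blast
qed

text \<open>If every \<open>b\<close> with \<open>p b \<subseteq> J\<close> lay in \<open>J + x A\<close>, one could write \<open>f = j\<^sub>1 + x f\<^sub>1\<close>,
  \<open>f\<^sub>1 = j\<^sub>2 + x f\<^sub>2\<close>, \dots for \<open>p = (J : f)\<close>; the chain of the ideals \<open>J + f\<^sub>k A\<close> becomes
  stationary, which makes a unit multiple \<open>(1 - a x) f\<^sub>k\<close>, hence \<open>f\<close>, an element of \<open>J\<close>.\<close>
lemma associated_prime_step:
  assumes A: "A \<subseteq> carrier R" and x: "x \<in> carrier R"
    and p: "p \<in> associated_primes R (Idl A)"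
    and reg: "\<And>b. b \<in> carrier R \<Longrightarrow> x \<otimes> b \<in> Idl A \<Longrightarrow> b \<in> Idl A"
    and unit: "\<And>a. a \<in> carrier R \<Longrightarrow> \<one> \<ominus> a \<otimes> x \<in> Units R"
  shows "\<exists>q\<in>associated_primes R (Idl (insert x A)). p \<subset> q"
proof -
  let ?J = "Idl A"
  have J: "ideal ?J R" by (rule genideal_ideal[OF A])
  interpret J: ideal ?J R by (rule J)
  have J': "ideal (Idl (insert x A)) R" using A x by (intro genideal_ideal) blast
  interpret J': ideal "Idl (insert x A)" R by (rule J')
  note mem' = genideal_insert[OF A x]
  have JR: "j \<in> carrier R" if "j \<in> ?J" for j using J.a_subset that by blast
  obtain f where f: "f \<in> carrier R" "p = {r \<in> carrier R. r \<otimes> f \<in> ?J}" and pp: "primeideal p R"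
    using p by (auto simp: associated_primes_def)
  interpret pp: primeideal p R by (rule pp)
  have fJ: "f \<notin> ?J"
  proof
    assume "f \<in> ?J"
    then have "r \<in> p" if "r \<in> carrier R" for r
      using that J.I_l_closed unfolding f(2) by blast
    then have "\<one> \<in> p" by simp
    then show False using pp.I_notcarr pp.one_imp_carrier by simp
  qed
  define N where "N = {b \<in> carrier R. \<forall>r\<in>p. r \<otimes> b \<in> ?J}"
  have "r \<otimes> f \<in> ?J" if "r \<in> p" for r using that unfolding f(2) by simp
  then have fN: "f \<in> N" unfolding N_def using f(1) by blast
  have NR: "b \<in> carrier R" if "b \<in> N" for b using that by (simp add: N_def)
  have pR: "r \<in> carrier R" if "r \<in> p" for r using pp.a_subset that by blast
  have "\<exists>b\<in>N. b \<notin> Idl (insert x A)"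
  proof (rule ccontr)
    assume no: "\<not> ?thesis"
    have "\<exists>c\<in>N. \<exists>j\<in>?J. b = j \<oplus> x \<otimes> c" if b: "b \<in> N" for b
    proof -
      have "b \<in> Idl (insert x A)" using no b by blast
      then obtain j c where c: "b = j \<oplus> x \<otimes> c" "j \<in> ?J" "c \<in> carrier R" unfolding mem' by blast
      \<comment> \<open>Cancelling \<open>x\<close>, which is regular modulo \<open>Idl A\<close>,
        shows that \<open>p\<close> annihilates the cofactor \<open>c\<close> too, so that the
        descent can be repeated.\<close>
      have "c \<in> N" unfolding N_def
      proof (intro CollectI conjI ballI)
        fix r assume r: "r \<in> p"
        have "x \<otimes> (r \<otimes> c) = r \<otimes> b \<ominus> r \<otimes> j"
          using c r pR[OF r] JR[OF c(2)] x by (simp add: r_distr m_lcomm minus_eq a_ac r_neg1 r_neg2 r_neg)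
        also have "\<dots> \<in> ?J"
        proof (rule minus_mem_ideal[OF J])
          show "r \<otimes> b \<in> ?J" using b r by (simp add: N_def)
          show "r \<otimes> j \<in> ?J" using c r pR J.I_l_closed by blast
        qed
        finally show "r \<otimes> c \<in> ?J" using reg[of "r \<otimes> c"] c pR[OF r] by simp
      qed (rule c(3))
      then show ?thesis using c by blast
    qed
    then obtain nx jx where nx: "\<And>b. b \<in> N \<Longrightarrow> nx b \<in> N" "\<And>b. b \<in> N \<Longrightarrow> jx b \<in> ?J"
      "\<And>b. b \<in> N \<Longrightarrow> b = jx b \<oplus> x \<otimes> nx b" by metis
    define fs where "fs = (\<lambda>n. (nx ^^ n) f)"
    have fsN: "fs n \<in> N" for n by (induction n) (simp_all add: fs_def fN nx)
    have fsR: "fs n \<in> carrier R" for n using NR fsN by blast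
    have fs_Suc: "fs n = jx (fs n) \<oplus> x \<otimes> fs (Suc n)" for n
      using nx(3)[OF fsN[of n]] by (simp add: fs_def)
    define K where "K = (\<lambda>n. Idl (insert (fs n) A))"
    have K: "ideal (K n) R" for n unfolding K_def using A fsR by (intro genideal_ideal) blast
    have memK: "fs n \<in> K n" for n
      unfolding K_def using A fsR[of n] genideal_self[of "insert (fs n) A"] by blast
    have JK: "?J \<subseteq> K n" for n
      unfolding K_def using A fsR[of n] genideal_self[of "insert (fs n) A"]
      by (intro genideal_minimal genideal_ideal) blast+
    have "K n \<subseteq> K (Suc n)" for n
    proof -
      interpret KS: ideal "K (Suc n)" R by (rule K)
      have "fs n \<in> K (Suc n)"
      proof (subst fs_Suc, rule additive_subgroup.a_closed[OF KS.is_additive_subgroup])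
        show "jx (fs n) \<in> K (Suc n)" using nx(2)[OF fsN] JK by blast
        show "x \<otimes> fs (Suc n) \<in> K (Suc n)" by (rule KS.I_l_closed[OF memK x])
      qed
      moreover have "A \<subseteq> K (Suc n)" using genideal_self[OF A] JK by blast
      ultimately have "Idl (insert (fs n) A) \<subseteq> K (Suc n)" by (intro genideal_minimal K) blast
      then show ?thesis by (simp add: K_def)
    qed
    then obtain n where "K (Suc n) = K n" using ideal_sequence_stable[of K] K by blast
    then have "fs (Suc n) \<in> Idl (insert (fs n) A)" using memK[of "Suc n"] by (simp add: K_def)
    then obtain j a where a: "fs (Suc n) = j \<oplus> fs n \<otimes> a" "j \<in> ?J" "a \<in> carrier R"
      unfolding genideal_insert[OF A fsR] by blast
    let ?g = "fs (Suc n)"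
    have jj: "jx (fs n) \<in> ?J" "jx (fs n) \<in> carrier R" using nx(2)[OF fsN] JR by blast+
    have "?g = j \<oplus> (jx (fs n) \<oplus> x \<otimes> ?g) \<otimes> a" using a(1) fs_Suc[of n] by simp
    also have "\<dots> = (j \<oplus> jx (fs n) \<otimes> a) \<oplus> (a \<otimes> x) \<otimes> ?g"
      using a(3) jj(2) JR[OF a(2)] fsR[of "Suc n"] x by (simp add: l_distr r_distr a_assoc m_ac)
    finally have g: "?g = (j \<oplus> jx (fs n) \<otimes> a) \<oplus> (a \<otimes> x) \<otimes> ?g" .
    have jS: "j \<oplus> jx (fs n) \<otimes> a \<in> ?J"
      using additive_subgroup.a_closed[OF J.is_additive_subgroup a(2) J.I_r_closed[OF jj(1) a(3)]] .
    have "(\<one> \<ominus> a \<otimes> x) \<otimes> ?g = ?g \<ominus> (a \<otimes> x) \<otimes> ?g"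
      using a x fsR by (simp add: minus_eq l_distr l_minus)
    also have "\<dots> = j \<oplus> jx (fs n) \<otimes> a"
      using arg_cong[OF g, of "\<lambda>z. z \<ominus> (a \<otimes> x) \<otimes> ?g"] JR[OF jS] a x fsR[of "Suc n"]
      by (simp add: minus_eq a_assoc r_neg)
    finally have uJ: "(\<one> \<ominus> a \<otimes> x) \<otimes> ?g \<in> ?J" using jS by simp
    have u: "\<one> \<ominus> a \<otimes> x \<in> Units R" by (rule unit[OF a(3)])
    have "inv (\<one> \<ominus> a \<otimes> x) \<otimes> ((\<one> \<ominus> a \<otimes> x) \<otimes> ?g) \<in> ?J"
      using J.I_l_closed[OF uJ] u by blast
    also have "inv (\<one> \<ominus> a \<otimes> x) \<otimes> ((\<one> \<ominus> a \<otimes> x) \<otimes> ?g) = ?g"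
      using u fsR by (simp add: m_assoc[symmetric] Units_closed)
    finally have "fs (Suc n) \<in> ?J" .
    moreover have step: "fs k \<in> ?J" if "fs (Suc k) \<in> ?J" for k
    proof -
      have "jx (fs k) \<oplus> x \<otimes> fs (Suc k) \<in> ?J"
        by (rule additive_subgroup.a_closed[OF J.is_additive_subgroup nx(2)[OF fsN] J.I_l_closed[OF that x]])
      then show ?thesis unfolding fs_Suc[of k, symmetric] .
    qed
    ultimately have "fs 0 \<in> ?J" by (intro inc_induct[of 0 "Suc n" "\<lambda>k. fs k \<in> ?J"]) simp_all
    then show False using fJ by (simp add: fs_def)
  qed
  \<comment> \<open>Modulo the larger ideal both \<open>p\<close> and \<open>x\<close> kill
    \<open>b\<close>, so a prime above its annihilator contains both; regularity keeps
    \<open>x\<close> out of \<open>p\<close>.\<close>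
  then obtain b where b: "b \<in> N" "b \<notin> Idl (insert x A)" by blast
  obtain q where q: "q \<in> associated_primes R (Idl (insert x A))"
    "{r \<in> carrier R. r \<otimes> b \<in> Idl (insert x A)} \<subseteq> q"
    using associated_prime_above_annihilator[OF J' NR[OF b(1)] b(2)] by blast
  have JJ': "?J \<subseteq> Idl (insert x A)"
    using genideal_self[of "insert x A"] A x by (intro genideal_minimal J') blast
  have "p \<subseteq> q"
  proof
    fix r assume r: "r \<in> p"
    then have "r \<otimes> b \<in> ?J" using b by (simp add: N_def)
    then show "r \<in> q" using q(2) JJ' pR[OF r] by blast
  qed
  moreover have "x \<in> q"
  proof -
    have "x \<in> Idl (insert x A)" using genideal_self[of "insert x A"] A x by blast
    then have "x \<otimes> b \<in> Idl (insert x A)" by (rule J'.I_r_closed[OF _ NR[OF b(1)]])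
    then show ?thesis using q(2) x by blast
  qed
  moreover have "x \<notin> p" using f reg[OF f(1)] fJ by blast
  ultimately show ?thesis using q(1) by blast
qed

text \<open>The hypothesis \<open>unit\<close> places the sequence in the Jacobson radical, which is
  all that is used of a local ring. Every prime of the chain is associated to the ideal of the
  elements treated so far; this invariant allows \<open>associated_prime_step\<close> to be applied
  again.\<close>

theorem regular_sequence_prime_chain:
  assumes reg: "regular_sequence R xs"
    and unit: "\<And>x a. x \<in> set xs \<Longrightarrow> a \<in> carrier R \<Longrightarrow> \<one> \<ominus> a \<otimes> x \<in> Units R"
    and p: "p \<in> associated_primes R {\<zero>}"
  shows "\<exists>P. prime_chain R P (length xs) \<and> P 0 = p"
proof -
  have "\<exists>P. prime_chain R P k \<and> P 0 = p \<and> P k \<in> associated_primes R (Idl (set (take k xs)))"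
    if "k \<le> length xs" for k
    using that
  proof (induction k)
    case 0
    have "Idl {} = {\<zero>}"
      using genideal_minimal[OF zeroideal, of "{}"]
        additive_subgroup.zero_closed[OF ideal.axioms(1)[OF genideal_ideal[of "{}"]]] by blast
    then show ?case using p by (intro exI[of _ "\<lambda>_. p"]) (auto simp: prime_chain_def associated_primes_def)
  next
    case (Suc k)
    then obtain P where P: "prime_chain R P k" "P 0 = p" "P k \<in> associated_primes R (Idl (set (take k xs)))"
      by auto
    have k: "k < length xs" using Suc by simp
    have xs: "set xs \<subseteq> carrier R" using reg by (simp add: regular_sequence_def)
    have eq: "set (take (Suc k) xs) = insert (xs ! k) (set (take k xs))"
      using k by (simp add: take_Suc_conv_app_nth)
    have "\<exists>q\<in>associated_primes R (Idl (insert (xs ! k) (set (take k xs)))). P k \<subset> q"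
    proof (rule associated_prime_step)
      show "set (take k xs) \<subseteq> carrier R" using xs set_take_subset by fastforce
      show "xs ! k \<in> carrier R" using xs k by auto
      show "b \<in> Idl (set (take k xs))" if "b \<in> carrier R" "xs ! k \<otimes> b \<in> Idl (set (take k xs))" for b
        using reg k that unfolding regular_sequence_def by blast
      show "\<one> \<ominus> a \<otimes> xs ! k \<in> Units R" if "a \<in> carrier R" for a using unit that k by simp
    qed (rule P(3))
    then obtain q where q: "q \<in> associated_primes R (Idl (set (take (Suc k) xs)))" "P k \<subset> q"
      unfolding eq by blast
    define P' where "P' = P(Suc k := q)"
    have "prime_chain R P' (Suc k)"
      unfolding prime_chain_def
    proof (intro conjI allI impI)
      fix i assume "i \<le> Suc k"
      then show "primeideal (P' i) R"
        using P(1) q(1) by (cases "i = Suc k") (auto simp: P'_def prime_chain_def associated_primes_def)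
    next
      fix i assume "i < Suc k"
      then show "P' i \<subset> P' (Suc i)"
        using P(1) q(2) by (cases "i = k") (simp_all add: P'_def prime_chain_def)
    qed
    moreover have "P' 0 = p" "P' (Suc k) = q" using P(2) by (simp_all add: P'_def)
    ultimately show ?case using q(1) by blast
  qed
  from this[of "length xs"] show ?thesis by auto
qed

end

subsection \<open>Localization at a prime\<close>

locale prime_localization = cring B + primeideal P B for B (structure) and P
begin

abbreviation S where "S \<equiv> carrier B - P"

lemma one_notin_P [simp]: "\<one> \<notin> P"
  using I_notcarr one_imp_carrier by auto

lemma mult_notin_P [simp]:
  "s \<in> carrier B \<Longrightarrow> t \<in> carrier B \<Longrightarrow> s \<notin> P \<Longrightarrow> t \<notin> P \<Longrightarrow> s \<otimes> t \<notin> P"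
  using I_prime by auto

lemma zero_B: "\<zero> \<in> carrier B"
  by simp

lemma one_S: "\<one> \<in> S"
  by simp

lemma mult_S: "s \<in> S \<Longrightarrow> t \<in> S \<Longrightarrow> s \<otimes> t \<in> S"
  by simp

lemma S_carrier: "s \<in> S \<Longrightarrow> s \<in> carrier B"
  by simp

lemma loc_frac_mem:
  "(b, t) \<in> loc_frac B P a s \<longleftrightarrow>
     b \<in> carrier B \<and> t \<in> S \<and> (\<exists>u\<in>S. u \<otimes> (a \<otimes> t) = u \<otimes> (b \<otimes> s))"
  by (simp add: loc_frac_def)

lemma loc_frac_self: "a \<in> carrier B \<Longrightarrow> s \<in> S \<Longrightarrow> (a, s) \<in> loc_frac B P a s"
  unfolding loc_frac_mem using one_S by blast

text \<open>The witness contains the middle denominator \<open>t\<close> besides \<open>u\<close>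
  and \<open>v\<close>, because \<open>t\<close> may be a zero divisor and cannot be
  cancelled.\<close>

lemma loc_rel_trans:
  assumes "a \<in> carrier B" "b \<in> carrier B" "c \<in> carrier B" "s \<in> S" "t \<in> S" "w \<in> S"
    and "\<exists>u\<in>S. u \<otimes> (a \<otimes> t) = u \<otimes> (b \<otimes> s)" "\<exists>u\<in>S. u \<otimes> (b \<otimes> w) = u \<otimes> (c \<otimes> t)"
  shows "\<exists>u\<in>S. u \<otimes> (a \<otimes> w) = u \<otimes> (c \<otimes> s)"
proof -
  obtain u v where uv: "u \<in> S" "v \<in> S" "u \<otimes> (a \<otimes> t) = u \<otimes> (b \<otimes> s)" "v \<otimes> (b \<otimes> w) = v \<otimes> (c \<otimes> t)"
    using assms by blast
  note car = assms(1-3) S_carrier[OF assms(4)] S_carrier[OF assms(5)] S_carrier[OF assms(6)]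
    S_carrier[OF uv(1)] S_carrier[OF uv(2)]
  have "(u \<otimes> v \<otimes> t) \<otimes> (a \<otimes> w) = (v \<otimes> w) \<otimes> (u \<otimes> (a \<otimes> t))" using car by (simp add: m_ac)
  also have "\<dots> = (u \<otimes> s) \<otimes> (v \<otimes> (b \<otimes> w))" unfolding uv(3) using car by (simp add: m_ac)
  also have "\<dots> = (u \<otimes> v \<otimes> t) \<otimes> (c \<otimes> s)" unfolding uv(4) using car by (simp add: m_ac)
  finally show ?thesis using uv assms by (intro bexI[of _ "u \<otimes> v \<otimes> t"]) (simp_all only: mult_S)
qed

lemma loc_frac_eq_iff:
  assumes "a \<in> carrier B" "s \<in> S" "b \<in> carrier B" "t \<in> S"
  shows "loc_frac B P a s = loc_frac B P b t \<longleftrightarrow> (\<exists>u\<in>S. u \<otimes> (a \<otimes> t) = u \<otimes> (b \<otimes> s))" (is "_ \<longleftrightarrow> ?r")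
proof
  assume "loc_frac B P a s = loc_frac B P b t"
  then have "(b, t) \<in> loc_frac B P a s" using loc_frac_self assms by simp
  then show ?r unfolding loc_frac_mem by blast
next
  assume r: ?r
  then have r': "\<exists>u\<in>S. u \<otimes> (b \<otimes> s) = u \<otimes> (a \<otimes> t)" by metis
  have "(c, w) \<in> loc_frac B P a s \<longleftrightarrow> (c, w) \<in> loc_frac B P b t" for c w
  proof (cases "c \<in> carrier B \<and> w \<in> S")
    case True
    then show ?thesis
      unfolding loc_frac_mem
      using loc_rel_trans[of b a c t s w] loc_rel_trans[of a b c s t w] r r' assms by blast
  qed (auto simp: loc_frac_mem)
  then show "loc_frac B P a s = loc_frac B P b t" by auto
qed

lemma loc_frac_eqI:
  "a \<in> carrier B \<Longrightarrow> s \<in> S \<Longrightarrow> b \<in> carrier B \<Longrightarrow> t \<in> S \<Longrightarrow> a \<otimes> t = b \<otimes> s \<Longrightarrow>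
     loc_frac B P a s = loc_frac B P b t"
  using loc_frac_eq_iff one_S by metis

abbreviation A where "A \<equiv> localization B P"

lemma carrier_A: "carrier A = {loc_frac B P a s | a s. a \<in> carrier B \<and> s \<in> S}"
  by (simp add: localization_def)

lemma loc_frac_closed [simp]: "a \<in> carrier B \<Longrightarrow> s \<in> S \<Longrightarrow> loc_frac B P a s \<in> carrier A"
  unfolding carrier_A by blast

lemma loc_fracE:
  assumes "x \<in> carrier A"
  obtains a s where "a \<in> carrier B" "s \<in> S" "x = loc_frac B P a s"
  using assms unfolding carrier_A by blast

lemma one_A: "\<one>\<^bsub>A\<^esub> = loc_frac B P \<one> \<one>" and zero_A: "\<zero>\<^bsub>A\<^esub> = loc_frac B P \<zero> \<one>"
  by (simp_all add: localization_def)

text \<open>The operations of \<open>localization\<close> are unions over all representatives; such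
  a union collapses as soon as every choice yields the same class.\<close>

lemma union_const:
  assumes "(a, s) \<in> X" "(b, t) \<in> Y"
    and "\<And>a' s' b' t'. (a', s') \<in> X \<Longrightarrow> (b', t') \<in> Y \<Longrightarrow> f a' s' b' t' = Z"
  shows "(\<Union>(a, s)\<in>X. \<Union>(b, t)\<in>Y. f a s b t) = Z"
  using assms by fast

lemma mult_A:
  assumes "a \<in> carrier B" "s \<in> S" "b \<in> carrier B" "t \<in> S"
  shows "loc_frac B P a s \<otimes>\<^bsub>A\<^esub> loc_frac B P b t = loc_frac B P (a \<otimes> b) (s \<otimes> t)"
proof -
  have "loc_frac B P (a' \<otimes> b') (s' \<otimes> t') = loc_frac B P (a \<otimes> b) (s \<otimes> t)"
    if "(a', s') \<in> loc_frac B P a s" "(b', t') \<in> loc_frac B P b t" for a' s' b' t'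
  proof -
    note that' = that[unfolded loc_frac_mem]
    have m: "a' \<in> carrier B" "s' \<in> S" "b' \<in> carrier B" "t' \<in> S" using that' by simp_all
    obtain u where u: "u \<in> S" "u \<otimes> (a \<otimes> s') = u \<otimes> (a' \<otimes> s)"
      by (rule bexE[OF conjunct2[OF conjunct2[OF that'(1)]]])
    obtain v where v: "v \<in> S" "v \<otimes> (b \<otimes> t') = v \<otimes> (b' \<otimes> t)"
      by (rule bexE[OF conjunct2[OF conjunct2[OF that'(2)]]])
    note uv = u(1) v(1) u(2) v(2)
    note car = assms(1,3) m(1,3) S_carrier[OF assms(2)] S_carrier[OF assms(4)] S_carrier[OF m(2)]
      S_carrier[OF m(4)] S_carrier[OF uv(1)] S_carrier[OF uv(2)]
    have "(u \<otimes> v) \<otimes> ((a' \<otimes> b') \<otimes> (s \<otimes> t)) = (u \<otimes> (a' \<otimes> s)) \<otimes> (v \<otimes> (b' \<otimes> t))"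
      using car by (simp add: m_ac)
    also have "\<dots> = (u \<otimes> v) \<otimes> ((a \<otimes> b) \<otimes> (s' \<otimes> t'))"
      unfolding uv(3,4)[symmetric] using car by (simp add: m_ac)
    finally show ?thesis
      using loc_frac_eq_iff[of "a' \<otimes> b'" "s' \<otimes> t'" "a \<otimes> b" "s \<otimes> t"] mult_S uv(1,2) m assms
      by (meson m_closed)
  qed
  note * = this
  have "loc_frac B P a s \<otimes>\<^bsub>A\<^esub> loc_frac B P b t =
      (\<Union>(a, s)\<in>loc_frac B P a s. \<Union>(b, t)\<in>loc_frac B P b t. loc_frac B P (a \<otimes> b) (s \<otimes> t))"
    by (simp only: localization_def monoid.simps ring.simps)
  also have "\<dots> = loc_frac B P (a \<otimes> b) (s \<otimes> t)"
    by (rule union_const[OF loc_frac_self[OF assms(1,2)] loc_frac_self[OF assms(3,4)] *])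
  finally show ?thesis .
qed

lemma add_A:
  assumes "a \<in> carrier B" "s \<in> S" "b \<in> carrier B" "t \<in> S"
  shows "loc_frac B P a s \<oplus>\<^bsub>A\<^esub> loc_frac B P b t = loc_frac B P (a \<otimes> t \<oplus> b \<otimes> s) (s \<otimes> t)"
proof -
  have "loc_frac B P (a' \<otimes> t' \<oplus> b' \<otimes> s') (s' \<otimes> t') = loc_frac B P (a \<otimes> t \<oplus> b \<otimes> s) (s \<otimes> t)"
    if "(a', s') \<in> loc_frac B P a s" "(b', t') \<in> loc_frac B P b t" for a' s' b' t'
  proof -
    note that' = that[unfolded loc_frac_mem]
    have m: "a' \<in> carrier B" "s' \<in> S" "b' \<in> carrier B" "t' \<in> S" using that' by simp_all
    obtain u where u: "u \<in> S" "u \<otimes> (a \<otimes> s') = u \<otimes> (a' \<otimes> s)"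
      by (rule bexE[OF conjunct2[OF conjunct2[OF that'(1)]]])
    obtain v where v: "v \<in> S" "v \<otimes> (b \<otimes> t') = v \<otimes> (b' \<otimes> t)"
      by (rule bexE[OF conjunct2[OF conjunct2[OF that'(2)]]])
    note uv = u(1) v(1) u(2) v(2)
    note car = assms(1,3) m(1,3) S_carrier[OF assms(2)] S_carrier[OF assms(4)] S_carrier[OF m(2)]
      S_carrier[OF m(4)] S_carrier[OF uv(1)] S_carrier[OF uv(2)]
    have "(u \<otimes> v) \<otimes> ((a' \<otimes> t' \<oplus> b' \<otimes> s') \<otimes> (s \<otimes> t)) =
      (v \<otimes> t \<otimes> t') \<otimes> (u \<otimes> (a' \<otimes> s)) \<oplus> (u \<otimes> s \<otimes> s') \<otimes> (v \<otimes> (b' \<otimes> t))"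
      using car by (simp add: m_ac l_distr r_distr)
    also have "\<dots> = (u \<otimes> v) \<otimes> ((a \<otimes> t \<oplus> b \<otimes> s) \<otimes> (s' \<otimes> t'))"
      unfolding uv(3,4)[symmetric] using car by (simp add: m_ac l_distr r_distr)
    finally have eq: "(u \<otimes> v) \<otimes> ((a' \<otimes> t' \<oplus> b' \<otimes> s') \<otimes> (s \<otimes> t)) =
      (u \<otimes> v) \<otimes> ((a \<otimes> t \<oplus> b \<otimes> s) \<otimes> (s' \<otimes> t'))" .
    have n: "a' \<otimes> t' \<oplus> b' \<otimes> s' \<in> carrier B" "a \<otimes> t \<oplus> b \<otimes> s \<in> carrier B" using car by simp_all
    show ?thesis
      unfolding loc_frac_eq_iff[OF n(1) mult_S[OF m(2,4)] n(2) mult_S[OF assms(2,4)]]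
      using eq mult_S[OF uv(1,2)] by (rule bexI)
  qed
  note * = this
  have "loc_frac B P a s \<oplus>\<^bsub>A\<^esub> loc_frac B P b t =
      (\<Union>(a, s)\<in>loc_frac B P a s. \<Union>(b, t)\<in>loc_frac B P b t. loc_frac B P (a \<otimes> t \<oplus> b \<otimes> s) (s \<otimes> t))"
    by (simp only: localization_def monoid.simps ring.simps)
  also have "\<dots> = loc_frac B P (a \<otimes> t \<oplus> b \<otimes> s) (s \<otimes> t)"
    by (rule union_const[OF loc_frac_self[OF assms(1,2)] loc_frac_self[OF assms(3,4)] *])
  finally show ?thesis .
qed

lemma cring_A: "cring A"
proof (rule cringI)
  show "abelian_group A"
  proof (rule abelian_groupI)
    fix x assume x: "x \<in> carrier A"
    then obtain a s where x': "a \<in> carrier B" "s \<in> S" "x = loc_frac B P a s" by (rule loc_fracE)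
    note sc = S_carrier[OF x'(2)]
    show "\<zero>\<^bsub>A\<^esub> \<oplus>\<^bsub>A\<^esub> x = x"
      unfolding x'(3) zero_A add_A[OF zero_B one_S x'(1,2)] using x'(1) sc by simp
    have "loc_frac B P (\<ominus> a) s \<oplus>\<^bsub>A\<^esub> x = loc_frac B P (\<ominus> a \<otimes> s \<oplus> a \<otimes> s) (s \<otimes> s)"
      unfolding x'(3) by (rule add_A) (use x' in simp_all)
    also have "\<dots> = loc_frac B P \<zero> \<one>"
    proof (rule loc_frac_eqI)
      show "(\<ominus> a \<otimes> s \<oplus> a \<otimes> s) \<otimes> \<one> = \<zero> \<otimes> (s \<otimes> s)" using x'(1) sc by (simp add: l_minus l_neg)
    qed (use x' sc mult_S in auto)
    finally show "\<exists>y\<in>carrier A. y \<oplus>\<^bsub>A\<^esub> x = \<zero>\<^bsub>A\<^esub>"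
      using x' by (intro bexI[of _ "loc_frac B P (\<ominus> a) s"]) (simp_all add: zero_A)
    fix y assume y: "y \<in> carrier A"
    then obtain b t where y': "b \<in> carrier B" "t \<in> S" "y = loc_frac B P b t" by (rule loc_fracE)
    note tc = S_carrier[OF y'(2)]
    show "x \<oplus>\<^bsub>A\<^esub> y \<in> carrier A"
      unfolding x'(3) y'(3) add_A[OF x'(1,2) y'(1,2)]
      by (rule loc_frac_closed) (use x' y' sc tc mult_S in auto)
    show "x \<oplus>\<^bsub>A\<^esub> y = y \<oplus>\<^bsub>A\<^esub> x"
      unfolding x'(3) y'(3) add_A[OF x'(1,2) y'(1,2)] add_A[OF y'(1,2) x'(1,2)]
      using x'(1) y'(1) sc tc by (simp add: a_comm m_comm)
    fix z assume z: "z \<in> carrier A"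
    then obtain c w where z': "c \<in> carrier B" "w \<in> S" "z = loc_frac B P c w" by (rule loc_fracE)
    note wc = S_carrier[OF z'(2)]
    have st: "s \<otimes> t \<in> S" "t \<otimes> w \<in> S" using x' y' z' mult_S by auto
    have n: "a \<otimes> t \<oplus> b \<otimes> s \<in> carrier B" "b \<otimes> w \<oplus> c \<otimes> t \<in> carrier B"
      using x' y' z' sc tc wc by simp_all
    show "x \<oplus>\<^bsub>A\<^esub> y \<oplus>\<^bsub>A\<^esub> z = x \<oplus>\<^bsub>A\<^esub> (y \<oplus>\<^bsub>A\<^esub> z)"
      unfolding x'(3) y'(3) z'(3) add_A[OF x'(1,2) y'(1,2)] add_A[OF y'(1,2) z'(1,2)]
        add_A[OF n(1) st(1) z'(1,2)] add_A[OF x'(1,2) n(2) st(2)]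
      using x'(1) y'(1) z'(1) sc tc wc by (simp add: l_distr r_distr m_ac a_ac)
  qed (simp add: zero_A)
  show "Group.comm_monoid A"
  proof (rule Group.comm_monoidI)
    show "\<one>\<^bsub>A\<^esub> \<in> carrier A" unfolding one_A by (rule loc_frac_closed) simp_all
    fix x assume x: "x \<in> carrier A"
    then obtain a s where x': "a \<in> carrier B" "s \<in> S" "x = loc_frac B P a s" by (rule loc_fracE)
    note sc = S_carrier[OF x'(2)]
    show "\<one>\<^bsub>A\<^esub> \<otimes>\<^bsub>A\<^esub> x = x"
      unfolding x'(3) one_A mult_A[OF one_closed one_S x'(1,2)] using x'(1) sc by simp
    fix y assume y: "y \<in> carrier A"
    then obtain b t where y': "b \<in> carrier B" "t \<in> S" "y = loc_frac B P b t" by (rule loc_fracE)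
    note tc = S_carrier[OF y'(2)]
    show "x \<otimes>\<^bsub>A\<^esub> y \<in> carrier A"
      unfolding x'(3) y'(3) mult_A[OF x'(1,2) y'(1,2)]
      by (rule loc_frac_closed) (use x' y' mult_S in auto)
    show "x \<otimes>\<^bsub>A\<^esub> y = y \<otimes>\<^bsub>A\<^esub> x"
      unfolding x'(3) y'(3) mult_A[OF x'(1,2) y'(1,2)] mult_A[OF y'(1,2) x'(1,2)]
      using x'(1) y'(1) sc tc by (simp add: m_comm)
    fix z assume z: "z \<in> carrier A"
    then obtain c w where z': "c \<in> carrier B" "w \<in> S" "z = loc_frac B P c w" by (rule loc_fracE)
    note wc = S_carrier[OF z'(2)]
    have st: "s \<otimes> t \<in> S" "t \<otimes> w \<in> S" using x' y' z' mult_S by auto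
    have n: "a \<otimes> b \<in> carrier B" "b \<otimes> c \<in> carrier B" using x' y' z' by simp_all
    show "x \<otimes>\<^bsub>A\<^esub> y \<otimes>\<^bsub>A\<^esub> z = x \<otimes>\<^bsub>A\<^esub> (y \<otimes>\<^bsub>A\<^esub> z)"
      unfolding x'(3) y'(3) z'(3) mult_A[OF x'(1,2) y'(1,2)] mult_A[OF y'(1,2) z'(1,2)]
        mult_A[OF n(1) st(1) z'(1,2)] mult_A[OF x'(1,2) n(2) st(2)]
      using x'(1) y'(1) z'(1) sc tc wc by (simp add: m_assoc)
  qed
  fix x y z assume "x \<in> carrier A" "y \<in> carrier A" "z \<in> carrier A"
  obtain a s where x': "a \<in> carrier B" "s \<in> S" "x = loc_frac B P a s" using \<open>x \<in> carrier A\<close> by (rule loc_fracE)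
  obtain b t where y': "b \<in> carrier B" "t \<in> S" "y = loc_frac B P b t" using \<open>y \<in> carrier A\<close> by (rule loc_fracE)
  obtain c w where z': "c \<in> carrier B" "w \<in> S" "z = loc_frac B P c w" using \<open>z \<in> carrier A\<close> by (rule loc_fracE)
  note sc = S_carrier[OF x'(2)] S_carrier[OF y'(2)] S_carrier[OF z'(2)]
  have st: "s \<otimes> t \<in> S" "s \<otimes> w \<in> S" "t \<otimes> w \<in> S" using x' y' z' mult_S by auto
  have n: "a \<otimes> t \<oplus> b \<otimes> s \<in> carrier B" "a \<otimes> c \<in> carrier B" "b \<otimes> c \<in> carrier B"
    using x' y' z' sc by simp_all
  show "(x \<oplus>\<^bsub>A\<^esub> y) \<otimes>\<^bsub>A\<^esub> z = x \<otimes>\<^bsub>A\<^esub> z \<oplus>\<^bsub>A\<^esub> y \<otimes>\<^bsub>A\<^esub> z"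
    unfolding x'(3) y'(3) z'(3) add_A[OF x'(1,2) y'(1,2)] mult_A[OF n(1) st(1) z'(1,2)]
      mult_A[OF x'(1,2) z'(1,2)] mult_A[OF y'(1,2) z'(1,2)] add_A[OF n(2) st(2) n(3) st(3)]
  proof (rule loc_frac_eqI)
    show "(a \<otimes> t \<oplus> b \<otimes> s) \<otimes> c \<otimes> (s \<otimes> w \<otimes> (t \<otimes> w)) =
        (a \<otimes> c \<otimes> (t \<otimes> w) \<oplus> b \<otimes> c \<otimes> (s \<otimes> w)) \<otimes> (s \<otimes> t \<otimes> w)"
      using x'(1) y'(1) z'(1) sc by (simp add: l_distr r_distr m_ac)
  qed (use x' y' z' sc st n mult_S in auto)
qed

lemma hom_A: "(\<lambda>b. loc_frac B P b \<one>) \<in> ring_hom B A"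
proof (rule ring_hom_memI)
  fix a b assume ab: "a \<in> carrier B" "b \<in> carrier B"
  show "loc_frac B P (a \<otimes> b) \<one> = loc_frac B P a \<one> \<otimes>\<^bsub>A\<^esub> loc_frac B P b \<one>"
    using ab mult_A[OF ab(1) one_S ab(2) one_S] by simp
  show "loc_frac B P (a \<oplus> b) \<one> = loc_frac B P a \<one> \<oplus>\<^bsub>A\<^esub> loc_frac B P b \<one>"
    using ab add_A[OF ab(1) one_S ab(2) one_S] by simp
qed (simp_all add: one_A)

lemma loc_frac_mult_denominator:
  "a \<in> carrier B \<Longrightarrow> s \<in> S \<Longrightarrow> loc_frac B P s \<one> \<otimes>\<^bsub>A\<^esub> loc_frac B P a s = loc_frac B P a \<one>"
proof -
  assume a: "a \<in> carrier B" and s: "s \<in> S"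
  have "loc_frac B P (s \<otimes> a) (\<one> \<otimes> s) = loc_frac B P a \<one>"
    by (rule loc_frac_eqI) (use a s in \<open>simp_all add: m_comm\<close>)
  then show ?thesis using mult_A[OF S_carrier[OF s] one_S a s] by simp
qed

lemma loc_frac_unit:
  assumes s: "s \<in> S"
  shows "loc_frac B P s \<one> \<in> Units A"
proof -
  interpret A: cring A by (rule cring_A)
  have "loc_frac B P s \<one> \<otimes>\<^bsub>A\<^esub> loc_frac B P \<one> s = \<one>\<^bsub>A\<^esub>"
    using loc_frac_mult_denominator[OF one_closed s] by (simp add: one_A)
  moreover have "loc_frac B P s \<one> \<in> carrier A" "loc_frac B P \<one> s \<in> carrier A"
    using loc_frac_closed[OF S_carrier[OF s] one_S] loc_frac_closed[OF one_closed s] by simp_all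
  moreover from calculation have "loc_frac B P \<one> s \<otimes>\<^bsub>A\<^esub> loc_frac B P s \<one> = \<one>\<^bsub>A\<^esub>"
    using A.m_comm by metis
  ultimately show ?thesis unfolding Units_def by blast
qed

lemma loc_frac_eq_zero_iff:
  "a \<in> carrier B \<Longrightarrow> loc_frac B P a \<one> = \<zero>\<^bsub>A\<^esub> \<longleftrightarrow> (\<exists>u\<in>S. u \<otimes> a = \<zero>)"
  unfolding zero_A using loc_frac_eq_iff[OF _ one_S zero_B one_S, of a] by simp

end

section \<open>Ideals and primes along a ring homomorphism\<close>

lemma ideal_subset: "ideal J R \<Longrightarrow> a \<in> J \<Longrightarrow> a \<in> carrier R"
  using additive_subgroup.a_subset[OF ideal.axioms(1)] by blast

lemma ideal_zero: "ideal J R \<Longrightarrow> \<zero>\<^bsub>R\<^esub> \<in> J"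
  by (rule additive_subgroup.zero_closed[OF ideal.axioms(1)])

lemma ideal_add: "ideal J R \<Longrightarrow> a \<in> J \<Longrightarrow> b \<in> J \<Longrightarrow> a \<oplus>\<^bsub>R\<^esub> b \<in> J"
  by (rule additive_subgroup.a_closed[OF ideal.axioms(1)])

context cring
begin

lemma ideal_introI:
  assumes "J \<subseteq> carrier R" "\<zero> \<in> J" "\<And>a b. a \<in> J \<Longrightarrow> b \<in> J \<Longrightarrow> a \<oplus> b \<in> J"
    and "\<And>r a. r \<in> carrier R \<Longrightarrow> a \<in> J \<Longrightarrow> r \<otimes> a \<in> J"
  shows "ideal J R"
proof (rule idealI)
  show "subgroup J (add_monoid R)"
  proof (rule subgroup.intro)
    fix a assume a: "a \<in> J"
    then have aR: "a \<in> carrier R" using assms(1) by blast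
    have "\<ominus> \<one> \<otimes> a \<in> J" by (rule assms(4)) (use a in simp_all)
    then show "inv\<^bsub>add_monoid R\<^esub> a \<in> J" using aR by (simp add: a_inv_def[symmetric] l_minus)
  qed (use assms in simp_all)
  fix a x assume a: "a \<in> J" and x: "x \<in> carrier R"
  show xa: "x \<otimes> a \<in> J" by (rule assms(4)[OF x a])
  have "a \<in> carrier R" using a assms(1) by blast
  then show "a \<otimes> x \<in> J" using xa x by (simp add: m_comm)
qed (rule ring_axioms)

lemma prime_one: "primeideal Q R \<Longrightarrow> \<one> \<notin> Q"
  using primeideal.I_notcarr ideal.one_imp_carrier primeideal.axioms(1) by metis

lemma prime_mult:
  "primeideal Q R \<Longrightarrow> a \<in> carrier R \<Longrightarrow> b \<in> carrier R \<Longrightarrow> a \<otimes> b \<in> Q \<longleftrightarrow> a \<in> Q \<or> b \<in> Q"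
  using primeideal.I_prime ideal.I_l_closed ideal.I_r_closed primeideal.axioms(1) by metis

end

context ring_hom_cring
begin

lemma ideal_vimage_h: "ideal J S \<Longrightarrow> ideal {a \<in> carrier R. h a \<in> J} R"
  by (rule R.ideal_introI) (auto simp: ideal_zero ideal_add ideal.I_l_closed)

lemma prime_vimage_h:
  assumes Q: "primeideal Q S"
  shows "primeideal {a \<in> carrier R. h a \<in> Q} R"
proof (rule primeidealI)
  show "ideal {a \<in> carrier R. h a \<in> Q} R" by (rule ideal_vimage_h[OF primeideal.axioms(1)[OF Q]])
  show "cring R" by (rule R.cring_axioms)
  have "\<one> \<notin> {a \<in> carrier R. h a \<in> Q}" using S.prime_one[OF Q] by simp
  then show "carrier R \<noteq> {a \<in> carrier R. h a \<in> Q}" using R.one_closed by blast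
  fix a b assume "a \<in> carrier R" "b \<in> carrier R" "a \<otimes> b \<in> {a \<in> carrier R. h a \<in> Q}"
  then show "a \<in> {a \<in> carrier R. h a \<in> Q} \<or> b \<in> {a \<in> carrier R. h a \<in> Q}"
    using S.prime_mult[OF Q, of "h a" "h b"] by simp
qed

end

text \<open>The localization of \<open>R / I\<close> at the image of \<open>M\<close>, characterized
  by its homomorphism from \<open>R\<close>: elements outside \<open>M\<close> become units, every
  element is a fraction, and the kernel is the part of \<open>R\<close> carried into
  \<open>I\<close> by some element outside \<open>M\<close>. Primes can then be moved between
  \<open>R\<close> and \<open>A\<close> without cosets and pairs.\<close>

locale localized_quotient = ring_hom_cring R A h for R (structure) and A and h +
  fixes I M
  assumes ideal_I: "ideal I R" and prime_M: "primeideal M R" and I_sub_M: "I \<subseteq> M"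
    and unit: "s \<in> carrier R - M \<Longrightarrow> h s \<in> Units A"
    and frac: "b \<in> carrier A \<Longrightarrow> \<exists>a\<in>carrier R. \<exists>s\<in>carrier R - M. h s \<otimes>\<^bsub>A\<^esub> b = h a"
    and kernel: "a \<in> carrier R \<Longrightarrow> h a = \<zero>\<^bsub>A\<^esub> \<longleftrightarrow> (\<exists>s\<in>carrier R - M. s \<otimes> a \<in> I)"
begin

text \<open>\<open>b\<close> is the fraction \<open>h a / h s\<close>; a relation, because numerator
  and denominator are not determined by \<open>b\<close>.\<close>

definition fr where
  "fr s a b \<longleftrightarrow> s \<in> carrier R \<and> s \<notin> M \<and> a \<in> carrier R \<and> b \<in> carrier A \<and> h s \<otimes>\<^bsub>A\<^esub> b = h a"

lemma fr_exists: "b \<in> carrier A \<Longrightarrow> \<exists>s a. fr s a b"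
  using frac[of b] unfolding fr_def by auto

lemma denom_mult: "s \<in> carrier R \<Longrightarrow> t \<in> carrier R \<Longrightarrow> s \<notin> M \<Longrightarrow> t \<notin> M \<Longrightarrow> s \<otimes> t \<notin> M"
  using R.prime_mult[OF prime_M] by simp

lemma fr_h: "a \<in> carrier R \<Longrightarrow> fr \<one> a (h a)"
  unfolding fr_def using R.prime_one[OF prime_M] by simp

lemma fr_add:
  assumes "fr s a b" "fr t c d"
  shows "fr (s \<otimes> t) (t \<otimes> a \<oplus> s \<otimes> c) (b \<oplus>\<^bsub>A\<^esub> d)"
proof -
  note f = assms[unfolded fr_def]
  have cl: "h s \<in> carrier A" "h t \<in> carrier A" "b \<in> carrier A" "d \<in> carrier A"
    and hst: "h (s \<otimes> t) = h s \<otimes>\<^bsub>A\<^esub> h t" using f by simp_all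
  have "h (s \<otimes> t) \<otimes>\<^bsub>A\<^esub> (b \<oplus>\<^bsub>A\<^esub> d) = h t \<otimes>\<^bsub>A\<^esub> (h s \<otimes>\<^bsub>A\<^esub> b) \<oplus>\<^bsub>A\<^esub> h s \<otimes>\<^bsub>A\<^esub> (h t \<otimes>\<^bsub>A\<^esub> d)"
    unfolding hst using cl by (simp add: S.r_distr S.m_ac)
  also have "\<dots> = h (t \<otimes> a \<oplus> s \<otimes> c)" using f by simp
  finally show ?thesis unfolding fr_def using f denom_mult by simp
qed

lemma fr_mult:
  assumes "fr s a b" "fr t c d"
  shows "fr (s \<otimes> t) (a \<otimes> c) (b \<otimes>\<^bsub>A\<^esub> d)"
proof -
  note f = assms[unfolded fr_def]
  have cl: "h s \<in> carrier A" "h t \<in> carrier A" "b \<in> carrier A" "d \<in> carrier A"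
    and hst: "h (s \<otimes> t) = h s \<otimes>\<^bsub>A\<^esub> h t" using f by simp_all
  have "h (s \<otimes> t) \<otimes>\<^bsub>A\<^esub> (b \<otimes>\<^bsub>A\<^esub> d) = (h s \<otimes>\<^bsub>A\<^esub> b) \<otimes>\<^bsub>A\<^esub> (h t \<otimes>\<^bsub>A\<^esub> d)"
    unfolding hst using cl by (simp add: S.m_ac)
  also have "\<dots> = h (a \<otimes> c)" using f by simp
  finally show ?thesis unfolding fr_def using f denom_mult by simp
qed

lemma fr_scale:
  assumes "fr s a b" "u \<in> carrier R" "u \<notin> M"
  shows "fr (u \<otimes> s) (u \<otimes> a) b"
proof -
  note f = assms(1)[unfolded fr_def]
  have "h (u \<otimes> s) \<otimes>\<^bsub>A\<^esub> b = h u \<otimes>\<^bsub>A\<^esub> (h s \<otimes>\<^bsub>A\<^esub> b)"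
    using f assms(2) by (simp add: S.m_assoc)
  also have "\<dots> = h (u \<otimes> a)" using f assms(2) by simp
  finally show ?thesis unfolding fr_def using f assms denom_mult by simp
qed

lemma fr_unique:
  assumes "fr s a b" "fr t c b"
  shows "\<exists>u\<in>carrier R - M. u \<otimes> (t \<otimes> a \<ominus> s \<otimes> c) \<in> I"
proof -
  note f = assms[unfolded fr_def]
  have "h (t \<otimes> a) = h t \<otimes>\<^bsub>A\<^esub> (h s \<otimes>\<^bsub>A\<^esub> b)" using f by simp
  also have "\<dots> = h s \<otimes>\<^bsub>A\<^esub> (h t \<otimes>\<^bsub>A\<^esub> b)" using f by (intro S.m_lcomm) simp_all
  also have "\<dots> = h (s \<otimes> c)" using f by simp
  finally have eq: "h (t \<otimes> a) = h (s \<otimes> c)" .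
  have tc: "t \<otimes> a \<in> carrier R" "s \<otimes> c \<in> carrier R" using f by simp_all
  have "h (t \<otimes> a \<ominus> s \<otimes> c) = h (t \<otimes> a) \<ominus>\<^bsub>A\<^esub> h (s \<otimes> c)"
    using tc by (simp only: a_minus_def hom_add hom_a_inv R.a_inv_closed)
  also have "\<dots> = \<zero>\<^bsub>A\<^esub>" unfolding eq a_minus_def using tc by (intro S.r_neg hom_closed)
  finally show ?thesis using kernel[of "t \<otimes> a \<ominus> s \<otimes> c"] tc by simp
qed

definition ext where
  "ext K = {b. \<exists>s a. fr s a b \<and> a \<in> K}"

lemma ext_sub: "ext K \<subseteq> carrier A"
  by (auto simp: ext_def fr_def)

lemma ideal_ext:
  assumes K: "ideal K R"
  shows "ideal (ext K) A"
proof (rule S.ideal_introI[OF ext_sub])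
  have "fr \<one> \<zero> \<zero>\<^bsub>A\<^esub>" using fr_h[OF R.zero_closed] by simp
  then show "\<zero>\<^bsub>A\<^esub> \<in> ext K" unfolding ext_def using ideal_zero[OF K] by blast
  fix b assume "b \<in> ext K"
  then obtain s a where b: "fr s a b" "a \<in> K" unfolding ext_def by blast
  { fix d assume "d \<in> ext K"
    then obtain t c where d: "fr t c d" "c \<in> K" unfolding ext_def by blast
    have "t \<otimes> a \<oplus> s \<otimes> c \<in> K"
      using b d by (intro ideal_add[OF K] ideal.I_l_closed[OF K]) (simp_all add: fr_def)
    then show "b \<oplus>\<^bsub>A\<^esub> d \<in> ext K" unfolding ext_def using fr_add[OF b(1) d(1)] by blast }
  fix r assume "r \<in> carrier A"
  then obtain t e where r: "fr t e r" using fr_exists by blast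
  have "e \<otimes> a \<in> K" using b r by (intro ideal.I_l_closed[OF K]) (simp_all add: fr_def)
  then show "r \<otimes>\<^bsub>A\<^esub> b \<in> ext K" unfolding ext_def using fr_mult[OF r b(1)] by blast
qed

lemma ext_mem_iff:
  assumes K: "ideal K R" and IK: "I \<subseteq> K" and f: "fr s a b"
  shows "b \<in> ext K \<longleftrightarrow> (\<exists>u\<in>carrier R - M. u \<otimes> a \<in> K)"
proof
  assume "b \<in> ext K"
  then obtain t c where c: "fr t c b" "c \<in> K" unfolding ext_def by blast
  obtain u where u: "u \<in> carrier R" "u \<notin> M" "u \<otimes> (t \<otimes> a \<ominus> s \<otimes> c) \<in> I"
    using fr_unique[OF f c(1)] by blast
  note car = f[unfolded fr_def] c(1)[unfolded fr_def]
  have "u \<otimes> (s \<otimes> c) \<in> K"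
    using c(2) car u by (intro ideal.I_l_closed[OF K]) simp_all
  then have "u \<otimes> (t \<otimes> a \<ominus> s \<otimes> c) \<oplus> u \<otimes> (s \<otimes> c) \<in> K"
    using u(3) IK by (intro ideal_add[OF K]) auto
  also have "u \<otimes> (t \<otimes> a \<ominus> s \<otimes> c) \<oplus> u \<otimes> (s \<otimes> c) = (u \<otimes> t) \<otimes> a"
    using car u(1) by (simp add: R.minus_eq R.r_distr R.r_minus R.a_assoc R.l_neg R.m_assoc)
  finally show "\<exists>u\<in>carrier R - M. u \<otimes> a \<in> K"
    using car u denom_mult[of u t] by (intro bexI[of _ "u \<otimes> t"]) simp_all
next
  assume "\<exists>u\<in>carrier R - M. u \<otimes> a \<in> K"
  then obtain u where u: "u \<in> carrier R" "u \<notin> M" "u \<otimes> a \<in> K" by blast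
  then show "b \<in> ext K" unfolding ext_def using fr_scale[OF f u(1,2)] by blast
qed

text \<open>A multiplier outside \<open>M\<close> is outside \<open>Q\<close> and cancels by
  primality. Membership hence does not depend on the chosen numerator, which makes extension
  followed by preimage the identity on primes between \<open>I\<close> and \<open>M\<close>.\<close>

lemma ext_prime_mem_iff:
  assumes Q: "primeideal Q R" and IQ: "I \<subseteq> Q" and QM: "Q \<subseteq> M" and f: "fr s a b"
  shows "b \<in> ext Q \<longleftrightarrow> a \<in> Q"
proof -
  have a: "a \<in> carrier R" using f by (simp add: fr_def)
  have "b \<in> ext Q \<longleftrightarrow> (\<exists>u\<in>carrier R - M. u \<otimes> a \<in> Q)"
    by (rule ext_mem_iff[OF primeideal.axioms(1)[OF Q] IQ f])
  also have "\<dots> \<longleftrightarrow> a \<in> Q"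
  proof
    assume "\<exists>u\<in>carrier R - M. u \<otimes> a \<in> Q"
    then show "a \<in> Q" using R.prime_mult[OF Q _ a] QM by blast
  next
    assume "a \<in> Q"
    then have "\<one> \<otimes> a \<in> Q" using a by simp
    then show "\<exists>u\<in>carrier R - M. u \<otimes> a \<in> Q"
      using R.prime_one[OF prime_M] R.one_closed by blast
  qed
  finally show ?thesis .
qed

lemma prime_ext:
  assumes Q: "primeideal Q R" and IQ: "I \<subseteq> Q" and QM: "Q \<subseteq> M"
  shows "primeideal (ext Q) A"
proof (rule primeidealI)
  note iff = ext_prime_mem_iff[OF Q IQ QM]
  show "ideal (ext Q) A" by (rule ideal_ext[OF primeideal.axioms(1)[OF Q]])
  show "cring A" by (rule S.cring_axioms)
  have "\<one>\<^bsub>A\<^esub> \<notin> ext Q" using iff[OF fr_h[OF R.one_closed]] R.prime_one[OF Q] by simp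
  then show "carrier A \<noteq> ext Q" using S.one_closed by blast
  fix b d assume bd: "b \<in> carrier A" "d \<in> carrier A" "b \<otimes>\<^bsub>A\<^esub> d \<in> ext Q"
  obtain s a where b: "fr s a b" using fr_exists[OF bd(1)] by blast
  obtain t c where d: "fr t c d" using fr_exists[OF bd(2)] by blast
  have "a \<otimes> c \<in> Q" using iff[OF fr_mult[OF b d]] bd(3) by blast
  then have "a \<in> Q \<or> c \<in> Q" using R.prime_mult[OF Q] b d unfolding fr_def by blast
  then show "b \<in> ext Q \<or> d \<in> ext Q" using iff[OF b] iff[OF d] by blast
qed

lemma vimage_ext:
  assumes "primeideal Q R" "I \<subseteq> Q" "Q \<subseteq> M"
  shows "{a \<in> carrier R. h a \<in> ext Q} = Q"
  using ext_prime_mem_iff[OF assms fr_h] ideal_subset[OF primeideal.axioms(1)[OF assms(1)]] by blast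

lemma Units_iff:
  assumes f: "fr s a b"
  shows "b \<in> Units A \<longleftrightarrow> b \<notin> ext M"
proof
  have pM: "primeideal (ext M) A" by (rule prime_ext[OF prime_M I_sub_M order_refl])
  assume "b \<in> Units A"
  then have "inv\<^bsub>A\<^esub> b \<otimes>\<^bsub>A\<^esub> b = \<one>\<^bsub>A\<^esub>" "inv\<^bsub>A\<^esub> b \<in> carrier A" by simp_all
  then show "b \<notin> ext M"
    using ideal.I_l_closed[OF primeideal.axioms(1)[OF pM], of b "inv\<^bsub>A\<^esub> b"] S.prime_one[OF pM] by auto
next
  assume "b \<notin> ext M"
  then have "a \<notin> M" using ext_prime_mem_iff[OF prime_M I_sub_M order_refl f] by simp
  then have u: "h a \<in> Units A" using unit f by (simp add: fr_def)
  have hs: "h s \<in> carrier A" and b: "b \<in> carrier A" and eq: "h s \<otimes>\<^bsub>A\<^esub> b = h a"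
    using f by (simp_all add: fr_def)
  have "(inv\<^bsub>A\<^esub> (h a) \<otimes>\<^bsub>A\<^esub> h s) \<otimes>\<^bsub>A\<^esub> b = \<one>\<^bsub>A\<^esub>"
    using u hs b eq by (simp add: S.m_assoc)
  moreover have "b \<otimes>\<^bsub>A\<^esub> (inv\<^bsub>A\<^esub> (h a) \<otimes>\<^bsub>A\<^esub> h s) = (inv\<^bsub>A\<^esub> (h a) \<otimes>\<^bsub>A\<^esub> h s) \<otimes>\<^bsub>A\<^esub> b"
    using u hs b by (intro S.m_comm) simp_all
  moreover have "inv\<^bsub>A\<^esub> (h a) \<otimes>\<^bsub>A\<^esub> h s \<in> carrier A" using u hs by simp
  ultimately show "b \<in> Units A" unfolding Units_def using b by auto
qed

lemma Units_eq: "Units A = carrier A - ext M"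
  using Units_iff fr_exists S.Units_closed by blast

text \<open>Everything outside \<open>ext M\<close> is a unit, so a proper ideal cannot leave
  \<open>ext M\<close>.\<close>

lemma maximalideal_iff: "maximalideal J A \<longleftrightarrow> J = ext M"
proof -
  have pM: "primeideal (ext M) A" by (rule prime_ext[OF prime_M I_sub_M order_refl])
  have sub: "J \<subseteq> ext M" if J: "ideal J A" "J \<noteq> carrier A" for J
  proof
    fix b assume b: "b \<in> J"
    show "b \<in> ext M"
    proof (rule ccontr)
      assume "b \<notin> ext M"
      then have u: "b \<in> Units A" using Units_eq ideal_subset[OF J(1) b] by blast
      have "inv\<^bsub>A\<^esub> b \<otimes>\<^bsub>A\<^esub> b \<in> J" by (rule ideal.I_l_closed[OF J(1) b]) (use u in simp)
      then have "\<one>\<^bsub>A\<^esub> \<in> J" using u by simp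
      then show False using ideal.one_imp_carrier[OF J(1)] J(2) by blast
    qed
  qed
  show ?thesis
  proof
    assume J: "maximalideal J A"
    then have J': "ideal J A" "J \<noteq> carrier A"
      using maximalideal.axioms(1) maximalideal.I_notcarr by auto
    have "ext M = J \<or> ext M = carrier A"
      by (rule maximalideal.I_maximal[OF J primeideal.axioms(1)[OF pM] sub[OF J'] ext_sub])
    moreover have "ext M \<noteq> carrier A" using primeideal.I_notcarr[OF pM] by simp
    ultimately show "J = ext M" by simp
  next
    assume J: "J = ext M"
    show "maximalideal J A"
      unfolding J
    proof (rule maximalidealI)
      show "ideal (ext M) A" by (rule primeideal.axioms(1)[OF pM])
      show "carrier A \<noteq> ext M" by (rule primeideal.I_notcarr[OF pM])
      show "K = ext M \<or> K = carrier A" if "ideal K A" "ext M \<subseteq> K" for K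
        using sub[OF that(1)] that(2) by blast
    qed
  qed
qed

lemma one_minus_Units:
  assumes "x \<in> ext M" "a \<in> carrier A"
  shows "\<one>\<^bsub>A\<^esub> \<ominus>\<^bsub>A\<^esub> a \<otimes>\<^bsub>A\<^esub> x \<in> Units A"
proof -
  have pM: "primeideal (ext M) A" by (rule prime_ext[OF prime_M I_sub_M order_refl])
  note iM = primeideal.axioms(1)[OF pM]
  have x: "x \<in> carrier A" using assms(1) ext_sub by blast
  have ax: "a \<otimes>\<^bsub>A\<^esub> x \<in> ext M" by (rule ideal.I_l_closed[OF iM assms])
  have axc: "a \<otimes>\<^bsub>A\<^esub> x \<in> carrier A" using x assms(2) by simp
  have "\<one>\<^bsub>A\<^esub> \<ominus>\<^bsub>A\<^esub> a \<otimes>\<^bsub>A\<^esub> x \<notin> ext M"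
  proof
    assume "\<one>\<^bsub>A\<^esub> \<ominus>\<^bsub>A\<^esub> a \<otimes>\<^bsub>A\<^esub> x \<in> ext M"
    then have "(\<one>\<^bsub>A\<^esub> \<ominus>\<^bsub>A\<^esub> a \<otimes>\<^bsub>A\<^esub> x) \<oplus>\<^bsub>A\<^esub> a \<otimes>\<^bsub>A\<^esub> x \<in> ext M" using ax by (rule ideal_add[OF iM])
    then have "\<one>\<^bsub>A\<^esub> \<in> ext M" using axc by (simp add: S.minus_eq S.a_assoc S.l_neg)
    then show False using S.prime_one[OF pM] by simp
  qed
  then show ?thesis unfolding Units_eq using axc by simp
qed

text \<open>A fraction and its numerator differ by the unit \<open>h s\<close>. Ideals of
  \<open>A\<close> are therefore determined by their preimages in \<open>R\<close>, which keeps
  chains strict and transfers finite generation.\<close>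

lemma fr_mem_ideal_iff:
  assumes J: "ideal J A" and f: "fr s a b"
  shows "b \<in> J \<longleftrightarrow> h a \<in> J"
proof
  have u: "h s \<in> Units A" using unit f by (simp add: fr_def)
  have b: "b \<in> carrier A" and eq: "h s \<otimes>\<^bsub>A\<^esub> b = h a" using f by (simp_all add: fr_def)
  show "h a \<in> J" if "b \<in> J"
    unfolding eq[symmetric] by (rule ideal.I_l_closed[OF J that S.Units_closed[OF u]])
  assume "h a \<in> J"
  then have "inv\<^bsub>A\<^esub> (h s) \<otimes>\<^bsub>A\<^esub> (h s \<otimes>\<^bsub>A\<^esub> b) \<in> J"
    unfolding eq by (rule ideal.I_l_closed[OF J]) (use u in simp)
  also have "inv\<^bsub>A\<^esub> (h s) \<otimes>\<^bsub>A\<^esub> (h s \<otimes>\<^bsub>A\<^esub> b) = (inv\<^bsub>A\<^esub> (h s) \<otimes>\<^bsub>A\<^esub> h s) \<otimes>\<^bsub>A\<^esub> b"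
    using S.Units_closed[OF u] S.Units_inv_closed[OF u] b by (intro S.m_assoc[symmetric])
  also have "\<dots> = b" using u b by simp
  finally show "b \<in> J" .
qed

lemma prime_chain_vimage:
  assumes P: "prime_chain A P n"
  shows "prime_chain R (\<lambda>i. {a \<in> carrier R. h a \<in> P i}) n"
  unfolding prime_chain_def
proof (intro conjI allI impI)
  show "primeideal {a \<in> carrier R. h a \<in> P i} R" if "i \<le> n" for i
    using P that by (intro prime_vimage_h) (simp add: prime_chain_def)
  fix i assume i: "i < n"
  then have sub: "P i \<subset> P (Suc i)" and pr: "primeideal (P i) A" "primeideal (P (Suc i)) A"
    using P by (simp_all add: prime_chain_def)
  then obtain b where b: "b \<in> P (Suc i)" "b \<notin> P i" by blast
  have "b \<in> carrier A" using ideal_subset[OF primeideal.axioms(1)[OF pr(2)] b(1)] .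
  then obtain s a where f: "fr s a b" using fr_exists by blast
  have "h a \<in> P (Suc i)" "h a \<notin> P i"
    using fr_mem_ideal_iff[OF primeideal.axioms(1)[OF pr(1)] f]
      fr_mem_ideal_iff[OF primeideal.axioms(1)[OF pr(2)] f] b by simp_all
  moreover have "a \<in> carrier R" using f by (simp add: fr_def)
  ultimately show "{a \<in> carrier R. h a \<in> P i} \<subset> {a \<in> carrier R. h a \<in> P (Suc i)}" using sub by blast
qed

lemma prime_chain_ext:
  assumes Q: "prime_chain R Q n" and IQ: "\<And>i. i \<le> n \<Longrightarrow> I \<subseteq> Q i" and QM: "\<And>i. i \<le> n \<Longrightarrow> Q i \<subseteq> M"
  shows "prime_chain A (\<lambda>i. ext (Q i)) n"
  unfolding prime_chain_def
proof (intro conjI allI impI)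
  have pr: "primeideal (Q i) R" if "i \<le> n" for i using Q that by (simp add: prime_chain_def)
  show "primeideal (ext (Q i)) A" if "i \<le> n" for i by (rule prime_ext[OF pr IQ QM]) (fact that)+
  fix i assume i: "i < n"
  then have sub: "Q i \<subset> Q (Suc i)" using Q by (simp add: prime_chain_def)
  then have "ext (Q i) \<subseteq> ext (Q (Suc i))" unfolding ext_def by blast
  moreover have "ext (Q i) \<noteq> ext (Q (Suc i))"
  proof
    assume eq: "ext (Q i) = ext (Q (Suc i))"
    have e1: "{a \<in> carrier R. h a \<in> ext (Q i)} = Q i"
      by (rule vimage_ext[OF pr IQ QM]) (use i in simp_all)
    have e2: "{a \<in> carrier R. h a \<in> ext (Q (Suc i))} = Q (Suc i)"
      by (rule vimage_ext[OF pr IQ QM]) (use i in simp_all)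
    have "Q i = Q (Suc i)" by (rule trans[OF sym[OF e1[unfolded eq]] e2])
    then show False using sub by simp
  qed
  ultimately show "ext (Q i) \<subset> ext (Q (Suc i))" by blast
qed

lemma noetherian_A:
  assumes R: "noetherian_ring R"
  shows "noetherian_ring A"
proof (rule S.noetherian_ringI)
  fix J assume J: "ideal J A"
  have V: "ideal {a \<in> carrier R. h a \<in> J} R" by (rule ideal_vimage_h[OF J])
  obtain F where F: "F \<subseteq> carrier R" "finite F" "{a \<in> carrier R. h a \<in> J} = Idl F"
    using noetherian_ring.finetely_gen[OF R V] by blast
  have hF: "h ` F \<subseteq> carrier A" using F(1) by auto
  have K: "ideal (Idl\<^bsub>A\<^esub> (h ` F)) A" by (rule S.genideal_ideal[OF hF])
  have FJ: "F \<subseteq> {a \<in> carrier R. h a \<in> J}" unfolding F(3) by (rule R.genideal_self[OF F(1)])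
  have "Idl\<^bsub>A\<^esub> (h ` F) \<subseteq> J" by (rule S.genideal_minimal[OF J]) (use FJ in blast)
  moreover have "J \<subseteq> Idl\<^bsub>A\<^esub> (h ` F)"
  proof
    fix b assume b: "b \<in> J"
    then obtain s a where f: "fr s a b" using fr_exists ideal_subset[OF J] by blast
    then have "a \<in> {a \<in> carrier R. h a \<in> J}" using fr_mem_ideal_iff[OF J f] b by (simp add: fr_def)
    then have "a \<in> Idl F" unfolding F(3) .
    moreover have "Idl F \<subseteq> {a \<in> carrier R. h a \<in> Idl\<^bsub>A\<^esub> (h ` F)}"
      by (rule R.genideal_minimal[OF ideal_vimage_h[OF K]]) (use F(1) S.genideal_self[OF hF] in blast)
    ultimately show "b \<in> Idl\<^bsub>A\<^esub> (h ` F)" using fr_mem_ideal_iff[OF K f] by blast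
  qed
  ultimately show "\<exists>B\<subseteq>carrier A. finite B \<and> J = Idl\<^bsub>A\<^esub> B"
    using hF F(2) by (intro exI[of _ "h ` F"]) simp
qed

text \<open>If \<open>P\<close> is the annihilator of \<open>f\<close> modulo \<open>I\<close>, then
  \<open>ext P\<close> is the annihilator of \<open>h f\<close>: a product vanishes in
  \<open>A\<close> when a factor outside \<open>M\<close> carries its numerator into
  \<open>I\<close>, and \<open>ext_mem_iff\<close> absorbs that factor.\<close>

lemma associated_prime_ext:
  assumes P: "P \<in> associated_primes R I" and PM: "P \<subseteq> M"
  shows "I \<subseteq> P" "ext P \<in> associated_primes A {\<zero>\<^bsub>A\<^esub>}"
proof -
  obtain f where prime: "primeideal P R" and f: "f \<in> carrier R" "P = {r \<in> carrier R. r \<otimes> f \<in> I}"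
    using P by (auto simp: associated_primes_def)
  show IP: "I \<subseteq> P" using f ideal.I_r_closed[OF ideal_I _ f(1)] ideal_subset[OF ideal_I] by blast
  have memP: "r \<in> P \<longleftrightarrow> r \<otimes> f \<in> I" if "r \<in> carrier R" for r using that unfolding f(2) by simp
  have iff: "b \<in> ext P \<longleftrightarrow> b \<otimes>\<^bsub>A\<^esub> h f = \<zero>\<^bsub>A\<^esub>" if b: "b \<in> carrier A" for b
  proof -
    obtain s a where fr: "fr s a b" using fr_exists[OF b] by blast
    then have a: "a \<in> carrier R" by (simp add: fr_def)
    have fr': "fr (s \<otimes> \<one>) (a \<otimes> f) (b \<otimes>\<^bsub>A\<^esub> h f)" by (rule fr_mult[OF fr fr_h[OF f(1)]])
    have z: "ideal {\<zero>\<^bsub>A\<^esub>} A" by (rule S.zeroideal)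
    have "b \<otimes>\<^bsub>A\<^esub> h f = \<zero>\<^bsub>A\<^esub> \<longleftrightarrow> h (a \<otimes> f) = \<zero>\<^bsub>A\<^esub>" using fr_mem_ideal_iff[OF z fr'] by simp
    also have "\<dots> \<longleftrightarrow> (\<exists>u\<in>carrier R - M. u \<otimes> (a \<otimes> f) \<in> I)" by (rule kernel[OF R.m_closed[OF a f(1)]])
    also have "\<dots> \<longleftrightarrow> (\<exists>u\<in>carrier R - M. u \<otimes> a \<in> P)"
      using memP a f(1) by (intro bex_cong) (simp_all add: R.m_assoc)
    also have "\<dots> \<longleftrightarrow> b \<in> ext P" using ext_mem_iff[OF primeideal.axioms(1)[OF prime] IP fr] by simp
    finally show ?thesis by simp
  qed
  have "ext P = {b \<in> carrier A. b \<otimes>\<^bsub>A\<^esub> h f \<in> {\<zero>\<^bsub>A\<^esub>}}" using iff ext_sub by blast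
  then show "ext P \<in> associated_primes A {\<zero>\<^bsub>A\<^esub>}"
    unfolding associated_primes_def using prime_ext[OF prime IP PM] f(1) by blast
qed

text \<open>The chain is built in the local ring, where members of \<open>ext M\<close> satisfy the
  unit condition, and is pulled back to \<open>R\<close>, where chain lengths can be
  bounded.\<close>

theorem regular_sequence_chain:
  assumes R: "noetherian_ring R" and P: "P \<in> associated_primes R I" and PM: "P \<subseteq> M"
    and xs: "regular_sequence A xs" "set xs \<subseteq> ext M"
  shows "\<exists>Q. prime_chain R Q (length xs) \<and> Q 0 = P"
proof -
  interpret N: noetherian_cring A
    by (intro noetherian_cring.intro noetherian_A[OF R] S.cring_axioms)
  have prime: "primeideal P R" using P by (simp add: associated_primes_def)
  obtain Q where Q: "prime_chain A Q (length xs)" "Q 0 = ext P"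
    using N.regular_sequence_prime_chain[OF xs(1) _ associated_prime_ext(2)[OF P PM]]
      one_minus_Units xs(2) by blast
  then show ?thesis
    using prime_chain_vimage[OF Q(1)] vimage_ext[OF prime associated_prime_ext(1)[OF P PM] PM]
    by (intro exI[of _ "\<lambda>i. {a \<in> carrier R. h a \<in> Q i}"]) simp
qed

text \<open>\<open>A\<close> is not the zero ring, so zero has an associated prime, at which each
  regular sequence starts a chain of its own length.\<close>

lemma depth_le_krull_dim:
  assumes R: "noetherian_ring R"
  shows "depth A (ext M) \<le> krull_dim A"
  unfolding depth_def
proof (rule Sup_least)
  interpret N: noetherian_cring A
    by (intro noetherian_cring.intro noetherian_A[OF R] S.cring_axioms)
  have pM: "primeideal (ext M) A" by (rule prime_ext[OF prime_M I_sub_M order_refl])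
  have "\<one>\<^bsub>A\<^esub> \<notin> {\<zero>\<^bsub>A\<^esub>}"
    using S.prime_one[OF pM] ideal_zero[OF primeideal.axioms(1)[OF pM]] by auto
  then obtain p where p: "p \<in> associated_primes A {\<zero>\<^bsub>A\<^esub>}"
    using N.associated_prime_above_annihilator[OF S.zeroideal S.one_closed] by blast
  fix e assume "e \<in> {enat (length xs) | xs. regular_sequence A xs \<and> set xs \<subseteq> ext M}"
  then obtain xs where xs: "e = enat (length xs)" "regular_sequence A xs" "set xs \<subseteq> ext M" by blast
  have "\<exists>P. prime_chain A P (length xs) \<and> P 0 = p"
    by (rule N.regular_sequence_prime_chain[OF xs(2) _ p]) (use one_minus_Units xs(3) in blast)
  then show "e \<le> krull_dim A" unfolding krull_dim_def xs(1) by (intro Sup_upper) blast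
qed

lemma cm_local_ring_iff:
  assumes "noetherian_ring R"
  shows "cm_local_ring A \<longleftrightarrow> depth A (ext M) = krull_dim A"
  unfolding cm_local_ring_def using S.cring_axioms noetherian_A[OF assms] maximalideal_iff by metis

lemma genideal_h_mem_iff:
  assumes F: "F \<subseteq> carrier R" and a: "a \<in> carrier R"
  shows "h a \<in> Idl\<^bsub>A\<^esub> (h ` F) \<longleftrightarrow> (\<exists>s\<in>carrier R - M. s \<otimes> a \<in> Idl (I \<union> F))"
proof -
  have IF: "I \<union> F \<subseteq> carrier R" using F ideal_subset[OF ideal_I] by blast
  have K: "ideal (Idl (I \<union> F)) R" by (rule R.genideal_ideal[OF IF])
  have IK: "I \<subseteq> Idl (I \<union> F)" "F \<subseteq> Idl (I \<union> F)" using R.genideal_self[OF IF] by auto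
  have hF: "h ` F \<subseteq> carrier A" using F by auto
  have L: "ideal (Idl\<^bsub>A\<^esub> (h ` F)) A" by (rule S.genideal_ideal[OF hF])
  have "Idl\<^bsub>A\<^esub> (h ` F) = ext (Idl (I \<union> F))"
  proof
    show "Idl\<^bsub>A\<^esub> (h ` F) \<subseteq> ext (Idl (I \<union> F))"
    proof (rule S.genideal_minimal[OF ideal_ext[OF K]], rule image_subsetI)
      fix x assume "x \<in> F"
      then have "fr \<one> x (h x)" "x \<in> Idl (I \<union> F)" using fr_h F IK by auto
      then show "h x \<in> ext (Idl (I \<union> F))" unfolding ext_def by blast
    qed
    have "I \<union> F \<subseteq> {a \<in> carrier R. h a \<in> Idl\<^bsub>A\<^esub> (h ` F)}"
    proof
      fix x assume x: "x \<in> I \<union> F"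
      have "h x \<in> Idl\<^bsub>A\<^esub> (h ` F)"
      proof (cases "x \<in> F")
        case True
        then show ?thesis using S.genideal_self[OF hF] by blast
      next
        case False
        then have xI: "x \<in> I" using x by blast
        then have "\<one> \<otimes> x \<in> I" using ideal_subset[OF ideal_I] by simp
        then have "\<exists>s\<in>carrier R - M. s \<otimes> x \<in> I" using R.prime_one[OF prime_M] R.one_closed by blast
        then have "h x = \<zero>\<^bsub>A\<^esub>" using kernel[OF ideal_subset[OF ideal_I xI]] by blast
        then show ?thesis using ideal_zero[OF L] by simp
      qed
      then show "x \<in> {a \<in> carrier R. h a \<in> Idl\<^bsub>A\<^esub> (h ` F)}" using x IF by blast
    qed
    then have sub: "Idl (I \<union> F) \<subseteq> {a \<in> carrier R. h a \<in> Idl\<^bsub>A\<^esub> (h ` F)}"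
      by (rule R.genideal_minimal[OF ideal_vimage_h[OF L]])
    show "ext (Idl (I \<union> F)) \<subseteq> Idl\<^bsub>A\<^esub> (h ` F)"
    proof
      fix b assume "b \<in> ext (Idl (I \<union> F))"
      then obtain s a where "fr s a b" "a \<in> Idl (I \<union> F)" unfolding ext_def by blast
      then show "b \<in> Idl\<^bsub>A\<^esub> (h ` F)" using fr_mem_ideal_iff[OF L] sub by blast
    qed
  qed
  then show ?thesis using ext_mem_iff[OF K IK(1) fr_h[OF a]] by simp
qed

text \<open>Flatness of localization by hand: denominators are cleared, regularity modulo
  \<open>I\<close> is used in \<open>R\<close>, and the denominators are restored. The image
  generates a proper ideal because \<open>I\<close> and the sequence lie in
  \<open>M\<close>.\<close>

lemma regular_sequence_map:
  assumes qs: "set qs \<subseteq> M"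
    and reg: "\<And>i b. i < length qs \<Longrightarrow> b \<in> carrier R \<Longrightarrow> qs ! i \<otimes> b \<in> Idl (I \<union> set (take i qs)) \<Longrightarrow>
      b \<in> Idl (I \<union> set (take i qs))"
  shows "regular_sequence A (map h qs)" "set (map h qs) \<subseteq> ext M"
proof -
  have MR: "M \<subseteq> carrier R" using ideal_subset[OF primeideal.axioms(1)[OF prime_M]] by blast
  have qsR: "set qs \<subseteq> carrier R" using qs MR by blast
  show ext: "set (map h qs) \<subseteq> ext M"
    using ext_prime_mem_iff[OF prime_M I_sub_M order_refl fr_h] qs qsR by auto
  show "regular_sequence A (map h qs)"
    unfolding regular_sequence_def
  proof (intro conjI allI impI ballI)
    show "set (map h qs) \<subseteq> carrier A" using ext ext_sub by blast
    show "Idl\<^bsub>A\<^esub> (set (map h qs)) \<noteq> carrier A"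
    proof
      assume eq: "Idl\<^bsub>A\<^esub> (set (map h qs)) = carrier A"
      have "h \<one> \<in> Idl\<^bsub>A\<^esub> (h ` set qs)" using eq by simp
      then obtain s where s: "s \<in> carrier R" "s \<notin> M" "s \<otimes> \<one> \<in> Idl (I \<union> set qs)"
        using genideal_h_mem_iff[OF qsR R.one_closed] by blast
      have "Idl (I \<union> set qs) \<subseteq> M"
        by (rule R.genideal_minimal[OF primeideal.axioms(1)[OF prime_M]]) (use I_sub_M qs in blast)
      then show False using s by auto
    qed
    fix i b assume i: "i < length (map h qs)" and b: "b \<in> carrier A"
      and prod: "map h qs ! i \<otimes>\<^bsub>A\<^esub> b \<in> Idl\<^bsub>A\<^esub> (set (take i (map h qs)))"
    have F: "set (take i qs) \<subseteq> carrier R" using qsR set_take_subset by fast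
    have eq: "set (take i (map h qs)) = h ` set (take i qs)" by (simp add: take_map)
    have hF: "h ` set (take i qs) \<subseteq> carrier A" using F by auto
    have L: "ideal (Idl\<^bsub>A\<^esub> (h ` set (take i qs))) A" by (rule S.genideal_ideal[OF hF])
    have q: "qs ! i \<in> carrier R" using i qsR by auto
    obtain s a where f: "fr s a b" using fr_exists[OF b] by blast
    then have a: "a \<in> carrier R" by (simp add: fr_def)
    have "h (qs ! i) \<otimes>\<^bsub>A\<^esub> b \<in> Idl\<^bsub>A\<^esub> (h ` set (take i qs))" using prod i unfolding eq by simp
    then have "h (qs ! i \<otimes> a) \<in> Idl\<^bsub>A\<^esub> (h ` set (take i qs))"
      using fr_mem_ideal_iff[OF L fr_mult[OF fr_h[OF q] f]] by simp
    then obtain t where t: "t \<in> carrier R" "t \<notin> M" "t \<otimes> (qs ! i \<otimes> a) \<in> Idl (I \<union> set (take i qs))"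
      using genideal_h_mem_iff[OF F R.m_closed[OF q a]] by blast
    have "qs ! i \<otimes> (t \<otimes> a) \<in> Idl (I \<union> set (take i qs))"
      using t(1,3) q a by (simp add: R.m_lcomm)
    then have "t \<otimes> a \<in> Idl (I \<union> set (take i qs))" using reg i t(1) a by simp
    then have "h a \<in> Idl\<^bsub>A\<^esub> (h ` set (take i qs))"
      using genideal_h_mem_iff[OF F a] t(1,2) by blast
    then show "b \<in> Idl\<^bsub>A\<^esub> (set (take i (map h qs)))" unfolding eq using fr_mem_ideal_iff[OF L f] by simp
  qed
qed

end

section \<open>Quotient rings and their localizations\<close>

context cring
begin

lemma quotient_hom:
  assumes I: "ideal I R"
  shows "ring_hom_cring R (R Quot I) ((+>) I)" "carrier (R Quot I) = (+>) I ` carrier R"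
    and "a \<in> carrier R \<Longrightarrow> I +> a = \<zero>\<^bsub>R Quot I\<^esub> \<longleftrightarrow> a \<in> I"
proof -
  show "ring_hom_cring R (R Quot I) ((+>) I)" by (rule ideal.rcos_ring_hom_cring[OF I cring_axioms])
  show "carrier (R Quot I) = (+>) I ` carrier R" by (auto simp: FactRing_def A_RCOSETS_def')
  assume a: "a \<in> carrier R"
  have z: "\<zero>\<^bsub>R Quot I\<^esub> = I" by (simp add: FactRing_def)
  interpret I: ideal I R by (rule I)
  have "a \<in> I +> a" by (rule I.a_rcos_self[OF a])
  then show "I +> a = \<zero>\<^bsub>R Quot I\<^esub> \<longleftrightarrow> a \<in> I" unfolding z using a_rcos_zero[OF I] by blast
qed

lemma quotient_eq_iff:
  assumes I: "ideal I R" and a: "a \<in> carrier R" "b \<in> carrier R"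
  shows "I +> a = I +> b \<longleftrightarrow> a \<ominus> b \<in> I"
proof -
  interpret q: ring_hom_cring R "R Quot I" "(+>) I" by (rule quotient_hom(1)[OF I])
  have "I +> (a \<ominus> b) = (I +> a) \<ominus>\<^bsub>R Quot I\<^esub> (I +> b)"
    using a by (simp only: a_minus_def q.hom_add q.hom_a_inv a_inv_closed)
  moreover have ab: "a \<ominus> b \<in> carrier R" using a by simp
  ultimately have "a \<ominus> b \<in> I \<longleftrightarrow> (I +> a) \<ominus>\<^bsub>R Quot I\<^esub> (I +> b) = \<zero>\<^bsub>R Quot I\<^esub>"
    using quotient_hom(3)[OF I ab] by simp
  also have "\<dots> \<longleftrightarrow> I +> a = I +> b" using q.S.r_right_minus_eq q.hom_closed a by simp
  finally show ?thesis by simp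
qed

lemma maximalideal_quotient:
  assumes I: "ideal I R" and M: "maximalideal M R" and IM: "I \<subseteq> M"
  shows "maximalideal ((+>) I ` M) (R Quot I)" "{r \<in> carrier R. I +> r \<in> (+>) I ` M} = M"
proof -
  interpret q: ring_hom_cring R "R Quot I" "(+>) I" by (rule quotient_hom(1)[OF I])
  have iM: "ideal M R" by (rule maximalideal.axioms(1)[OF M])
  have mem: "r \<in> M" if r: "r \<in> carrier R" "I +> r \<in> (+>) I ` M" for r
  proof -
    obtain r0 where r0: "r0 \<in> M" "I +> r = I +> r0" using r(2) by blast
    have r0R: "r0 \<in> carrier R" by (rule ideal_subset[OF iM r0(1)])
    have "r \<ominus> r0 \<in> M" using quotient_eq_iff[OF I r(1) r0R] r0(2) IM by blast
    then have "(r \<ominus> r0) \<oplus> r0 \<in> M" using r0(1) by (rule ideal_add[OF iM])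
    then show ?thesis using r(1) r0R by (simp add: minus_eq a_assoc l_neg)
  qed
  show eq: "{r \<in> carrier R. I +> r \<in> (+>) I ` M} = M" using mem ideal_subset[OF iM] by blast
  show "maximalideal ((+>) I ` M) (R Quot I)"
  proof (rule maximalidealI)
    show "ideal ((+>) I ` M) (R Quot I)" by (rule ring_ideal_imp_quot_ideal[OF I iM])
    show "carrier (R Quot I) \<noteq> (+>) I ` M"
    proof
      assume "carrier (R Quot I) = (+>) I ` M"
      then have "carrier R \<subseteq> M" using mem q.hom_closed by blast
      then show False using maximalideal.I_notcarr[OF M] ideal_subset[OF iM] by blast
    qed
    fix K assume K: "ideal K (R Quot I)" "(+>) I ` M \<subseteq> K" "K \<subseteq> carrier (R Quot I)"
    let ?K = "{r \<in> carrier R. I +> r \<in> K}"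
    have "K \<subseteq> (+>) I ` carrier R" using K(3) unfolding quotient_hom(2)[OF I] .
    then have K_eq: "K = (+>) I ` ?K" by blast
    have MK: "M \<subseteq> ?K" using K(2) ideal_subset[OF iM] by blast
    define K' where "K' = ?K"
    have K': "K = (+>) I ` K'" using K_eq unfolding K'_def .
    have "K' = M \<or> K' = carrier R"
      unfolding K'_def by (rule maximalideal.I_maximal[OF M q.ideal_vimage_h[OF K(1)] MK]) blast
    then show "K = (+>) I ` M \<or> K = carrier (R Quot I)"
      unfolding quotient_hom(2)[OF I] K' by (elim disjE) simp_all
  qed
qed

text \<open>Instantiates the abstract description with the residue map followed by the localization
  map; after this, cosets and classes of pairs need not be opened again.\<close>

lemma localized_quotient_localization:
  assumes I: "ideal I R" and m: "maximalideal m (R Quot I)"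
  defines "M \<equiv> {r \<in> carrier R. I +> r \<in> m}"
  shows "maximalideal M R"
    and "localized_quotient R (localization (R Quot I) m)
      (\<lambda>r. loc_frac (R Quot I) m (I +> r) \<one>\<^bsub>R Quot I\<^esub>) I M"
proof -
  let ?Q = "R Quot I"
  interpret q: ring_hom_cring R ?Q "(+>) I" by (rule quotient_hom(1)[OF I])
  have prime_m: "primeideal m ?Q" by (rule q.S.maximalideal_prime[OF m])
  have im: "ideal m ?Q" by (rule maximalideal.axioms(1)[OF m])
  have iM: "ideal M R" unfolding M_def by (rule q.ideal_vimage_h[OF im])
  have IM: "I \<subseteq> M"
  proof
    fix i assume i: "i \<in> I"
    then have "I +> i = \<zero>\<^bsub>?Q\<^esub>" using quotient_hom(3)[OF I ideal_subset[OF I i]] by simp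
    then show "i \<in> M" using ideal_zero[OF im] ideal_subset[OF I i] by (simp add: M_def)
  qed
  show "maximalideal M R"
  proof (rule maximalidealI[OF iM])
    show "carrier R \<noteq> M"
    proof
      assume "carrier R = M"
      then have "carrier ?Q \<subseteq> m" using quotient_hom(2)[OF I] by (auto simp: M_def)
      then show False using maximalideal.I_notcarr[OF m] ideal_subset[OF im] by blast
    qed
    fix J assume J: "ideal J R" "M \<subseteq> J" "J \<subseteq> carrier R"
    have K: "ideal ((+>) I ` J) ?Q" by (rule ring_ideal_imp_quot_ideal[OF I J(1)])
    have mK: "m \<subseteq> (+>) I ` J"
    proof
      fix x assume x: "x \<in> m"
      then obtain r where r: "r \<in> carrier R" "x = I +> r"
        using ideal_subset[OF im x] quotient_hom(2)[OF I] by blast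
      then show "x \<in> (+>) I ` J" using x J(2) by (auto simp: M_def)
    qed
    have Kc: "(+>) I ` J \<subseteq> carrier ?Q" using J(3) quotient_hom(2)[OF I] by blast
    have "(+>) I ` J = m \<or> (+>) I ` J = carrier ?Q"
      by (rule maximalideal.I_maximal[OF m K mK Kc])
    then show "J = M \<or> J = carrier R"
    proof
      assume "(+>) I ` J = m"
      then have "J \<subseteq> M" using J(3) unfolding M_def by blast
      then show ?thesis using J(2) by blast
    next
      assume "(+>) I ` J = carrier ?Q"
      then have "I +> \<one> \<in> (+>) I ` J" using quotient_hom(2)[OF I] one_closed by blast
      then obtain j where j: "j \<in> J" "I +> \<one> = I +> j" by blast
      have jR: "j \<in> carrier R" using j J(3) by blast
      have "\<one> \<ominus> j \<in> J" using quotient_eq_iff[OF I one_closed jR] j(2) IM J(2) by blast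
      then have "(\<one> \<ominus> j) \<oplus> j \<in> J" using j(1) by (rule ideal_add[OF J(1)])
      then have "\<one> \<in> J" using jR by (simp add: minus_eq a_assoc l_neg)
      then show ?thesis using ideal.one_imp_carrier[OF J(1)] by blast
    qed
  qed
  interpret L: prime_localization ?Q m
    by (intro prime_localization.intro q.S.cring_axioms prime_m)
  let ?h = "\<lambda>r. loc_frac ?Q m (I +> r) \<one>\<^bsub>?Q\<^esub>"
  have "(\<lambda>b. loc_frac ?Q m b \<one>\<^bsub>?Q\<^esub>) \<circ> (+>) I \<in> ring_hom R (localization ?Q m)"
    by (rule ring_hom_trans[OF q.homh L.hom_A])
  then have hom: "ring_hom_cring R (localization ?Q m) ?h"
    by (intro ring_hom_cring.intro ring_hom_cring_axioms.intro cring_axioms L.cring_A) (simp add: comp_def)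
  have nM: "I +> s \<in> carrier ?Q - m" if "s \<in> carrier R - M" for s
    using that q.hom_closed by (auto simp: M_def)
  have surj: "\<exists>r\<in>carrier R. x = I +> r" if "x \<in> carrier ?Q" for x
    using that quotient_hom(2)[OF I] by blast
  show "localized_quotient R (localization ?Q m) ?h I M"
  proof (intro localized_quotient.intro localized_quotient_axioms.intro hom I IM)
    show "primeideal M R" unfolding M_def by (rule q.prime_vimage_h[OF prime_m])
    show "?h s \<in> Units (localization ?Q m)" if "s \<in> carrier R - M" for s
      by (rule L.loc_frac_unit[OF nM[OF that]])
    show "\<exists>a\<in>carrier R. \<exists>s\<in>carrier R - M. ?h s \<otimes>\<^bsub>localization ?Q m\<^esub> b = ?h a"
      if b: "b \<in> carrier (localization ?Q m)" for b
    proof -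
      obtain x t where xt: "x \<in> carrier ?Q" "t \<in> carrier ?Q - m" "b = loc_frac ?Q m x t"
        by (rule L.loc_fracE[OF b])
      obtain a where a: "a \<in> carrier R" "x = I +> a" using surj xt(1) by blast
      obtain s where s: "s \<in> carrier R" "t = I +> s" using surj xt(2) by blast
      have "?h s \<otimes>\<^bsub>localization ?Q m\<^esub> b = ?h a"
        using L.loc_frac_mult_denominator[OF xt(1,2)] unfolding xt(3) a(2) s(2) .
      moreover have "s \<notin> M" using xt(2) s by (simp add: M_def)
      ultimately show ?thesis using a(1) s(1) by blast
    qed
    fix a assume a: "a \<in> carrier R"
    have "?h a = \<zero>\<^bsub>localization ?Q m\<^esub> \<longleftrightarrow> (\<exists>u\<in>carrier ?Q - m. u \<otimes>\<^bsub>?Q\<^esub> (I +> a) = \<zero>\<^bsub>?Q\<^esub>)"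
      by (rule L.loc_frac_eq_zero_iff[OF q.hom_closed[OF a]])
    also have "\<dots> \<longleftrightarrow> (\<exists>s\<in>carrier R - M. (I +> s) \<otimes>\<^bsub>?Q\<^esub> (I +> a) = \<zero>\<^bsub>?Q\<^esub>)"
    proof
      assume "\<exists>u\<in>carrier ?Q - m. u \<otimes>\<^bsub>?Q\<^esub> (I +> a) = \<zero>\<^bsub>?Q\<^esub>"
      then obtain u where u: "u \<in> carrier ?Q" "u \<notin> m" "u \<otimes>\<^bsub>?Q\<^esub> (I +> a) = \<zero>\<^bsub>?Q\<^esub>" by blast
      obtain s where s: "s \<in> carrier R" "u = I +> s" using surj u(1) by blast
      have "s \<in> carrier R - M" using s u(2) by (simp add: M_def)
      then show "\<exists>s\<in>carrier R - M. (I +> s) \<otimes>\<^bsub>?Q\<^esub> (I +> a) = \<zero>\<^bsub>?Q\<^esub>" using u(3) unfolding s(2) by blast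
    next
      assume "\<exists>s\<in>carrier R - M. (I +> s) \<otimes>\<^bsub>?Q\<^esub> (I +> a) = \<zero>\<^bsub>?Q\<^esub>"
      then show "\<exists>u\<in>carrier ?Q - m. u \<otimes>\<^bsub>?Q\<^esub> (I +> a) = \<zero>\<^bsub>?Q\<^esub>" using nM by blast
    qed
    also have "\<dots> \<longleftrightarrow> (\<exists>s\<in>carrier R - M. s \<otimes> a \<in> I)"
    proof (rule bex_cong[OF refl])
      fix s assume "s \<in> carrier R - M"
      then have s: "s \<in> carrier R" by simp
      have "(I +> s) \<otimes>\<^bsub>?Q\<^esub> (I +> a) = I +> (s \<otimes> a)" using q.hom_mult[OF s a] by simp
      then show "(I +> s) \<otimes>\<^bsub>?Q\<^esub> (I +> a) = \<zero>\<^bsub>?Q\<^esub> \<longleftrightarrow> s \<otimes> a \<in> I"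
        using quotient_hom(3)[OF I m_closed[OF s a]] by simp
    qed
    finally show "?h a = \<zero>\<^bsub>localization ?Q m\<^esub> \<longleftrightarrow> (\<exists>s\<in>carrier R - M. s \<otimes> a \<in> I)" .
  qed
qed

lemma noetherian_quotient:
  assumes R: "noetherian_ring R" and I: "ideal I R"
  shows "noetherian_ring (R Quot I)"
proof -
  interpret q: ring_hom_cring R "R Quot I" "(+>) I" by (rule quotient_hom(1)[OF I])
  show ?thesis
  proof (rule q.S.noetherian_ringI)
    fix J assume J: "ideal J (R Quot I)"
    have V: "ideal {r \<in> carrier R. I +> r \<in> J} R" by (rule q.ideal_vimage_h[OF J])
    obtain F where F: "F \<subseteq> carrier R" "finite F" "{r \<in> carrier R. I +> r \<in> J} = Idl F"
      using noetherian_ring.finetely_gen[OF R V] by blast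
    have qF: "(+>) I ` F \<subseteq> carrier (R Quot I)" using F(1) q.hom_closed by blast
    let ?K = "Idl\<^bsub>R Quot I\<^esub> ((+>) I ` F)"
    have K: "ideal ?K (R Quot I)" by (rule q.S.genideal_ideal[OF qF])
    have FJ: "F \<subseteq> {r \<in> carrier R. I +> r \<in> J}" unfolding F(3) by (rule genideal_self[OF F(1)])
    have "?K \<subseteq> J" by (rule q.S.genideal_minimal[OF J]) (use FJ in blast)
    moreover have "J \<subseteq> ?K"
    proof
      fix b assume b: "b \<in> J"
      have "b \<in> (+>) I ` carrier R" using ideal_subset[OF J b] unfolding quotient_hom(2)[OF I] .
      then obtain r where r: "r \<in> carrier R" "b = I +> r" by blast
      then have "r \<in> {r \<in> carrier R. I +> r \<in> J}" using b by simp
      then have "r \<in> Idl F" unfolding F(3) .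
      moreover have "Idl F \<subseteq> {r \<in> carrier R. I +> r \<in> ?K}"
        by (rule genideal_minimal[OF q.ideal_vimage_h[OF K]]) (use F(1) q.S.genideal_self[OF qF] in blast)
      ultimately show "b \<in> ?K" using r(2) by blast
    qed
    ultimately show "\<exists>B\<subseteq>carrier (R Quot I). finite B \<and> J = Idl\<^bsub>R Quot I\<^esub> B"
      using qF F(2) by (intro exI[of _ "(+>) I ` F"]) simp
  qed
qed

end

subsection \<open>Well-covered forests\<close>

locale oriented_graph =
  fixes V :: "'v set" and E :: "('v \<times> 'v) set" and d :: "'v \<Rightarrow> nat"
  assumes finite_V: "finite V" and E_sub: "(u, v) \<in> E \<Longrightarrow> u \<in> V \<and> v \<in> V"
    and orient: "(u, v) \<in> E \<Longrightarrow> (v, u) \<notin> E"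
    and d_pos: "v \<in> V \<Longrightarrow> 1 \<le> d v"
    and d_source: "v \<in> V \<Longrightarrow> (\<And>u. (u, v) \<notin> E) \<Longrightarrow> d v = 1"
    and no_isolated: "v \<in> V \<Longrightarrow> \<exists>u. (u, v) \<in> E \<or> (v, u) \<in> E"
begin

definition adj :: "'v \<Rightarrow> 'v \<Rightarrow> bool" where
  "adj u v \<longleftrightarrow> (u, v) \<in> E \<or> (v, u) \<in> E"

lemma adj_sym: "adj u v \<Longrightarrow> adj v u"
  by (auto simp: adj_def)

lemma adj_irrefl: "\<not> adj u u"
  using orient by (auto simp: adj_def)

lemma adj_V: "adj u v \<Longrightarrow> u \<in> V" "adj u v \<Longrightarrow> v \<in> V"
  using E_sub by (auto simp: adj_def)

text \<open>An arbitrary graph on the \<open>x i\<close> with one pendant vertex \<open>y i\<close>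
  attached to each: the graph-theoretic half of the condition on matchings.\<close>

definition whiskered :: "nat \<Rightarrow> (nat \<Rightarrow> 'v) \<Rightarrow> (nat \<Rightarrow> 'v) \<Rightarrow> bool" where
  "whiskered r x y \<longleftrightarrow> inj_on x {1..r} \<and> inj_on y {1..r} \<and> x ` {1..r} \<inter> y ` {1..r} = {} \<and>
     V = x ` {1..r} \<union> y ` {1..r} \<and> (\<forall>i\<in>{1..r}. \<forall>u. adj (y i) u \<longleftrightarrow> u = x i)"

definition indep :: "'v set \<Rightarrow> bool" where
  "indep S \<longleftrightarrow> (\<forall>u\<in>S. \<forall>v\<in>S. \<not> adj u v)"

text \<open>Relative to the subgraph induced on \<open>W\<close>, because the matching is found by
  deleting vertices.\<close>

definition max_indep :: "'v set \<Rightarrow> 'v set \<Rightarrow> bool" where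
  "max_indep W S \<longleftrightarrow> S \<subseteq> W \<and> indep S \<and> (\<forall>w\<in>W - S. \<exists>s\<in>S. adj w s)"

lemma max_indep_extend:
  assumes "finite W" "S0 \<subseteq> W" "indep S0"
  shows "\<exists>S. S0 \<subseteq> S \<and> max_indep W S"
proof -
  let ?A = "{S. S \<subseteq> W \<and> indep S}"
  have "finite ?A" by (rule finite_subset[of _ "Pow W"]) (use assms in auto)
  moreover have "S0 \<in> ?A" using assms by simp
  ultimately obtain S where S: "S \<in> ?A" "S0 \<subseteq> S" and max: "\<forall>T\<in>?A. S \<subseteq> T \<longrightarrow> S = T"
    using finite_has_maximal2[of ?A S0] by blast
  have "\<exists>s\<in>S. adj w s" if w: "w \<in> W - S" for w
  proof (rule ccontr)
    assume "\<not> ?thesis"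
    then have "insert w S \<in> ?A" using S(1) w adj_irrefl adj_sym by (auto simp: indep_def)
    then have "S = insert w S" using max by blast
    then show False using w by blast
  qed
  then have "max_indep W S" using S(1) by (simp add: max_indep_def)
  then show ?thesis using S(2) by blast
qed

text \<open>The vertex covers \<open>C\<close> for which the monomial with exponent \<open>cover_exp C v\<close> at \<open>v \<in> C\<close>
  and large exponents outside \<open>C\<close> is mapped into the edge ideal by exactly the variables
  in \<open>C\<close>.\<close>
definition cover_exp :: "'v set \<Rightarrow> 'v \<Rightarrow> nat" where
  "cover_exp C v = (if \<exists>w. (v, w) \<in> E \<and> w \<notin> C then 0 else d v - 1)"

text \<open>The last clause provides, for each \<open>v\<close> in \<open>C\<close>, a generator of
  the edge ideal dividing the monomial after one more factor \<open>v\<close>: from an edge leaving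
  the cover, or else from an edge \<open>u -> v\<close> where the exponent \<open>d v - 1\<close> is
  completed to \<open>d v\<close> and \<open>u\<close> already occurs.\<close>

definition strong_cover :: "'v set \<Rightarrow> bool" where
  "strong_cover C \<longleftrightarrow> C \<subseteq> V \<and> (\<forall>(u, v)\<in>E. u \<in> C \<or> v \<in> C) \<and>
     (\<forall>v\<in>C. (\<exists>w. (v, w) \<in> E \<and> w \<notin> C) \<or> (\<exists>u. (u, v) \<in> E \<and> (u \<notin> C \<or> 1 \<le> cover_exp C u)))"

text \<open>A vertex outside \<open>S\<close> has a neighbour in \<open>S\<close> by maximality, and
  either direction of that edge satisfies one of the alternatives.\<close>

lemma strong_cover_max_indep:
  assumes S: "max_indep V S"
  shows "strong_cover (V - S)"
  unfolding strong_cover_def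
proof (intro conjI ballI)
  fix e assume e: "e \<in> E"
  obtain u v where uv: "e = (u, v)" by (cases e)
  then have "u \<notin> S \<or> v \<notin> S" "u \<in> V" "v \<in> V"
    using e S E_sub by (auto simp: max_indep_def indep_def adj_def)
  then show "case e of (u, v) \<Rightarrow> u \<in> V - S \<or> v \<in> V - S" using uv by auto
next
  fix v assume "v \<in> V - S"
  then obtain s where "s \<in> S" "adj v s" using S by (auto simp: max_indep_def)
  then show "(\<exists>w. (v, w) \<in> E \<and> w \<notin> V - S) \<or> (\<exists>u. (u, v) \<in> E \<and> (u \<notin> V - S \<or> 1 \<le> cover_exp (V - S) u))"
    by (auto simp: adj_def)
qed auto

lemma whiskered_adj: "whiskered r x y \<Longrightarrow> i \<in> {1..r} \<Longrightarrow> adj (x i) (y i)"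
  using adj_sym unfolding whiskered_def by blast

lemma whiskered_card:
  assumes "whiskered r x y"
  shows "card V = 2 * r"
proof -
  have "card V = card (x ` {1..r}) + card (y ` {1..r})"
    using assms unfolding whiskered_def by (metis card_Un_disjoint finite_atLeastAtMost finite_imageI)
  also have "\<dots> = r + r" using assms by (simp add: whiskered_def card_image)
  finally show ?thesis by simp
qed

end

section \<open>Leaves, matchings and weights in a forest\<close>

locale oriented_forest = oriented_graph +
  assumes acyclic: "\<not> (\<exists>vs. distinct vs \<and> 3 \<le> length vs \<and> successively adj vs \<and> adj (last vs) (hd vs))"
begin

lemma no_triangle: "adj a b \<Longrightarrow> adj b c \<Longrightarrow> adj c a \<Longrightarrow> False"
  using acyclic[unfolded not_ex, rule_format, of "[a, b, c]"] adj_irrefl by auto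

lemma no_square: "adj a b \<Longrightarrow> adj b c \<Longrightarrow> adj c d' \<Longrightarrow> adj d' a \<Longrightarrow> a \<noteq> c \<Longrightarrow> b \<noteq> d' \<Longrightarrow> False"
  using acyclic[unfolded not_ex, rule_format, of "[a, b, c, d']"] adj_irrefl by auto

text \<open>The set of all \<open>x i\<close> is a strong cover with \<open>r\<close> elements. The
  other cover contains both vertices of the pair \<open>i0\<close>: its complement \<open>S\<close>
  takes one vertex from every other pair, namely \<open>x k\<close> when it points to
  \<open>x i0\<close>, and \<open>y k\<close> otherwise. Here \<open>y i0\<close> is supported by
  \<open>x i0\<close>, whose weight leaves it a positive \<open>cover_exp\<close>.\<close>

lemma whiskered_strong_covers:
  assumes w: "whiskered r x y" and i0: "i0 \<in> {1..r}" and e: "(x i0, y i0) \<in> E" and d: "2 \<le> d (x i0)"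
  shows "\<exists>C C'. strong_cover C \<and> strong_cover C' \<and> card C = r \<and> card C' = r + 1"
proof -
  have inj_x: "inj_on x {1..r}" and inj_y: "inj_on y {1..r}" and disj: "x ` {1..r} \<inter> y ` {1..r} = {}"
    and V: "V = x ` {1..r} \<union> y ` {1..r}" and leaf: "\<And>i u. i \<in> {1..r} \<Longrightarrow> adj (y i) u \<longleftrightarrow> u = x i"
    using w unfolding whiskered_def by auto
  have nxy: "x i \<noteq> y j" if "i \<in> {1..r}" "j \<in> {1..r}" for i j using disj that by blast
  have xV: "x i \<in> V" "y i \<in> V" if "i \<in> {1..r}" for i using V that by auto
  define T where "T = {z. (z, x i0) \<in> E}"
  define f where "f = (\<lambda>k. if x k \<in> T then x k else y k)"
  define S where "S = f ` ({1..r} - {i0})"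
  have Tadj: "adj z (x i0)" if "z \<in> T" for z using that by (simp add: T_def adj_def)
  have Tx: "\<exists>k\<in>{1..r} - {i0}. z = x k" if z: "z \<in> T" for z
  proof -
    have "z \<in> V" using z E_sub by (auto simp: T_def)
    then consider k where "k \<in> {1..r}" "z = x k" | k where "k \<in> {1..r}" "z = y k" using V by blast
    then show ?thesis
    proof cases
      case 1
      then have "k \<noteq> i0" using Tadj[OF z] adj_irrefl by auto
      then show ?thesis using 1 by blast
    next
      case 2
      then have "x i0 = x k" using Tadj[OF z] leaf by blast
      then have "i0 = k" using inj_x i0 2 by (auto dest: inj_onD)
      then have "(y i0, x i0) \<in> E" using z 2 by (simp add: T_def)
      then show ?thesis using e orient by blast
    qed
  qed
  have TS: "T \<subseteq> S"
  proof
    fix z assume z: "z \<in> T"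
    then obtain k where "k \<in> {1..r} - {i0}" "z = x k" using Tx by blast
    then show "z \<in> S" using z unfolding S_def f_def by (intro image_eqI[of _ _ k]) auto
  qed
  have inj_f: "inj_on f ({1..r} - {i0})"
  proof (rule inj_onI)
    fix a b assume ab: "a \<in> {1..r} - {i0}" "b \<in> {1..r} - {i0}" "f a = f b"
    then have "x a = x b \<or> y a = y b" using nxy[of a b] nxy[of b a] by (auto simp: f_def split: if_splits)
    then show "a = b" using ab inj_x inj_y by (auto dest: inj_onD)
  qed
  have cardS: "card S = r - 1" unfolding S_def using inj_f i0 by (simp add: card_image)
  have SV: "S \<subseteq> V" unfolding S_def f_def using xV by auto
  have x0: "x i0 \<notin> S"
  proof
    assume "x i0 \<in> S"
    then obtain k where k: "k \<in> {1..r} - {i0}" "x i0 = f k" unfolding S_def by blast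
    then have "x i0 = x k" using nxy[of i0 k] i0 by (auto simp: f_def split: if_splits)
    then show False using k(1) i0 inj_x by (auto dest: inj_onD)
  qed
  have y0: "y i0 \<notin> S"
  proof
    assume "y i0 \<in> S"
    then obtain k where k: "k \<in> {1..r} - {i0}" "y i0 = f k" unfolding S_def by blast
    then have "y i0 = y k" using nxy[of k i0] i0 by (auto simp: f_def split: if_splits)
    then show False using k(1) i0 inj_y by (auto dest: inj_onD)
  qed
  \<comment> \<open>A source would have weight 1; hence some vertex points to \<open>x i0\<close>,
    and it is what supports \<open>x i0\<close> itself in the larger cover.\<close>
  have "T \<noteq> {}"
  proof
    assume "T = {}"
    then have "d (x i0) = 1" using d_source[OF xV(1)[OF i0]] by (auto simp: T_def)
    then show False using d by simp
  qed
  then obtain z where z: "z \<in> T" by blast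
  let ?C' = "V - S"
  have nbr: "w \<in> T" if "w \<in> S" "adj (x i0) w" for w
  proof -
    obtain k where k: "k \<in> {1..r} - {i0}" "w = f k" using \<open>w \<in> S\<close> unfolding S_def by blast
    show ?thesis
    proof (cases "x k \<in> T")
      case True
      then show ?thesis using k by (simp add: f_def)
    next
      case False
      then have "adj (y k) (x i0)" using k that(2) adj_sym by (simp add: f_def)
      then have "x i0 = x k" using leaf k(1) by blast
      then show ?thesis using k(1) i0 inj_x by (auto dest: inj_onD)
    qed
  qed
  \<comment> \<open>All neighbours of \<open>x i0\<close> in \<open>S\<close> point towards it, so
    no edge from \<open>x i0\<close> leaves the cover and the exponent is
    \<open>d (x i0) - 1\<close>.\<close>
  have exp0: "1 \<le> cover_exp ?C' (x i0)"
  proof -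
    have "w \<in> ?C'" if "(x i0, w) \<in> E" for w
    proof (rule ccontr)
      assume "w \<notin> ?C'"
      then have "w \<in> S" using E_sub[OF that] by blast
      then have "w \<in> T" using nbr that by (simp add: adj_def)
      then show False using that orient by (simp add: T_def)
    qed
    then show ?thesis using d by (auto simp: cover_exp_def)
  qed
  have "strong_cover ?C'"
    unfolding strong_cover_def
  proof (intro conjI ballI)
    fix e' assume e': "e' \<in> E"
    obtain u v where uv: "e' = (u, v)" by (cases e')
    have a: "adj u v" using e' uv by (simp add: adj_def)
    have "\<not> (u \<in> S \<and> v \<in> S)"
    proof
      assume uvS: "u \<in> S \<and> v \<in> S"
      then obtain k l where k: "k \<in> {1..r} - {i0}" "u = f k" and l: "l \<in> {1..r} - {i0}" "v = f l"
        unfolding S_def by blast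
      consider "x k \<in> T" "x l \<in> T" | "x k \<notin> T" | "x l \<notin> T" by blast
      then show False
      proof cases
        \<comment> \<open>Two adjacent vertices that both point to \<open>x i0\<close> would form a
          triangle with it.\<close>
        case 1
        then have "adj u (x i0)" "adj v (x i0)" using Tadj k l by (simp_all add: f_def)
        then show False using no_triangle[OF a] adj_sym by blast
      next
        case 2
        then have "v = x k" using a k leaf by (simp add: f_def)
        then show False using l 2 nxy[of k l] k(1) inj_x by (auto simp: f_def split: if_splits)
      next
        case 3
        then have "u = x l" using adj_sym[OF a] l leaf by (simp add: f_def)
        then show False using k 3 nxy[of l k] l(1) by (auto simp: f_def split: if_splits)
      qed
    qed
    then show "case e' of (u, v) \<Rightarrow> u \<in> ?C' \<or> v \<in> ?C'" using uv E_sub e' by auto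
  next
    fix v assume v: "v \<in> ?C'"
    show "(\<exists>w. (v, w) \<in> E \<and> w \<notin> ?C') \<or> (\<exists>u. (u, v) \<in> E \<and> (u \<notin> ?C' \<or> 1 \<le> cover_exp ?C' u))"
    proof (cases "v = y i0")
      case True
      then show ?thesis using e exp0 by blast
    next
      case False
      have "\<exists>s\<in>S. adj v s"
      proof (cases "v = x i0")
        case True
        then show ?thesis using z Tadj adj_sym TS by blast
      next
        case False
        then obtain k where k: "k \<in> {1..r} - {i0}" "v = x k \<or> v = y k"
          using v V \<open>v \<noteq> y i0\<close> by blast
        have "f k \<in> S" using k(1) by (simp add: S_def)
        moreover have "adj v (f k)"
          using k v \<open>f k \<in> S\<close> leaf[of k] adj_sym by (auto simp: f_def split: if_splits)
        ultimately show ?thesis by blast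
      qed
      then show ?thesis using SV by (auto simp: adj_def)
    qed
  qed auto
  moreover have "card ?C' = r + 1"
    using whiskered_card[OF w] cardS i0 SV finite_V by (simp add: card_Diff_subset finite_subset)
  moreover have "strong_cover (V - y ` {1..r})"
  proof (rule strong_cover_max_indep, unfold max_indep_def indep_def, intro conjI ballI)
    show "\<not> adj u v" if "u \<in> y ` {1..r}" "v \<in> y ` {1..r}" for u v
      using that leaf nxy by fastforce
    fix v assume "v \<in> V - y ` {1..r}"
    then obtain i where "i \<in> {1..r}" "v = x i" using V by blast
    then show "\<exists>s\<in>y ` {1..r}. adj v s" using whiskered_adj[OF w] by blast
  qed (use V in blast)
  moreover have "card (V - y ` {1..r}) = r"
  proof -
    have "V - y ` {1..r} = x ` {1..r}" using V disj by blast
    then show ?thesis using inj_x by (simp add: card_image)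
  qed
  ultimately show ?thesis by blast
qed

text \<open>The first vertex of a longest path has all its neighbours on the path, and any neighbour
  other than the second vertex would close a cycle.\<close>

lemma leaf_exists:
  assumes W: "finite W" "W \<noteq> {}" "\<And>w. w \<in> W \<Longrightarrow> \<exists>u\<in>W. adj w u"
  shows "\<exists>y\<in>W. \<exists>x\<in>W. \<forall>u\<in>W. adj y u \<longleftrightarrow> u = x"
proof -
  let ?P = "\<lambda>vs. vs \<noteq> [] \<and> distinct vs \<and> set vs \<subseteq> W \<and> successively adj vs"
  obtain w where "w \<in> W" using W(2) by blast
  then have "?P [w]" by simp
  moreover have "length vs < Suc (card W)" if "?P vs" for vs
    using that distinct_card[of vs] card_mono[OF W(1), of "set vs"] by simp
  ultimately obtain vs where vs: "?P vs" and max: "\<And>us. ?P us \<Longrightarrow> length us \<le> length vs"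
    using ex_has_greatest_nat[of ?P "[w]" length "Suc (card W)"] by blast
  obtain y r where r: "vs = y # r" using vs by (cases vs) auto
  have yW: "y \<in> W" using vs r by simp
  have in_path: "u \<in> set vs" if u: "u \<in> W" "adj y u" for u
  proof (rule ccontr)
    assume "u \<notin> set vs"
    then have "?P (u # vs)" using vs u adj_sym r by simp
    then show False using max by fastforce
  qed
  obtain u0 where u0: "u0 \<in> W" "adj y u0" using W(3) yW by blast
  have "r \<noteq> []" using in_path[OF u0] u0 adj_irrefl r by auto
  then obtain x r' where r': "r = x # r'" by (cases r) auto
  have x: "x \<in> W" "adj y x" using vs r r' by simp_all
  have "u = x" if u: "u \<in> W" "adj y u" for u
  proof (rule ccontr)
    assume "u \<noteq> x"
    moreover have "u \<noteq> y" using u adj_irrefl by auto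
    ultimately have "u \<in> set r'" using in_path[OF u] r r' by simp
    then obtain r1 r2 where r1: "r' = r1 @ u # r2" by (meson split_list)
    let ?c = "y # x # r1 @ [u]"
    have vs_eq: "vs = ?c @ r2" using r r' r1 by simp
    have vs': "distinct (?c @ r2)" "successively adj (?c @ r2)" using vs vs_eq by simp_all
    have "distinct ?c" using vs'(1) by (rule distinct_append[THEN iffD1, THEN conjunct1])
    moreover have "successively adj ?c"
      using vs'(2) by (rule successively_append_iff[THEN iffD1, THEN conjunct1])
    moreover have "adj (last ?c) (hd ?c)" using u adj_sym by simp
    moreover have "3 \<le> length ?c" by simp
    ultimately show False using acyclic by blast
  qed
  then show ?thesis using yW x by blast
qed

text \<open>The induction must preserve that maximal independent sets have equal size and that no
  vertex is isolated. The value \<open>card M\<close> is carried along because \<open>y\<close> is a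
  leaf of \<open>W\<close> only; leaves of the whole forest are later recovered from this value in
  \<open>matching_edge_has_leaf\<close>.\<close>

lemma well_covered_matching:
  assumes "W \<subseteq> V" "\<And>w. w \<in> W \<Longrightarrow> \<exists>u\<in>W. adj w u"
    and "\<And>S T. max_indep W S \<Longrightarrow> max_indep W T \<Longrightarrow> card S = card T"
  shows "\<exists>M. finite M \<and> M \<subseteq> {{u, v} | u v. adj u v} \<and> disjoint M \<and> \<Union>M = W \<and>
    (\<forall>S. max_indep W S \<longrightarrow> card S = card M)"
  using assms
proof (induction "card W" arbitrary: W rule: less_induct)
  case less
  have finW: "finite W" using less.prems(1) finite_V by (rule finite_subset)
  show ?case
  proof (cases "W = {}")
    case True
    then show ?thesis by (intro exI[of _ "{}"]) (auto simp: max_indep_def disjoint_def)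
  next
    case False
    obtain y x where yx: "y \<in> W" "x \<in> W" "\<And>u. u \<in> W \<Longrightarrow> adj y u \<longleftrightarrow> u = x"
      using leaf_exists[OF finW False less.prems(2)] by blast
    have axy: "adj y x" "x \<noteq> y" using yx adj_irrefl by auto
    define W' where "W' = W - {x, y}"
    have W'W: "W' \<subseteq> W" "finite W'" "card W' < card W"
      using finW yx by (auto simp: W'_def intro: psubset_card_mono)
    \<comment> \<open>A vertex \<open>w\<close> that became isolated would be pendant at
      \<open>x\<close>; a maximal independent set through \<open>x\<close> could then trade
      \<open>x\<close> for \<open>y\<close> and \<open>w\<close> and grow.\<close>
    have no_iso: "\<exists>u\<in>W'. adj w u" if w: "w \<in> W'" for w
    proof (rule ccontr)
      assume n: "\<not> ?thesis"
      have wy: "\<not> adj w y" "\<not> adj y w" using yx(3)[of w] w adj_sym by (auto simp: W'_def)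
      have w_nbr: "u = x" if "u \<in> W" "adj w u" for u using n that wy by (auto simp: W'_def)
      then have wx: "adj w x" using less.prems(2)[of w] w by (auto simp: W'_def)
      obtain S where S: "{x} \<subseteq> S" "max_indep W S"
        using max_indep_extend[OF finW, of "{x}"] yx adj_irrefl by (auto simp: indep_def)
      have SW: "S \<subseteq> W" "indep S" using S by (auto simp: max_indep_def)
      have nS: "y \<notin> S" "w \<notin> S" using SW S(1) axy wx by (auto simp: indep_def)
      define S' where "S' = insert y (insert w (S - {x}))"
      have "indep S'"
      proof -
        have "\<not> adj y s" "\<not> adj w s" if "s \<in> S - {x}" for s
          using that SW yx(3)[of s] w_nbr[of s] by auto
        then show ?thesis using SW(2) wy adj_irrefl adj_sym unfolding indep_def S'_def by blast
      qed
      moreover have "S' \<subseteq> W" using SW w yx by (auto simp: S'_def W'_def)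
      ultimately obtain T where T: "S' \<subseteq> T" "max_indep W T" using max_indep_extend[OF finW] by blast
      have finS: "finite S" and finT: "finite T" using SW T finW finite_subset by (auto simp: max_indep_def)
      have "y \<noteq> w" using w by (auto simp: W'_def)
      then have "card S' = Suc (Suc (card (S - {x})))" using nS finS by (simp add: S'_def)
      also have "Suc (card (S - {x})) = card S" by (rule card_Suc_Diff1[OF finS]) (use S(1) in simp)
      finally have "card S < card T" using card_mono[OF finT T(1)] by simp
      then show False using less.prems(3)[OF S(2) T(2)] by simp
    qed
    \<comment> \<open>\<open>y\<close> dominates \<open>x\<close> and has no other neighbour in
      \<open>W\<close>, so adding it to a maximal independent set of \<open>W'\<close> keeps the set
      independent and maximal.\<close>
    have up: "max_indep W (insert y S)" "card (insert y S) = Suc (card S)" if S: "max_indep W' S" for S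
    proof -
      have S': "S \<subseteq> W'" "indep S" "\<And>w. w \<in> W' - S \<Longrightarrow> \<exists>s\<in>S. adj w s" using S by (auto simp: max_indep_def)
      have ny: "\<not> adj y s" "\<not> adj s y" if "s \<in> S" for s
        using yx(3)[of s] S'(1) that adj_sym by (auto simp: W'_def)
      show "max_indep W (insert y S)"
        unfolding max_indep_def
      proof (intro conjI ballI)
        show "insert y S \<subseteq> W" using S' yx W'W by blast
        show "indep (insert y S)" using S'(2) ny adj_irrefl by (auto simp: indep_def)
        fix w assume w: "w \<in> W - insert y S"
        show "\<exists>s\<in>insert y S. adj w s"
        proof (cases "w = x")
          case True
          then show ?thesis using axy adj_sym by blast
        next
          case False
          then show ?thesis using S'(3)[of w] w by (auto simp: W'_def)
        qed
      qed
      have "y \<notin> S" using S'(1) by (auto simp: W'_def)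
      then show "card (insert y S) = Suc (card S)" using finite_subset[OF S'(1) W'W(2)] by simp
    qed
    have "\<exists>M. finite M \<and> M \<subseteq> {{u, v} | u v. adj u v} \<and> disjoint M \<and> \<Union>M = W' \<and>
        (\<forall>S. max_indep W' S \<longrightarrow> card S = card M)"
    proof (rule less.hyps[OF W'W(3)])
      show "W' \<subseteq> V" using W'W less.prems(1) by blast
      show "\<exists>u\<in>W'. adj w u" if "w \<in> W'" for w by (rule no_iso[OF that])
      show "card S = card T" if "max_indep W' S" "max_indep W' T" for S T
        using less.prems(3)[OF up(1)[OF that(1)] up(1)[OF that(2)]] up(2)[OF that(1)] up(2)[OF that(2)] by simp
    qed
    then obtain M where M: "finite M" "M \<subseteq> {{u, v} | u v. adj u v}" "disjoint M" "\<Union>M = W'"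
      "\<And>S. max_indep W' S \<Longrightarrow> card S = card M" by blast
    have nM: "{x, y} \<inter> \<Union>M = {}" unfolding M(4) W'_def by blast
    obtain S0 where S0: "max_indep W' S0"
      using max_indep_extend[OF W'W(2), of "{}"] by (auto simp: indep_def)
    show ?thesis
    proof (intro exI[of _ "insert {x, y} M"] conjI allI impI)
      show "insert {x, y} M \<subseteq> {{u, v} | u v. adj u v}" using M(2) axy(1) adj_sym by blast
      show "disjoint (insert {x, y} M)" using M(3) nM by (auto simp: disjoint_def)
      show "\<Union>(insert {x, y} M) = W" using M(4) yx by (auto simp: W'_def)
      fix S assume S: "max_indep W S"
      have "{x, y} \<notin> M" using nM by blast
      then show "card S = card (insert {x, y} M)"
        using less.prems(3)[OF S up(1)[OF S0]] up(2)[OF S0] M(1) M(5)[OF S0] by simp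
    qed (use M in simp)
  qed
qed

text \<open>If both ends had further neighbours \<open>a'\<close> and \<open>b'\<close>, these would
  not be adjacent, as there is no 4-cycle. A maximal independent set through them avoids
  \<open>a\<close> and \<open>b\<close>, and with at most one vertex in each of the other matching
  edges it is smaller than \<open>card M\<close>.\<close>

lemma matching_edge_has_leaf:
  assumes M: "finite M" "M \<subseteq> {{u, v} | u v. adj u v}" "\<Union>M = V"
    and card: "\<And>S. max_indep V S \<Longrightarrow> card S = card M"
    and ab: "{a, b} \<in> M" "adj a b"
  shows "(\<forall>u. adj a u \<longrightarrow> u = b) \<or> (\<forall>u. adj b u \<longrightarrow> u = a)"
proof (rule ccontr)
  assume "\<not> ?thesis"
  then obtain a' b' where a': "adj a a'" "a' \<noteq> b" and b': "adj b b'" "b' \<noteq> a" by blast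
  have "\<not> adj a' b'" "\<not> adj b' a'"
    using no_square[of a' a b b'] a' b' ab(2) adj_sym by blast+
  then have i: "indep {a', b'}" using adj_irrefl by (auto simp: indep_def)
  have "{a', b'} \<subseteq> V" using a' b' adj_V by auto
  from max_indep_extend[OF finite_V this i]
  obtain S where S: "{a', b'} \<subseteq> S" "max_indep V S" by (elim exE conjE)
  have SV: "S \<subseteq> V" "indep S" using S by (auto simp: max_indep_def)
  have nS: "a \<notin> S" "b \<notin> S" using S(1) SV(2) a' b' by (auto simp: indep_def)
  have "\<forall>s\<in>S. \<exists>m\<in>M. s \<in> m" using SV M(3) by blast
  then obtain f where f: "\<And>s. s \<in> S \<Longrightarrow> f s \<in> M" "\<And>s. s \<in> S \<Longrightarrow> s \<in> f s" by metis
  have "inj_on f S"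
  proof (rule inj_onI)
    fix s t assume st: "s \<in> S" "t \<in> S" "f s = f t"
    obtain u v where uv: "f s = {u, v}" "adj u v" using f(1)[OF st(1)] M(2) by blast
    have "s \<in> {u, v}" "t \<in> {u, v}" using f(2) st uv(1) by auto
    then show "s = t" using SV(2) st(1,2) uv(2) adj_sym by (auto simp: indep_def)
  qed
  moreover have "f ` S \<subseteq> M - {{a, b}}" using f nS by fastforce
  ultimately have "card S \<le> card (M - {{a, b}})" using M(1) by (intro card_inj_on_le[of f]) auto
  also have "\<dots> < card M" using M(1) ab(1) by (intro psubset_card_mono) auto
  finally show False using card[OF S(2)] by simp
qed

theorem whiskered_if_strong_covers_equicardinal:
  assumes eq: "\<And>C C'. strong_cover C \<Longrightarrow> strong_cover C' \<Longrightarrow> card C = card C'"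
  shows "\<exists>r x y. whiskered r x y \<and> (\<forall>i\<in>{1..r}. (x i, y i) \<in> E \<longrightarrow> d (x i) = 1)"
proof -
  have wc: "card S = card T" if "max_indep V S" "max_indep V T" for S T
  proof -
    have sub: "S \<subseteq> V" "T \<subseteq> V" using that by (auto simp: max_indep_def)
    have "card (V - S) = card (V - T)" using eq strong_cover_max_indep that by blast
    then show ?thesis
      using sub finite_V card_mono[OF finite_V sub(1)] card_mono[OF finite_V sub(2)]
      by (simp add: card_Diff_subset finite_subset)
  qed
  have nbr: "\<exists>u\<in>V. adj w u" if "w \<in> V" for w
    using no_isolated[OF that] E_sub by (auto simp: adj_def)
  have "\<exists>M. finite M \<and> M \<subseteq> {{u, v} | u v. adj u v} \<and> disjoint M \<and> \<Union>M = V \<and>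
    (\<forall>S. max_indep V S \<longrightarrow> card S = card M)"
  proof (rule well_covered_matching[OF order_refl])
    show "\<exists>u\<in>V. adj w u" if "w \<in> V" for w by (rule nbr[OF that])
    show "card S = card T" if "max_indep V S" "max_indep V T" for S T by (rule wc[OF that])
  qed
  then obtain M where M: "finite M" "M \<subseteq> {{u, v} | u v. adj u v}" "disjoint M" "\<Union>M = V"
    and M_card: "\<forall>S. max_indep V S \<longrightarrow> card S = card M" by (elim exE conjE)
  note M = M M_card[rule_format]
  have "\<exists>x y. m = {x, y} \<and> (\<forall>u. adj y u \<longleftrightarrow> u = x)" if m: "m \<in> M" for m
  proof -
    obtain a b where ab: "m = {a, b}" "adj a b" using M(2) m by blast
    have "(\<forall>u. adj a u \<longrightarrow> u = b) \<or> (\<forall>u. adj b u \<longrightarrow> u = a)"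
      by (rule matching_edge_has_leaf[OF M(1,2,4,5)]) (use ab m in auto)
    then show ?thesis
    proof
      assume "\<forall>u. adj a u \<longrightarrow> u = b"
      then have "\<forall>u. adj a u \<longleftrightarrow> u = b" using ab(2) by blast
      moreover have "m = {b, a}" unfolding ab(1) by (rule insert_commute)
      ultimately show ?thesis by blast
    next
      assume "\<forall>u. adj b u \<longrightarrow> u = a"
      then have "\<forall>u. adj b u \<longleftrightarrow> u = a" using adj_sym[OF ab(2)] by blast
      then show ?thesis using ab(1) by blast
    qed
  qed
  then obtain X Y where XY: "\<And>m. m \<in> M \<Longrightarrow> m = {X m, Y m}"
    "\<And>m u. m \<in> M \<Longrightarrow> adj (Y m) u \<longleftrightarrow> u = X m" by metis
  define r where "r = card M"
  obtain g where g: "bij_betw g {1..r} M"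
    using finite_same_card_bij[of "{1..r}" M] M(1) by (auto simp: r_def)
  define x where "x = X \<circ> g"
  define y where "y = Y \<circ> g"
  have gM: "g i \<in> M" if "i \<in> {1..r}" for i using g that by (auto simp: bij_betw_def)
  have gi: "g i = {x i, y i}" if "i \<in> {1..r}" for i using XY(1)[OF gM[OF that]] by (simp add: x_def y_def)
  have meet: "i = j" if "i \<in> {1..r}" "j \<in> {1..r}" "g i \<inter> g j \<noteq> {}" for i j
  proof -
    have "g i = g j" using M(3) gM that unfolding disjoint_def by blast
    then show ?thesis using g that(1,2) by (auto simp: bij_betw_def dest: inj_onD)
  qed
  have leaf: "adj (y i) u \<longleftrightarrow> u = x i" if "i \<in> {1..r}" for i u
    using XY(2)[OF gM[OF that]] by (simp add: x_def y_def)
  have w: "whiskered r x y"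
    unfolding whiskered_def
  proof (intro conjI ballI allI)
    show "inj_on x {1..r}" "inj_on y {1..r}" using meet gi by (auto intro!: inj_onI)
    show "x ` {1..r} \<inter> y ` {1..r} = {}"
    proof (rule equals0I)
      fix v assume "v \<in> x ` {1..r} \<inter> y ` {1..r}"
      then obtain i j where ij: "i \<in> {1..r}" "j \<in> {1..r}" "v = x i" "v = y j" by blast
      then have "i = j" using meet[of i j] gi by auto
      then show False using leaf[of i "x i"] ij adj_irrefl by auto
    qed
    have "M = g ` {1..r}" using g by (simp add: bij_betw_def)
    then have "V = \<Union>(g ` {1..r})" using M(4) by simp
    then show "V = x ` {1..r} \<union> y ` {1..r}" using gi by auto
  qed (use leaf in blast)
  have "d (x i) = 1" if i: "i \<in> {1..r}" "(x i, y i) \<in> E" for i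
  proof (rule ccontr)
    assume "d (x i) \<noteq> 1"
    moreover have "1 \<le> d (x i)" using d_pos E_sub i(2) by blast
    ultimately have "2 \<le> d (x i)" by simp
    from whiskered_strong_covers[OF w i this] obtain C C' where
      "strong_cover C" "strong_cover C'" "card C = r" "card C' = r + 1" by blast
    then show False using eq[of C C'] by simp
  qed
  then show ?thesis using w by blast
qed

end

subsection \<open>Splitting the edge ideal of a whiskered graph\<close>

text \<open>The generators are \<open>x\<^sub>i ^ e\<^sub>i * y\<^sub>i ^ c\<^sub>i\<close> and, for \<open>(i, j) \<in> A\<close>,
  \<open>x\<^sub>i * x\<^sub>j ^ e\<^sub>j\<close>.\<close>
definition whisker_monomials ::
  "(nat \<Rightarrow> 'v) \<Rightarrow> (nat \<Rightarrow> 'v) \<Rightarrow> nat set \<Rightarrow> (nat \<Rightarrow> nat) \<Rightarrow> (nat \<Rightarrow> nat) \<Rightarrow> (nat \<times> nat) set \<Rightarrow>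
     ('v \<Rightarrow>\<^sub>0 nat) set" where
  "whisker_monomials x y N e c A =
     {m. \<exists>i\<in>N. e i \<le> Poly_Mapping.lookup m (x i) \<and> c i \<le> Poly_Mapping.lookup m (y i)} \<union>
     {m. \<exists>(i, j)\<in>A. 1 \<le> Poly_Mapping.lookup m (x i) \<and> e j \<le> Poly_Mapping.lookup m (x j)}"

lemma up_closed_whisker_monomials: "up_closed (whisker_monomials x y N e c A)"
  unfolding up_closed_def whisker_monomials_def lookup_add
  by (auto simp: lookup_add intro: trans_le_add1)

text \<open>For adding a variable: if the \<open>i\<close>-th generator is replaced by the variable
  dividing it, the existential over all generators gains exactly one disjunct.\<close>

lemma bex_update:
  "i \<in> N \<Longrightarrow> (P i \<Longrightarrow> S) \<Longrightarrow> (\<And>k. k \<noteq> i \<Longrightarrow> P' k \<longleftrightarrow> P k) \<Longrightarrow> (P' i \<longleftrightarrow> S) \<Longrightarrow>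
    (\<exists>k\<in>N. P' k) \<longleftrightarrow> (\<exists>k\<in>N. P k) \<or> S"
  by metis

text \<open>Passing to the colon by \<open>x\<^sub>i\<close> or to the sum with \<open>x\<^sub>i\<close>, for \<open>(i, j) \<in> A\<close>, removes an element
  from \<open>A\<close> and does not increase \<open>e\<close> and \<open>c\<close>.\<close>
lemma whisker_induct:
  fixes x y :: "nat \<Rightarrow> 'v" and Q :: "('v \<Rightarrow>\<^sub>0 nat) set \<Rightarrow> bool"
  assumes N: "finite N" and inj: "inj_on x N" "inj_on y N" "x ` N \<inter> y ` N = {}"
    and univ: "Q UNIV"
    and base: "\<And>B. B \<subseteq> N \<Longrightarrow> Q (touching (x ` B \<union> y ` (N - B)))"
    and split: "\<And>U v. v \<in> x ` N \<union> y ` N \<Longrightarrow> up_closed U \<Longrightarrow>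
      Q {m. m + Poly_Mapping.single v 1 \<in> U} \<Longrightarrow> Q (U \<union> {m. 1 \<le> Poly_Mapping.lookup m v}) \<Longrightarrow> Q U"
    and A: "A \<subseteq> N \<times> N" "\<And>i j. (i, j) \<in> A \<Longrightarrow> i \<noteq> j \<and> 1 \<le> e i \<and> 1 \<le> e j"
  shows "Q (whisker_monomials x y N e c A)"
  using A
\<comment> \<open>Each splitting drops an element of \<open>A\<close> or, once \<open>A\<close> is
  empty, lowers a sum of exponents.\<close>
proof (induction "card A + (\<Sum>i\<in>N. e i + c i)" arbitrary: A e c rule: less_induct)
  case less
  let ?U = "whisker_monomials x y N e c A"
  have xeq: "x i = x j \<longleftrightarrow> i = j" "y i = y j \<longleftrightarrow> i = j" "x i \<noteq> y j" "y i \<noteq> x j" if "i \<in> N" "j \<in> N" for i j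
    using that inj by (auto dest: inj_onD)
  have finA: "finite A" using less.prems(1) N by (meson finite_SigmaI finite_subset)
  have AN: "i \<in> N" "j \<in> N" if "(i, j) \<in> A" for i j using that less.prems(1) by auto
  have lkx: "Poly_Mapping.lookup (m + Poly_Mapping.single (x i) 1) (x k) =
      (if k = i then Suc (Poly_Mapping.lookup m (x k)) else Poly_Mapping.lookup m (x k))"
    "Poly_Mapping.lookup (m + Poly_Mapping.single (x i) 1) (y k) = Poly_Mapping.lookup m (y k)"
    "Poly_Mapping.lookup (m + Poly_Mapping.single (y i) 1) (y k) =
      (if k = i then Suc (Poly_Mapping.lookup m (y k)) else Poly_Mapping.lookup m (y k))"
    "Poly_Mapping.lookup (m + Poly_Mapping.single (y i) 1) (x k) = Poly_Mapping.lookup m (x k)"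
    if "i \<in> N" "k \<in> N" for m i k
    using xeq[OF that] by (auto simp: lookup_add lookup_single when_def)
  show ?case
  proof (cases "A = {}")
    case False
    then obtain i j where ij: "(i, j) \<in> A" by auto
    note N' = AN[OF ij] and ij' = less.prems(2)[OF ij]
    show ?thesis
    proof (rule split[of "x i", OF _ up_closed_whisker_monomials])
      show "x i \<in> x ` N \<union> y ` N" using N' by blast
      \<comment> \<open>Adding \<open>x i\<close> replaces all generators divisible by it by
        \<open>x i\<close> itself, coded as a whisker with exponents 1 and 0; the pairs involving
        \<open>i\<close> disappear.\<close>
      define A' where "A' = {(k, l) \<in> A. k \<noteq> i \<and> l \<noteq> i}"
      have A'A: "A' \<subset> A" using ij by (auto simp: A'_def)
      have cA': "card A' < card A" by (rule psubset_card_mono[OF finA A'A])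
      define e1 where "e1 = e(i := 1)"
      define c1 where "c1 = c(i := 0)"
      have eq1: "?U \<union> {m. 1 \<le> Poly_Mapping.lookup m (x i)} = whisker_monomials x y N e1 c1 A'"
      proof (intro equalityI subsetI)
        fix m assume "m \<in> ?U \<union> {m. 1 \<le> Poly_Mapping.lookup m (x i)}"
        then consider "1 \<le> Poly_Mapping.lookup m (x i)"
          | k where "k \<in> N" "e k \<le> Poly_Mapping.lookup m (x k)" "c k \<le> Poly_Mapping.lookup m (y k)"
          | k l where "(k, l) \<in> A" "1 \<le> Poly_Mapping.lookup m (x k)" "e l \<le> Poly_Mapping.lookup m (x l)"
          unfolding whisker_monomials_def by blast
        then show "m \<in> whisker_monomials x y N e1 c1 A'"
        proof cases
          case 1
          then show ?thesis using N' unfolding whisker_monomials_def e1_def c1_def by auto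
        next
          case 2
          then have "e1 k \<le> Poly_Mapping.lookup m (x k)" "c1 k \<le> Poly_Mapping.lookup m (y k)"
            using ij' by (auto simp: e1_def c1_def)
          then show ?thesis using 2(1) unfolding whisker_monomials_def by blast
        next
          case 3
          show ?thesis
          proof (cases "k = i \<or> l = i")
            case True
            then have "1 \<le> Poly_Mapping.lookup m (x i)" using 3 ij' by auto
            then show ?thesis using N' unfolding whisker_monomials_def e1_def c1_def by auto
          next
            case False
            then have "(k, l) \<in> A'" "e1 l \<le> Poly_Mapping.lookup m (x l)" using 3 by (auto simp: A'_def e1_def)
            then show ?thesis using 3(2) unfolding whisker_monomials_def by blast
          qed
        qed
      next
        fix m assume "m \<in> whisker_monomials x y N e1 c1 A'"
        then consider k where "k \<in> N" "e1 k \<le> Poly_Mapping.lookup m (x k)" "c1 k \<le> Poly_Mapping.lookup m (y k)"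
          | k l where "(k, l) \<in> A'" "1 \<le> Poly_Mapping.lookup m (x k)" "e1 l \<le> Poly_Mapping.lookup m (x l)"
          unfolding whisker_monomials_def by blast
        then show "m \<in> ?U \<union> {m. 1 \<le> Poly_Mapping.lookup m (x i)}"
        proof cases
          case 1
          then show ?thesis
            by (cases "k = i") (auto simp: whisker_monomials_def e1_def c1_def)
        next
          case 2
          then have "(k, l) \<in> A" "e l \<le> Poly_Mapping.lookup m (x l)" by (auto simp: A'_def e1_def)
          then show ?thesis using 2(2) unfolding whisker_monomials_def by blast
        qed
      qed
      show "Q (?U \<union> {m. 1 \<le> Poly_Mapping.lookup m (x i)})"
        unfolding eq1
      proof (rule less.hyps)
        have "(\<Sum>k\<in>N. e1 k + c1 k) \<le> (\<Sum>k\<in>N. e k + c k)"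
          by (rule sum_mono) (use ij' in \<open>auto simp: e1_def c1_def\<close>)
        then show "card A' + (\<Sum>k\<in>N. e1 k + c1 k) < card A + (\<Sum>k\<in>N. e k + c k)" using cA' by simp
        show "A' \<subseteq> N \<times> N" using A'A less.prems(1) by blast
        show "k \<noteq> l \<and> 1 \<le> e1 k \<and> 1 \<le> e1 l" if "(k, l) \<in> A'" for k l
          using that less.prems(2)[of k l] by (auto simp: A'_def e1_def)
      qed
      \<comment> \<open>Division by \<open>x i\<close>: a pair \<open>(i, k)\<close> leaves the pure
        power of \<open>x k\<close> with exponent \<open>e k\<close>, so \<open>c k\<close> becomes
        0. A pair \<open>(k, i)\<close> merely loses one exponent at \<open>x i\<close>, unless
        \<open>e i = 1\<close>; then \<open>x k\<close> itself remains, and the pair turns into a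
        whisker with exponents 1 and 0.\<close>
      define A2 where "A2 = {(k, l) \<in> A. k \<noteq> i \<and> (l = i \<longrightarrow> 2 \<le> e i)}"
      define e2 where "e2 = (\<lambda>k. if k = i then e i - 1 else if e i = 1 \<and> (k, i) \<in> A then 1 else e k)"
      define c2 where "c2 = (\<lambda>k. if (i, k) \<in> A \<or> e i = 1 \<and> (k, i) \<in> A then 0 else c k)"
      have A2A: "A2 \<subset> A" using ij by (auto simp: A2_def)
      have cA2: "card A2 < card A" by (rule psubset_card_mono[OF finA A2A])
      have e2_le: "e2 k \<le> e k" "c2 k \<le> c k" for k
        using less.prems(2)[of k i] by (auto simp: e2_def c2_def)
      have c2i: "c2 i = c i" using less.prems(2)[of i i] by (auto simp: c2_def)
      have ii: "(i, i) \<notin> A" using less.prems(2)[of i i] by blast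
      have eq2: "{m. m + Poly_Mapping.single (x i) 1 \<in> ?U} = whisker_monomials x y N e2 c2 A2"
      proof (intro equalityI subsetI)
        fix m assume "m \<in> {m. m + Poly_Mapping.single (x i) 1 \<in> ?U}"
        then have "m + Poly_Mapping.single (x i) 1 \<in> ?U" by simp
        then consider k where "k \<in> N" "e k \<le> Poly_Mapping.lookup (m + Poly_Mapping.single (x i) 1) (x k)"
            "c k \<le> Poly_Mapping.lookup (m + Poly_Mapping.single (x i) 1) (y k)"
          | k l where "(k, l) \<in> A" "1 \<le> Poly_Mapping.lookup (m + Poly_Mapping.single (x i) 1) (x k)"
            "e l \<le> Poly_Mapping.lookup (m + Poly_Mapping.single (x i) 1) (x l)"
          unfolding whisker_monomials_def by blast
        then show "m \<in> whisker_monomials x y N e2 c2 A2"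
        proof cases
          case 1
          have "e2 k \<le> Poly_Mapping.lookup m (x k)"
          proof (cases "k = i")
            case True
            then show ?thesis using 1(2) unfolding lkx(1)[OF N'(1) 1(1)] by (simp add: e2_def)
          next
            case False
            then show ?thesis using 1(2) e2_le(1)[of k] unfolding lkx(1)[OF N'(1) 1(1)] by simp
          qed
          moreover have "c2 k \<le> Poly_Mapping.lookup m (y k)"
            using 1(3) e2_le(2)[of k] unfolding lkx(2)[OF N'(1) 1(1)] by simp
          ultimately show ?thesis using 1(1) unfolding whisker_monomials_def by blast
        next
          case 2
          note kl = AN[OF 2(1)] and kl' = less.prems(2)[OF 2(1)]
          note lk = lkx(1)[OF N'(1) kl(1), of m] lkx(1)[OF N'(1) kl(2), of m]
          have "e i = 1 \<or> 2 \<le> e i" using ij' by linarith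
          then consider "k = i" | "k \<noteq> i" "l = i" "e i = 1" | "k \<noteq> i" "l = i" "2 \<le> e i" | "k \<noteq> i" "l \<noteq> i"
            by blast
          then show ?thesis
          proof cases
            case 1
            then have "l \<noteq> i" "(i, l) \<in> A" using 2(1) kl' by auto
            then have "c2 l = 0" "e l \<le> Poly_Mapping.lookup m (x l)" using 2(3) lk by (auto simp: c2_def)
            then have "e2 l \<le> Poly_Mapping.lookup m (x l)" "c2 l \<le> Poly_Mapping.lookup m (y l)"
              using e2_le(1)[of l] by auto
            then show ?thesis using kl(2) unfolding whisker_monomials_def by blast
          next
            case c: 2
            then have "c2 k = 0" "e2 k = 1" "1 \<le> Poly_Mapping.lookup m (x k)"
              using 2 lk by (auto simp: c2_def e2_def)
            then have "e2 k \<le> Poly_Mapping.lookup m (x k)" "c2 k \<le> Poly_Mapping.lookup m (y k)" by simp_all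
            then show ?thesis using kl(1) unfolding whisker_monomials_def by blast
          next
            case c: 3
            then have "(k, l) \<in> A2" "1 \<le> Poly_Mapping.lookup m (x k)" "e2 l \<le> Poly_Mapping.lookup m (x l)"
              using 2 lk by (auto simp: A2_def e2_def)
            then show ?thesis unfolding whisker_monomials_def by blast
          next
            case c: 4
            then have "(k, l) \<in> A2" "1 \<le> Poly_Mapping.lookup m (x k)" "e2 l \<le> Poly_Mapping.lookup m (x l)"
              using 2 lk e2_le(1)[of l] by (auto simp: A2_def)
            then show ?thesis unfolding whisker_monomials_def by blast
          qed
        qed
      next
        fix m assume "m \<in> whisker_monomials x y N e2 c2 A2"
        then consider k where "k \<in> N" "e2 k \<le> Poly_Mapping.lookup m (x k)" "c2 k \<le> Poly_Mapping.lookup m (y k)"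
          | k l where "(k, l) \<in> A2" "1 \<le> Poly_Mapping.lookup m (x k)" "e2 l \<le> Poly_Mapping.lookup m (x l)"
          unfolding whisker_monomials_def by blast
        then have "m + Poly_Mapping.single (x i) 1 \<in> ?U"
        proof cases
          case 1
          note lk = lkx(1,2)[OF N'(1) 1(1), of m]
          consider "k = i" | "k \<noteq> i" "e i = 1" "(k, i) \<in> A" | "k \<noteq> i" "\<not> (e i = 1 \<and> (k, i) \<in> A)" "(i, k) \<in> A"
            | "k \<noteq> i" "\<not> (e i = 1 \<and> (k, i) \<in> A)" "(i, k) \<notin> A" by blast
          then show ?thesis
          proof cases
            case c: 1
            then have "e k \<le> Poly_Mapping.lookup (m + Poly_Mapping.single (x i) 1) (x k)"
              "c k \<le> Poly_Mapping.lookup (m + Poly_Mapping.single (x i) 1) (y k)"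
              using 1 lk c2i by (auto simp: e2_def)
            then show ?thesis using 1(1) unfolding whisker_monomials_def by blast
          next
            case c: 2
            then have "1 \<le> Poly_Mapping.lookup (m + Poly_Mapping.single (x i) 1) (x k)"
              "e i \<le> Poly_Mapping.lookup (m + Poly_Mapping.single (x i) 1) (x i)"
              using 1 lk lkx(1)[OF N'(1) N'(1), of m] by (auto simp: e2_def)
            then show ?thesis using c(3) unfolding whisker_monomials_def by blast
          next
            case c: 3
            then have "e k \<le> Poly_Mapping.lookup (m + Poly_Mapping.single (x i) 1) (x k)"
              "1 \<le> Poly_Mapping.lookup (m + Poly_Mapping.single (x i) 1) (x i)"
              using 1 lk lkx(1)[OF N'(1) N'(1), of m] by (auto simp: e2_def)
            then show ?thesis using c(3) unfolding whisker_monomials_def by blast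
          next
            case c: 4
            then have "e k \<le> Poly_Mapping.lookup (m + Poly_Mapping.single (x i) 1) (x k)"
              "c k \<le> Poly_Mapping.lookup (m + Poly_Mapping.single (x i) 1) (y k)"
              using 1 lk by (auto simp: e2_def c2_def split: if_splits)
            then show ?thesis using 1(1) unfolding whisker_monomials_def by blast
          qed
        next
          case 2
          then have kA: "(k, l) \<in> A" "k \<noteq> i" "l = i \<longrightarrow> 2 \<le> e i" by (auto simp: A2_def)
          note kl = AN[OF kA(1)]
          note lk = lkx(1)[OF N'(1) kl(1), of m] lkx(1)[OF N'(1) kl(2), of m]
          show ?thesis
          \<comment> \<open>Here \<open>e2 l\<close> may be 1 instead of \<open>e l\<close>; in that
            case the generator of the pair \<open>(l, i)\<close> takes over.\<close>
          proof (cases "e i = 1 \<and> (l, i) \<in> A \<and> l \<noteq> i")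
            case True
            then have "1 \<le> Poly_Mapping.lookup (m + Poly_Mapping.single (x i) 1) (x l)"
              "e i \<le> Poly_Mapping.lookup (m + Poly_Mapping.single (x i) 1) (x i)"
              using 2 lk lkx(1)[OF N'(1) N'(1), of m] by (auto simp: e2_def)
            then show ?thesis using True unfolding whisker_monomials_def by blast
          next
            case False
            then have "1 \<le> Poly_Mapping.lookup (m + Poly_Mapping.single (x i) 1) (x k)"
              "e l \<le> Poly_Mapping.lookup (m + Poly_Mapping.single (x i) 1) (x l)"
              using 2 lk kA ii by (auto simp: e2_def split: if_splits)
            then show ?thesis using kA(1) unfolding whisker_monomials_def by blast
          qed
        qed
        then show "m \<in> {m. m + Poly_Mapping.single (x i) 1 \<in> ?U}" by simp
      qed
      show "Q {m. m + Poly_Mapping.single (x i) 1 \<in> ?U}"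
        unfolding eq2
      proof (rule less.hyps)
        have "(\<Sum>k\<in>N. e2 k + c2 k) \<le> (\<Sum>k\<in>N. e k + c k)"
          by (rule sum_mono) (intro add_mono e2_le)
        then show "card A2 + (\<Sum>k\<in>N. e2 k + c2 k) < card A + (\<Sum>k\<in>N. e k + c k)" using cA2 by simp
        show "A2 \<subseteq> N \<times> N" using A2A less.prems(1) by blast
        show "k \<noteq> l \<and> 1 \<le> e2 k \<and> 1 \<le> e2 l" if "(k, l) \<in> A2" for k l
          using that less.prems(2)[of k l] by (auto simp: A2_def e2_def)
      qed
    qed
  next
    case True
    have wm: "whisker_monomials x y N e c {} =
        {m. \<exists>i\<in>N. e i \<le> Poly_Mapping.lookup m (x i) \<and> c i \<le> Poly_Mapping.lookup m (y i)}" for e c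
      by (simp add: whisker_monomials_def)
    have U: "?U = {m. \<exists>i\<in>N. e i \<le> Poly_Mapping.lookup m (x i) \<and> c i \<le> Poly_Mapping.lookup m (y i)}"
      unfolding True by (rule wm)
    have lt: "(\<Sum>k\<in>N. e' k + c' k) < (\<Sum>k\<in>N. e k + c k)"
      if i: "i \<in> N" and that: "\<And>k. k \<noteq> i \<Longrightarrow> e' k = e k \<and> c' k = c k" "e' i + c' i < e i + c i" for e' c' i
    proof (rule sum_strict_mono_ex1[OF N])
      have "e' k + c' k \<le> e k + c k" for k
        using that(1)[of k] that(2) by (cases "k = i") simp_all
      then show "\<forall>k\<in>N. e' k + c' k \<le> e k + c k" by blast
      show "\<exists>k\<in>N. e' k + c' k < e k + c k" using that(2) i by blast
    qed
    \<comment> \<open>Only monomials in disjoint pairs of variables are left. A zero exponent sum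
      means the unit ideal, sums all equal to 1 mean an ideal of variables, and a sum of at least 2
      can be split at a variable that occurs.\<close>
    consider i where "i \<in> N" "e i + c i = 0" | i where "i \<in> N" "2 \<le> e i + c i" "1 \<le> e i"
      | i where "i \<in> N" "2 \<le> e i + c i" "e i = 0" | "\<forall>i\<in>N. e i + c i = 1"
      by (metis One_nat_def Suc_1 Suc_leI less_2_cases linorder_not_le not_gr_zero)
    then show ?thesis
    proof cases
      case 1
      then have "m \<in> ?U" for m unfolding U by (intro CollectI bexI[of _ i]) simp_all
      then have "?U = UNIV" by blast
      then show ?thesis using univ by simp
    next
      case 4
      define B where "B = {i \<in> N. e i = 1}"
      have "?U = touching (x ` B \<union> y ` (N - B))"
        unfolding U touching_def
      proof (intro Collect_cong)
        fix m
        have "(e i \<le> Poly_Mapping.lookup m (x i) \<and> c i \<le> Poly_Mapping.lookup m (y i)) \<longleftrightarrow>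
            1 \<le> Poly_Mapping.lookup m (if i \<in> B then x i else y i)" if "i \<in> N" for i
        proof -
          have "e i = 1 \<and> c i = 0 \<or> e i = 0 \<and> c i = 1" using 4 that by force
          then show ?thesis using that by (auto simp: B_def)
        qed
        then have "(\<exists>i\<in>N. e i \<le> Poly_Mapping.lookup m (x i) \<and> c i \<le> Poly_Mapping.lookup m (y i)) \<longleftrightarrow>
            (\<exists>i\<in>N. 1 \<le> Poly_Mapping.lookup m (if i \<in> B then x i else y i))"
          by (intro bex_cong refl) blast
        also have "\<dots> \<longleftrightarrow> (\<exists>v\<in>(\<lambda>i. if i \<in> B then x i else y i) ` N. 1 \<le> Poly_Mapping.lookup m v)"
          by (simp only: bex_simps)
        also have "(\<lambda>i. if i \<in> B then x i else y i) ` N = x ` B \<union> y ` (N - B)"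
          unfolding B_def by (auto simp: image_iff)
        finally show "(\<exists>i\<in>N. e i \<le> Poly_Mapping.lookup m (x i) \<and> c i \<le> Poly_Mapping.lookup m (y i)) \<longleftrightarrow>
            (\<exists>v\<in>x ` B \<union> y ` (N - B). 1 \<le> Poly_Mapping.lookup m v)" .
      qed
      moreover have "B \<subseteq> N" by (auto simp: B_def)
      ultimately show ?thesis using base by simp
    next
      case (2 i)
      show ?thesis
      proof (rule split[of "x i", OF _ up_closed_whisker_monomials])
        show "x i \<in> x ` N \<union> y ` N" using 2 by blast
        have eq: "{m. m + Poly_Mapping.single (x i) 1 \<in> ?U} = whisker_monomials x y N (e(i := e i - 1)) c {}"
          unfolding U wm mem_Collect_eq
        proof (intro Collect_cong bex_cong refl)
          fix m k assume k: "k \<in> N"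
          show "(e k \<le> Poly_Mapping.lookup (m + Poly_Mapping.single (x i) 1) (x k) \<and>
              c k \<le> Poly_Mapping.lookup (m + Poly_Mapping.single (x i) 1) (y k)) \<longleftrightarrow>
            (e(i := e i - 1)) k \<le> Poly_Mapping.lookup m (x k) \<and> c k \<le> Poly_Mapping.lookup m (y k)"
            unfolding lkx[OF 2(1) k] using 2 by auto
        qed
        show "Q {m. m + Poly_Mapping.single (x i) 1 \<in> ?U}"
          unfolding eq by (rule less.hyps) (use 2 True lt[OF 2(1), of "e(i := e i - 1)" c] in auto)
        have eq': "?U \<union> {m. 1 \<le> Poly_Mapping.lookup m (x i)} = whisker_monomials x y N (e(i := 1)) (c(i := 0)) {}"
          unfolding U wm Collect_disj_eq[symmetric] using 2 by (intro Collect_cong bex_update[symmetric]) auto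
        show "Q (?U \<union> {m. 1 \<le> Poly_Mapping.lookup m (x i)})"
          unfolding eq' by (rule less.hyps) (use 2 True lt[OF 2(1), of "e(i := 1)" "c(i := 0)"] in auto)
      qed
    next
      case (3 i)
      show ?thesis
      proof (rule split[of "y i", OF _ up_closed_whisker_monomials])
        show "y i \<in> x ` N \<union> y ` N" using 3 by blast
        have eq: "{m. m + Poly_Mapping.single (y i) 1 \<in> ?U} = whisker_monomials x y N e (c(i := c i - 1)) {}"
          unfolding U wm mem_Collect_eq
        proof (intro Collect_cong bex_cong refl)
          fix m k assume k: "k \<in> N"
          show "(e k \<le> Poly_Mapping.lookup (m + Poly_Mapping.single (y i) 1) (x k) \<and>
              c k \<le> Poly_Mapping.lookup (m + Poly_Mapping.single (y i) 1) (y k)) \<longleftrightarrow>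
            e k \<le> Poly_Mapping.lookup m (x k) \<and> (c(i := c i - 1)) k \<le> Poly_Mapping.lookup m (y k)"
            unfolding lkx[OF 3(1) k] using 3 by auto
        qed
        show "Q {m. m + Poly_Mapping.single (y i) 1 \<in> ?U}"
          unfolding eq by (rule less.hyps) (use 3 True lt[OF 3(1), of e "c(i := c i - 1)"] in auto)
        have eq': "?U \<union> {m. 1 \<le> Poly_Mapping.lookup m (y i)} = whisker_monomials x y N (e(i := 0)) (c(i := 1)) {}"
          unfolding U wm Collect_disj_eq[symmetric] using 3 by (intro Collect_cong bex_update[symmetric]) auto
        show "Q (?U \<union> {m. 1 \<le> Poly_Mapping.lookup m (y i)})"
          unfolding eq' by (rule less.hyps) (use 3 True lt[OF 3(1), of "e(i := 0)" "c(i := 1)"] in auto)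
      qed
    qed
  qed
qed

subsection \<open>Regular sequences modulo the edge ideal\<close>

text \<open>\<open>L\<close> is then extended from the polynomials without \<open>w\<close>, so that
  the quotient by it is a polynomial ring in \<open>w\<close>.\<close>

definition var_closed :: "'v \<Rightarrow> ('v, 'k::field) mpoly set \<Rightarrow> bool" where
  "var_closed w L \<longleftrightarrow> (\<forall>f\<in>L. \<forall>t. poly.coeff (uni w f) t \<in> L)"

text \<open>Take the highest coefficient of \<open>f\<close>, at \<open>s\<close>, that is not in
  \<open>L\<close>. The coefficient of the product at \<open>degree P + s\<close> is this
  coefficient plus an element of \<open>L\<close>, since \<open>P\<close> is monic.\<close>

lemma monic_regular:
  fixes V :: "'v set" and L :: "('v, 'k::field) mpoly set"
  assumes L: "ideal_on (polys V) L" "var_closed w L" and w: "w \<in> V"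
    and P: "coeffs_in (polys {}) P" "lead_coeff P = 1"
    and f: "f \<in> polys V" "poly P (var w) * f \<in> L"
  shows "f \<in> L"
proof -
  let ?F = "uni w f"
  have L0: "0 \<in> L" using L(1) by (simp add: ideal_on_def)
  have PS: "poly.coeff P i \<in> polys V" for i
    using coeffs_inD[OF P(1), of i] polys_mono[of "{}" V] by blast
  have FS: "poly.coeff ?F i \<in> polys V" for i
    using coeff_uni_mem[OF f(1), of w i] polys_mono[of "V - {w}" V] by blast
  have "uni w (poly P (var w)) = P" by (rule uni_poly[of _ "{}"]) (use P(1) in \<open>simp_all add: coeffs_in_def\<close>)
  then have PF: "poly.coeff (P * ?F) t \<in> L" for t
    using L(2) f(2) unfolding var_closed_def by (metis uni_mult)
  have F: "poly.coeff ?F t \<in> L" for t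
  proof (rule ccontr)
    assume t: "poly.coeff ?F t \<notin> L"
    define T where "T = {t. poly.coeff ?F t \<notin> L}"
    have "T \<subseteq> {..Polynomial.degree ?F}" using L0 le_degree[of ?F] by (force simp: T_def)
    then have finT: "finite T" by (rule finite_subset) simp
    define s where "s = Max T"
    have s: "s \<in> T" "\<And>u. s < u \<Longrightarrow> poly.coeff ?F u \<in> L"
      using Max_in[OF finT] Max_ge[OF finT] t by (force simp: s_def T_def)+
    let ?n = "Polynomial.degree P + s"
    have "poly.coeff (P * ?F) ?n = (\<Sum>i\<le>?n. poly.coeff P i * poly.coeff ?F (?n - i))"
      by (rule coeff_mult)
    also have "\<dots> = poly.coeff ?F s +
        (\<Sum>i\<in>{..?n} - {Polynomial.degree P}. poly.coeff P i * poly.coeff ?F (?n - i))"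
      using P(2) by (subst sum.remove[of _ "Polynomial.degree P"]) simp_all
    finally have eq: "poly.coeff (P * ?F) ?n = poly.coeff ?F s +
        (\<Sum>i\<in>{..?n} - {Polynomial.degree P}. poly.coeff P i * poly.coeff ?F (?n - i))" .
    have "(\<Sum>i\<in>{..?n} - {Polynomial.degree P}. poly.coeff P i * poly.coeff ?F (?n - i)) \<in> L"
    proof (rule polys.ideal_on_sum[OF L(1)])
      fix i assume i: "i \<in> {..?n} - {Polynomial.degree P}"
      show "poly.coeff P i * poly.coeff ?F (?n - i) \<in> L"
      proof (cases "i < Polynomial.degree P")
        case True
        then show ?thesis using s(2)[of "?n - i"] PS by (intro polys.ideal_on_mult[OF L(1)]) auto
      next
        case False
        then have "poly.coeff P i = 0" using i by (intro coeff_eq_0) auto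
        then show ?thesis using L0 by simp
      qed
    qed
    from polys.ideal_on_diff[OF L(1) PF[of ?n] this]
    have "poly.coeff ?F s \<in> L" unfolding eq by simp
    then show False using s(1) by (simp add: T_def)
  qed
  have "poly ?F (var w) \<in> L"
    unfolding poly_altdef
    by (intro polys.ideal_on_sum[OF L(1)] polys.ideal_on_mult'[OF L(1)] F polys.power_mem var_mem_polys w)
  then show ?thesis unfolding poly_uni .
qed

lemma var_closed_var_ideal:
  fixes V :: "'v set"
  assumes "w \<notin> C"
  shows "var_closed w (var_ideal V C :: ('v, 'k::field) mpoly set)"
  unfolding var_closed_def
proof (intro ballI allI)
  fix f :: "('v, 'k) mpoly" and t assume f: "f \<in> var_ideal V C"
  have J: "ideal_on (polys V) (var_ideal V C :: ('v, 'k) mpoly set)"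
    by (rule ideal_on_monomial_ideal[OF up_closed_touching])
  show "poly.coeff (uni w f) t \<in> var_ideal V C"
    unfolding uni_def coeff_sum coeff_monom
  proof (rule polys.ideal_on_sum[OF J])
    fix m assume m: "m \<in> Poly_Mapping.keys f"
    then have mV: "Poly_Mapping.keys m \<subseteq> V" and mC: "m \<in> touching C"
      using f by (auto simp: monomial_ideal_def polys_def)
    obtain v where v: "v \<in> C" "1 \<le> Poly_Mapping.lookup m v" using mC by (auto simp: touching_def)
    then have "v \<noteq> w" using assms by auto
    then have "drop_var w m \<in> touching C" using v by (auto simp: touching_def drop_var_def lookup_update)
    moreover have "Poly_Mapping.keys (drop_var w m) \<subseteq> V" using mV by (auto simp: keys_drop_var)
    ultimately have "Poly_Mapping.single (drop_var w m) c \<in> var_ideal V C" for c :: 'k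
      by (simp add: monomial_ideal_def single_mem_polys)
    moreover have "0 \<in> (var_ideal V C :: ('v, 'k) mpoly set)" using J by (simp add: ideal_on_def)
    ultimately show "(if Poly_Mapping.lookup m w = t
        then Poly_Mapping.single (drop_var w m) (Poly_Mapping.lookup f m) else 0) \<in> var_ideal V C"
      by simp
  qed
qed

lemma var_closed_adjoin:
  assumes L: "ideal_on (polys V) L" "var_closed w L" and q: "q \<in> polys (V - {w})"
  shows "var_closed w (adjoin (polys V) L q)"
  unfolding var_closed_def
proof (intro ballI allI)
  fix f t assume "f \<in> adjoin (polys V) L q"
  then obtain l r where f: "f = l + q * r" "l \<in> L" "r \<in> polys V" unfolding adjoin_def by blast
  have "poly.coeff (uni w f) t = poly.coeff (uni w l) t + q * poly.coeff (uni w r) t"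
    unfolding f(1) uni_add uni_mult using uni_const[OF q] by simp
  moreover have "poly.coeff (uni w l) t \<in> L" using L(2) f(2) by (simp add: var_closed_def)
  moreover have "poly.coeff (uni w r) t \<in> polys V"
    using coeff_uni_mem[OF f(3), of w t] polys_mono[of "V - {w}" V] by blast
  ultimately show "poly.coeff (uni w f) t \<in> adjoin (polys V) L q" unfolding adjoin_def by blast
qed

lemma (in unital_subring) poly_diff_mem_ideal:
  assumes J: "ideal_on S J" and ab: "a \<in> S" "b \<in> S" "a - b \<in> J" and P: "coeffs_in S P"
  shows "poly P a - poly P b \<in> J"
  using P
proof (induction P rule: pCons_induct)
  case 0
  then show ?case using J by (simp add: ideal_on_def)
next
  case (pCons c P)
  have P: "coeffs_in S P"
    unfolding coeffs_in_def
  proof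
    fix i show "poly.coeff P i \<in> S" using coeffs_inD[OF pCons.prems, of "Suc i"] by simp
  qed
  have "poly (pCons c P) a - poly (pCons c P) b = a * (poly P a - poly P b) + (a - b) * poly P b"
    by (simp add: algebra_simps)
  also have "\<dots> \<in> J"
    by (intro ideal_on_add[OF J] ideal_on_mult[OF J ab(1) pCons.IH[OF P]]
        ideal_on_mult'[OF J _ ab(3)] poly_mem[OF P ab(2)])
  finally show ?case .
qed

text \<open>Modulo \<open>L\<close> the variable \<open>z i\<close> vanishes, so the element with
  index \<open>i\<close> becomes \<open>P i\<close> evaluated at \<open>w i\<close>. Since
  \<open>w i\<close> differs from the variables of the preceding elements, \<open>L\<close> enlarged
  by these remains closed with respect to \<open>w i\<close>, and \<open>monic_regular\<close>
  applies.\<close>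

lemma whisker_base_regular:
  fixes V :: "'v set" and L :: "('v, 'k::field) mpoly set"
  assumes P: "\<And>i. i \<in> set ks \<Longrightarrow> coeffs_in (polys {}) (P i) \<and> lead_coeff (P i) = 1"
    and "\<And>i. i \<in> set ks \<Longrightarrow> w i \<in> V \<and> z i \<in> V"
    and "distinct ks" "inj_on w (set ks)"
    and "ideal_on (polys V) L" "\<And>i. i \<in> set ks \<Longrightarrow> var_closed (w i) L"
    and "\<And>i. i \<in> set ks \<Longrightarrow> var (z i) \<in> L"
  shows "weakly_regular (polys V) L (map (\<lambda>i. poly (P i) (var (w i) + var (z i))) ks)"
  using assms
proof (induction ks arbitrary: L)
  case (Cons k ks)
  let ?q = "\<lambda>i. poly (P i) (var (w i) + var (z i))"
  let ?p = "poly (P k) (var (w k))"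
  have L: "ideal_on (polys V) L" and wk: "var (w k) \<in> polys V" "var (z k) \<in> polys V"
    and zL: "var (z k) \<in> L"
    using Cons.prems by (auto intro: var_mem_polys)
  have Pk: "coeffs_in (polys V) (P k)"
    using Cons.prems(1)[of k] polys_mono[of "{}" V] by (auto simp: coeffs_in_def)
  have "(var (w k) + var (z k)) - var (w k) \<in> L" using zL by simp
  then have qp: "?q k - ?p \<in> L"
    using wk by (intro polys.poly_diff_mem_ideal[OF L _ _ _ Pk] polys.add_mem)
  have "b \<in> L" if b: "b \<in> polys V" "?q k * b \<in> L" for b
  proof (rule monic_regular[OF L])
    show "var_closed (w k) L" "w k \<in> V" "coeffs_in (polys {}) (P k)" "lead_coeff (P k) = 1"
      using Cons.prems by auto
    have "?q k * b - (?q k - ?p) * b \<in> L"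
      by (intro polys.ideal_on_diff[OF L] polys.ideal_on_mult'[OF L] b qp)
    then show "?p * b \<in> L" by (simp add: algebra_simps)
  qed (rule b(1))
  moreover have "weakly_regular (polys V) (adjoin (polys V) L (?q k)) (map ?q ks)"
    unfolding polys.adjoin_cong[OF L qp]
  proof (rule Cons.IH)
    have "?p \<in> polys V" by (rule polys.poly_mem[OF Pk wk(1)])
    then show "ideal_on (polys V) (adjoin (polys V) L ?p)" by (rule polys.ideal_on_adjoin[OF L])
    fix i assume i: "i \<in> set ks"
    then have "i \<noteq> k" using Cons.prems(3) by auto
    then have "w i \<noteq> w k" using inj_onD[OF Cons.prems(4), of i k] i by auto
    then have 1: "var (w k) \<in> polys (V - {w i})" using Cons.prems(2)[of k] by (intro var_mem_polys) auto
    have 2: "coeffs_in (polys (V - {w i})) (P k)"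
      using Cons.prems(1)[of k] polys_mono[of "{}" "V - {w i}"] by (auto simp: coeffs_in_def)
    show "var_closed (w i) (adjoin (polys V) L ?p)"
      by (rule var_closed_adjoin[OF L _ polys.poly_mem[OF 2 1]]) (use Cons.prems(6) i in simp)
    have "var (z i) \<in> L" using Cons.prems(7) i by simp
    then show "var (z i) \<in> adjoin (polys V) L ?p" using polys.adjoin_supset by blast
  qed (use Cons.prems in auto)
  ultimately show ?case by simp
qed simp

locale whisker_pairs =
  fixes V :: "'v set" and r :: nat and x y :: "nat \<Rightarrow> 'v"
  assumes inj_x: "inj_on x {1..r}" and inj_y: "inj_on y {1..r}"
    and disj: "x ` {1..r} \<inter> y ` {1..r} = {}" and V_eq: "V = x ` {1..r} \<union> y ` {1..r}"
begin

lemma card_transversal: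
  assumes "B \<subseteq> {1..r}"
  shows "card (x ` B \<union> y ` ({1..r} - B)) = r" "x ` B \<union> y ` ({1..r} - B) \<subseteq> V"
proof -
  have fin: "finite B" using assms by (rule finite_subset) simp
  have "card (x ` B \<union> y ` ({1..r} - B)) = card (x ` B) + card (y ` ({1..r} - B))"
    by (rule card_Un_disjoint) (use fin assms disj in auto)
  also have "\<dots> = card B + card ({1..r} - B)"
    using inj_on_subset[OF inj_x assms] inj_on_subset[OF inj_y, of "{1..r} - B"] by (simp add: card_image)
  also have "\<dots> = r" using assms fin card_mono[OF _ assms] by (simp add: card_Diff_subset)
  finally show "card (x ` B \<union> y ` ({1..r} - B)) = r" .
  show "x ` B \<union> y ` ({1..r} - B) \<subseteq> V" using assms V_eq by blast
qed

lemma split_monomial_ideal: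
  assumes "v \<in> V"
  shows "colon (polys V) (monomial_ideal V U) (var v :: ('v, 'k::field) mpoly) =
    monomial_ideal V {m. m + Poly_Mapping.single v 1 \<in> U}"
  unfolding var_def by (rule colon_monomial_ideal) (use assms in simp)

text \<open>One and the same sequence has to work for all primes at the end of the splitting. The
  sum \<open>x i + y i\<close> is symmetric, so it is immaterial which of the two vertices a prime
  contains.\<close>

lemma whisker_regular:
  fixes P :: "nat \<Rightarrow> ('v, 'k::field) mpoly poly"
  assumes P: "\<And>i. i \<in> {1..r} \<Longrightarrow> coeffs_in (polys {}) (P i) \<and> lead_coeff (P i) = 1"
    and A: "A \<subseteq> {1..r} \<times> {1..r}" "\<And>i j. (i, j) \<in> A \<Longrightarrow> i \<noteq> j \<and> 1 \<le> e i \<and> 1 \<le> e j"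
  defines "qs \<equiv> map (\<lambda>i. poly (P i) (var (x i) + var (y i))) [1..<Suc r]"
  shows "weakly_regular (polys V) (monomial_ideal V (whisker_monomials x y {1..r} e c A)) qs"
proof -
  have qsV: "set qs \<subseteq> polys V"
  proof -
    have "poly (P i) (var (x i) + var (y i)) \<in> polys V" if i: "i \<in> {1..r}" for i
    proof (rule polys.poly_mem)
      show "coeffs_in (polys V) (P i)" using P[OF i] polys_mono[of "{}" V] by (auto simp: coeffs_in_def)
      show "var (x i) + var (y i) \<in> polys V"
        using i V_eq by (intro polys.add_mem var_mem_polys) auto
    qed
    then show ?thesis by (auto simp: qs_def)
  qed
  show ?thesis
  proof (rule whisker_induct[OF _ inj_x inj_y disj _ _ _ A])
    show "weakly_regular (polys V) (monomial_ideal V UNIV) qs"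
    proof -
      have "monomial_ideal V UNIV = (polys V :: ('v, 'k) mpoly set)" by (simp add: monomial_ideal_def)
      moreover have "ideal_on (polys V) (polys V :: ('v, 'k) mpoly set)" by (simp add: ideal_on_def)
      ultimately show ?thesis using polys.weakly_regular_trivial qsV by metis
    qed
  next
    fix U v assume v: "v \<in> x ` {1..r} \<union> y ` {1..r}" and U: "up_closed U"
      and 1: "weakly_regular (polys V) (monomial_ideal V {m. m + Poly_Mapping.single v 1 \<in> U}) qs"
      and 2: "weakly_regular (polys V) (monomial_ideal V (U \<union> {m. 1 \<le> Poly_Mapping.lookup m v})) qs"
    have vV: "v \<in> V" using v V_eq by simp
    show "weakly_regular (polys V) (monomial_ideal V U) qs"
    proof (rule polys.weakly_regular_split[OF ideal_on_monomial_ideal[OF U] var_mem_polys[OF vV] qsV])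
      show "weakly_regular (polys V) (colon (polys V) (monomial_ideal V U) (var v)) qs"
        unfolding split_monomial_ideal[OF vV] by (rule 1)
      show "weakly_regular (polys V) (adjoin (polys V) (monomial_ideal V U) (var v)) qs"
        unfolding adjoin_monomial_ideal[OF vV U] by (rule 2)
    qed
  next
    fix B assume B: "B \<subseteq> {1..r}"
    let ?C = "x ` B \<union> y ` ({1..r} - B)"
    \<comment> \<open>\<open>w i\<close> is the vertex of the pair that stays free in the quotient,
      \<open>z i\<close> the one that is killed.\<close>
    define w where "w = (\<lambda>i. if i \<in> B then y i else x i)"
    define z where "z = (\<lambda>i. if i \<in> B then x i else y i)"
    have nxy: "x i \<noteq> y j" "y j \<noteq> x i" if "i \<in> {1..r}" "j \<in> {1..r}" for i j
      using disj that by (metis disjoint_iff image_eqI)+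
    have qs: "qs = map (\<lambda>i. poly (P i) (var (w i) + var (z i))) [1..<Suc r]"
      unfolding qs_def w_def z_def by (intro map_cong refl) (auto simp: add.commute)
    show "weakly_regular (polys V) (var_ideal V ?C) qs"
      unfolding qs
    proof (rule whisker_base_regular)
      show "inj_on w (set [1..<Suc r])"
      proof (rule inj_onI)
        fix i j assume "i \<in> set [1..<Suc r]" "j \<in> set [1..<Suc r]" "w i = w j"
        then show "i = j" using nxy[of i j] nxy[of j i] inj_x inj_y
          by (auto simp: w_def dest: inj_onD split: if_splits)
      qed
      show "ideal_on (polys V) (var_ideal V ?C :: ('v, 'k) mpoly set)"
        by (rule ideal_on_monomial_ideal[OF up_closed_touching])
      fix i assume "i \<in> set [1..<Suc r]"
      then have i: "i \<in> {1..r}" by auto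
      show "coeffs_in (polys {}) (P i) \<and> lead_coeff (P i) = 1" by (rule P[OF i])
      show "w i \<in> V \<and> z i \<in> V" using i V_eq by (auto simp: w_def z_def)
      show "var_closed (w i) (var_ideal V ?C :: ('v, 'k) mpoly set)"
      proof (rule var_closed_var_ideal)
        show "w i \<notin> ?C"
          using i B nxy inj_x inj_y by (auto simp: w_def dest: inj_onD)
      qed
      have "z i \<in> ?C" using i by (auto simp: z_def)
      then have "Poly_Mapping.single (z i) 1 \<in> touching ?C"
        unfolding touching_def by (intro CollectI bexI[of _ "z i"]) simp_all
      moreover have "z i \<in> V" using i V_eq by (auto simp: z_def)
      ultimately show "var (z i) \<in> (var_ideal V ?C :: ('v, 'k) mpoly set)"
        by (simp add: monomial_ideal_def var_mem_polys) (simp add: var_def)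
    qed simp
  qed simp
qed

text \<open>The splitting ends in unit ideals, which have no associated primes, and in primes
  generated by a transversal of the pairs, which have only themselves. An inclusion suffices,
  because all these primes have height \<open>r\<close>.\<close>

lemma associated_primes_whisker:
  assumes A: "A \<subseteq> {1..r} \<times> {1..r}" "\<And>i j. (i, j) \<in> A \<Longrightarrow> i \<noteq> j \<and> 1 \<le> e i \<and> 1 \<le> e j"
  shows "associated_primes (ring_on (polys V))
      (monomial_ideal V (whisker_monomials x y {1..r} e c A) :: ('v, 'k::field) mpoly set)
    \<subseteq> {var_ideal V C | C. C \<subseteq> V \<and> card C = r}" (is "_ \<subseteq> ?X")
proof -
  let ?ass = "associated_primes (ring_on (polys V :: ('v, 'k) mpoly set))"
  show ?thesis
proof (rule whisker_induct[OF _ inj_x inj_y disj _ _ _ A])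
  show "?ass (monomial_ideal V UNIV :: ('v, 'k) mpoly set) \<subseteq> ?X"
  proof
    fix P :: "('v, 'k) mpoly set" assume "P \<in> ?ass (monomial_ideal V UNIV)"
    then obtain f where P: "primeideal P (ring_on (polys V))" "f \<in> polys V"
      "P = {r \<in> polys V. r * f \<in> monomial_ideal V UNIV}" by (auto simp: associated_primes_def)
    then have "1 \<in> P" by (simp add: monomial_ideal_def)
    then show "P \<in> ?X" using P(1) by (simp add: polys.primeideal_on_iff)
  qed
next
  fix U v assume v: "v \<in> x ` {1..r} \<union> y ` {1..r}" and U: "up_closed U"
    and 1: "?ass (monomial_ideal V {m. m + Poly_Mapping.single v 1 \<in> U} :: ('v, 'k) mpoly set) \<subseteq> ?X"
    and 2: "?ass (monomial_ideal V (U \<union> {m. 1 \<le> Poly_Mapping.lookup m v}) :: ('v, 'k) mpoly set) \<subseteq> ?X"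
  have vV: "v \<in> V" using v V_eq by simp
  show "?ass (monomial_ideal V U :: ('v, 'k) mpoly set) \<subseteq> ?X"
  proof
    fix P :: "('v, 'k) mpoly set" assume "P \<in> ?ass (monomial_ideal V U)"
    from polys.associated_primes_split[OF ideal_on_monomial_ideal[OF U] var_mem_polys[OF vV] this]
    show "P \<in> ?X" unfolding split_monomial_ideal[OF vV] adjoin_monomial_ideal[OF vV U] using 1 2 by blast
  qed
next
  fix B assume B: "B \<subseteq> {1..r}"
  let ?C = "x ` B \<union> y ` ({1..r} - B)"
  have finV: "finite V" by (simp add: V_eq)
  show "?ass (var_ideal V ?C :: ('v, 'k) mpoly set) \<subseteq> ?X"
  proof
    let ?J = "var_ideal V ?C :: ('v, 'k) mpoly set"
    fix P :: "('v, 'k) mpoly set" assume "P \<in> ?ass ?J"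
    then obtain f where P: "primeideal P (ring_on (polys V))" "f \<in> polys V"
      "P = {r \<in> polys V. r * f \<in> ?J}" by (auto simp: associated_primes_def)
    note J = prime_var_ideal[OF finV, of ?C, where ?'k = 'k, unfolded polys.primeideal_on_iff]
    have fJ: "f \<notin> ?J"
    proof
      assume "f \<in> ?J"
      then have "1 \<in> P" using P by simp
      then show False using P(1) by (simp add: polys.primeideal_on_iff)
    qed
    have mem: "r * f \<in> ?J \<longleftrightarrow> r \<in> ?J" if "r \<in> polys V" for r
      using J that P(2) fJ polys.ideal_on_mult'[of V ?J f r] by blast
    have "?J \<subseteq> polys V" by (auto simp: monomial_ideal_def)
    then have "P = ?J" unfolding P(3) using mem by blast
    then show "P \<in> ?X" using card_transversal[OF B] by blast
  qed
qed simp
qed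

end

subsection \<open>Heights of variable primes\<close>

lemma prime_chain_append:
  assumes P: "prime_chain A P n" and Q: "prime_chain A Q k" and "P n = Q 0"
  shows "prime_chain A (\<lambda>i. if i \<le> n then P i else Q (i - n)) (n + k)"
  unfolding prime_chain_def
proof (intro conjI allI impI)
  fix i assume "i \<le> n + k"
  then show "primeideal (if i \<le> n then P i else Q (i - n)) A" using P Q by (auto simp: prime_chain_def)
next
  fix i assume i: "i < n + k"
  consider "i < n" | "i = n" | "n < i" by linarith
  then show "(if i \<le> n then P i else Q (i - n)) \<subset> (if Suc i \<le> n then P (Suc i) else Q (Suc i - n))"
  proof cases
    case 1
    then show ?thesis using P by (simp add: prime_chain_def)
  next
    case 2
    then have "Q 0 \<subset> Q (Suc 0)" using Q i unfolding prime_chain_def by auto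
    then show ?thesis using 2 assms(3) by simp
  next
    case 3
    then have "Q (i - n) \<subset> Q (Suc (i - n))" using Q i unfolding prime_chain_def by auto
    then show ?thesis using 3 by (simp add: Suc_diff_le)
  qed
qed

lemma var_mem_var_ideal_iff:
  fixes V :: "'v set"
  assumes "v \<in> V"
  shows "(var v :: ('v, 'k::field) mpoly) \<in> var_ideal V C \<longleftrightarrow> v \<in> C"
proof -
  have "Poly_Mapping.keys (var v :: ('v, 'k) mpoly) = {Poly_Mapping.single v 1}" by (simp add: var_def)
  then show ?thesis
    using var_mem_polys[OF assms, where ?'b = 'k]
    by (auto simp: monomial_ideal_def touching_def lookup_single when_def split: if_splits)
qed

lemma var_ideal_mono: "C \<subseteq> C' \<Longrightarrow> var_ideal V C \<subseteq> var_ideal V C'"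
  unfolding monomial_ideal_def touching_def by blast

lemma var_chain:
  fixes V :: "'v set"
  assumes V: "finite V" and C: "C \<subseteq> C'" "C' \<subseteq> V"
  shows "\<exists>Q :: nat \<Rightarrow> ('v, 'k::field) mpoly set. prime_chain (ring_on (polys V)) Q (card C' - card C) \<and>
    Q 0 = var_ideal V C \<and> Q (card C' - card C) = var_ideal V C' \<and>
    (\<forall>i. var_ideal V C \<subseteq> Q i \<and> Q i \<subseteq> var_ideal V C')"
proof -
  have fin: "finite (C' - C)" using V C by (meson finite_Diff finite_subset)
  obtain xs where xs: "set xs = C' - C" "distinct xs" using finite_distinct_list[OF fin] by blast
  have len: "length xs = card C' - card C"
    using distinct_card[OF xs(2)] xs(1) C V by (metis card_Diff_subset finite_subset)
  let ?D = "\<lambda>i. C \<union> set (take i xs)"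
  let ?Q = "\<lambda>i. var_ideal V (?D i) :: ('v, 'k) mpoly set"
  have DC: "C \<subseteq> ?D i" "?D i \<subseteq> C'" for i using xs(1) C(1) set_take_subset[of i xs] by auto
  have "prime_chain (ring_on (polys V)) ?Q (length xs)"
    unfolding prime_chain_def
  proof (intro conjI allI impI)
    show "primeideal (?Q i) (ring_on (polys V))" for i by (rule prime_var_ideal[OF V])
    fix i assume i: "i < length xs"
    have sub: "?D i \<subseteq> ?D (Suc i)" using i by (auto simp: take_Suc_conv_app_nth)
    have x: "xs ! i \<in> ?D (Suc i)" using i by (simp add: take_Suc_conv_app_nth)
    have "xs ! i \<in> set xs" using i by simp
    then have xV: "xs ! i \<in> V" "xs ! i \<notin> C" using xs(1) C by auto
    have "xs ! i \<notin> set (take i xs)"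
      using xs(2) i by (auto simp: in_set_conv_nth nth_eq_iff_index_eq)
    then have "xs ! i \<notin> ?D i" using xV by simp
    then have "(var (xs ! i) :: ('v, 'k) mpoly) \<in> ?Q (Suc i)" "(var (xs ! i) :: ('v, 'k) mpoly) \<notin> ?Q i"
      unfolding var_mem_var_ideal_iff[OF xV(1)] using x by simp_all
    then show "?Q i \<subset> ?Q (Suc i)" using var_ideal_mono[OF sub] by blast
  qed
  moreover have "?D (length xs) = C'" using xs(1) C by auto
  moreover have "?D 0 = C" by simp
  moreover have "var_ideal V C \<subseteq> ?Q i" for i by (rule var_ideal_mono[OF DC(1)])
  moreover have "?Q i \<subseteq> var_ideal V C'" for i by (rule var_ideal_mono[OF DC(2)])
  ultimately show ?thesis
    unfolding len[symmetric] by (intro exI[of _ ?Q] conjI allI) (assumption | simp only:)+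
qed

text \<open>For the upper bound, a chain ending in this prime is prolonged by adjoining the
  remaining variables one at a time; the whole chain is bounded by \<open>prime_chain_length\<close>
  with the empty set.\<close>

lemma height_var_ideal:
  fixes V :: "'v set"
  assumes V: "finite V" and C: "C \<subseteq> V"
  shows "height (ring_on (polys V)) (var_ideal V C :: ('v, 'k::field) mpoly set) = enat (card C)"
  unfolding height_def
proof (rule antisym)
  let ?J = "var_ideal V C :: ('v, 'k) mpoly set"
  show "Sup {enat n | n. \<exists>P. prime_chain (ring_on (polys V)) P n \<and> P n = ?J} \<le> enat (card C)"
  proof (rule Sup_least)
    fix e assume "e \<in> {enat n | n. \<exists>P. prime_chain (ring_on (polys V)) P n \<and> P n = ?J}"
    then obtain n P where P: "e = enat n" "prime_chain (ring_on (polys V)) P n" "P n = ?J" by blast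
    obtain Q :: "nat \<Rightarrow> ('v, 'k) mpoly set" where Q: "prime_chain (ring_on (polys V)) Q (card V - card C)" "Q 0 = ?J"
      using var_chain[OF V C order_refl] by blast
    have "n + (card V - card C) + card ({} :: 'v set) \<le> card V"
      by (rule prime_chain_length[OF V prime_chain_append[OF P(2) Q(1)]]) (simp_all add: P Q)
    then show "e \<le> enat (card C)" using card_mono[OF V C] P(1) by simp
  qed
  obtain Q :: "nat \<Rightarrow> ('v, 'k) mpoly set" where "prime_chain (ring_on (polys V)) Q (card C - card ({} :: 'v set))"
    "Q (card C - card ({} :: 'v set)) = ?J"
    using var_chain[OF V _ C, of "{}"] by blast
  then show "enat (card C) \<le> Sup {enat n | n. \<exists>P. prime_chain (ring_on (polys V)) P n \<and> P n = ?J}"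
    by (intro Sup_upper) auto
qed

lemma maximal_var_ideal:
  fixes V :: "'v set"
  assumes V: "finite V"
  shows "maximalideal (var_ideal V V :: ('v, 'k::field) mpoly set) (ring_on (polys V))"
proof (rule maximalidealI)
  let ?M = "var_ideal V V :: ('v, 'k) mpoly set"
  have prime: "primeideal ?M (ring_on (polys V))" by (rule prime_var_ideal[OF V])
  show M: "ideal ?M (ring_on (polys V))" by (rule primeideal.axioms(1)[OF prime])
  show "carrier (ring_on (polys V)) \<noteq> ?M" by (rule primeideal.I_notcarr[OF prime])
  fix J assume J: "ideal J (ring_on (polys V))" "?M \<subseteq> J" "J \<subseteq> carrier (ring_on (polys V))"
  have J': "ideal_on (polys V) J" using J(1) by (simp add: polys.ideal_on_iff)
  show "J = ?M \<or> J = carrier (ring_on (polys V))"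
  proof (cases "J \<subseteq> ?M")
    case False
    then obtain f where f: "f \<in> J" "f \<notin> ?M" by blast
    have "f \<in> polys V" using f(1) J(3) by auto
    then obtain p where p: "p \<in> polys (V - V)" "f - p \<in> ?M" using var_ideal_reduce by blast
    obtain a where a: "p = Poly_Mapping.single 0 a" using polys_empty[of p] p(1) by auto
    have "a \<noteq> 0" using f(2) p(2) a by (auto simp del: diff_0_right)
    have "f - (f - p) \<in> J" using polys.ideal_on_diff[OF J' f(1)] p(2) J(2) by blast
    then have "p \<in> J" by simp
    then have "Poly_Mapping.single 0 (inverse a) * p \<in> J"
      by (intro polys.ideal_on_mult[OF J']) (simp_all add: single_mem_polys)
    then have "1 \<in> J" using \<open>a \<noteq> 0\<close> by (simp add: a mult_single)
    then have "b \<in> J" if "b \<in> polys V" for b using polys.ideal_on_mult[OF J' that, of 1] by simp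
    then show ?thesis using J(3) by auto
  qed (use J(2) in blast)
qed

context unital_subring
begin

lemma genideal_adjoin:
  assumes J: "ideal_on S J" and q: "q \<in> S" and F: "F \<subseteq> S"
  shows "Idl\<^bsub>ring_on S\<^esub> (J \<union> insert q F) = Idl\<^bsub>ring_on S\<^esub> (adjoin S J q \<union> F)"
proof (rule equalityI)
  interpret R: ring "ring_on S" by (rule ring_ring_on)
  have JS: "J \<subseteq> S" using J by (simp add: ideal_on_def)
  have aS: "adjoin S J q \<subseteq> S" using ideal_on_adjoin[OF J q] by (simp add: ideal_on_def)
  have s1: "J \<union> insert q F \<subseteq> carrier (ring_on S)" using JS q F by simp
  have s2: "adjoin S J q \<union> F \<subseteq> carrier (ring_on S)" using aS F by simp
  note id1 = R.genideal_ideal[OF s1] and id2 = R.genideal_ideal[OF s2]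
  note g1 = R.genideal_self[OF s1] and g2 = R.genideal_self[OF s2]
  show "Idl\<^bsub>ring_on S\<^esub> (J \<union> insert q F) \<subseteq> Idl\<^bsub>ring_on S\<^esub> (adjoin S J q \<union> F)"
    using g2 adjoin_supset[of J q] adjoin_mem[OF J, of q] by (intro R.genideal_minimal[OF id2]) blast
  note id1' = id1[unfolded ideal_on_iff]
  have "adjoin S J q \<subseteq> Idl\<^bsub>ring_on S\<^esub> (J \<union> insert q F)"
  proof
    fix a assume "a \<in> adjoin S J q"
    then obtain j r where a: "a = j + q * r" "j \<in> J" "r \<in> S" unfolding adjoin_def by blast
    have "j \<in> Idl\<^bsub>ring_on S\<^esub> (J \<union> insert q F)" "q \<in> Idl\<^bsub>ring_on S\<^esub> (J \<union> insert q F)" using g1 a(2) by auto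
    then show "a \<in> Idl\<^bsub>ring_on S\<^esub> (J \<union> insert q F)"
      unfolding a(1) by (intro ideal_on_add[OF id1'] ideal_on_mult'[OF id1'] a(3))
  qed
  then show "Idl\<^bsub>ring_on S\<^esub> (adjoin S J q \<union> F) \<subseteq> Idl\<^bsub>ring_on S\<^esub> (J \<union> insert q F)"
    using g1 by (intro R.genideal_minimal[OF id1]) blast
qed

text \<open>Passes from the recursive to the indexed form of regularity;
  \<open>genideal_adjoin\<close> shifts one element of the sequence into the ideal.\<close>

lemma weakly_regular_nth:
  assumes "ideal_on S J" "set qs \<subseteq> S" "weakly_regular S J qs" "i < length qs" "b \<in> S"
    and "qs ! i * b \<in> Idl\<^bsub>ring_on S\<^esub> (J \<union> set (take i qs))"
  shows "b \<in> Idl\<^bsub>ring_on S\<^esub> (J \<union> set (take i qs))"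
  using assms
proof (induction qs arbitrary: J i)
  case (Cons q qs)
  interpret R: ring "ring_on S" by (rule ring_ring_on)
  have J: "ideal_on S J" and q: "q \<in> S" using Cons.prems by auto
  show ?case
  proof (cases i)
    case 0
    have idJ: "ideal J (ring_on S)" using J by (simp add: ideal_on_iff)
    have "Idl\<^bsub>ring_on S\<^esub> J = J"
      by (rule equalityI[OF R.genideal_minimal[OF idJ order_refl] R.genideal_self])
        (use J in \<open>simp add: ideal_on_def\<close>)
    then have eq: "Idl\<^bsub>ring_on S\<^esub> (J \<union> set (take i (q # qs))) = J"
      unfolding 0 take_0 list.set(1) Un_empty_right .
    have "q * b \<in> J" using Cons.prems(6) unfolding eq unfolding 0 nth_Cons_0 ring_on_simps .
    moreover have "\<forall>b\<in>S. q * b \<in> J \<longrightarrow> b \<in> J" using Cons.prems(3) unfolding weakly_regular.simps by (rule conjunct1)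
    ultimately show ?thesis unfolding eq using Cons.prems(5) by (simp only:)
  next
    case (Suc k)
    have F: "set (take k qs) \<subseteq> S" using Cons.prems(2) set_take_subset[of k qs] by auto
    have eq: "Idl\<^bsub>ring_on S\<^esub> (J \<union> set (take i (q # qs))) = Idl\<^bsub>ring_on S\<^esub> (adjoin S J q \<union> set (take k qs))"
      using genideal_adjoin[OF J q F] Suc by simp
    show ?thesis
      unfolding eq by (rule Cons.IH[OF ideal_on_adjoin[OF J q]]) (use Cons.prems Suc eq in simp_all)
  qed
qed simp

end

subsection \<open>The edge ideal\<close>

context oriented_graph
begin

definition edge_monomials :: "('v \<Rightarrow>\<^sub>0 nat) set" where
  "edge_monomials = {m. \<exists>(u, v)\<in>E. 1 \<le> Poly_Mapping.lookup m u \<and> d v \<le> Poly_Mapping.lookup m v}"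

lemma up_closed_edge_monomials: "up_closed edge_monomials"
  unfolding up_closed_def
proof (intro ballI allI)
  fix m n assume "m \<in> edge_monomials"
  then obtain u v where uv: "(u, v) \<in> E" "1 \<le> Poly_Mapping.lookup m u" "d v \<le> Poly_Mapping.lookup m v"
    unfolding edge_monomials_def by blast
  then have "1 \<le> Poly_Mapping.lookup (m + n) u" "d v \<le> Poly_Mapping.lookup (m + n) v"
    by (simp_all add: lookup_add)
  then show "m + n \<in> edge_monomials" unfolding edge_monomials_def using uv(1) by blast
qed

lemma genideal_edges:
  "Idl\<^bsub>ring_on (polys V)\<^esub> {var x * var y ^ d y | x y. (x, y) \<in> E} =
    (monomial_ideal V edge_monomials :: ('v, 'k::field) mpoly set)"
proof -
  define g where "g = (\<lambda>(x, y). Poly_Mapping.single x 1 + Poly_Mapping.single y (d y))"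
  have "{var x * var y ^ d y | x y. (x, y) \<in> E} =
      (\<lambda>g. Poly_Mapping.single g 1 :: ('v, 'k) mpoly) ` (g ` E)" (is "?l = ?r")
  proof -
    have "var x * var y ^ d y = (Poly_Mapping.single (g (x, y)) 1 :: ('v, 'k) mpoly)" for x y
      unfolding var_power unfolding var_def by (simp add: mult_single g_def)
    then show ?thesis by (auto simp: image_iff split: prod.splits)
  qed
  moreover have "Idl\<^bsub>ring_on (polys V)\<^esub> ?r = monomial_ideal V {m. \<exists>h\<in>g ` E. \<exists>n. m = h + n}"
  proof (rule genideal_monomials)
    fix h assume "h \<in> g ` E"
    then obtain x y where "(x, y) \<in> E" "h = g (x, y)" by auto
    then show "Poly_Mapping.keys h \<subseteq> V"
      using E_sub[of x y] by (auto simp: g_def keys_add_nat split: if_splits)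
  qed
  moreover have "{m. \<exists>h\<in>g ` E. \<exists>n. m = h + n} = edge_monomials"
  proof (intro equalityI subsetI)
    fix m assume "m \<in> {m. \<exists>h\<in>g ` E. \<exists>n. m = h + n}"
    then obtain x y n where m: "(x, y) \<in> E" "m = g (x, y) + n" by auto
    then have "1 \<le> Poly_Mapping.lookup m x" "d y \<le> Poly_Mapping.lookup m y"
      by (simp_all add: g_def lookup_add)
    then show "m \<in> edge_monomials" unfolding edge_monomials_def using m(1) by blast
  next
    fix m assume "m \<in> edge_monomials"
    then obtain x y where xy: "(x, y) \<in> E" "1 \<le> Poly_Mapping.lookup m x" "d y \<le> Poly_Mapping.lookup m y"
      unfolding edge_monomials_def by blast
    have ne: "x \<noteq> y" using xy(1) orient by auto
    define n where "n = Poly_Mapping.update x (Poly_Mapping.lookup m x - 1)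
      (Poly_Mapping.update y (Poly_Mapping.lookup m y - d y) m)"
    have "m = g (x, y) + n"
      using xy ne by (intro poly_mapping_eqI)
        (auto simp: g_def n_def lookup_add lookup_update lookup_single when_def)
    then show "m \<in> {m. \<exists>h\<in>g ` E. \<exists>n. m = h + n}" using xy(1) by blast
  qed
  ultimately show ?thesis by metis
qed

text \<open>The annihilator of the monomial with exponent \<open>cover_exp C v\<close> at \<open>v \<in> C\<close> and a large
  exponent at the other vertices.\<close>
lemma associated_strong_cover:
  assumes C: "strong_cover C"
  shows "var_ideal V C \<in> associated_primes (ring_on (polys V))
    (monomial_ideal V edge_monomials :: ('v, 'k::field) mpoly set)"
proof -
  have CV: "C \<subseteq> V" and cover: "\<And>u v. (u, v) \<in> E \<Longrightarrow> u \<in> C \<or> v \<in> C"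
    and strong: "\<And>v. v \<in> C \<Longrightarrow> (\<exists>w. (v, w) \<in> E \<and> w \<notin> C) \<or>
      (\<exists>u. (u, v) \<in> E \<and> (u \<notin> C \<or> 1 \<le> cover_exp C u))"
    using C unfolding strong_cover_def by auto
  \<comment> \<open>At least every weight, and positive: outside \<open>C\<close> each variable
    counts both as the tail of an edge and as a head with its full power.\<close>
  define b where "b = Suc (\<Sum>v\<in>V. d v)"
  define k where "k = (\<lambda>v. if v \<in> C then cover_exp C v else b)"
  define m where "m = (\<Sum>v\<in>V. Poly_Mapping.single v (k v))"
  have lm: "Poly_Mapping.lookup m v = (if v \<in> V then k v else 0)" for v
    using finite_V by (simp add: m_def lookup_sum lookup_single when_def)
  have mV: "Poly_Mapping.keys m \<subseteq> V" by (auto simp: in_keys_iff lm split: if_splits)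
  have db: "d v \<le> b" if "v \<in> V" for v
    using member_le_sum[OF that, of d] finite_V by (simp add: b_def)
  have iff: "n + m \<in> edge_monomials \<longleftrightarrow> n \<in> touching C" if n: "Poly_Mapping.keys n \<subseteq> V" for n
  proof
    assume "n \<in> touching C"
    then obtain v where v: "v \<in> C" "1 \<le> Poly_Mapping.lookup n v" unfolding touching_def by blast
    have vV: "v \<in> V" using v(1) CV by blast
    show "n + m \<in> edge_monomials"
    proof (cases "\<exists>w. (v, w) \<in> E \<and> w \<notin> C")
      case True
      then obtain w where w: "(v, w) \<in> E" "w \<notin> C" by blast
      have "w \<in> V" using E_sub w(1) by blast
      then have "d w \<le> Poly_Mapping.lookup (n + m) w" "1 \<le> Poly_Mapping.lookup (n + m) v"
        using db[of w] v(2) w(2) by (simp_all add: lookup_add lm k_def)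
      then show ?thesis unfolding edge_monomials_def using w(1) by blast
    next
      case False
      then obtain u where u: "(u, v) \<in> E" "u \<notin> C \<or> 1 \<le> cover_exp C u" using strong[OF v(1)] by blast
      have "u \<in> V" using E_sub u(1) by blast
      then have 1: "1 \<le> Poly_Mapping.lookup (n + m) u"
        using u(2) by (auto simp: lookup_add lm k_def b_def)
      have "cover_exp C v = d v - 1" unfolding cover_exp_def if_not_P[OF False] ..
      then have "d v \<le> Poly_Mapping.lookup (n + m) v"
        using v vV by (simp add: lookup_add lm k_def)
      with 1 show ?thesis unfolding edge_monomials_def using u(1) by blast
    qed
  next
    assume "n + m \<in> edge_monomials"
    then obtain u v where uv: "(u, v) \<in> E" "1 \<le> Poly_Mapping.lookup (n + m) u"
      "d v \<le> Poly_Mapping.lookup (n + m) v" unfolding edge_monomials_def by blast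
    have V: "u \<in> V" "v \<in> V" using E_sub uv(1) by auto
    show "n \<in> touching C"
    proof (rule ccontr)
      assume "n \<notin> touching C"
      then have n0: "Poly_Mapping.lookup n w = 0" if "w \<in> C" for w
        using that by (force simp: touching_def)
      \<comment> \<open>At a vertex of \<open>C\<close> the exponent stays below the weight, so the
        head of the edge is outside \<open>C\<close>. Its tail then lies in \<open>C\<close> with an
        edge leaving the cover and has exponent 0.\<close>
      have "v \<notin> C"
      proof
        assume v: "v \<in> C"
        then have "d v \<le> cover_exp C v" using uv(3) n0[OF v] V(2) by (simp add: lookup_add lm k_def)
        moreover have "cover_exp C v < d v" using d_pos[OF V(2)] by (simp add: cover_exp_def)
        ultimately show False by simp
      qed
      moreover from this have "u \<in> C" using cover uv(1) by blast
      ultimately have "Poly_Mapping.lookup (n + m) u = 0"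
        using n0[of u] uv(1) V(1) by (auto simp: lookup_add lm k_def cover_exp_def)
      then show False using uv(2) by simp
    qed
  qed
  define f :: "('v, 'k) mpoly" where "f = Poly_Mapping.single m 1"
  have f: "f \<in> polys V" unfolding f_def by (rule single_mem_polys[OF mV])
  have "p * f \<in> monomial_ideal V edge_monomials \<longleftrightarrow> p \<in> var_ideal V C"
    if p: "p \<in> polys V" for p :: "('v, 'k) mpoly"
  proof -
    have "Poly_Mapping.keys (p * f) = (\<lambda>n. n + m) ` Poly_Mapping.keys p"
      unfolding f_def by (rule keys_mult_single)
    then have "p * f \<in> monomial_ideal V edge_monomials \<longleftrightarrow> (\<forall>n\<in>Poly_Mapping.keys p. n + m \<in> edge_monomials)"
      using polys.mult_mem[OF p f] by (auto simp: monomial_ideal_def)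
    also have "\<dots> \<longleftrightarrow> (\<forall>n\<in>Poly_Mapping.keys p. n \<in> touching C)"
      using p iff by (intro ball_cong) (auto simp: polys_def)
    also have "\<dots> \<longleftrightarrow> p \<in> var_ideal V C" using p by (auto simp: monomial_ideal_def)
    finally show ?thesis .
  qed
  then have eq: "var_ideal V C = {p \<in> polys V. p * f \<in> monomial_ideal V edge_monomials}"
    by (auto simp: monomial_ideal_def[of V "touching C"])
  show ?thesis
    unfolding associated_primes_def ring_on_simps mem_Collect_eq
    by (intro conjI bexI[of _ f] prime_var_ideal[OF finite_V] eq f)
qed

lemma edge_ideal_ideal:
  "ideal (monomial_ideal V edge_monomials :: ('v, 'k::field) mpoly set) (ring_on (polys V))"
  unfolding polys.ideal_on_iff by (rule ideal_on_monomial_ideal[OF up_closed_edge_monomials])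

lemma edge_ideal_sub_maximal: "monomial_ideal V edge_monomials \<subseteq> var_ideal V V"
  using E_sub unfolding monomial_ideal_def edge_monomials_def touching_def by blast

text \<open>At the maximal ideal of the variables, the associated prime of \<open>C\<close> bounds
  the depth by \<open>card V - card C\<close>, while the variables outside \<open>C'\<close> yield a
  chain showing that the dimension is at least \<open>card V - card C'\<close>.\<close>

lemma cohen_macaulay_imp_card_le:
  assumes CM: "cohen_macaulay_ring
      (ring_on (polys V) Quot (monomial_ideal V edge_monomials :: ('v, 'k::field) mpoly set))"
    and C: "strong_cover C" and C': "strong_cover C'"
  shows "card C \<le> card C'"
proof -
  let ?R = "ring_on (polys V) :: ('v, 'k) mpoly ring"
  let ?I = "monomial_ideal V edge_monomials :: ('v, 'k) mpoly set"
  let ?M = "var_ideal V V :: ('v, 'k) mpoly set"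
  interpret R: cring ?R by (rule polys.cring_ring_on)
  note max = maximal_var_ideal[OF finite_V, where ?'k = 'k]
  let ?m = "a_r_coset ?R ?I ` ?M"
  have m: "maximalideal ?m (?R Quot ?I)"
    and eqM: "{p \<in> carrier ?R. a_r_coset ?R ?I p \<in> ?m} = ?M"
    using R.maximalideal_quotient[OF edge_ideal_ideal max edge_ideal_sub_maximal] by blast+
  let ?A = "localization (?R Quot ?I) ?m"
  let ?h = "\<lambda>p. loc_frac (?R Quot ?I) ?m (a_r_coset ?R ?I p) \<one>\<^bsub>?R Quot ?I\<^esub>"
  interpret L: localized_quotient ?R ?A ?h ?I ?M
    using R.localized_quotient_localization(2)[OF edge_ideal_ideal m] unfolding eqM .
  have noeth: "noetherian_ring ?R" by (rule noetherian_polys[OF finite_V])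
  have "cm_local_ring ?A" using CM m unfolding cohen_macaulay_ring_def by blast
  then have dd: "depth ?A (L.ext ?M) = krull_dim ?A" using L.cm_local_ring_iff[OF noeth] by blast
  have CV: "C \<subseteq> V" "C' \<subseteq> V" using C C' unfolding strong_cover_def by auto
  have upper: "depth ?A (L.ext ?M) \<le> enat (card V - card C)"
    unfolding depth_def
  proof (rule Sup_least)
    fix e assume "e \<in> {enat (length xs) | xs. regular_sequence ?A xs \<and> set xs \<subseteq> L.ext ?M}"
    then obtain xs where xs: "e = enat (length xs)" "regular_sequence ?A xs" "set xs \<subseteq> L.ext ?M" by blast
    obtain Q where Q: "prime_chain ?R Q (length xs)" "Q 0 = var_ideal V C"
      using L.regular_sequence_chain[OF noeth associated_strong_cover[OF C] var_ideal_mono[OF CV(1)] xs(2,3)]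
      by blast
    have "length xs + card C \<le> card V"
    proof (rule prime_chain_length[OF finite_V Q(1) CV(1)])
      show "var ` C \<subseteq> Q 0"
        unfolding Q(2) by (intro image_subsetI var_mem_var_ideal_iff[THEN iffD2] subsetD[OF CV(1)])
    qed
    then show "e \<le> enat (card V - card C)" by (simp add: xs(1))
  qed
  have lower: "enat (card V - card C') \<le> krull_dim ?A"
  proof -
    obtain Q :: "nat \<Rightarrow> ('v, 'k) mpoly set" where Q: "prime_chain ?R Q (card V - card C')"
      "\<And>i. var_ideal V C' \<subseteq> Q i" "\<And>i. Q i \<subseteq> var_ideal V V"
      using var_chain[OF finite_V CV(2) order_refl] by blast
    have I: "?I \<subseteq> var_ideal V C'"
      by (rule L.associated_prime_ext(1)[OF associated_strong_cover[OF C'] var_ideal_mono[OF CV(2)]])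
    have "prime_chain ?A (\<lambda>i. L.ext (Q i)) (card V - card C')"
      by (rule L.prime_chain_ext[OF Q(1)]) (use Q(2,3) I in blast)+
    then show ?thesis unfolding krull_dim_def by (intro Sup_upper) blast
  qed
  have "card V - card C' \<le> card V - card C"
    using order_trans[OF lower order_trans[OF eq_refl[OF dd[symmetric]] upper]] unfolding enat_ord_simps(1) .
  then show ?thesis using card_mono[OF finite_V CV(1)] card_mono[OF finite_V CV(2)] by simp
qed

lemma unmixed_imp_card_eq:
  assumes "unmixed (ring_on (polys V)) (monomial_ideal V edge_monomials :: ('v, 'k::field) mpoly set)"
    and C: "strong_cover C" and C': "strong_cover C'"
  shows "card C = card C'"
proof -
  have CV: "C \<subseteq> V" "C' \<subseteq> V" using C C' unfolding strong_cover_def by auto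
  have "height (ring_on (polys V)) (var_ideal V C :: ('v, 'k) mpoly set) =
      height (ring_on (polys V)) (var_ideal V C' :: ('v, 'k) mpoly set)"
    using assms(1) associated_strong_cover[OF C] associated_strong_cover[OF C'] unfolding unmixed_def by blast
  then show ?thesis 
    unfolding height_var_ideal[OF finite_V CV(1)] height_var_ideal[OF finite_V CV(2)] by simp
qed

end

locale whiskered_graph = oriented_graph V E d for V :: "'v set" and E and d +
  fixes r x y
  assumes whiskered: "whiskered r x y" and weight: "i \<in> {1..r} \<Longrightarrow> (x i, y i) \<in> E \<Longrightarrow> d (x i) = 1"
begin

sublocale whisker_pairs V r x y
  using whiskered unfolding whiskered_def by unfold_locales auto

lemma leaf_iff: "i \<in> {1..r} \<Longrightarrow> adj (y i) u \<longleftrightarrow> u = x i"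
  using whiskered unfolding whiskered_def by blast

text \<open>In \<open>y i -> x i\<close> the vertex \<open>x i\<close> has exponent
  \<open>d (x i)\<close>, as in the edges entering it from the core. In \<open>x i -> y i\<close> it
  has exponent 1, which is \<open>d (x i)\<close> by the weight condition. So a single exponent per
  \<open>x i\<close> serves for all generators, as \<open>whisker_monomials\<close>
  requires.\<close>

definition e where "e = (\<lambda>i. d (x i))"
definition c where "c = (\<lambda>i. if (x i, y i) \<in> E then d (y i) else 1)"
definition core where "core = {(i, j). i \<in> {1..r} \<and> j \<in> {1..r} \<and> (x i, x j) \<in> E}"

lemma core_props: "core \<subseteq> {1..r} \<times> {1..r}" "(i, j) \<in> core \<Longrightarrow> i \<noteq> j \<and> 1 \<le> e i \<and> 1 \<le> e j"
  using orient E_sub d_pos by (auto simp: core_def e_def)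

lemma edge_monomials_eq: "edge_monomials = whisker_monomials x y {1..r} e c core"
proof (intro equalityI subsetI)
  fix m assume "m \<in> edge_monomials"
  then obtain u v where uv: "(u, v) \<in> E" "1 \<le> Poly_Mapping.lookup m u" "d v \<le> Poly_Mapping.lookup m v"
    unfolding edge_monomials_def by blast
  have a: "adj u v" using uv(1) by (simp add: adj_def)
  have "u \<in> V" "v \<in> V" using E_sub uv(1) by auto
  then consider i j where "i \<in> {1..r}" "j \<in> {1..r}" "u = x i" "v = x j"
    | i where "i \<in> {1..r}" "u = y i" | i where "i \<in> {1..r}" "v = y i"
    unfolding V_eq by blast
  then show "m \<in> whisker_monomials x y {1..r} e c core"
  proof cases
    case 1
    then have "(i, j) \<in> core" using uv(1) by (simp add: core_def)
    then show ?thesis using uv(2,3) 1 unfolding whisker_monomials_def e_def by blast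
  next
    case 2
    then have v: "v = x i" using a leaf_iff by blast
    then have "(x i, y i) \<notin> E" using uv(1) orient 2 by blast
    then have "e i \<le> Poly_Mapping.lookup m (x i)" "c i \<le> Poly_Mapping.lookup m (y i)"
      using uv 2 v by (simp_all add: e_def c_def)
    then show ?thesis using 2(1) unfolding whisker_monomials_def by blast
  next
    case 3
    then have u: "u = x i" using adj_sym[OF a] leaf_iff by blast
    then have "e i \<le> Poly_Mapping.lookup m (x i)" "c i \<le> Poly_Mapping.lookup m (y i)"
      using uv 3 weight[OF 3(1)] by (simp_all add: e_def c_def)
    then show ?thesis using 3(1) unfolding whisker_monomials_def by blast
  qed
next
  fix m assume "m \<in> whisker_monomials x y {1..r} e c core"
  then consider i where "i \<in> {1..r}" "e i \<le> Poly_Mapping.lookup m (x i)" "c i \<le> Poly_Mapping.lookup m (y i)"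
    | i j where "(i, j) \<in> core" "1 \<le> Poly_Mapping.lookup m (x i)" "e j \<le> Poly_Mapping.lookup m (x j)"
    unfolding whisker_monomials_def by blast
  then show "m \<in> edge_monomials"
  proof cases
    case 1
    have "adj (x i) (y i)" by (rule whiskered_adj[OF whiskered 1(1)])
    then consider "(x i, y i) \<in> E" | "(y i, x i) \<in> E" "(x i, y i) \<notin> E" using orient by (auto simp: adj_def)
    then show ?thesis
    proof cases
      case xy: 1
      then have "1 \<le> Poly_Mapping.lookup m (x i)" "d (y i) \<le> Poly_Mapping.lookup m (y i)"
        using 1 weight[OF 1(1) xy] by (simp_all add: e_def c_def)
      then show ?thesis using xy unfolding edge_monomials_def by blast
    next
      case yx: 2
      then have "1 \<le> Poly_Mapping.lookup m (y i)" "d (x i) \<le> Poly_Mapping.lookup m (x i)"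
        using 1 by (simp_all add: e_def c_def)
      then show ?thesis using yx(1) unfolding edge_monomials_def by blast
    qed
  next
    case 2
    then have "(x i, x j) \<in> E" by (simp add: core_def)
    then show ?thesis using 2 unfolding edge_monomials_def e_def by blast
  qed
qed

theorem unmixed_edge_ideal:
  "unmixed (ring_on (polys V)) (monomial_ideal V edge_monomials :: ('v, 'k::field) mpoly set)"
proof -
  have "height (ring_on (polys V)) P = enat r"
    if P: "P \<in> associated_primes (ring_on (polys V)) (monomial_ideal V edge_monomials :: ('v, 'k) mpoly set)" for P
  proof -
    have "associated_primes (ring_on (polys V)) (monomial_ideal V edge_monomials :: ('v, 'k) mpoly set)
        \<subseteq> {var_ideal V C | C. C \<subseteq> V \<and> card C = r}"
      unfolding edge_monomials_eq by (rule associated_primes_whisker[OF core_props])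
    then obtain C where C: "P = var_ideal V C" "C \<subseteq> V" "card C = r" using P by fast
    show ?thesis unfolding C(1) height_var_ideal[OF finite_V C(2)] C(3) ..
  qed
  then show ?thesis unfolding unmixed_def by simp
qed

lemma edge_mem_ideal:
  assumes "(u, v) \<in> E"
  shows "var u * var v ^ d v \<in> (monomial_ideal V edge_monomials :: ('v, 'k::field) mpoly set)"
proof -
  have V: "u \<in> V" "v \<in> V" using E_sub assms by auto
  have "{var x * var y ^ d y | x y. (x, y) \<in> E} \<subseteq> carrier (ring_on (polys V) :: ('v, 'k) mpoly ring)"
    using E_sub by (auto intro!: polys.mult_mem polys.power_mem var_mem_polys)
  from ring.genideal_self[OF polys.ring_ring_on this]
  show ?thesis unfolding genideal_edges using assms by blast
qed

lemma prime_contains_pair: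
  fixes P :: "('v, 'k::field) mpoly set"
  assumes P: "primeideal P (ring_on (polys V))" and I: "monomial_ideal V edge_monomials \<subseteq> P"
    and i: "i \<in> {1..r}"
  shows "var (x i) \<in> P \<or> var (y i) \<in> P"
proof -
  have V: "x i \<in> V" "y i \<in> V" using i V_eq by auto
  have pr: "a \<in> P \<or> b \<in> P" if "a \<in> polys V" "b \<in> polys V" "a * b \<in> P" for a b
    using P that unfolding polys.primeideal_on_iff by blast
  have pow: "a \<in> P" if "a \<in> polys V" "a ^ n \<in> P" for a n
    using that(2)
  proof (induction n)
    case 0
    then show ?case using P unfolding polys.primeideal_on_iff by simp
  next
    case (Suc n)
    then show ?case using pr[OF that(1) polys.power_mem[OF that(1)]] by auto
  qed
  have edge: "var u \<in> P \<or> var v \<in> P" if uv: "(u, v) \<in> E" for u v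
  proof -
    have uvV: "u \<in> V" "v \<in> V" using E_sub uv by auto
    have "var u * var v ^ d v \<in> P" using edge_mem_ideal[OF uv] I by blast
    then have "var u \<in> P \<or> var v ^ d v \<in> P"
      by (intro pr polys.power_mem var_mem_polys uvV)
    then show ?thesis using pow[OF var_mem_polys[OF uvV(2)]] by blast
  qed
  have "adj (x i) (y i)" by (rule whiskered_adj[OF whiskered i])
  then show ?thesis using edge unfolding adj_def by blast
qed

text \<open>At every maximal ideal depth and dimension are \<open>r\<close>. The adapted sequence
  has length \<open>r\<close>; conversely, the first prime of any chain contains a vertex of each
  pair, so the chain has length at most \<open>2 r - r\<close>.\<close>

theorem cohen_macaulay_edge_ideal:
  "cohen_macaulay_ring
    (ring_on (polys V) Quot (monomial_ideal V edge_monomials :: ('v, 'k::field) mpoly set))"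
proof -
  let ?R = "ring_on (polys V) :: ('v, 'k) mpoly ring"
  let ?I = "monomial_ideal V edge_monomials :: ('v, 'k) mpoly set"
  interpret R: cring ?R by (rule polys.cring_ring_on)
  have noeth: "noetherian_ring ?R" by (rule noetherian_polys[OF finite_V])
  have id: "ideal ?I ?R" by (rule edge_ideal_ideal)
  have "cm_local_ring (localization (?R Quot ?I) m)" if m: "maximalideal m (?R Quot ?I)" for m
  proof -
    define M where "M = {p \<in> carrier ?R. a_r_coset ?R ?I p \<in> m}"
    let ?A = "localization (?R Quot ?I) m"
    let ?h = "\<lambda>p. loc_frac (?R Quot ?I) m (a_r_coset ?R ?I p) \<one>\<^bsub>?R Quot ?I\<^esub>"
    have max: "maximalideal M ?R" unfolding M_def by (rule R.localized_quotient_localization(1)[OF id m])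
    interpret L: localized_quotient ?R ?A ?h ?I M
      unfolding M_def by (rule R.localized_quotient_localization(2)[OF id m])
    have idM: "ideal_on (polys V) M"
      using primeideal.axioms(1)[OF L.prime_M] by (simp add: polys.ideal_on_iff)
    have "\<exists>P. coeffs_in (polys {}) P \<and> lead_coeff P = 1 \<and> poly P (var (x i) + var (y i)) \<in> M"
      if i: "i \<in> {1..r}" for i
    proof -
      have V: "x i \<in> V" "y i \<in> V" using i V_eq by auto
      \<comment> \<open>One vertex of the pair lies in \<open>M\<close>; \<open>w\<close> is the
        other, so that the sum is congruent to a single variable, to which Zariski's lemma
        applies.\<close>
      obtain w where w: "w \<in> V" "var (x i) + var (y i) - var w \<in> M"
        using prime_contains_pair[OF L.prime_M L.I_sub_M i] V that by (metis add_diff_cancel_left' add_diff_cancel_right')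
      obtain P where P: "coeffs_in (polys {}) P" "lead_coeff P = 1" "poly P (var w) \<in> M"
        using zariski[OF finite_V w(1) max] by blast
      have PV: "coeffs_in (polys V) P" using P(1) polys_mono[of "{}" V] by (auto simp: coeffs_in_def)
      have "poly P (var (x i) + var (y i)) - poly P (var w) \<in> M"
        using V w by (intro polys.poly_diff_mem_ideal[OF idM _ _ w(2) PV] polys.add_mem var_mem_polys)
      then have "poly P (var (x i) + var (y i)) \<in> M" using P(3) polys.ideal_on_cancel[OF idM] by blast
      then show ?thesis using P(1,2) by blast
    qed
    then obtain P where P: "\<And>i. i \<in> {1..r} \<Longrightarrow> coeffs_in (polys {}) (P i) \<and> lead_coeff (P i) = 1 \<and>
        poly (P i) (var (x i) + var (y i)) \<in> M" by metis
    define qs where "qs = map (\<lambda>i. poly (P i) (var (x i) + var (y i))) [1..<Suc r]"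
    have qsM: "set qs \<subseteq> M" using P by (auto simp: qs_def)
    have qsV: "set qs \<subseteq> polys V" using qsM polys.ideal_on_sub[OF idM] by blast
    have wr: "weakly_regular (polys V) ?I qs"
      unfolding edge_monomials_eq qs_def by (rule whisker_regular[OF _ core_props]) (use P in blast)
    have I': "ideal_on (polys V) ?I" by (rule ideal_on_monomial_ideal[OF up_closed_edge_monomials])
    have reg: "regular_sequence ?A (map ?h qs)" "set (map ?h qs) \<subseteq> L.ext M"
      using L.regular_sequence_map[OF qsM] polys.weakly_regular_nth[OF I' qsV wr] by simp_all
    have "length (map ?h qs) = r" by (simp add: qs_def)
    then have "enat r \<le> depth ?A (L.ext M)"
      unfolding depth_def using reg by (intro Sup_upper) blast
    moreover have "krull_dim ?A \<le> enat r"
      unfolding krull_dim_def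
    proof (rule Sup_least)
      fix n assume "n \<in> {enat n | n. \<exists>P. prime_chain ?A P n}"
      then obtain k Q where Q: "n = enat k" "prime_chain ?A Q k" by blast
      define Q' where "Q' = (\<lambda>i. {p \<in> carrier ?R. ?h p \<in> Q i})"
      have Q': "prime_chain ?R Q' k" unfolding Q'_def by (rule L.prime_chain_vimage[OF Q(2)])
      have pr: "primeideal (Q' 0) ?R" using Q' by (simp add: prime_chain_def)
      have IQ: "?I \<subseteq> Q' 0"
      proof
        fix p assume p: "p \<in> ?I"
        then have pV: "p \<in> carrier ?R" by (simp add: monomial_ideal_def)
        have "\<one>\<^bsub>?R\<^esub> \<in> carrier ?R - M" using R.prime_one[OF L.prime_M] by simp
        moreover have "\<one>\<^bsub>?R\<^esub> \<otimes>\<^bsub>?R\<^esub> p \<in> ?I" using p by simp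
        ultimately have "?h p = \<zero>\<^bsub>?A\<^esub>" using L.kernel[OF pV] by blast
        moreover have "\<zero>\<^bsub>?A\<^esub> \<in> Q 0"
          using Q(2) primeideal.axioms(1) ideal_zero unfolding prime_chain_def by blast
        ultimately show "p \<in> Q' 0" using pV by (simp add: Q'_def)
      qed
      \<comment> \<open>Where the first prime does not contain \<open>x i\<close>, it contains
        \<open>y i\<close>; this selects a transversal of \<open>r\<close> variables inside
        it.\<close>
      define B where "B = {i \<in> {1..r}. var (x i) \<in> Q' 0}"
      have B: "B \<subseteq> {1..r}" by (auto simp: B_def)
      have "k + card (x ` B \<union> y ` ({1..r} - B)) \<le> card V"
      proof (rule prime_chain_length[OF finite_V Q' card_transversal(2)[OF B]])
        have "var (y i) \<in> Q' 0" if "i \<in> {1..r} - B" for i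
          using prime_contains_pair[OF pr IQ, of i] that unfolding B_def by blast
        then show "var ` (x ` B \<union> y ` ({1..r} - B)) \<subseteq> Q' 0" unfolding B_def by blast
      qed
      then show "n \<le> enat r" using card_transversal(1)[OF B] whiskered_card[OF whiskered] Q(1) by simp
    qed
    ultimately have "depth ?A (L.ext M) = krull_dim ?A"
      using L.depth_le_krull_dim[OF noeth] by (meson antisym order_trans)
    then show ?thesis using L.cm_local_ring_iff[OF noeth] by blast
  qed
  moreover have "cring (?R Quot ?I)" by (rule ideal.quotient_is_cring[OF id R.cring_axioms])
  ultimately show ?thesis
    unfolding cohen_macaulay_ring_def using R.noetherian_quotient[OF noeth id] by blast
qed

end

subsection \<open>The equivalence\<close>

lemma pcas_zip: "us \<noteq> [] \<Longrightarrow> pcas (hd us) (zip us (tl us)) (last us)"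
proof (induction us rule: induct_list012)
  case (3 a b us)
  then show ?case by simp
qed simp_all

lemma pawalk_verts_zip: "us \<noteq> [] \<Longrightarrow> pawalk_verts (hd us) (zip us (tl us)) = us"
proof (induction us rule: induct_list012)
  case (3 a b us)
  then show ?case by simp
qed simp_all

lemma set_zip_successively: "successively P us \<Longrightarrow> (a, b) \<in> set (zip us (tl us)) \<Longrightarrow> P a b"
proof (induction us rule: induct_list012)
  case (3 a b us)
  then show ?case by auto
qed simp_all

lemma (in weighted_oriented_graph) parcs_underlying:
  "(u, v) \<in> parcs (underlying D) \<longleftrightarrow> (u, v) \<in> parcs D \<or> (v, u) \<in> parcs D"
  unfolding parcs_mk_symmetric 
proof
  assume "(u, v) \<in> parcs D \<or> (v, u) \<in> parcs D"
  then obtain e where "e \<in> arcs D" "e = (u, v) \<or> e = (v, u)" by auto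
  then show "(u, v) \<in> (\<Union>e\<in>arcs D. {(tail D e, head D e), (head D e, tail D e)})"
    by (intro UN_I[of e]) auto
qed auto

lemma vertex_degree_eq: "vertex_degree G v = card {w. (v, w) \<in> parcs G}"
proof -
  have "out_arcs (with_proj G) v = Pair v ` {w. (v, w) \<in> parcs G}" by (auto simp: out_arcs_def)
  then show ?thesis unfolding out_degree_def by (simp add: card_image inj_on_def)
qed

lemma (in weighted_oriented_graph) oriented_graphI:
  assumes "no_isolated_vertices (underlying D)"
  shows "oriented_graph (pverts D) (parcs D) d"
proof
  show "finite (pverts D)" by (rule pair_finite_verts)
  show "u \<in> pverts D \<and> v \<in> pverts D" if "(u, v) \<in> parcs D" for u v
    using in_arcsD1[OF that] in_arcsD2[OF that] by blast
  show "(v, u) \<notin> parcs D" if "(u, v) \<in> parcs D" for u v by (rule oriented[OF that])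
  show "1 \<le> d v" if "v \<in> pverts D" for v by (rule weight_pos[OF that])
  show "d v = 1" if "v \<in> pverts D" "\<And>u. (u, v) \<notin> parcs D" for v
    using that by (intro weight_source) (auto simp: in_arcs_def)
  show "\<exists>u. (u, v) \<in> parcs D \<or> (v, u) \<in> parcs D" if "v \<in> pverts D" for v
  proof -
    have "vertex_degree (underlying D) v \<noteq> 0" using assms that by (simp add: no_isolated_vertices_def)
    then have "{w. (v, w) \<in> parcs (underlying D)} \<noteq> {}" unfolding vertex_degree_eq by (metis card.empty)
    then show ?thesis unfolding parcs_underlying by blast
  qed
qed

lemma (in weighted_oriented_graph) oriented_forestI:
  assumes "no_isolated_vertices (underlying D)" and forest: "undirected_forest (underlying D)"
  shows "oriented_forest (pverts D) (parcs D) d"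
proof -
  interpret G: oriented_graph "pverts D" "parcs D" d by (rule oriented_graphI[OF assms(1)])
  have adj: "G.adj u v \<longleftrightarrow> (u, v) \<in> parcs (underlying D)" for u v
    unfolding G.adj_def parcs_underlying ..
  have "False" if vs: "distinct vs" "3 \<le> length vs" "successively G.adj vs" "G.adj (last vs) (hd vs)" for vs
  proof -
    \<comment> \<open>Repeating the first vertex at the end turns the vertex list into a closed walk
      whose arcs are the pairs of consecutive entries.\<close>
    define us where "us = vs @ [hd vs]"
    have ne: "vs \<noteq> []" using vs(2) by auto
    have us: "us \<noteq> []" "hd us = hd vs" "last us = hd vs" "length us = Suc (length vs)"
      using ne by (simp_all add: us_def)
    have succ: "successively G.adj us" using vs ne by (auto simp: us_def successively_append_iff)
    define p where "p = zip us (tl us)"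
    have "set p \<subseteq> parcs (underlying D)"
      using set_zip_successively[OF succ] adj unfolding p_def by auto
    moreover have "hd vs \<in> pverts (underlying D)" using G.adj_V(2)[OF vs(4)] by simp
    moreover have "pcas (hd vs) p (hd vs)" using pcas_zip[OF us(1)] us by (simp add: p_def)
    ultimately have "pre_digraph.awalk (with_proj (underlying D)) (hd vs) p (hd vs)"
      unfolding pre_digraph.awalk_def cas_with_proj_eq by simp
    moreover have "pawalk_verts (hd vs) p = us" using pawalk_verts_zip[OF us(1)] us by (simp add: p_def)
    then have "distinct (tl (pre_digraph.awalk_verts (with_proj (underlying D)) (hd vs) p))"
      unfolding awalk_verts_with_proj_eq using vs(1) ne by (cases vs) (auto simp: us_def)
    moreover have len: "length p = length vs" using us(4) by (simp add: p_def)
    moreover from len have "p \<noteq> []" using vs(2) by auto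
    ultimately have "pre_digraph.cycle (with_proj (underlying D)) p \<and> length p \<ge> 3"
      unfolding pre_digraph.cycle_def using vs(2) by auto
    then show False using forest unfolding undirected_forest_def by blast
  qed
  then show ?thesis
    by (intro oriented_forest.intro G.oriented_graph_axioms oriented_forest_axioms.intro) blast
qed

text \<open>Disjointness of the matching together with injectivity of the numbering separates
  distinct indices. A vertex of degree 1 that is matched with \<open>x i\<close> has
  \<open>x i\<close> as its only neighbour.\<close>

lemma (in oriented_graph) whiskered_iff_matching:
  assumes G: "\<And>u v. (u, v) \<in> parcs G \<longleftrightarrow> adj u v" "pverts G = V"
  shows "whiskered r x y \<longleftrightarrow> inj_on (\<lambda>i. {x i, y i}) {1..r} \<and>
    perfect_matching G ((\<lambda>i. {x i, y i}) ` {1..r}) \<and> (\<forall>i\<in>{1..r}. vertex_degree G (y i) = 1)"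
    (is "_ \<longleftrightarrow> ?r")
proof
  assume w: "whiskered r x y"
  have inj: "inj_on x {1..r}" "inj_on y {1..r}" and disj: "x ` {1..r} \<inter> y ` {1..r} = {}"
    and V: "V = x ` {1..r} \<union> y ` {1..r}" and leaf: "\<And>i u. i \<in> {1..r} \<Longrightarrow> adj (y i) u \<longleftrightarrow> u = x i"
    using w unfolding whiskered_def by auto
  have meet: "i = j" if ij: "i \<in> {1..r}" "j \<in> {1..r}" "{x i, y i} \<inter> {x j, y j} \<noteq> {}" for i j
  proof -
    have "x i \<noteq> y j" "y i \<noteq> x j" using disj ij(1,2) by (metis disjoint_iff image_eqI)+
    then have "x i = x j \<or> y i = y j" using ij(3) by auto
    then show ?thesis using inj ij(1,2) by (auto dest: inj_onD)
  qed
  have "inj_on (\<lambda>i. {x i, y i}) {1..r}" by (rule inj_onI) (use meet in blast)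
  moreover have "perfect_matching G ((\<lambda>i. {x i, y i}) ` {1..r})"
    unfolding perfect_matching_def
  proof (intro conjI)
    show "(\<lambda>i. {x i, y i}) ` {1..r} \<subseteq> {{u, v} | u v. (u, v) \<in> parcs G}"
      using whiskered_adj[OF w] G(1) by blast
    show "disjoint ((\<lambda>i. {x i, y i}) ` {1..r})"
      unfolding disjoint_def using meet by blast
    show "\<Union>((\<lambda>i. {x i, y i}) ` {1..r}) = pverts G" unfolding G(2) V by blast
  qed
  moreover have "vertex_degree G (y i) = 1" if "i \<in> {1..r}" for i
    unfolding vertex_degree_eq G(1) using leaf[OF that] by simp
  ultimately show ?r by blast
next
  assume r: ?r
  let ?f = "\<lambda>i. {x i, y i}"
  have inj: "inj_on ?f {1..r}" and M: "?f ` {1..r} \<subseteq> {{u, v} | u v. (u, v) \<in> parcs G}"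
    and disj: "disjoint (?f ` {1..r})" and cov: "\<Union>(?f ` {1..r}) = V"
    and deg: "\<And>i. i \<in> {1..r} \<Longrightarrow> vertex_degree G (y i) = 1"
    using r unfolding perfect_matching_def G(2) by auto
  have meet: "i = j" if "i \<in> {1..r}" "j \<in> {1..r}" "?f i \<inter> ?f j \<noteq> {}" for i j
  proof -
    have "?f i = ?f j" using disjointD[OF disj imageI[OF that(1)] imageI[OF that(2)]] that(3) by argo
    then show ?thesis by (rule inj_onD[OF inj]) (use that in simp_all)
  qed
  have a: "adj (y i) (x i)" if i: "i \<in> {1..r}" for i
  proof -
    have "?f i \<in> {{u, v} | u v. (u, v) \<in> parcs G}" by (rule subsetD[OF M imageI[OF i]])
    then have "\<exists>u v. (x i = u \<and> y i = v \<or> x i = v \<and> y i = u) \<and> adj u v"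
      unfolding mem_Collect_eq G(1) doubleton_eq_iff .
    then show ?thesis using adj_sym by auto
  qed
  have leaf: "adj (y i) u \<longleftrightarrow> u = x i" if i: "i \<in> {1..r}" for i u
  proof -
    have "card {w. adj (y i) w} = 1" using deg[OF i] unfolding vertex_degree_eq G(1) .
    then obtain w where "{w. adj (y i) w} = {w}" by (rule card_1_singletonE)
    then have iff: "adj (y i) v \<longleftrightarrow> v = w" for v by (metis mem_Collect_eq singleton_iff)
    then have "x i = w" using a[OF i] by blast
    then show ?thesis unfolding iff by blast
  qed
  have "x i \<noteq> y j" if "i \<in> {1..r}" "j \<in> {1..r}" for i j
  proof
    assume eq: "x i = y j"
    then have "i = j" using meet[OF that] by auto
    then show False using a[OF that(1)] eq adj_irrefl by auto
  qed
  then have "x ` {1..r} \<inter> y ` {1..r} = {}" by blast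
  moreover have "inj_on x {1..r}" "inj_on y {1..r}" by (rule inj_onI, use meet in blast)+
  moreover have "V = x ` {1..r} \<union> y ` {1..r}" using cov by blast
  ultimately show "whiskered r x y" unfolding whiskered_def using leaf by blast
qed

theorem theorem5:
  fixes D :: "'v pair_pre_digraph" and d :: "'v \<Rightarrow> nat"
    and R :: "(('v \<Rightarrow>\<^sub>0 nat) \<Rightarrow>\<^sub>0 'k::field) ring"
    and I :: "(('v \<Rightarrow>\<^sub>0 nat) \<Rightarrow>\<^sub>0 'k) set"
    and G :: "'v pair_pre_digraph"
  assumes "weighted_oriented_graph D d"
    and "G = underlying D"
    and "undirected_forest G"
    and "no_isolated_vertices G"
    and "R = mpoly_ring (pverts D)"
    and "I = edge_ideal D d"
  shows "(cohen_macaulay_ring (R Quot I) \<longleftrightarrow> unmixed R I) \<and>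
    (unmixed R I \<longleftrightarrow>
      (\<exists>(r::nat) x y.
         inj_on (\<lambda>i. {x i, y i}) {1..r} \<and>
         perfect_matching G ((\<lambda>i. {x i, y i}) ` {1..r}) \<and>
         (\<forall>i\<in>{1..r}. vertex_degree G (y i) = 1) \<and>
         (\<forall>i\<in>{1..r}. (x i, y i) \<in> parcs D \<longrightarrow> d (x i) = 1)))"
proof -
  interpret W: weighted_oriented_graph D d by (rule assms(1))
  interpret F: oriented_forest "pverts D" "parcs D" d
    by (rule W.oriented_forestI) (use assms(2-4) in simp_all)
  have R: "R = ring_on (polys (pverts D))" unfolding assms(5) by (rule mpoly_ring_eq)
  have I: "I = monomial_ideal (pverts D) F.edge_monomials"
    unfolding assms(6) edge_ideal_def mpoly_ring_eq by (rule F.genideal_edges)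
  \<comment> \<open>The combinatorial condition is the hub: each of the two algebraic conditions
    implies it, and it implies both.\<close>
  let ?c = "\<exists>r x y. F.whiskered r x y \<and> (\<forall>i\<in>{1..r}. (x i, y i) \<in> parcs D \<longrightarrow> d (x i) = 1)"
  have G: "(u, v) \<in> parcs G \<longleftrightarrow> F.adj u v" "pverts G = pverts D" for u v
    unfolding assms(2) W.parcs_underlying F.adj_def by simp_all
  have "?c" if CM: "cohen_macaulay_ring (R Quot I)"
    by (rule F.whiskered_if_strong_covers_equicardinal)
      (intro antisym F.cohen_macaulay_imp_card_le[OF CM[unfolded R I]])
  moreover have "?c" if "unmixed R I"
    by (rule F.whiskered_if_strong_covers_equicardinal) (rule F.unmixed_imp_card_eq[OF that[unfolded R I]])
  moreover have "cohen_macaulay_ring (R Quot I) \<and> unmixed R I" if c: ?c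
  proof -
    obtain r x y where w: "F.whiskered r x y" "\<forall>i\<in>{1..r}. (x i, y i) \<in> parcs D \<longrightarrow> d (x i) = 1"
      using c by blast
    interpret whiskered_graph "pverts D" "parcs D" d r x y
      using w by unfold_locales auto
    show ?thesis unfolding R I using cohen_macaulay_edge_ideal unmixed_edge_ideal by blast
  qed
  moreover have "?c \<longleftrightarrow> (\<exists>(r::nat) x y.
         inj_on (\<lambda>i. {x i, y i}) {1..r} \<and>
         perfect_matching G ((\<lambda>i. {x i, y i}) ` {1..r}) \<and>
         (\<forall>i\<in>{1..r}. vertex_degree G (y i) = 1) \<and>
         (\<forall>i\<in>{1..r}. (x i, y i) \<in> parcs D \<longrightarrow> d (x i) = 1))"
    unfolding F.whiskered_iff_matching[OF G] by blast
  ultimately show ?thesis by blast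
qed

end
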